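(* Let $n \in \{2,3\}$ and let $\Omega \subset \mathbb{R}^n$ be a domain. Let $f_k \in BV(\Omega, \mathbb{R}^n)$, $k\in\mathbb{N}$, be homeomorphisms such that for every $k$ we have $J_{f_k} > 0$ on a set of positive $\mathcal{L}^n$-measure, and let $f \in BV(\Omega, \mathbb{R}^n)$ be the weak-* limit of $\{f_k\}$ in $BV$. Then for $\mathcal{L}^n$-almost every $x_0 \in \Omega$ we have $J_f(x_0) \geq 0$. Moreover, in the case $n=2$, $f$ (that is, a suitable representative of $f$) is differentiable $\mathcal{L}^2$-almost everywhere in $\Omega$.
   Context: A domain is a nonempty open connected set; $\mathcal{L}^n$ is Lebesgue measure. A homeomorphism $g:\Omega\to\mathbb{R}^n$ means a homeomorphism of $\Omega$ onto its image $g(\Omega)$. $BV(\Omega,\mathbb{R}^n)$ is the space of $g\in L^1(\Omega,\mathbb{R}^n)$ whose distributional derivative $Dg$ is an $\mathbb{R}^{n\times n}$-valued Radon measure on $\Omega$ of finite total variation $|Dg|(\Omega)<\infty$. Decompose $Dg = D^a g + D^s g$ into its absolutely continuous and singular parts with respect to $\mathcal{L}^n$, and write $D^a g = \nabla g\,\mathcal{L}^n$ with $\nabla g \in L^1(\Omega,\mathbb{R}^{n\times n})$. The Jacobian is $J_g(x) = \det \nabla g(x)$, defined for $\mathcal{L}^n$-a.e. $x\in\Omega$. A sequence $\{f_k\}\subset BV(\Omega,\mathbb{R}^n)$ converges weakly-* in $BV$ to $f\in BV(\Omega,\mathbb{R}^n)$ if $f_k\to f$ in $L^1(\Omega,\mathbb{R}^n)$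 and $Df_k \overset{*}{\rightharpoonup} Df$ as measures, i.e. $\int_\Omega \phi\, dDf_k \to \int_\Omega \phi\, dDf$ for every continuous compactly supported $\phi$ on $\Omega$ (with values in $\mathbb{R}^{n\times n}$). *)

theory Defs
  imports "HOL-Analysis.Analysis"
begin

section \<open>Vector-valued measures of finite total variation\<close>

text \<open>
  A vector-valued measure is a countably additive set function on the sigma-algebra of \<open>M\<close>;
  only \<open>sets M\<close> and \<open>space M\<close> matter, and the values on non-measurable sets are irrelevant.
  With \<open>M = restrict_space borel \<Omega>\<close> and finite total variation these are exactly the
  vector-valued Radon measures \<open>\<mu>\<close> on the open set \<open>\<Omega>\<close> with \<open>\<bar>\<mu>\<bar>(\<Omega>) < \<infinity>\<close>.
\<close>

definition vector_measure :: "'a measure \<Rightarrow> ('a set \<Rightarrow> 'b::real_normed_vector) \<Rightarrow> bool" where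
  "vector_measure M \<mu> \<longleftrightarrow> \<mu> {} = 0 \<and>
     (\<forall>A :: nat \<Rightarrow> 'a set. range A \<subseteq> sets M \<longrightarrow> disjoint_family A \<longrightarrow>
        (\<lambda>i. \<mu> (A i)) sums \<mu> (\<Union>i. A i))"

definition total_variation ::
    "'a measure \<Rightarrow> ('a set \<Rightarrow> 'b::real_normed_vector) \<Rightarrow> 'a set \<Rightarrow> ennreal" where
  "total_variation M \<mu> A =
     (SUP P \<in> {P :: nat \<Rightarrow> 'a set. range P \<subseteq> sets M \<and> disjoint_family P \<and> (\<Union>i. P i) = A}.
        \<Sum>i. ennreal (norm (\<mu> (P i))))"

text \<open>
  Integration against a finite signed measure \<open>\<nu>\<close> uses the Jordan decomposition
  \<open>\<nu> = \<nu>\<^sup>+ - \<nu>\<^sup>-\<close> with \<open>\<nu>\<^sup>+ A = sup {\<nu> B | B \<subseteq> A}\<close> and \<open>\<nu>\<^sup>- = (-\<nu>)\<^sup>+\<close>.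
  The truncation of negative reals by \<open>ennreal\<close> is harmless because \<open>B = {}\<close> contributes 0.
\<close>

definition positive_variation :: "'a measure \<Rightarrow> ('a set \<Rightarrow> real) \<Rightarrow> 'a measure" where
  "positive_variation M \<nu> =
     measure_of (space M) (sets M) (\<lambda>A. SUP B \<in> {B \<in> sets M. B \<subseteq> A}. ennreal (\<nu> B))"

definition signed_integral :: "'a measure \<Rightarrow> ('a set \<Rightarrow> real) \<Rightarrow> ('a \<Rightarrow> real) \<Rightarrow> real" where
  "signed_integral M \<nu> \<phi> =
     (LINT x|positive_variation M \<nu>. \<phi> x) - (LINT x|positive_variation M (\<lambda>A. - \<nu> A). \<phi> x)"

definition matrix_integral ::
    "'a measure \<Rightarrow> ('a set \<Rightarrow> real^'n^'n) \<Rightarrow> ('a \<Rightarrow> real^'n^'n) \<Rightarrow> real" where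
  "matrix_integral M \<mu> \<phi> =
     (\<Sum>i\<in>UNIV. \<Sum>j\<in>UNIV. signed_integral M (\<lambda>A. \<mu> A $ i $ j) (\<lambda>x. \<phi> x $ i $ j))"


section \<open>Test functions\<close>

definition compact_support_in :: "(real^'n) set \<Rightarrow> (real^'n \<Rightarrow> 'b::real_normed_vector) \<Rightarrow> bool" where
  "compact_support_in \<Omega> \<phi> \<longleftrightarrow>
     compact (closure {x. \<phi> x \<noteq> 0}) \<and> closure {x. \<phi> x \<noteq> 0} \<subseteq> \<Omega>"

definition partial_deriv :: "'n \<Rightarrow> (real^'n \<Rightarrow> real) \<Rightarrow> real^'n \<Rightarrow> real" where
  "partial_deriv j \<phi> x = frechet_derivative \<phi> (at x) (axis j 1)"

primrec C_k :: "nat \<Rightarrow> (real^'n \<Rightarrow> real) \<Rightarrow> bool" where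
  "C_k 0 \<phi> \<longleftrightarrow> continuous_on UNIV \<phi>"
| "C_k (Suc k) \<phi> \<longleftrightarrow> \<phi> differentiable_on UNIV \<and> (\<forall>j. C_k k (partial_deriv j \<phi>))"

text \<open>
  Functions with compact support in the open set \<open>\<Omega>\<close> are identified with their
  extension by 0, so that test functions can be taken smooth (continuous) on the whole space.
\<close>

definition smooth_test_function :: "(real^'n) set \<Rightarrow> (real^'n \<Rightarrow> real) \<Rightarrow> bool" where
  "smooth_test_function \<Omega> \<phi> \<longleftrightarrow> (\<forall>k. C_k k \<phi>) \<and> compact_support_in \<Omega> \<phi>"


section \<open>Functions of bounded variation\<close>

text \<open>Entry \<open>(i, j)\<close> of the derivative is the \<open>j\<close>-th partial derivative of the \<open>i\<close>-th component.\<close>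

definition is_measure_derivative ::
    "(real^'n) set \<Rightarrow> (real^'n \<Rightarrow> real^'n) \<Rightarrow> ((real^'n) set \<Rightarrow> real^'n^'n) \<Rightarrow> bool" where
  "is_measure_derivative \<Omega> g \<mu> \<longleftrightarrow>
     vector_measure (restrict_space borel \<Omega>) \<mu> \<and>
     total_variation (restrict_space borel \<Omega>) \<mu> \<Omega> < \<infinity> \<and>
     (\<forall>\<phi> i j. smooth_test_function \<Omega> \<phi> \<longrightarrow>
        (LINT x|lebesgue_on \<Omega>. g x $ i * partial_deriv j \<phi> x) =
        - signed_integral (restrict_space borel \<Omega>) (\<lambda>A. \<mu> A $ i $ j) \<phi>)"

definition BV :: "(real^'n) set \<Rightarrow> (real^'n \<Rightarrow> real^'n) set" where
  "BV \<Omega> = {g. integrable (lebesgue_on \<Omega>) g \<and> (\<exists>\<mu>. is_measure_derivative \<Omega> g \<mu>)}"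

text \<open>For \<open>g \<in> BV \<Omega>\<close> the measure \<open>Dg\<close> is unique on the Borel subsets of \<open>\<Omega>\<close>.\<close>

definition BV_derivative ::
    "(real^'n) set \<Rightarrow> (real^'n \<Rightarrow> real^'n) \<Rightarrow> (real^'n) set \<Rightarrow> real^'n^'n" where
  "BV_derivative \<Omega> g = (SOME \<mu>. is_measure_derivative \<Omega> g \<mu>)"

definition lebesgue_decomposition ::
    "(real^'n) set \<Rightarrow> ((real^'n) set \<Rightarrow> 'b::real_normed_vector) \<Rightarrow>
     ((real^'n) set \<Rightarrow> 'b) \<Rightarrow> ((real^'n) set \<Rightarrow> 'b) \<Rightarrow> bool" where
  "lebesgue_decomposition \<Omega> \<mu> \<mu>a \<mu>s \<longleftrightarrow>
     vector_measure (restrict_space borel \<Omega>) \<mu>a \<and>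
     vector_measure (restrict_space borel \<Omega>) \<mu>s \<and>
     (\<forall>A \<in> sets (restrict_space borel \<Omega>). \<mu> A = \<mu>a A + \<mu>s A) \<and>
     (\<forall>A \<in> sets (restrict_space borel \<Omega>). emeasure lborel A = 0 \<longrightarrow> \<mu>a A = 0) \<and>
     (\<exists>N \<in> sets (restrict_space borel \<Omega>). emeasure lborel N = 0 \<and>
        total_variation (restrict_space borel \<Omega>) \<mu>s (\<Omega> - N) = 0)"

definition is_BV_gradient ::
    "(real^'n) set \<Rightarrow> (real^'n \<Rightarrow> real^'n) \<Rightarrow> (real^'n \<Rightarrow> real^'n^'n) \<Rightarrow> bool" where
  "is_BV_gradient \<Omega> g G \<longleftrightarrow>
     integrable (lebesgue_on \<Omega>) G \<and>
     (\<exists>\<mu>a \<mu>s. lebesgue_decomposition \<Omega> (BV_derivative \<Omega> g) \<mu>a \<mu>s \<and>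
        (\<forall>A \<in> sets (restrict_space borel \<Omega>). \<mu>a A = (LINT x|lebesgue_on A. G x)))"

text \<open>The density is unique only up to Lebesgue null sets; one representative is chosen.\<close>

definition BV_gradient ::
    "(real^'n) set \<Rightarrow> (real^'n \<Rightarrow> real^'n) \<Rightarrow> real^'n \<Rightarrow> real^'n^'n" where
  "BV_gradient \<Omega> g = (SOME G. is_BV_gradient \<Omega> g G)"

definition BV_jacobian :: "(real^'n) set \<Rightarrow> (real^'n \<Rightarrow> real^'n) \<Rightarrow> real^'n \<Rightarrow> real" where
  "BV_jacobian \<Omega> g x = det (BV_gradient \<Omega> g x)"

definition BV_weak_star_limit ::
    "(real^'n) set \<Rightarrow> (nat \<Rightarrow> real^'n \<Rightarrow> real^'n) \<Rightarrow> (real^'n \<Rightarrow> real^'n) \<Rightarrow> bool" where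
  "BV_weak_star_limit \<Omega> f_seq f \<longleftrightarrow>
     (\<forall>k. f_seq k \<in> BV \<Omega>) \<and> f \<in> BV \<Omega> \<and>
     (\<lambda>k. LINT x|lebesgue_on \<Omega>. norm (f_seq k x - f x)) \<longlonglongrightarrow> 0 \<and>
     (\<forall>\<phi> :: real^'n \<Rightarrow> real^'n^'n. continuous_on UNIV \<phi> \<longrightarrow> compact_support_in \<Omega> \<phi> \<longrightarrow>
        (\<lambda>k. matrix_integral (restrict_space borel \<Omega>) (BV_derivative \<Omega> (f_seq k)) \<phi>)
          \<longlonglongrightarrow> matrix_integral (restrict_space borel \<Omega>) (BV_derivative \<Omega> f) \<phi>)"

end

theory Submission
 imports Defs "HOL-Homology.Homology"
begin

text \<open>
 The sign of the determinant of an injective linear map is a homotopy invariant of the maps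
 \<open>z \<mapsto> A z\<close> (n = 2, \<open>z\<close> in a circle) and \<open>(z, w) \<mapsto> A (K\<^sub>1 z - K\<^sub>2 w)\<close> (n = 3, linked circles
 \<open>K\<^sub>1\<close>, \<open>K\<^sub>2\<close>) into the complement of the origin. For a homeomorphism \<open>g\<close> of a connected domain
 the maps \<open>(z, w) \<mapsto> g (x + r K\<^sub>1 z) - g (x + r K\<^sub>2 w)\<close> are all homotopic, whatever \<open>x\<close> and \<open>r\<close>.
 At almost every \<open>x\<close> the blow-ups of \<open>f\<close> converge to the linear map \<open>\<nabla>f(x)\<close> in \<open>L\<^sup>1\<close>, and \<open>\<bar>Df\<^sub>k\<bar>\<close>
 of balls near \<open>x\<close> is at most a constant times the volume, so that most pairs of points are joined
 by segments on which \<open>f\<^sub>k\<close> oscillates little. Hence the two circles can be moved slightly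
 so that \<open>f\<^sub>k\<close> is uniformly close to the affine map on them, and \<open>det \<nabla>f(x) < 0\<close> forces the homotopy
 invariant of \<open>f\<^sub>k\<close> to be that of an orientation reversing linear map; a point with \<open>J > 0\<close>
 gives the opposite sign. In the plane, good triangles and the maximum principle for the
 open map \<open>f\<^sub>k\<close> bound its oscillation on balls, which upgrades the \<open>L\<^sup>1\<close> blow-up to differentiability.
\<close>

text \<open>The obstacle is that weak-* convergence bounds |Df_k| near x only by a multiple of the
  volume: although f_k is L^1-close to an affine map, Df_k - \<nabla>f(x) need not be small in total
  variation. Smallness is therefore gained from scale. On balls of radius \<delta> r the oscillation
  along most segments is at most a constant times \<delta> r, with a constant independent of
  \<delta>, and this is small against the size r of the link; hence the order of quantifiers in
  \<open>mass_controlled\<close>.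

  Uniform control of this kind is available only on one-dimensional sets, so for n = 3 no surface
  around x can be used to read off a degree. Two linked curves replace it, with a difference map
  defined on a torus; for n = 2 the second curve is the constant centre. The degree itself belongs
  to spheres, and the torus map reaches one through the join of two circles.

  The same blow-up statement is applied a second time to the constant sequence f_k, at a point where
  its Jacobian is positive, so that both signs are compared for one and the same k.\<close>

abbreviation "homotopic_maps X Y \<equiv> homotopic_with_canon (\<lambda>_. True) X Y"

abbreviation "borel_on X \<equiv> restrict_space borel X"


section \<open>Orientation of linear maps on links\<close>

text \<open>A homotopy would preserve the Brouwer degree, which is 1 for the identity and -1 for a
  reflection. The degree is defined for self-maps of \<open>nsphere p\<close>, a set of real
  sequences, so \<open>\<phi>\<close> (from coordinates to vectors) and \<open>\<psi>\<close>
  (normalised coordinates of a nonzero vector) carry the homotopy there.\<close>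

lemma reflection_not_homotopic_id:
 fixes b :: "'b::euclidean_space"
 assumes b: "b \<in> Basis"
 shows "\<not> homotopic_maps (sphere 0 1) (- {0}) (\<lambda>x. x) (\<lambda>x. x - (2 * (x \<bullet> b)) *\<^sub>R b)"
proof
 assume hom: "homotopic_maps (sphere 0 1) (- {0}) (\<lambda>x. x) (\<lambda>x. x - (2 * (x \<bullet> b)) *\<^sub>R b)"
 define p where "p = DIM('b) - 1"
 have p: "DIM('b) = Suc p" using DIM_positive[where 'a='b] by (simp add: p_def)
 obtain e where e: "bij_betw e {..p} (Basis::'b set)" "e 0 = b"
 proof -
  have "card {..p} = card (Basis::'b set)" using p by simp
  then obtain e0 where e0: "bij_betw e0 {..p} (Basis::'b set)"
   using finite_same_card_bij[of "{..p}" "Basis::'b set"] by auto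
  have "b \<in> e0 ` {..p}" using e0 b by (simp add: bij_betw_def)
  then obtain k where k: "k \<le> p" "e0 k = b" by blast
  \<comment> \<open>The transposition gives \<open>b\<close> the index 0, the coordinate that
    \<open>Brouwer_degree2_reflection\<close> negates.\<close>
  have "bij_betw (e0 \<circ> Transposition.transpose 0 k) {..p} Basis"
   using e0 k by (intro bij_betw_trans[OF _ e0]) (simp add: bij_betw_transpose_iff)
  moreover have "(e0 \<circ> Transposition.transpose 0 k) 0 = b" using k by simp
  ultimately show ?thesis using that by blast
 qed
 have eB: "e i \<in> Basis" if "i \<le> p" for i using e that by (auto simp: bij_betw_def)
 have einj: "e i = e j \<longleftrightarrow> i = j" if "i \<le> p" "j \<le> p" for i j
  using e that by (auto simp: bij_betw_def inj_on_def)
 define \<phi> where "\<phi> = (\<lambda>v::nat => real. \<Sum>i\<le>p. v i *\<^sub>R e i)"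
 define \<psi> where "\<psi> = (\<lambda>x::'b. \<lambda>i. if i \<le> p then (x /\<^sub>R norm x) \<bullet> e i else 0)"
 have ip: "\<phi> v \<bullet> e i = v i" if "i \<le> p" for v i
 proof -
  have "\<phi> v \<bullet> e i = (\<Sum>j\<le>p. if j = i then v j else 0)"
   unfolding \<phi>_def inner_sum_left using that
   by (intro sum.cong) (auto simp: inner_Basis eB einj)
  then show ?thesis using that by simp
 qed
 have nrm: "(norm x)\<^sup>2 = (\<Sum>i\<le>p. (x \<bullet> e i)\<^sup>2)" for x :: 'b
 proof -
  have "(norm x)\<^sup>2 = (\<Sum>b\<in>Basis. (x \<bullet> b)\<^sup>2)"
   unfolding power2_norm_eq_inner euclidean_inner[of x x] by (simp add: power2_eq_square)
  also have "\<dots> = (\<Sum>i\<le>p. (x \<bullet> e i)\<^sup>2)"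
   using sum.reindex_bij_betw[OF e(1), of "\<lambda>b. (x \<bullet> b)\<^sup>2"] by simp
  finally show ?thesis .
 qed
 have n1: "norm (\<phi> v) = 1" if "(\<Sum>i\<le>p. (v i)\<^sup>2) = 1" for v
 proof -
  have "(norm (\<phi> v))\<^sup>2 = 1" using that by (simp add: nrm ip)
  then show ?thesis by (metis norm_ge_zero power2_eq_1_iff abs_of_nonneg real_sqrt_abs real_sqrt_one)
 qed
 have top: "topspace (nsphere p) = {x. (\<Sum>i\<le>p. (x i)\<^sup>2) = 1 \<and> (\<forall>i>p. x i = 0)}"
  by (simp add: nsphere)
 have c\<phi>: "continuous_map (nsphere p) (top_of_set (sphere 0 1)) \<phi>"
  unfolding continuous_map_in_subtopology
 proof
  show "continuous_map (nsphere p) euclidean \<phi>"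
  proof -
   have "continuous_on UNIV \<phi>"
    unfolding \<phi>_def by (intro continuous_intros continuous_on_product_coordinates)
   then show ?thesis
    unfolding nsphere euclidean_product_topology
    by (simp add: continuous_on_subset[of UNIV])
  qed
  show "\<phi> \<in> topspace (nsphere p) \<rightarrow> sphere 0 1"
   by (auto simp: top n1)
 qed
 have c\<psi>: "continuous_map (top_of_set (- {0})) (nsphere p) \<psi>"
  unfolding nsphere continuous_map_in_subtopology
 proof
  have "continuous_on (- {0}) (\<lambda>x. \<psi> x i)" for i
   unfolding \<psi>_def by (cases "i \<le> p") (auto intro!: continuous_intros)
  then show "continuous_map (top_of_set (- {0})) (powertop_real UNIV) \<psi>"
   by (simp add: continuous_map_componentwise_UNIV)
  have "(\<Sum>i\<le>p. (\<psi> x i)\<^sup>2) = 1" if "x ~= 0" for x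
  proof -
   have "(\<Sum>i\<le>p. (\<psi> x i)\<^sup>2) = (norm (x /\<^sub>R norm x))\<^sup>2"
    unfolding nrm by (simp add: \<psi>_def)
   then show ?thesis using that by simp
  qed
  then show "\<psi> \<in> topspace (top_of_set (- {0})) \<rightarrow> {x. (\<Sum>i\<le>p. (x i)\<^sup>2) = 1 \<and> (\<forall>i>p. x i = 0)}"
   by (auto simp: \<psi>_def)
 qed
 let ?r = "\<lambda>x::'b. x - (2 * (x \<bullet> b)) *\<^sub>R b"
 have "homotopic_with (\<lambda>_. True) (nsphere p) (nsphere p) (\<psi> \<circ> (\<lambda>x. x) \<circ> \<phi>) (\<psi> \<circ> ?r \<circ> \<phi>)"
  by (rule homotopic_with_compose_continuous_map_right[OF homotopic_with_compose_continuous_map_left[OF hom c\<psi>] c\<phi>]) auto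
 then have "Brouwer_degree2 p (\<psi> \<circ> (\<lambda>x. x) \<circ> \<phi>) = Brouwer_degree2 p (\<psi> \<circ> ?r \<circ> \<phi>)"
  by (rule Brouwer_degree2_homotopic)
 moreover have "Brouwer_degree2 p (\<psi> \<circ> (\<lambda>x. x) \<circ> \<phi>) = Brouwer_degree2 p id"
  by (rule Brouwer_degree2_eq) (auto simp: top \<psi>_def ip n1 fun_eq_iff)
 moreover have "Brouwer_degree2 p (\<psi> \<circ> ?r \<circ> \<phi>) = Brouwer_degree2 p (\<lambda>x i. if i = 0 then - x i else x i)"
 proof (rule Brouwer_degree2_eq)
  fix v assume "v \<in> topspace (nsphere p)"
  then have v: "(\<Sum>i\<le>p. (v i)\<^sup>2) = 1" "!!i. i > p ==> v i = 0" by (auto simp: top)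
  have b1: "b \<bullet> b = 1" using b by simp
  have n: "norm (?r (\<phi> v)) = 1"
  proof -
   have "(?r (\<phi> v)) \<bullet> (?r (\<phi> v)) = \<phi> v \<bullet> \<phi> v"
    using b1 by (simp add: inner_diff_left inner_diff_right algebra_simps inner_commute)
   then show ?thesis using n1[OF v(1)] by (simp add: norm_eq_sqrt_inner)
  qed
  have "b \<bullet> e i = (if i = 0 then 1 else 0)" if "i \<le> p" for i
   using that einj[of 0 i] eB[of i] eB[of 0] e(2) by (auto simp: inner_Basis b)
  then show "(\<psi> \<circ> ?r \<circ> \<phi>) v = (\<lambda>i. if i = 0 then - v i else v i)"
   using v ip[of 0 v] e(2)
   unfolding fun_eq_iff o_def \<psi>_def n by (auto simp: inner_diff_left ip)
 qed
 ultimately show False by (simp add: Brouwer_degree2_reflection)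
qed

section \<open>Path components of the invertible matrices\<close>

definition householder :: "real^'n => real^'n^'n" where
 "householder v = (\<chi> i j. (if i = j then 1 else 0) - 2 * v $ i * v $ j / (v \<bullet> v))"

lemma householder_mult_vector: "householder v *v x = x - (2 * (x \<bullet> v) / (v \<bullet> v)) *\<^sub>R v"
proof -
 have xv: "x \<bullet> v = (\<Sum>j\<in>UNIV. x $ j * v $ j)" by (simp add: inner_vec_def)
 have "(householder v *v x) $ i = (x - (2 * (x \<bullet> v) / (v \<bullet> v)) *\<^sub>R v) $ i" for i
 proof -
  have "(householder v *v x) $ i = (\<Sum>j\<in>UNIV. (if i = j then 1 else 0) * x $ j) - (\<Sum>j\<in>UNIV. (2 * v $ i / (v \<bullet> v)) * (x $ j * v $ j))"
   unfolding sum_subtractf[symmetric]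
   by (auto simp: householder_def matrix_vector_mult_def left_diff_distrib intro!: sum.cong)
  also have "(\<Sum>j\<in>UNIV. (if i = j then 1 else 0) * x $ j) = (\<Sum>j\<in>UNIV. if j = i then x $ j else 0)"
   by (intro sum.cong) auto
  also have "\<dots> = x $ i" by simp
  also have "(\<Sum>j\<in>UNIV. (2 * v $ i / (v \<bullet> v)) * (x $ j * v $ j)) = (2 * v $ i / (v \<bullet> v)) * (x \<bullet> v)"
   unfolding xv by (simp add: sum_distrib_left sum_divide_distrib)
  finally show ?thesis by simp
 qed
 then show ?thesis by (simp add: vec_eq_iff)
qed

lemma det_householder_nonzero:
 assumes "v ~= 0" shows "det (householder v) ~= 0"
proof -
 have "householder v *v (householder v *v x) = x" for x
  using assms by (simp add: householder_mult_vector inner_diff_left)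
 then have "householder v ** householder v = mat 1"
  by (simp add: matrix_eq matrix_vector_mul_assoc[symmetric])
 then have "det (householder v) * det (householder v) = 1"
  by (metis det_I det_mul)
 then show ?thesis by auto
qed

lemma det_householder_axis: "det (householder (axis k 1 :: real^'n)) = - 1"
proof -
 have "det (householder (axis k 1 :: real^'n)) = (\<Prod>i\<in>UNIV. householder (axis k 1 :: real^'n) $ i $ i)"
  by (rule det_diagonal) (auto simp: householder_def axis_def)
 also have "\<dots> = (\<Prod>i\<in>UNIV. if i = k then - 1 else 1)"
  by (intro prod.cong) (auto simp: householder_def axis_def inner_axis_axis[unfolded axis_def])
 finally show ?thesis by simp
qed

abbreviation GLpath :: "real^'n^'n => real^'n^'n => bool" where
 "GLpath \<equiv> path_component {M. det M ~= 0}"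

lemma continuous_on_matrix_mult:
 fixes f g :: "'a::topological_space => real^'n^'n"
 assumes "continuous_on S f" "continuous_on S g"
 shows "continuous_on S (\<lambda>x. f x ** g x)"
 unfolding matrix_matrix_mult_def using assms by (intro continuous_intros)

lemma continuous_on_matrix_vector_mult:
 fixes f :: "'a::topological_space => real^'n^'n" and g :: "'a => real^'n"
 assumes "continuous_on S f" "continuous_on S g"
 shows "continuous_on S (\<lambda>x. f x *v g x)"
 unfolding matrix_vector_mult_def using assms by (intro continuous_intros)

lemma continuous_on_det_compose:
 fixes f :: "'a::topological_space => real^'n^'n"
 assumes "continuous_on S f" shows "continuous_on S (\<lambda>x. det (f x))"
 unfolding det_def using assms by (intro continuous_intros)

lemma GLpath_mult:
 assumes "GLpath A B" "GLpath C D" shows "GLpath (A ** C) (B ** D)"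
proof -
 obtain p q where p: "path p" "path_image p \<subseteq> {M. det M ~= 0}" "pathstart p = A" "pathfinish p = B"
  and q: "path q" "path_image q \<subseteq> {M. det M ~= 0}" "pathstart q = C" "pathfinish q = D"
  using assms by (auto simp: path_component_def)
 have "path (\<lambda>t. p t ** q t)"
  using p q unfolding path_def by (intro continuous_on_matrix_mult)
 moreover have "path_image (\<lambda>t. p t ** q t) \<subseteq> {M. det M ~= 0}"
  using p(2) q(2) by (fastforce simp: path_image_def det_mul)
 ultimately show ?thesis
  using p q unfolding path_component_def pathstart_def pathfinish_def by metis
qed

text \<open>Nonzero vectors form a path-connected set from dimension two on, and the unnormalised
  formula for the reflection is continuous there.\<close>

lemma GLpath_householder:
 fixes v w :: "real^'n"
 assumes "CARD('n) \<ge> 2" "v ~= 0" "w ~= 0"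
 shows "GLpath (householder v) (householder w)"
proof -
 have "path_connected (- {0} :: (real^'n) set)"
  using assms by (intro path_connected_punctured_universe) simp
 then have "path_connected (householder ` (- {0} :: (real^'n) set))"
  unfolding householder_def
  by (rule path_connected_continuous_image[rotated]) (auto intro!: continuous_intros)
 moreover have "householder ` (- {0} :: (real^'n) set) \<subseteq> {M. det M ~= 0}"
  by (auto simp: det_householder_nonzero)
 ultimately show ?thesis
  using assms unfolding path_connected_component
  by (meson ComplI imageI path_component_of_subset singletonD)
qed

lemma GLpath_line:
 assumes "!!t. 0 \<le> t ==> t \<le> 1 ==> det ((1 - t) *\<^sub>R A + t *\<^sub>R B) ~= 0"
 shows "GLpath A B"
 unfolding path_component_def
proof (intro exI conjI)
 show "path (linepath A B)" "pathstart (linepath A B) = A" "pathfinish (linepath A B) = B" by auto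
 show "path_image (linepath A B) \<subseteq> {M. det M ~= 0}"
  using assms unfolding path_image_def linepath_def by auto
qed

text \<open>Matrices with this property are closed under products because the square of a reflection
  is the identity, so elementary matrices suffice: a shear contracts to the identity, a swap is
  itself a reflection, and a diagonal matrix deforms to its signs. Singular matrices enter the
  induction, hence the guard \<open>det A ~= 0\<close> in \<open>P\<close>.\<close>

lemma GLpath_normal_form:
 fixes A :: "real^'n^'n" and k :: 'n
 assumes n: "CARD('n) \<ge> 2" and "det A ~= 0"
 shows "GLpath A (mat 1) \<or> GLpath A (householder (axis k 1))"
proof -
 let ?R = "householder (axis k 1) :: real^'n^'n"
 have RR: "GLpath (?R ** ?R) (mat 1)"
 proof -
  have "?R *v (?R *v x) = x" for x
   by (simp add: householder_mult_vector inner_diff_left inner_axis_axis)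
  then have "?R ** ?R = mat 1" by (simp add: matrix_eq matrix_vector_mul_assoc[symmetric])
  then show ?thesis by (simp add: path_component_refl)
 qed
 define P where "P = (\<lambda>A::real^'n^'n. det A ~= 0 --> GLpath A (mat 1) \<or> GLpath A ?R)"
 have mult: "P (A ** B)" if "P A" "P B" for A B
 proof -
  have "GLpath (A ** B) (mat 1) \<or> GLpath (A ** B) ?R"
   if "GLpath A (mat 1) \<or> GLpath A ?R" "GLpath B (mat 1) \<or> GLpath B ?R"
   using that GLpath_mult[of A "mat 1" B "mat 1", simplified] GLpath_mult[of A "mat 1" B ?R, simplified]
    GLpath_mult[of A ?R B "mat 1", simplified] GLpath_mult[of A ?R B ?R] path_component_trans[OF _ RR, of "A ** B"]
   by blast
  with that show ?thesis by (auto simp: P_def det_mul)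
 qed
 have hh: "P (householder v)" if "v ~= 0" for v
  using GLpath_householder[OF n that, of "axis k 1"] by (auto simp: P_def axis_eq_0_iff)
 have one: "P (mat 1)" by (simp add: P_def path_component_refl)
 have "P A"
 proof (rule induct_matrix_elementary)
  show "P (A ** B)" if "P A" "P B" for A B using mult that .
  show "P A" if "row i A = 0" for A i using that by (simp add: P_def det_zero_row)
  show "P A" if diag: "!!i j. i ~= j ==> A $ i $ j = 0" for A
  proof (cases "det A = 0")
   case False
   have dA: "det A = (\<Prod>i\<in>UNIV. A $ i $ i)" by (rule det_diagonal) (use diag in auto)
   have nz: "A $ i $ i ~= 0" for i using False unfolding dA by simp
   \<comment> \<open>Sign matrices with -1 exactly on \<open>S\<close>; each is a product of
     reflections in axis directions, one for each element of \<open>S\<close>.\<close>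
   define D where "D = (\<lambda>S::'n set. (\<chi> i j. if i = j then (if i \<in> S then - 1 else 1) else 0) :: real^'n^'n)"
   have PD: "P (D S)" for S
   proof (induction S rule: finite_induct[OF finite])
    case 1
    have "D {} = mat 1" by (simp add: D_def mat_def vec_eq_iff)
    then show ?case using one by simp
   next
    case (2 j S)
    have "D (insert j S) = D S ** householder (axis j 1)"
     unfolding matrix_eq
    proof
     fix x :: "real^'n"
     have Dx: "(D S *v x) $ i = (if i \<in> S then - x $ i else x $ i)" for S i and x :: "real^'n"
     proof -
      have "(D S *v x) $ i = (\<Sum>j\<in>UNIV. if j = i then (if i \<in> S then - x $ i else x $ i) else 0)"
       unfolding D_def matrix_vector_mult_def vec_lambda_beta by (intro sum.cong refl) auto
      then show ?thesis by simp
     qed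
     show "D (insert j S) *v x = (D S ** householder (axis j 1)) *v x"
      using 2(2) unfolding matrix_vector_mul_assoc[symmetric] vec_eq_iff Dx householder_mult_vector
      by (simp add: inner_axis inner_axis_axis) (auto simp: axis_def)
    qed
    then show ?case using mult[OF 2(3) hh[of "axis j 1"]] by (simp add: axis_eq_0_iff)
   qed
   let ?S = "{i. A $ i $ i < 0}"
   \<comment> \<open>Along the straight segment every diagonal entry keeps its sign, so the
     determinant never vanishes.\<close>
   have "GLpath A (D ?S)"
   proof (rule GLpath_line)
    fix t :: real assume t: "0 \<le> t" "t \<le> 1"
    have "det ((1 - t) *\<^sub>R A + t *\<^sub>R D ?S) = (\<Prod>i\<in>UNIV. ((1 - t) *\<^sub>R A + t *\<^sub>R D ?S) $ i $ i)"
     by (rule det_diagonal) (use diag in \<open>auto simp: D_def\<close>)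
    moreover have "((1 - t) *\<^sub>R A + t *\<^sub>R D ?S) $ i $ i ~= 0" for i
    proof (cases "A $ i $ i < 0")
     case True
     then have "(1 - t) * A $ i $ i \<le> 0" "t = 0 ==> (1 - t) * A $ i $ i < 0"
      using t by (auto simp: mult_nonneg_nonpos)
     then show ?thesis using True t by (cases "t = 0") (auto simp: D_def)
    next
     case F: False
     then have "(1 - t) * A $ i $ i \<ge> 0" "t = 0 ==> (1 - t) * A $ i $ i > 0"
      using t nz[of i] by (auto simp: less_le)
     then have "(1 - t) * A $ i $ i + t > 0" using t by (cases "t = 0") auto
     then show ?thesis using F by (simp add: D_def)
    qed
    ultimately show "det ((1 - t) *\<^sub>R A + t *\<^sub>R D ?S) ~= 0" by simp
   qed
   moreover have "det (D ?S) ~= 0"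
    using path_component_mem(2)[OF calculation] by simp
   ultimately show ?thesis using PD[of ?S] path_component_trans[of _ A "D ?S"] by (auto simp: P_def)
  qed (simp add: P_def)
  show "P (\<chi> i j. mat 1 $ i $ Transposition.transpose m n j)" if mn: "m ~= n" for m n
  proof -
   let ?v = "axis m 1 - axis n 1 :: real^'n"
   have vv: "?v \<bullet> ?v = 2" using mn by (simp add: inner_diff_left inner_diff_right inner_axis_axis)
   \<comment> \<open>Exchanging two coordinates is the reflection in the hyperplane orthogonal to
     the difference of the two axes.\<close>
   have "(\<chi> i j. mat 1 $ i $ Transposition.transpose m n j) = householder ?v"
    unfolding householder_def vv using mn
    by (auto simp: vec_eq_iff mat_def axis_def Transposition.transpose_def)
   moreover have "?v ~= 0" using vv by force
   ultimately show ?thesis using hh by simp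
  qed
  show "P (\<chi> i j. if i = m \<and> j = n then c else of_bool (i = j))" if mn: "m ~= n" for m n and c :: real
  proof -
   define E where "E = (\<lambda>c::real. (\<chi> i j. if i = m \<and> j = n then c else of_bool (i = j)) :: real^'n^'n)"
   have "E c ** E (- c) = mat 1" for c
    unfolding matrix_eq
   proof
    fix x :: "real^'n"
    have Ex: "(E c *v x) $ i = x $ i + (if i = m then c * x $ n else 0)" for c i and x :: "real^'n"
    proof -
     have "(E c *v x) $ i = (\<Sum>j\<in>UNIV. (if j = i then x $ j else 0) + (if j = n then (if i = m then c * x $ n else 0) else 0))"
      unfolding E_def matrix_vector_mult_def using mn by (auto intro!: sum.cong)
     then show ?thesis by (simp add: sum.distrib)
    qed
    show "(E c ** E (- c)) *v x = mat 1 *v x"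
     using mn unfolding matrix_vector_mul_assoc[symmetric] vec_eq_iff Ex by simp
   qed
   then have "det (E c) * det (E (- c)) = 1" for c by (metis det_I det_mul)
   then have nz: "det (E c) ~= 0" for c by (metis mult_zero_left zero_neq_one)
   have e1: "E 0 = mat 1" using mn by (auto simp: E_def mat_def vec_eq_iff)
   have "GLpath (E c) (E 0)"
   proof (rule GLpath_line)
    fix t :: real
    have "(1 - t) *\<^sub>R E c + t *\<^sub>R E 0 = E ((1 - t) * c)"
     using mn by (auto simp: E_def vec_eq_iff)
    then show "det ((1 - t) *\<^sub>R E c + t *\<^sub>R E 0) ~= 0" using nz by simp
   qed
   then have "GLpath (E c) (mat 1)" by (simp only: e1)
   then show ?thesis by (simp add: P_def E_def)
  qed
 qed
 then show ?thesis using assms by (simp add: P_def)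
qed

lemma GLpath_det_sign:
 assumes "GLpath A B" shows "det A * det B > 0"
proof (rule ccontr)
 assume neg: "\<not> det A * det B > 0"
 obtain p where p: "path p" "path_image p \<subseteq> {M. det M ~= 0}" "pathstart p = A" "pathfinish p = B"
  using assms by (auto simp: path_component_def)
 have c: "continuous_on {0..1} (\<lambda>t. det (p t))"
  using p(1) unfolding path_def by (rule continuous_on_det_compose)
 have nz: "det (p t) ~= 0" if "t \<in> {0..1}" for t using p(2) that by (fastforce simp: path_image_def)
 have e: "p 0 = A" "p 1 = B" using p by (auto simp: pathstart_def pathfinish_def)
 have "det A ~= 0" "det B ~= 0" using nz[of 0] nz[of 1] e by auto
 with neg consider "det A \<le> 0" "0 \<le> det B" | "det B \<le> 0" "0 \<le> det A"
  by (metis linear mult_neg_neg mult_pos_pos not_le order_less_le)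
 then show False
 proof cases
  case 1
  then have "\<exists>t\<ge>0. t \<le> 1 \<and> det (p t) = 0" using c e by (intro IVT') auto
  then show False using nz by auto
 next
  case 2
  then have "\<exists>t\<ge>0. t \<le> 1 \<and> det (p t) = 0" using c e by (intro IVT2') auto
  then show False using nz by auto
 qed
qed

section \<open>Homotopies of maps into the punctured space\<close>

lemma homotopic_with_canonI:
 fixes H :: "real => 'a::topological_space => 'b::topological_space"
 assumes "continuous_on ({0..1} \<times> S) (\<lambda>z. H (fst z) (snd z))"
  and "!!t x. t \<in> {0..1} ==> x \<in> S ==> H t x \<in> T"
  and "!!x. x \<in> S ==> H 0 x = f x" "!!x. x \<in> S ==> H 1 x = g x"
 shows "homotopic_maps S T f g"
proof -
 define h where "h = (\<lambda>z. H (fst z) (snd z))"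
 have "continuous_map (prod_topology (top_of_set {0..1}) (top_of_set S)) (top_of_set T) h"
  using assms(1,2) by (auto simp: h_def)
 moreover have "\<forall>x\<in>topspace (top_of_set S). h (0, x) = f x" "\<forall>x\<in>topspace (top_of_set S). h (1, x) = g x"
  using assms(3,4) by (auto simp: h_def)
 ultimately show ?thesis by (subst homotopic_with) auto
qed

lemma homotopic_with_canonE:
 assumes "homotopic_maps S T f g"
 obtains h where "continuous_on ({0..1} \<times> S) h" "!!t x. t \<in> {0..1::real} ==> x \<in> S ==> h (t, x) \<in> T"
  "!!x. h (0, x) = f x" "!!x. h (1, x) = g x"
proof -
 obtain h where h: "continuous_map (prod_topology (top_of_set {0..1::real}) (top_of_set S)) (top_of_set T) h"
    "\<forall>x. h(0, x) = f x" "\<forall>x. h(1, x) = g x"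
  using assms unfolding homotopic_with_def by blast
 from h(1) have "continuous_on ({0..1} \<times> S) h" "h \<in> {0..1} \<times> S \<rightarrow> T" by auto
 with h that[of h] show ?thesis by blast
qed

lemma GLpath_homotopic:
 assumes "GLpath A B" "continuous_on S h" "!!x. x \<in> S ==> h x ~= 0"
 shows "homotopic_maps S (- {0}) (\<lambda>x. A *v h x) (\<lambda>x. B *v h x)"
proof -
 obtain p where p: "path p" "path_image p \<subseteq> {M. det M ~= 0}" "pathstart p = A" "pathfinish p = B"
  using assms by (auto simp: path_component_def)
 have nz: "det (p t) ~= 0" if "t \<in> {0..1}" for t using p(2) that by (fastforce simp: path_image_def)
 have "p t *v h x ~= 0" if "t \<in> {0..1}" "x \<in> S" for t x
  using nz[OF that(1)] assms(3)[OF that(2)]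
  by (metis invertible_det_nz matrix_left_invertible_ker invertible_left_inverse)
 moreover have "continuous_on ({0..1} \<times> S) (\<lambda>z. p (fst z) *v h (snd z))"
  using p(1) assms(2) unfolding path_def
  by (intro continuous_on_matrix_vector_mult) (auto intro!: continuous_on_compose2[of "{0..1}" p] continuous_on_compose2[of S h] continuous_intros)
 ultimately show ?thesis
  using p by (intro homotopic_with_canonI[of _ "\<lambda>t x. p t *v h x"]) (auto simp: pathstart_def pathfinish_def)
qed

lemma GLpath_of_det:
 fixes A :: "real^'n^'n"
 assumes n: "CARD('n) \<ge> 2"
 shows "det A > 0 ==> GLpath A (mat 1)" "det A < 0 ==> GLpath A (householder (axis k 1))"
 using GLpath_normal_form[OF n, of A k] GLpath_det_sign[of A "mat 1"] GLpath_det_sign[of A "householder (axis k 1)"]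
 by (auto simp: det_householder_axis)

lemma matrix_vector_mult_nonzero:
 fixes A :: "real^'n^'n"
 assumes "det A ~= 0" "x ~= 0" shows "A *v x ~= 0"
 using assms by (metis invertible_det_nz matrix_left_invertible_ker invertible_left_inverse)

text \<open>Moving \<open>A\<close> to the identity and \<open>B\<close> to one fixed reflection
  inside the invertible matrices removes both from the problem: what remains to be excluded is a
  homotopy from \<open>h\<close> to its mirror image.\<close>

lemma opposite_det_homotopic:
 fixes A B :: "real^'n^'n"
 assumes n: "CARD('n) \<ge> 2" and "det A > 0" "det B < 0"
  and h: "continuous_on S h" "!!x. x \<in> S ==> h x ~= 0"
  and hom: "homotopic_maps S (- {0}) (\<lambda>x. A *v h x) (\<lambda>x. B *v h x)"
 shows "homotopic_maps S (- {0}) h (\<lambda>x. householder (axis k 1) *v h x)"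
proof -
 have 1: "homotopic_maps S (- {0}) (\<lambda>x. A *v h x) (\<lambda>x. mat 1 *v h x)"
  using GLpath_of_det(1)[OF n assms(2)] h by (rule GLpath_homotopic)
 have 2: "homotopic_maps S (- {0}) (\<lambda>x. B *v h x) (\<lambda>x. householder (axis k 1) *v h x)"
  using GLpath_of_det(2)[OF n assms(3)] h by (rule GLpath_homotopic)
 have "homotopic_maps S (- {0}) (\<lambda>x. mat 1 *v h x) (\<lambda>x. householder (axis k 1) *v h x)"
  using homotopic_with_trans[OF homotopic_with_symD[OF 1] homotopic_with_trans[OF hom 2]] .
 then show ?thesis by simp
qed

section \<open>Circles, linked circles and the orientation of a linear map\<close>

definition plane_circle :: "'n => 'n => complex => real^'n" where
 "plane_circle i j z = axis i (Re z) + axis j (Im z)"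

lemma continuous_on_axis [continuous_intros]:
 fixes f :: "'a::topological_space => real"
 assumes "continuous_on S f" shows "continuous_on S (\<lambda>x. axis i (f x) :: real^'n)"
proof -
 have "(\<lambda>x. axis i (f x) :: real^'n) = (\<lambda>x. f x *\<^sub>R axis i 1)" by (auto simp: axis_def vec_eq_iff fun_eq_iff)
 moreover have "continuous_on S (\<lambda>x. f x *\<^sub>R (axis i 1 :: real^'n))" using assms by (intro continuous_intros)
 ultimately show ?thesis by (simp only:)
qed

text \<open>With two coordinates \<open>plane_circle\<close> identifies the complex unit circle with
  the unit sphere, so the homotopy from \<open>opposite_det_homotopic\<close> becomes one between
  the identity and a reflection of that sphere.\<close>

lemma no_orientation_change_2:
 fixes A B :: "real^'n^'n"
 assumes ij: "UNIV = {i, j}" "i ~= j" and "det A > 0" "det B < 0"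
 shows "\<not> homotopic_maps (sphere 0 1) (- {0})
   (\<lambda>z. A *v plane_circle i j z) (\<lambda>z. B *v plane_circle i j z)"
proof
 assume hom: "homotopic_maps (sphere 0 1) (- {0})
   (\<lambda>z. A *v plane_circle i j z) (\<lambda>z. B *v plane_circle i j z)"
 have "card {i, j} = 2" using ij(2) by simp
 then have n: "CARD('n) \<ge> 2" unfolding ij(1)[symmetric] by simp
 have comp: "plane_circle i j z $ i = Re z" "plane_circle i j z $ j = Im z" for z
  using ij(2) by (auto simp: plane_circle_def axis_def)
 have nz: "plane_circle i j z ~= 0" if "z \<in> sphere 0 1" for z
 proof
  assume "plane_circle i j z = 0"
  then have "z = 0" using comp[of z] by (simp add: complex_eq_iff)
  with that show False by simp
 qed
 have "homotopic_maps (sphere 0 1) (- {0})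
   (plane_circle i j) (\<lambda>z. householder (axis i 1) *v plane_circle i j z)"
  using nz hom by (intro opposite_det_homotopic[OF n assms(3,4)])
   (auto simp: plane_circle_def intro!: continuous_intros)
 then have "homotopic_maps (sphere 0 1 :: (real^'n) set) (- {0})
   (plane_circle i j \<circ> (\<lambda>v. Complex (v $ i) (v $ j))) ((\<lambda>z. householder (axis i 1) *v plane_circle i j z) \<circ> (\<lambda>v. Complex (v $ i) (v $ j)))"
 proof (rule homotopic_with_compose_continuous_map_right)
  have "norm (Complex (v $ i) (v $ j)) = norm v" for v :: "real^'n"
   unfolding norm_vec_def L2_set_def ij(1) using ij(2) by (simp add: complex_norm)
  then show "continuous_map (top_of_set (sphere 0 1 :: (real^'n) set)) (top_of_set (sphere 0 1)) (\<lambda>v. Complex (v $ i) (v $ j))"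
   by (auto intro!: continuous_intros)
 qed auto
 moreover have "plane_circle i j (Complex (v $ i) (v $ j)) = v" for v
 proof -
  have "plane_circle i j (Complex (v $ i) (v $ j)) $ l = v $ l" for l
  proof -
   have "l \<in> {i, j}" using ij(1) by blast
   then show ?thesis using comp[of "Complex (v $ i) (v $ j)"] by auto
  qed
  then show ?thesis by (simp add: vec_eq_iff)
 qed
 ultimately have "homotopic_maps (sphere 0 1 :: (real^'n) set) (- {0}) (\<lambda>v. v)
   (\<lambda>v. v - (2 * (v \<bullet> axis i 1)) *\<^sub>R axis i 1)"
  by (simp add: o_def householder_mult_vector inner_axis_axis)
 then show False using reflection_not_homotopic_id[of "axis i 1 :: real^'n"] by (simp add: axis_in_Basis_iff)
qed

text \<open>The unit circle in the plane of \<open>i\<close> and \<open>k\<close> centred at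
  \<open>axis i 1\<close>. It meets the plane of \<open>i\<close> and \<open>j\<close> at the centre
  of \<open>plane_circle\<close> and at twice the unit vector, once inside and once outside, so the
  two circles are linked.\<close>

definition link_circle :: "'n => 'n => complex => real^'n" where
 "link_circle i k z = axis i (1 + Re z) + axis k (Im z)"

text \<open>At zeros of \<open>c\<close> the bound on \<open>f\<close> nearby forces the product to
  0, whatever values \<open>f\<close> takes there. This extends a homotopy on a product of circles
  over the degenerate points of their join.\<close>

lemma continuous_on_scale_bounded:
 fixes c :: "'a::topological_space => real" and f :: "'a => 'b::real_normed_vector"
 assumes c: "continuous_on S c" and f: "continuous_on {x\<in>S. c x ~= 0} f"
  and b: "!!x. x \<in> S ==> c x ~= 0 ==> norm (f x) \<le> M"
 shows "continuous_on S (\<lambda>x. c x *\<^sub>R f x)"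
 unfolding continuous_on_def
proof
 fix x assume x: "x \<in> S"
 have ct: "(c \<longlongrightarrow> c x) (at x within S)" using c x by (auto simp: continuous_on_def)
 show "((\<lambda>x. c x *\<^sub>R f x) \<longlongrightarrow> c x *\<^sub>R f x) (at x within S)"
 proof (cases "c x = 0")
  case True
  have "((\<lambda>y. norm (c y) * \<bar>M\<bar>) \<longlongrightarrow> norm (c x) * \<bar>M\<bar>) (at x within S)"
   using ct by (intro tendsto_intros)
  then have "((\<lambda>y. norm (c y) * \<bar>M\<bar>) \<longlongrightarrow> 0) (at x within S)" using True by simp
  moreover have "norm (c y *\<^sub>R f y) \<le> norm (c y) * \<bar>M\<bar>" if "y \<in> S" for y
   using b[OF that] by (cases "c y = 0") (auto intro!: mult_left_mono)
  then have "\<forall>\<^sub>F y in at x within S. norm (c y *\<^sub>R f y) \<le> norm (c y) * \<bar>M\<bar>"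
   unfolding eventually_at_filter by (intro always_eventually) blast
  ultimately have "((\<lambda>y. c y *\<^sub>R f y) \<longlongrightarrow> 0) (at x within S)"
   by (rule Lim_null_comparison[rotated])
  then show ?thesis using True by simp
 next
  case False
  let ?S = "{x\<in>S. c x ~= 0}"
  have "(f \<longlongrightarrow> f x) (at x within ?S)" using f x False by (auto simp: continuous_on_def)
  moreover have "at x within ?S = at x within S"
  proof -
   have "\<forall>\<^sub>F y in at x within S. c y ~= 0"
    using ct False by (rule tendsto_imp_eventually_ne)
   then have "eventually (\<lambda>y. y ~= x --> (y \<in> ?S) = (y \<in> S)) (nhds x)"
    unfolding eventually_at_filter by (rule eventually_mono) auto
   then show ?thesis
    unfolding at_within_def by (simp add: filter_eq_iff eventually_inf_principal)
     (auto elim: eventually_elim2)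
  qed
  ultimately show ?thesis using ct by (simp add: tendsto_scaleR)
 qed
qed

text \<open>The segment between the suspended linking map and a linear isomorphism avoids the origin.\<close>

lemma link_join_segment_nonzero:
 fixes a1 a2 b1 b2 A B t :: real
 assumes A: "A = sqrt (a1\<^sup>2 + a2\<^sup>2)" and B: "B = sqrt (b1\<^sup>2 + b2\<^sup>2)"
  and ne: "A ~= 0 \<or> B ~= 0" and t: "0 \<le> t" "t \<le> 1"
  and e1: "t * (A\<^sup>2 - B\<^sup>2) + (1 - t) * (a1 + b1) = 0"
  and e2: "t * (a1 * B - A * B - b1 * A) + (1 - t) * (a1 - b1) = 0"
  and e3: "t * (a2 * B) + (1 - t) * a2 = 0"
  and e4: "t * (b2 * A) + (1 - t) * b2 = 0"
 shows False
proof -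
 have A0: "A \<ge> 0" and B0: "B \<ge> 0" using A B by auto
 have "a2 * (t * B + (1 - t)) = 0" using e3 by (simp add: algebra_simps)
 moreover have "b2 * (t * A + (1 - t)) = 0" using e4 by (simp add: algebra_simps)
 moreover have "t * B + (1 - t) > 0" "t * A + (1 - t) > 0"
  using t A0 B0 e1 ne by (cases "t = 1"; force simp: add_nonneg_pos)+
 moreover have not1: "\<not> (t = 1 \<and> B = 0)" "\<not> (t = 1 \<and> A = 0)" using e1 ne by auto
 ultimately have "a2 = 0" "b2 = 0" by auto
 then have AB: "A = \<bar>a1\<bar>" "B = \<bar>b1\<bar>" using A B by auto
 define x where "x = a1" define y where "y = b1"
 \<comment> \<open>With both imaginary parts zero the moduli are |x| and |y|. The first equation
   then factors, and the sign cases below play this factorisation against the second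
   equation.\<close>
 have f1: "(x + y) * (t * (x - y) + (1 - t)) = 0"
  using e1 AB by (simp add: x_def y_def algebra_simps power2_eq_square)
 have f2: "t * (x * \<bar>y\<bar> - \<bar>x\<bar> * \<bar>y\<bar> - y * \<bar>x\<bar>) + (1 - t) * (x - y) = 0"
  using e2 AB by (simp add: x_def y_def)
 have ne': "x ~= 0 \<or> y ~= 0" using ne AB by (auto simp: x_def y_def)
 have n1: "t = 1 ==> x ~= 0 \<and> y ~= 0" using not1 AB by (auto simp: x_def y_def)
 consider "x = 0" | "y = 0" | "x > 0" "y < 0" | "x < 0" "y > 0" | "x > 0" "y > 0" | "x < 0" "y < 0" by linarith
 then show False
 proof cases
  case 1 then show False using f2 n1 ne' t by auto
 next
  case 2 then show False using f2 n1 ne' t by auto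
 next
  case 3
  have s: "t * (x - y) + (1 - t) > 0"
   using 3 t by (cases "t = 1") (auto intro: add_nonneg_pos)
  then have "x = - y" using f1 by auto
  then have "t * (x * x) + (1 - t) * (x + x) = 0" using f2 3 by simp
  moreover have "t * (x * x) + (1 - t) * (x + x) > 0"
   using 3 t by (cases "t = 0") (auto intro!: add_pos_nonneg)
  ultimately show False by simp
 next
  case 4
  then have "t * (3 * (x * y)) + (1 - t) * (x - y) = 0" using f2 by (simp add: algebra_simps)
  moreover have xy: "x * y < 0" using 4 by (simp add: mult_neg_pos)
  then have "3 * (x * y) \<le> 0" by linarith
  then have "t * (3 * (x * y)) \<le> 0" using t(1) by (simp add: mult_nonneg_nonpos)
  moreover have "(1 - t) * (x - y) \<le> 0" using 4 t by (simp add: mult_nonneg_nonpos)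
  ultimately have "t * (3 * (x * y)) = 0" "(1 - t) * (x - y) = 0" by linarith+
  then have "t = 0" "t = 1" using 4 xy by (simp_all add: mult_eq_0_iff)
  then show False by simp
 next
  case 5
  then have g: "- t * (x * y) + (1 - t) * (x - y) = 0" using f2 by (simp add: algebra_simps)
  from f1 5 have h: "t * (x - y) + (1 - t) = 0" by auto
  show False
  proof (cases "t = 0")
   case True then show False using h by simp
  next
   case False
   then have "x - y \<le> 0" using h t by (smt (verit) mult_pos_pos)
   then have "(1 - t) * (x - y) \<le> 0" using t by (simp add: mult_nonneg_nonpos)
   moreover have "t * (x * y) > 0" using 5 False t by simp
   ultimately show False using g by linarith
  qed
 next
  case 6
  then have g: "- t * (x * y) + (1 - t) * (x - y) = 0" using f2 by (simp add: algebra_simps)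
  from f1 6 have h: "t * (x - y) + (1 - t) = 0" by auto
  show False
  proof (cases "t = 0")
   case True then show False using h by simp
  next
   case False
   then have "x - y \<le> 0" using h t by (smt (verit) mult_pos_pos)
   then have "(1 - t) * (x - y) \<le> 0" using t by (simp add: mult_nonneg_nonpos)
   moreover have "t * (x * y) > 0" using 6 False t by (simp add: mult_neg_neg)
   ultimately show False using g by linarith
  qed
 qed
qed

text \<open>Degree theory on spheres does not apply to the torus map \<open>?U\<close> directly. A
  homotopy \<open>h\<close> from \<open>?U\<close> to its mirror image is therefore suspended: a
  pair (a, b) of complex numbers, not both zero, goes to |a|^2 - |b|^2 together with |a| |b| times
  \<open>h\<close> at the normalised pair. Time 0 deforms to a linear isomorphism \<open>L\<close>,
  and time 1 is time 0 followed by a reflection; cancelling \<open>L\<close> leaves the identity of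
  a sphere homotopic to a reflection.\<close>

lemma no_orientation_change_3:
 fixes A B :: "real^'n^'n"
 assumes ijk: "UNIV = {i, j, k}" "i ~= j" "j ~= k" "i ~= k" and "det A > 0" "det B < 0"
 shows "\<not> homotopic_maps (sphere 0 1 \<times> sphere 0 1) (- {0})
   (\<lambda>z. A *v (plane_circle i j (fst z) - link_circle i k (snd z)))
   (\<lambda>z. B *v (plane_circle i j (fst z) - link_circle i k (snd z)))"
proof
 assume hom: "homotopic_maps (sphere 0 1 \<times> sphere 0 1) (- {0})
   (\<lambda>z. A *v (plane_circle i j (fst z) - link_circle i k (snd z)))
   (\<lambda>z. B *v (plane_circle i j (fst z) - link_circle i k (snd z)))"
 let ?T = "sphere 0 1 \<times> sphere 0 1 :: (complex \<times> complex) set"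
 let ?U = "\<lambda>z. plane_circle i j (fst z) - link_circle i k (snd z)"
 let ?R = "householder (axis i 1) :: real^'n^'n"
 have "card {i, j, k} = 3" using ijk(2-4) by simp
 then have n: "CARD('n) \<ge> 2" unfolding ijk(1)[symmetric] by simp
 have Uc: "?U z $ i = Re (fst z) - 1 - Re (snd z)" "?U z $ j = Im (fst z)" "?U z $ k = - Im (snd z)" for z
  using ijk(2-4) by (auto simp: plane_circle_def link_circle_def axis_def)
 have vec_eq: "v = w \<longleftrightarrow> v $ i = w $ i \<and> v $ j = w $ j \<and> v $ k = w $ k" for v w :: "real^'n"
  using ijk(1) unfolding vec_eq_iff by (metis (full_types) UNIV_I insertE singletonD)
 have U0: "?U z ~= 0" if "z \<in> ?T" for z
 proof
  assume z: "?U z = 0"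
  obtain s t where st: "z = (s, t)" by force
  have "Im s = 0" "Im t = 0" "Re s - 1 - Re t = 0" using z Uc[of z] st by (auto simp: vec_eq)
  moreover have "norm s = 1" "norm t = 1" using that st by auto
  ultimately have "\<bar>Re s\<bar> = 1" "\<bar>Re t\<bar> = 1" by (simp_all add: cmod_eq_Re)
  with \<open>Re s - 1 - Re t = 0\<close> show False by linarith
 qed
 have contU: "continuous_on S ?U" for S
  unfolding plane_circle_def link_circle_def by (intro continuous_intros)
 have "homotopic_maps ?T (- {0}) ?U (\<lambda>z. ?R *v ?U z)"
  using U0 hom contU by (intro opposite_det_homotopic[OF n assms(5,6)]) auto
 then obtain h where h: "continuous_on ({0..1} \<times> ?T) h" "!!t x. t \<in> {0..1::real} ==> x \<in> ?T ==> h (t, x) \<in> - {0}"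
  "!!x. h (0, x) = ?U x" "!!x. h (1, x) = ?R *v ?U x" by (rule homotopic_with_canonE) blast
 have "compact (h ` ({0..1} \<times> ?T))"
  by (intro compact_continuous_image h compact_Times) auto
 then obtain M where M: "!!z. z \<in> {0..1} \<times> ?T ==> norm (h z) \<le> M"
  using compact_imp_bounded bounded_iff by (metis (no_types, lifting) image_eqI)
 \<comment> \<open>Never zero: if \<open>a\<close> or \<open>b\<close> vanishes the first component
   does not, and otherwise the second is a positive multiple of a value of \<open>h\<close>.
   Division by zero at degenerate points is harmless since the factor in front is 0 there.\<close>
 define F where "F = (\<lambda>t (z::complex \<times> complex). ((norm (fst z))\<^sup>2 - (norm (snd z))\<^sup>2,
   (norm (fst z) * norm (snd z)) *\<^sub>R h (t, (fst z / norm (fst z), snd z / norm (snd z)))) :: real \<times> (real^'n))"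
 have sph: "(a / norm a, b / norm b) \<in> ?T" if "a ~= 0" "b ~= 0" for a b :: complex
  using that by (simp add: norm_divide)
 let ?D = "- {0} :: (complex \<times> complex) set"
 have hF: "homotopic_maps ?D (- {0}) (F 0) (F 1)"
 proof (rule homotopic_with_canonI[of _ F])
  show "continuous_on ({0..1} \<times> ?D) (\<lambda>z. F (fst z) (snd z))"
   unfolding F_def
  proof (intro continuous_on_Pair)
   show "continuous_on ({0..1} \<times> ?D)
    (\<lambda>x. (cmod (fst (snd x)) * cmod (snd (snd x))) *\<^sub>R
     h (fst x, fst (snd x) / complex_of_real (cmod (fst (snd x))), snd (snd x) / complex_of_real (cmod (snd (snd x)))))"
   proof (rule continuous_on_scale_bounded[where M=M])
    let ?C = "{x \<in> {0..1} \<times> ?D. cmod (fst (snd x)) * cmod (snd (snd x)) ~= 0}"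
    show "continuous_on ?C (\<lambda>x. h (fst x, fst (snd x) / complex_of_real (cmod (fst (snd x))), snd (snd x) / complex_of_real (cmod (snd (snd x)))))"
     by (rule continuous_on_compose2[OF h(1)]) (auto simp: norm_divide intro!: continuous_intros)
   qed (auto intro!: continuous_intros M sph simp: norm_divide)
  qed (intro continuous_intros)
  show "F t z \<in> - {0}" if "t \<in> {0..1}" "z \<in> ?D" for t z
  proof -
   obtain a b where z: "z = (a, b)" by force
   show ?thesis
   proof (cases "a = 0 \<or> b = 0")
    case True then show ?thesis using that z by (auto simp: F_def zero_prod_def)
   next
    case False
    then show ?thesis using h(2)[OF that(1) sph[of a b]] z by (auto simp: F_def zero_prod_def)
   qed
  qed
 qed auto
 \<comment> \<open>A linear model of \<open>F 0\<close>. In the coordinates \<open>j\<close> and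
   \<open>k\<close> it only drops the factors |b| and |a|, so a zero on the connecting segment
   forces both imaginary parts to vanish; \<open>link_join_segment_nonzero\<close> settles what is
   left.\<close>
 define L where "L = (\<lambda>z::complex\<times>complex. (Re (fst z) + Re (snd z),
    axis i (Re (fst z) - Re (snd z)) + axis j (Im (fst z)) + axis k (- Im (snd z))) :: real \<times> (real^'n))"
 have F0: "F 0 (a, b) = ((norm a)\<^sup>2 - (norm b)\<^sup>2, axis i (Re a * norm b - norm a * norm b - Re b * norm a) +
   axis j (Im a * norm b) + axis k (- Im b * norm a))" for a b
 proof (cases "a = 0 \<or> b = 0")
  case True
  then show ?thesis by (auto simp: F_def vec_eq axis_def)
 next
  case False
  then show ?thesis using ijk(2-4) unfolding F_def h(3) vec_eq prod.inject
   by (simp add: plane_circle_def link_circle_def axis_def field_simps)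
 qed
 have FL: "homotopic_maps ?D (- {0}) (F 0) L"
 proof (rule homotopic_with_linear)
  show "continuous_on ?D (F 0)" using homotopic_with_imp_continuous[OF hF] by simp
  show "continuous_on ?D L" unfolding L_def by (intro continuous_intros)
  fix z assume z: "z \<in> ?D"
  obtain a b where ab: "z = (a, b)" by force
  show "closed_segment (F 0 z) (L z) \<subseteq> - {0}"
  proof
   fix w assume "w \<in> closed_segment (F 0 z) (L z)"
   then have "w \<in> closed_segment (L z) (F 0 z)" by (simp add: closed_segment_commute)
   then obtain t where t: "0 \<le> t" "t \<le> 1" "w = (1 - t) *\<^sub>R L z + t *\<^sub>R F 0 z"
    by (auto simp: closed_segment_def)
   show "w \<in> - {0}"
   proof (rule ccontr)
    assume "\<not> w \<in> - {0}"
    then have w0: "(1 - t) *\<^sub>R L z + t *\<^sub>R F 0 z = 0" using t by simp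
    have "fst ((1 - t) *\<^sub>R L z + t *\<^sub>R F 0 z) = 0" "snd ((1 - t) *\<^sub>R L z + t *\<^sub>R F 0 z) $ i = 0"
     "snd ((1 - t) *\<^sub>R L z + t *\<^sub>R F 0 z) $ j = 0" "snd ((1 - t) *\<^sub>R L z + t *\<^sub>R F 0 z) $ k = 0"
     unfolding w0 by simp_all
    moreover have "fst ((1 - t) *\<^sub>R L z + t *\<^sub>R F 0 z) = t * ((norm a)\<^sup>2 - (norm b)\<^sup>2) + (1 - t) * (Re a + Re b)"
     "snd ((1 - t) *\<^sub>R L z + t *\<^sub>R F 0 z) $ i = t * (Re a * norm b - norm a * norm b - Re b * norm a) + (1 - t) * (Re a - Re b)"
     "snd ((1 - t) *\<^sub>R L z + t *\<^sub>R F 0 z) $ j = t * (Im a * norm b) + (1 - t) * Im a"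
     "snd ((1 - t) *\<^sub>R L z + t *\<^sub>R F 0 z) $ k = - (t * (Im b * norm a) + (1 - t) * Im b)"
     using ijk(2-4) by (simp_all add: ab F0 L_def axis_def)
    moreover have "norm a ~= 0 \<or> norm b ~= 0" using z ab by (auto simp: zero_prod_def)
    ultimately show False
     using link_join_segment_nonzero[of "norm a" "Re a" "Im a" "norm b" "Re b" "Im b" t] t(1,2)
     by (simp add: cmod_def)
   qed
  qed
 qed
 let ?R' = "\<lambda>y::real \<times> (real^'n). (fst y, ?R *v snd y)"
 have R'c: "continuous_map (top_of_set (- {0})) (top_of_set (- {0})) ?R'"
 proof -
  have "?R *v x ~= 0" if "x ~= 0" for x
   using that by (intro matrix_vector_mult_nonzero det_householder_nonzero) (auto simp: axis_eq_0_iff)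
  then have "?R' y ~= 0" if "y ~= 0" for y
   using that by (cases y) (auto simp: zero_prod_def)
  moreover have "continuous_on (- {0}) ?R'"
   by (intro continuous_on_Pair continuous_on_matrix_vector_mult continuous_on_fst continuous_on_snd continuous_on_const continuous_on_id)
  ultimately show ?thesis by auto
 qed
 have "homotopic_maps ?D (- {0}) (?R' \<circ> F 0) (?R' \<circ> L)"
  using FL R'c by (rule homotopic_with_compose_continuous_map_left) auto
 moreover have "(?R' \<circ> F 0) = F 1"
  unfolding F_def h(3,4) by (simp add: fun_eq_iff matrix_vector_mult_scaleR)
 ultimately have "homotopic_maps ?D (- {0}) L (?R' \<circ> L)"
  using homotopic_with_trans[OF homotopic_with_symD[OF FL] homotopic_with_trans[OF hF]] by simp
 \<comment> \<open>A right inverse of \<open>L\<close>, obtained by recovering the two real parts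
   from their sum and difference.\<close>
 moreover define G where "G = (\<lambda>y::real \<times> (real^'n). (Complex ((fst y + snd y $ i) / 2) (snd y $ j), Complex ((fst y - snd y $ i) / 2) (- snd y $ k)))"
 have LG: "L (G y) = y" for y
  using ijk(2-4) by (cases y) (simp add: L_def G_def vec_eq axis_def field_simps)
 have "continuous_map (top_of_set (sphere 0 1)) (top_of_set ?D) G"
 proof -
  have "G y \<in> - {0}" if "y \<in> sphere 0 1" for y
  proof
   assume "G y \<in> {0}"
   then have "G y = 0" by simp
   then have "L (G y) = 0" by (simp add: L_def zero_prod_def) (simp add: vec_eq axis_def)
   then show False using LG[of y] that by simp
  qed
  then have "G \<in> sphere 0 1 \<rightarrow> - {0}" by blast
  moreover have "continuous_on (sphere 0 1) G" unfolding G_def by (intro continuous_intros) auto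
  ultimately show ?thesis unfolding continuous_map_in_subtopology by simp
 qed
 ultimately have "homotopic_maps (sphere 0 1) (- {0}) (L \<circ> G) ((?R' \<circ> L) \<circ> G)"
  by (rule homotopic_with_compose_continuous_map_right) (rule TrueI)
 moreover have "L \<circ> G = (\<lambda>y. y)" by (simp add: fun_eq_iff LG)
 moreover have "?R' y = y - (2 * (y \<bullet> (0, axis i 1))) *\<^sub>R (0, axis i 1)" for y
  by (cases y) (simp add: householder_mult_vector inner_axis_axis)
 then have "(?R' \<circ> L) \<circ> G = (\<lambda>y. y - (2 * (y \<bullet> (0, axis i 1))) *\<^sub>R (0, axis i 1))"
  unfolding o_def LG by (rule ext)
 ultimately have "homotopic_maps (sphere 0 1 :: (real \<times> (real^'n)) set) (- {0}) (\<lambda>y. y)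
   (\<lambda>y. y - (2 * (y \<bullet> (0, axis i 1))) *\<^sub>R (0, axis i 1))"
  by (simp only:)
 then show False
  using reflection_not_homotopic_id[of "(0, axis i 1) :: real \<times> (real^'n)"] by (simp add: Basis_prod_def axis_in_Basis_iff)
qed

text \<open>An injective map sends disjoint curves to disjoint curves, so moving the centre of a
 small linked pair along a path never makes the difference map vanish.\<close>

lemma link_difference_homotopic:
 fixes g :: "'a::euclidean_space => 'b::real_normed_vector" and K1 :: "'c::topological_space => 'a" and K2 :: "'d::topological_space => 'a"
 assumes W: "open W" "connected W" and g: "continuous_on W g" "inj_on g W"
  and K: "continuous_on X K1" "continuous_on Y K2" "!!s. s \<in> X ==> norm (K1 s) < 1" "!!t. t \<in> Y ==> norm (K2 t) < 1"
  and dis: "!!s t. s \<in> X ==> t \<in> Y ==> K1 s ~= K2 t"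
  and x: "ball x r \<subseteq> W" "r > 0" and x': "ball x' r' \<subseteq> W" "r' > 0"
 shows "homotopic_maps (X \<times> Y) (- {0})
   (\<lambda>z. g (x + r *\<^sub>R K1 (fst z)) - g (x + r *\<^sub>R K2 (snd z)))
   (\<lambda>z. g (x' + r' *\<^sub>R K1 (fst z)) - g (x' + r' *\<^sub>R K2 (snd z)))"
proof -
 have inb: "c + \<rho> *\<^sub>R v \<in> ball c \<rho>" if "norm v < 1" "\<rho> > 0" for c v :: 'a and \<rho>
  using that by (simp add: dist_norm mult_less_cancel_left_pos[of \<rho> "norm v" 1, simplified])
 \<comment> \<open>Any simultaneous motion of centre and radius that keeps the ball inside
   \<open>W\<close> is a homotopy: at each time the two curves are disjoint in \<open>W\<close>, and
   injectivity of \<open>g\<close> keeps their images apart.\<close>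
 have *: "homotopic_maps (X \<times> Y) (- {0})
   (\<lambda>z. g (c 0 + \<rho> 0 *\<^sub>R K1 (fst z)) - g (c 0 + \<rho> 0 *\<^sub>R K2 (snd z)))
   (\<lambda>z. g (c 1 + \<rho> 1 *\<^sub>R K1 (fst z)) - g (c 1 + \<rho> 1 *\<^sub>R K2 (snd z)))"
  if c: "continuous_on {0..1} c" "continuous_on {0..1} \<rho>" and b: "!!t. t \<in> {0..1::real} ==> ball (c t) (\<rho> t) \<subseteq> W \<and> \<rho> t > 0"
  for c \<rho>
 proof (rule homotopic_with_canonI[of _ "\<lambda>t z. g (c t + \<rho> t *\<^sub>R K1 (fst z)) - g (c t + \<rho> t *\<^sub>R K2 (snd z))"])
  have in1: "c t + \<rho> t *\<^sub>R K1 s \<in> W" if "t \<in> {0..1}" "s \<in> X" for t s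
   using b[OF that(1)] inb[OF K(3)[OF that(2)]] by blast
  have in2: "c t + \<rho> t *\<^sub>R K2 s \<in> W" if "t \<in> {0..1}" "s \<in> Y" for t s
   using b[OF that(1)] inb[OF K(4)[OF that(2)]] by blast
  have cc: "continuous_on ({0..1} \<times> X \<times> Y) (\<lambda>z. c (fst z))" "continuous_on ({0..1} \<times> X \<times> Y) (\<lambda>z. \<rho> (fst z))"
   by (rule continuous_on_compose2[OF c(1)] continuous_on_compose2[OF c(2)]; auto intro!: continuous_intros)+
  have ck: "continuous_on ({0..1::real} \<times> X \<times> Y) (\<lambda>z. K1 (fst (snd z)))" "continuous_on ({0..1::real} \<times> X \<times> Y) (\<lambda>z. K2 (snd (snd z)))"
   by (rule continuous_on_compose2[OF K(1)] continuous_on_compose2[OF K(2)]; auto intro!: continuous_intros)+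
  show "continuous_on ({0..1} \<times> X \<times> Y) (\<lambda>z. g (c (fst z) + \<rho> (fst z) *\<^sub>R K1 (fst (snd z))) - g (c (fst z) + \<rho> (fst z) *\<^sub>R K2 (snd (snd z))))"
   by (intro continuous_on_diff continuous_on_compose2[OF g(1)] continuous_intros cc ck) (auto intro: in1 in2)
  show "g (c t + \<rho> t *\<^sub>R K1 (fst z)) - g (c t + \<rho> t *\<^sub>R K2 (snd z)) \<in> - {0}" if "t \<in> {0..1}" "z \<in> X \<times> Y" for t z
  proof -
   have "c t + \<rho> t *\<^sub>R K1 (fst z) ~= c t + \<rho> t *\<^sub>R K2 (snd z)" using dis[of "fst z" "snd z"] b[OF that(1)] that(2) by auto
   moreover have "c t + \<rho> t *\<^sub>R K1 (fst z) \<in> W" "c t + \<rho> t *\<^sub>R K2 (snd z) \<in> W"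
    using that in1[OF that(1)] in2[OF that(1)] by auto
   ultimately have "g (c t + \<rho> t *\<^sub>R K1 (fst z)) ~= g (c t + \<rho> t *\<^sub>R K2 (snd z))"
    using inj_onD[OF g(2)] by blast
   then show ?thesis by simp
  qed
 qed auto
 have "path_connected W" using W connected_open_path_connected by blast
 moreover have "x \<in> W" "x' \<in> W" using x x' by (auto intro: subsetD)
 ultimately obtain p where p: "path p" "path_image p \<subseteq> W" "pathstart p = x" "pathfinish p = x'"
  unfolding path_connected_def by blast
 have "compact (path_image p)" using p(1) by (rule compact_path_image)
 then obtain e where e: "e > 0" "(\<Union>y\<in>path_image p. ball y e) \<subseteq> W"
  using compact_subset_open_imp_ball_epsilon_subset[OF _ W(1) p(2)] by blast
 \<comment> \<open>A radius that fits around every point of the path: shrink to it at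
   \<open>x\<close>, travel along the path, and grow again at \<open>x'\<close>.\<close>
 define \<epsilon> where "\<epsilon> = min e (min r r')"
 have \<epsilon>: "\<epsilon> > 0" "\<epsilon> \<le> e" "\<epsilon> \<le> r" "\<epsilon> \<le> r'" using e x x' by (auto simp: \<epsilon>_def)
 have pos: "(1 - t) * a + t * b > 0" "(1 - t) * a + t * b \<le> max a b" if "0 \<le> t" "t \<le> 1" "a > 0" "b > 0" for t a b :: real
 proof -
  show "(1 - t) * a + t * b > 0" using that by (cases "t = 0") (auto intro: add_nonneg_pos)
  show "(1 - t) * a + t * b \<le> max a b" by (rule convex_bound_le) (use that in auto)
 qed
 have st: "!!t. t \<in> {0..1} ==> ball y ((1 - t) * a + t * b) \<subseteq> W \<and> (1 - t) * a + t * b > 0"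
  if "ball y (max a b) \<subseteq> W" "a > 0" "b > 0" for y a b
  using pos[of _ a b] that by (meson atLeastAtMost_iff order_trans subset_ball)
 have mx: "max r \<epsilon> = r" "max \<epsilon> r' = r'" using \<epsilon> by auto
 have 1: "homotopic_maps (X \<times> Y) (- {0})
   (\<lambda>z. g (x + r *\<^sub>R K1 (fst z)) - g (x + r *\<^sub>R K2 (snd z)))
   (\<lambda>z. g (x + \<epsilon> *\<^sub>R K1 (fst z)) - g (x + \<epsilon> *\<^sub>R K2 (snd z)))"
 proof -
  have "continuous_on {0..1} (\<lambda>t. (1 - t) * r + t * \<epsilon>)" by (intro continuous_intros)
  from *[OF continuous_on_const this] st[of x r \<epsilon>] x \<epsilon> mx show ?thesis by simp
 qed
 have 2: "homotopic_maps (X \<times> Y) (- {0})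
   (\<lambda>z. g (x + \<epsilon> *\<^sub>R K1 (fst z)) - g (x + \<epsilon> *\<^sub>R K2 (snd z)))
   (\<lambda>z. g (x' + \<epsilon> *\<^sub>R K1 (fst z)) - g (x' + \<epsilon> *\<^sub>R K2 (snd z)))"
 proof -
  have "ball (p t) \<epsilon> \<subseteq> W" if "t \<in> {0..1}" for t
   using e(2) \<epsilon>(2) that unfolding path_image_def by (auto simp: subset_eq)
  then show ?thesis
   using *[of p "\<lambda>_. \<epsilon>"] p \<epsilon>(1) by (auto simp: path_def pathstart_def pathfinish_def)
 qed
 have 3: "homotopic_maps (X \<times> Y) (- {0})
   (\<lambda>z. g (x' + \<epsilon> *\<^sub>R K1 (fst z)) - g (x' + \<epsilon> *\<^sub>R K2 (snd z)))
   (\<lambda>z. g (x' + r' *\<^sub>R K1 (fst z)) - g (x' + r' *\<^sub>R K2 (snd z)))"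
 proof -
  have "continuous_on {0..1} (\<lambda>t. (1 - t) * \<epsilon> + t * r')" by (intro continuous_intros)
  from *[OF continuous_on_const this] st[of x' \<epsilon> r'] x' \<epsilon> mx show ?thesis by simp
 qed
 show ?thesis using homotopic_with_trans[OF homotopic_with_trans[OF 1 2] 3] .
qed

section \<open>Mollification and segment estimates\<close>

text \<open>The function exp(-1/t) for t > 0 with the powers of 1/t that its derivatives produce.
  Differentiation raises the index by one or two, so linear combinations of the family stay closed
  under it, and every member tends to 0 at 0.\<close>

definition flat_exp :: "nat => real => real" where
 "flat_exp m t = (if t \<le> 0 then 0 else (inverse t) ^ m * exp (- inverse t))"

lemma flat_exp_tendsto_0: "(flat_exp m \<longlongrightarrow> 0) (at 0)"
proof -
 have "((\<lambda>t. (inverse t) ^ m / exp (inverse t)) \<longlongrightarrow> 0) (at_right (0::real))"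
  by (rule filterlim_compose[OF tendsto_power_div_exp_0 filterlim_inverse_at_top_right])
 moreover have "\<forall>\<^sub>F t in at_right (0::real). (inverse t) ^ m / exp (inverse t) = flat_exp m t"
  by (simp add: eventually_at_filter flat_exp_def exp_minus divide_inverse)
 ultimately have "(flat_exp m \<longlongrightarrow> 0) (at_right 0)"
  using tendsto_cong by force
 moreover have "(flat_exp m \<longlongrightarrow> 0) (at_left 0)"
 proof -
  have "\<forall>\<^sub>F t in at_left (0::real). flat_exp m t = 0"
   by (simp add: eventually_at_filter flat_exp_def)
  then show ?thesis by (simp add: tendsto_eventually)
 qed
 ultimately show ?thesis by (simp add: filterlim_at_split)
qed

lemma flat_exp_has_derivative:
 "(flat_exp m has_real_derivative flat_exp (m + 2) t - real m * flat_exp (m + 1) t) (at t)"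
proof -
 consider "t < 0" | "t = 0" | "t > 0" by linarith
 then show ?thesis
 proof cases
  case 1
  have "((\<lambda>_. 0) has_real_derivative 0) (at t)" by simp
  then have "(flat_exp m has_real_derivative 0) (at t)"
   by (rule DERIV_cong_ev[OF refl _ refl, THEN iffD1, rotated])
    (use eventually_nhds_in_open[of "{..<0}" t] 1 in \<open>auto elim!: eventually_mono simp: flat_exp_def\<close>)
  then show ?thesis using 1 by (simp add: flat_exp_def)
 next
  case 2
  have "flat_exp m h / h = flat_exp (m + 1) h" if "h ~= 0" for h
   using that by (simp add: flat_exp_def divide_inverse)
  then have "\<forall>\<^sub>F h in at 0. flat_exp (m + 1) h = (flat_exp m (0 + h) - flat_exp m 0) / h"
   by (simp add: eventually_at_filter flat_exp_def[of m 0])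
  then have "((\<lambda>h. (flat_exp m (0 + h) - flat_exp m 0) / h) \<longlongrightarrow> 0) (at 0)"
   using flat_exp_tendsto_0[of "m + 1"] tendsto_cong by fast
  then show ?thesis using 2 by (simp add: DERIV_def flat_exp_def)
 next
  case 3
  have "((\<lambda>t. (inverse t) ^ m * exp (- inverse t)) has_real_derivative
    (inverse t) ^ m * (exp (- inverse t) * (inverse t * inverse t)) +
    real m * inverse t ^ (m - 1) * (- (inverse t * inverse t)) * exp (- inverse t)) (at t)"
   using 3 by (auto intro!: derivative_eq_intros simp: power2_eq_square)
  moreover have "(inverse t) ^ m * (exp (- inverse t) * (inverse t * inverse t)) +
    real m * inverse t ^ (m - 1) * (- (inverse t * inverse t)) * exp (- inverse t) =
    flat_exp (m + 2) t - real m * flat_exp (m + 1) t"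
   using 3 by (cases m) (auto simp: flat_exp_def algebra_simps)
  ultimately have "((\<lambda>t. (inverse t) ^ m * exp (- inverse t)) has_real_derivative flat_exp (m + 2) t - real m * flat_exp (m + 1) t) (at t)"
   by simp
  then show ?thesis
   by (rule DERIV_cong_ev[OF refl _ refl, THEN iffD1, rotated])
    (use eventually_nhds_in_open[of "{0<..}" t] 3 in \<open>auto elim!: eventually_mono simp: flat_exp_def\<close>)
 qed
qed

text \<open>An algebra of functions that is closed under partial derivatives and contains the
 standard bump functions; it witnesses smoothness without computing higher derivatives.\<close>

inductive bump_alg :: "((real,'n::finite) vec => real) => bool" where
 bump_const: "bump_alg (\<lambda>_. c)"
| bump_coord: "bump_alg (\<lambda>x. x \<bullet> v)"
| bump_flat: "bump_alg (\<lambda>x. flat_exp m (1 - b * (x \<bullet> x)))"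
| bump_add: "bump_alg f ==> bump_alg g ==> bump_alg (\<lambda>x. f x + g x)"
| bump_mult: "bump_alg f ==> bump_alg g ==> bump_alg (\<lambda>x. f x * g x)"

lemma bump_alg_derivative:
 "bump_alg f ==> \<exists>f'. (\<forall>x. (f has_derivative f' x) (at x)) \<and> (\<forall>j. bump_alg (\<lambda>x. f' x (axis j 1)))"
proof (induction rule: bump_alg.induct)
 case (bump_const c)
 show ?case by (rule exI[of _ "\<lambda>_ _. 0"]) (auto intro: bump_alg.intros)
next
 case (bump_coord v)
 have "((\<lambda>x::real^'a. x \<bullet> v) has_derivative (\<lambda>h. h \<bullet> v)) (at x)" for x
  by (auto intro!: derivative_eq_intros)
 then show ?case by (intro exI[of _ "\<lambda>_ h. h \<bullet> v"]) (auto intro: bump_alg.intros)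
next
 case (bump_flat m b)
 let ?F = "\<lambda>t. flat_exp (m + 2) t - real m * flat_exp (m + 1) t"
 have d: "((\<lambda>x. flat_exp m (1 - b * (x \<bullet> x))) has_derivative (\<lambda>h. (- (2 * b)) * (x \<bullet> h) * ?F (1 - b * (x \<bullet> x)))) (at x)" for x :: "real^'a"
 proof -
  have "((\<lambda>x. 1 - b * (x \<bullet> x)) has_derivative (\<lambda>h. - (2 * b) * (x \<bullet> h))) (at x)"
   by (auto intro!: derivative_eq_intros simp: inner_commute algebra_simps)
  from has_derivative_compose[OF this flat_exp_has_derivative[unfolded has_field_derivative_def, of m "1 - b * (x \<bullet> x)"]]
  show ?thesis by (simp add: mult_ac)
 qed
 have e: "(\<lambda>x. (- (2 * b)) * (x \<bullet> axis j 1) * ?F (1 - b * (x \<bullet> x))) =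
   (\<lambda>x::real^'a. ((- (2 * b)) * (x \<bullet> axis j 1)) * (flat_exp (m + 2) (1 - b * (x \<bullet> x)) + (- real m) * flat_exp (m + 1) (1 - b * (x \<bullet> x))))" for j
  by (simp add: inner_axis)
 show ?case
  by (intro exI[of _ "\<lambda>x h. (- (2 * b)) * (x \<bullet> h) * ?F (1 - b * (x \<bullet> x))"] conjI allI d)
   (unfold e, intro bump_alg.intros)
next
 case (bump_add f g)
 then obtain f' g' where "!!x. (f has_derivative f' x) (at x)" "!!j. bump_alg (\<lambda>x. f' x (axis j 1))"
  "!!x. (g has_derivative g' x) (at x)" "!!j. bump_alg (\<lambda>x. g' x (axis j 1))" by blast
 then show ?case
  by (intro exI[of _ "\<lambda>x h. f' x h + g' x h"] conjI allI has_derivative_add bump_alg.intros) auto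
next
 case (bump_mult f g)
 then obtain f' g' where *: "!!x. (f has_derivative f' x) (at x)" "!!j. bump_alg (\<lambda>x. f' x (axis j 1))"
  "!!x. (g has_derivative g' x) (at x)" "!!j. bump_alg (\<lambda>x. g' x (axis j 1))" by blast
 show ?case
  by (intro exI[of _ "\<lambda>x h. f x * g' x h + f' x h * g x"] conjI allI has_derivative_mult bump_alg.intros * bump_mult.hyps)
qed

lemma partial_derivI: "(f has_derivative f') (at x) ==> partial_deriv j f x = f' (axis j 1)"
 by (simp add: partial_deriv_def frechet_derivative_at[symmetric])

lemma bump_alg_C_k: "bump_alg f ==> C_k k f"
proof (induction k arbitrary: f)
 case 0
 then obtain f' where f': "!!x. (f has_derivative f' x) (at x)" using bump_alg_derivative by blast
 show ?case using has_derivative_continuous[OF f'] by (simp add: continuous_at_imp_continuous_on)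
next
 case (Suc k)
 then obtain f' where f': "!!x. (f has_derivative f' x) (at x)" "!!j. bump_alg (\<lambda>x. f' x (axis j 1))"
  using bump_alg_derivative by blast
 have "partial_deriv j f = (\<lambda>x. f' x (axis j 1))" for j
  using partial_derivI[OF f'(1)] by auto
 then have "C_k k (partial_deriv j f)" for j using Suc.IH[OF f'(2)] by simp
 moreover have "f differentiable_on UNIV" using f'(1) by (auto simp: differentiable_on_def differentiable_def intro: has_derivative_at_withinI)
 ultimately show ?case by simp
qed

section \<open>Convolution with smooth kernels of compact support\<close>

definition smooth_compact :: "(real^'n => real) => bool" where
 "smooth_compact \<eta> \<longleftrightarrow> (\<forall>k. C_k k \<eta>) \<and> (\<exists>R. \<forall>x. norm x > R --> \<eta> x = 0)"

lemma smooth_compact_has_derivative: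
 fixes \<eta> :: "real^'n => real"
 assumes "smooth_compact \<eta>"
 shows "(\<eta> has_derivative (\<lambda>h. (\<chi> j. partial_deriv j \<eta> x) \<bullet> h)) (at x)"
proof -
 have "C_k (Suc 0) \<eta>" using assms unfolding smooth_compact_def by blast
 then have "\<eta> differentiable at x" by (simp add: differentiable_on_def)
 then have d: "(\<eta> has_derivative frechet_derivative \<eta> (at x)) (at x)" by (simp add: frechet_derivative_works)
 then interpret bounded_linear "frechet_derivative \<eta> (at x)" by (rule has_derivative_bounded_linear)
 have "frechet_derivative \<eta> (at x) h = (\<chi> j. partial_deriv j \<eta> x) \<bullet> h" for h :: "real^'n"
 proof -
  have "h = (\<Sum>j\<in>UNIV. h $ j *\<^sub>R axis j 1)" using basis_expansion[of h] by (simp add: scalar_mult_eq_scaleR)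
  then have "frechet_derivative \<eta> (at x) h = frechet_derivative \<eta> (at x) (\<Sum>j\<in>UNIV. h $ j *\<^sub>R axis j 1)" by simp
  also have "\<dots> = (\<Sum>j\<in>UNIV. h $ j * partial_deriv j \<eta> x)" by (simp add: sum scaleR partial_deriv_def)
  finally show ?thesis by (simp add: inner_vec_def mult.commute)
 qed
 then have "frechet_derivative \<eta> (at x) = (\<lambda>h. (\<chi> j. partial_deriv j \<eta> x) \<bullet> h)" by (rule ext)
 then show ?thesis using d by (simp only:)
qed

lemma smooth_compact_partial:
 assumes "smooth_compact \<eta>" shows "smooth_compact (partial_deriv j \<eta>)"
proof -
 have "C_k (Suc k) \<eta>" for k using assms unfolding smooth_compact_def by blast
 then have "C_k k (partial_deriv j \<eta>)" for k by simp
 moreover obtain R where R: "!!x. norm x > R ==> \<eta> x = 0" using assms unfolding smooth_compact_def by blast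
 have "partial_deriv j \<eta> x = 0" if "norm x > R" for x
 proof -
  have "open {x::real^'n. norm x > R}" by (intro open_Collect_less continuous_intros)
  moreover have "((\<lambda>_. 0) has_derivative (\<lambda>_. 0)) (at x)" by simp
  ultimately have "(\<eta> has_derivative (\<lambda>_. 0)) (at x)"
   using that R by (intro has_derivative_transform_within_open[of "\<lambda>_. 0" "\<lambda>_. 0" x UNIV "{x. norm x > R}" \<eta>]) auto
  then show ?thesis by (simp add: partial_derivI)
 qed
 ultimately show ?thesis unfolding smooth_compact_def by blast
qed

lemma smooth_compact_continuous: "smooth_compact \<eta> ==> continuous_on S \<eta>"
 using continuous_on_subset[of UNIV \<eta> S] C_k.simps(1)[of \<eta>] unfolding smooth_compact_def by blast

lemma smooth_compact_measurable: "smooth_compact \<eta> ==> \<eta> \<in> borel_measurable borel"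
 by (rule borel_measurable_continuous_onI) (rule smooth_compact_continuous)

lemma compact_support_bounded:
 fixes f :: "'a::euclidean_space => 'b::euclidean_space"
 assumes "continuous_on UNIV f" "!!x. norm x > R ==> f x = 0"
 obtains B where "B > 0" "!!x. norm (f x) \<le> B"
proof -
 have "compact (f ` cball 0 R)" by (intro compact_continuous_image continuous_on_subset[OF assms(1)]) auto
 then obtain B where B: "B > 0" "!!x. x \<in> cball 0 R ==> norm (f x) \<le> B"
  by (metis (no_types, lifting) bounded_pos compact_imp_bounded imageI)
 have "norm (f x) \<le> B" for x
  using B assms(2)[of x] by (cases "norm x > R") auto
 with B that show ?thesis by blast
qed

lemma compact_support_uniformly_continuous:
 fixes f :: "'a::euclidean_space => 'b::euclidean_space"
 assumes c: "continuous_on UNIV f" and z: "!!x. norm x > R ==> f x = 0"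
 shows "uniformly_continuous_on UNIV f"
 unfolding uniformly_continuous_on_def
proof (intro allI impI)
 fix e :: real assume e: "e > 0"
 have "uniformly_continuous_on (cball 0 (R + 1)) f"
  by (intro compact_uniformly_continuous continuous_on_subset[OF c]) auto
 then obtain d where d: "d > 0" "!!x y. x \<in> cball 0 (R + 1) ==> y \<in> cball 0 (R + 1) ==> dist y x < d ==> dist (f y) (f x) < e"
  using e unfolding uniformly_continuous_on_def by metis
 show "\<exists>d>0. \<forall>x\<in>UNIV. \<forall>x'\<in>UNIV. dist x' x < d --> dist (f x') (f x) < e"
 proof (intro exI[of _ "min d 1"] conjI ballI impI)
  fix x y :: 'a assume xy: "dist y x < min d 1"
  have "norm y \<le> norm x + dist y x" "norm x \<le> norm y + dist y x"
   using norm_triangle_sub[of y x] norm_triangle_sub[of x y] by (simp_all add: dist_norm norm_minus_commute)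
  then consider "x \<in> cball 0 (R + 1)" "y \<in> cball 0 (R + 1)" | "norm x > R" "norm y > R"
   using xy by (force simp: dist_norm)
  then show "dist (f y) (f x) < e" using d xy z e by cases auto
 qed (use d in auto)
qed

definition convolve :: "(real^'n => real) => (real^'n => real) => real^'n => real" where
 "convolve u \<eta> x = (\<integral>y. u y * \<eta> (x - y) \<partial>lborel)"

lemma smooth_compact_bounded:
 assumes "smooth_compact \<eta>" obtains B where "B > 0" "!!x. \<bar>\<eta> x\<bar> \<le> B"
 using compact_support_bounded[OF smooth_compact_continuous[OF assms]] assms
 unfolding smooth_compact_def by (metis real_norm_def)

lemma integrable_mult_smooth_compact:
 fixes u :: "real^'n => real"
 assumes u: "integrable lborel u" and \<eta>: "smooth_compact \<eta>" and f: "f \<in> borel_measurable borel"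
 shows "integrable lborel (\<lambda>y. u y * \<eta> (f y))"
proof -
 obtain B where B: "B > 0" "!!x. \<bar>\<eta> x\<bar> \<le> B" using smooth_compact_bounded[OF \<eta>] by blast
 have [measurable]: "u \<in> borel_measurable borel" using u by simp
 note [measurable] = smooth_compact_measurable[OF \<eta>] f
 show ?thesis
 proof (rule Bochner_Integration.integrable_bound)
  show "integrable lborel (\<lambda>y. u y * B)" using u by simp
  show "AE y in lborel. norm (u y * \<eta> (f y)) \<le> norm (u y * B)"
   using B by (intro AE_I2) (auto simp: abs_mult intro!: mult_left_mono)
 qed measurable
qed

text \<open>All derivatives fall on the kernel, so integrability of \<open>u\<close> suffices. The
  remainder in the first order expansion of \<open>\<eta>\<close> is small uniformly in the base
  point, because a continuous gradient of compact support is uniformly continuous; integration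
  against |u| keeps it small.\<close>

lemma convolve_has_derivative:
 fixes u :: "real^'n => real"
 assumes u: "integrable lborel u" and \<eta>: "smooth_compact \<eta>"
 shows "(convolve u \<eta> has_derivative (\<lambda>h. (\<chi> j. convolve u (partial_deriv j \<eta>) x) \<bullet> h)) (at x)"
proof -
 let ?G = "\<lambda>x. \<chi> j. partial_deriv j \<eta> x"
 have [measurable]: "u \<in> borel_measurable borel" using u by simp
 note \<eta>j = smooth_compact_partial[OF \<eta>]
 have Gc: "continuous_on UNIV ?G" using smooth_compact_continuous[OF \<eta>j] by (intro continuous_intros)
 obtain R where R: "!!x. norm x > R ==> ?G x = 0"
 proof -
  have "\<forall>j. \<exists>R. \<forall>x. norm x > R --> partial_deriv j \<eta> x = 0" using \<eta>j unfolding smooth_compact_def by blast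
  then obtain R where R: "!!j x. norm x > R j ==> partial_deriv j \<eta> x = 0" by metis
  have "?G x = 0" if "norm x > Max (range R)" for x
  proof -
   have "norm x > R j" for j using that by (simp add: Max_ge_iff le_less_trans)
   then show ?thesis using R by (simp add: vec_eq_iff)
  qed
  then show ?thesis using that by blast
 qed
 have unif: "uniformly_continuous_on UNIV ?G" by (rule compact_support_uniformly_continuous[OF Gc R])
 have lin: "(\<chi> j. convolve u (partial_deriv j \<eta>) x) \<bullet> h = (\<integral>y. u y * (?G (x - y) \<bullet> h) \<partial>lborel)" for h
 proof -
  have "(\<chi> j. convolve u (partial_deriv j \<eta>) x) \<bullet> h = (\<Sum>j\<in>UNIV. (\<integral>y. u y * partial_deriv j \<eta> (x - y) * h $ j \<partial>lborel))"
   unfolding inner_vec_def convolve_def by simp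
  also have "\<dots> = (\<integral>y. (\<Sum>j\<in>UNIV. u y * partial_deriv j \<eta> (x - y) * h $ j) \<partial>lborel)"
   by (rule Bochner_Integration.integral_sum[symmetric])
    (intro integrable_mult_left integrable_mult_smooth_compact u \<eta>j, measurable)
  also have "\<dots> = (\<integral>y. u y * (?G (x - y) \<bullet> h) \<partial>lborel)"
   by (simp add: inner_vec_def sum_distrib_left mult_ac)
  finally show ?thesis .
 qed
 show ?thesis
  unfolding has_derivative_at_alt
 proof (intro conjI allI impI)
  show "bounded_linear (\<lambda>h. (\<chi> j. convolve u (partial_deriv j \<eta>) x) \<bullet> h)"
   by (rule bounded_linear_inner_right)
  fix e :: real assume e: "e > 0"
  let ?I = "\<integral>y. \<bar>u y\<bar> \<partial>lborel"
  have I0: "?I \<ge> 0" by simp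
  \<comment> \<open>The summand 1 avoids division by zero when \<open>u\<close> vanishes almost
    everywhere.\<close>
  define e' where "e' = e / (1 + ?I)"
  have I1: "1 + ?I > 0" using I0 by linarith
  have "e * ?I \<le> e * (1 + ?I)" using e by simp
  then have e': "e' > 0" "e' * ?I \<le> e" using e I1 by (simp_all add: e'_def pos_divide_le_eq)
  obtain d where d: "d > 0" "!!y z. dist y z < d ==> dist (?G y) (?G z) < e'"
   using unif e'(1) unfolding uniformly_continuous_on_def by (metis UNIV_I)
  have key: "\<bar>\<eta> (z + h) - \<eta> z - ?G z \<bullet> h\<bar> \<le> e' * norm h" if h: "norm h < d" for z h
  proof -
   have "((\<lambda>t. \<eta> (z + t *\<^sub>R h)) has_real_derivative ?G (z + t *\<^sub>R h) \<bullet> h) (at t)" for t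
   proof -
    have "((\<lambda>t. z + t *\<^sub>R h) has_derivative (\<lambda>s. s *\<^sub>R h)) (at t)"
     by (auto intro!: derivative_eq_intros)
    from has_derivative_compose[OF this smooth_compact_has_derivative[OF \<eta>]]
    show ?thesis unfolding has_field_derivative_def by (rule has_derivative_eq_rhs) (simp add: fun_eq_iff)
   qed
   then obtain t where t: "0 < t" "t < 1" "\<eta> (z + 1 *\<^sub>R h) - \<eta> (z + 0 *\<^sub>R h) = (1 - 0) * (?G (z + t *\<^sub>R h) \<bullet> h)"
    using MVT2[of 0 1 "\<lambda>t. \<eta> (z + t *\<^sub>R h)" "\<lambda>t. ?G (z + t *\<^sub>R h) \<bullet> h"] by auto
   have "dist (z + t *\<^sub>R h) z < d"
    using t h by (simp add: dist_norm) (meson le_less_trans less_imp_le mult_left_le_one_le norm_ge_zero)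
   then have "norm (?G (z + t *\<^sub>R h) - ?G z) \<le> e'" using d(2) by (simp add: dist_norm less_imp_le)
   then have "\<bar>(?G (z + t *\<^sub>R h) - ?G z) \<bullet> h\<bar> \<le> e' * norm h"
    by (meson Cauchy_Schwarz_ineq2 mult_right_mono norm_ge_zero order_trans)
   then show ?thesis using t(3) by (simp add: inner_diff_left)
  qed
  show "\<exists>d>0. \<forall>y. norm (y - x) < d -->
    norm (convolve u \<eta> y - convolve u \<eta> x - (\<chi> j. convolve u (partial_deriv j \<eta>) x) \<bullet> (y - x)) \<le> e * norm (y - x)"
  proof (intro exI[of _ d] conjI allI impI d(1))
   fix x' assume x': "norm (x' - x) < d"
   define h where "h = x' - x"
   have i1: "integrable lborel (\<lambda>y. u y * \<eta> (x' - y))" "integrable lborel (\<lambda>y. u y * \<eta> (x - y))"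
    by (intro integrable_mult_smooth_compact u \<eta>; measurable)+
   have i2: "integrable lborel (\<lambda>y. u y * (?G (x - y) \<bullet> h))"
   proof -
    have "integrable lborel (\<lambda>y. \<Sum>j\<in>UNIV. u y * partial_deriv j \<eta> (x - y) * h $ j)"
     by (intro Bochner_Integration.integrable_sum integrable_mult_left integrable_mult_smooth_compact u \<eta>j, measurable)
    then show ?thesis by (simp add: inner_vec_def sum_distrib_left mult_ac)
   qed
   have "x - y + h = x' - y" for y by (simp add: h_def)
   then have eq: "u y * (\<eta> (x - y + h) - \<eta> (x - y) - ?G (x - y) \<bullet> h) =
     u y * \<eta> (x' - y) - u y * \<eta> (x - y) - u y * (?G (x - y) \<bullet> h)" for y
    by (simp only: right_diff_distrib)
   have "convolve u \<eta> x' - convolve u \<eta> x - (\<chi> j. convolve u (partial_deriv j \<eta>) x) \<bullet> h =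
     (\<integral>y. u y * (\<eta> (x - y + h) - \<eta> (x - y) - ?G (x - y) \<bullet> h) \<partial>lborel)"
    unfolding lin eq unfolding convolve_def using i1 i2 by simp
   also have "\<bar>\<dots>\<bar> \<le> (\<integral>y. \<bar>u y\<bar> * (e' * norm h) \<partial>lborel)"
   proof (rule order_trans[OF integral_abs_bound integral_mono])
    have "integrable lborel (\<lambda>y. u y * \<eta> (x' - y) - u y * \<eta> (x - y) - u y * (?G (x - y) \<bullet> h))" using i1 i2 by simp
    then show "integrable lborel (\<lambda>y. \<bar>u y * (\<eta> (x - y + h) - \<eta> (x - y) - ?G (x - y) \<bullet> h)\<bar>)"
     unfolding eq by (rule integrable_abs)
    show "\<bar>u y * (\<eta> (x - y + h) - \<eta> (x - y) - ?G (x - y) \<bullet> h)\<bar> \<le> \<bar>u y\<bar> * (e' * norm h)" for y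
     unfolding abs_mult using key[of h "x - y"] x' by (intro mult_left_mono) (auto simp: h_def)
   qed (use u in simp)
   also have "\<dots> = e' * ?I * norm h" by simp
   also have "\<dots> \<le> e * norm h" using e'(2) by (intro mult_right_mono) auto
   finally show "norm (convolve u \<eta> x' - convolve u \<eta> x - (\<chi> j. convolve u (partial_deriv j \<eta>) x) \<bullet> (x' - x)) \<le> e * norm (x' - x)"
    by (simp add: h_def)
  qed
 qed
qed

lemma partial_deriv_convolve:
 assumes "integrable lborel u" "smooth_compact \<eta>"
 shows "partial_deriv j (convolve u \<eta>) = convolve u (partial_deriv j \<eta>)"
 using partial_derivI[OF convolve_has_derivative[OF assms]] by (auto simp: inner_axis)

lemma convolve_C_k:
 assumes "integrable lborel u" "smooth_compact \<eta>"
 shows "C_k k (convolve u \<eta>)"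
 using assms(2)
proof (induction k arbitrary: \<eta>)
 case 0
 show ?case
  using has_derivative_continuous[OF convolve_has_derivative[OF assms(1) 0]] by (simp add: continuous_at_imp_continuous_on)
next
 case (Suc k)
 have "convolve u \<eta> differentiable_on UNIV"
  using convolve_has_derivative[OF assms(1) Suc.prems] unfolding differentiable_on_def differentiable_def
  by (auto intro: has_derivative_at_withinI)
 then show ?case
  using Suc.IH[OF smooth_compact_partial[OF Suc.prems]] by (simp add: partial_deriv_convolve[OF assms(1) Suc.prems])
qed

text \<open>The last bound, a constant over the volume of a ball of comparable radius, is what makes
  mollifications converge at every Lebesgue point. The symmetry makes partial derivatives of the
  kernel odd, which serves to transfer a mollification from one factor of an integral to the
  other.\<close>

lemma mollifier_exists:
 assumes e: "\<epsilon> > 0"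
 obtains \<rho> :: "real^'n => real" where "smooth_compact \<rho>" "!!x. \<rho> x \<ge> 0" "!!x. norm x \<ge> \<epsilon> ==> \<rho> x = 0"
  "!!x. \<rho> (- x) = \<rho> x" "integrable lborel \<rho>" "(\<integral>x. \<rho> x \<partial>lborel) = 1"
  "!!x. \<rho> x \<le> exp (4/3) / measure lborel (ball (0::real^'n) (\<epsilon>/2))"
proof -
 define \<eta> where "\<eta> = (\<lambda>x::real^'n. flat_exp 0 (1 - (1/\<epsilon>\<^sup>2) * (x \<bullet> x)))"
 have xx: "x \<bullet> x = (norm x)\<^sup>2" for x :: "real^'n" by (simp add: power2_norm_eq_inner)
 have z: "\<eta> x = 0" if "norm x \<ge> \<epsilon>" for x
 proof -
  have "\<epsilon>\<^sup>2 \<le> (norm x)\<^sup>2" using that e by (intro power_mono) auto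
  then show ?thesis using e by (simp add: \<eta>_def flat_exp_def xx field_simps)
 qed
 have nn: "\<eta> x \<ge> 0" for x by (simp add: \<eta>_def flat_exp_def)
 have le1: "\<eta> x \<le> 1" for x by (auto simp: \<eta>_def flat_exp_def)
 \<comment> \<open>On the half-size ball the argument of the flat exponential is at least 3/4,
   whence the value exp(-4/3); it bounds the normalising integral from below.\<close>
 have low: "\<eta> x \<ge> exp (- (4/3))" if "x \<in> ball 0 (\<epsilon>/2)" for x
 proof -
  have "(norm x)\<^sup>2 \<le> (\<epsilon>/2)\<^sup>2" using that by (intro power_mono) auto
  then have s: "1 - (1/\<epsilon>\<^sup>2) * (norm x)\<^sup>2 \<ge> 3/4" (is "?s \<ge> 3/4") using e by (simp add: field_simps power2_eq_square)
  then have "inverse ?s \<le> inverse (3/4)" by (intro le_imp_inverse_le) auto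
  then have "exp (- (4/3)) \<le> exp (- inverse ?s)" by simp
  moreover have "\<not> ?s \<le> 0" using s by linarith
  ultimately show ?thesis unfolding \<eta>_def flat_exp_def xx by (simp only: if_False power_0 mult_1)
 qed
 have bump: "bump_alg \<eta>" unfolding \<eta>_def by (rule bump_flat)
 have "continuous_on UNIV \<eta>" using bump_alg_C_k[OF bump, of 0] by simp
 then have [measurable]: "\<eta> \<in> borel_measurable borel" by (rule borel_measurable_continuous_onI)
 have fb: "emeasure lborel (ball (0::real^'n) r) < \<infinity>" for r by (intro emeasure_bounded_finite) simp
 have int: "integrable lborel \<eta>"
 proof (rule Bochner_Integration.integrable_bound)
  show "integrable lborel (\<lambda>x::real^'n. indicator (ball 0 \<epsilon>) x :: real)" using fb by (intro integrable_real_indicator) auto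
  show "AE x in lborel. norm (\<eta> x) \<le> norm (indicator (ball 0 \<epsilon>) x :: real)"
   using nn le1 z by (intro AE_I2) (auto simp: indicator_def)
 qed measurable
 define c where "c = (\<integral>x. \<eta> x \<partial>lborel)"
 let ?m = "measure lborel (ball (0::real^'n) (\<epsilon>/2))"
 have m: "?m > 0" using e content_ball_pos[of "\<epsilon>/2" "0::real^'n"] by simp
 have "exp (- (4/3)) * ?m = (\<integral>x. exp (- (4/3)) * indicator (ball (0::real^'n) (\<epsilon>/2)) x \<partial>lborel)" by simp
 also have "\<dots> \<le> c" unfolding c_def
 proof (rule integral_mono[OF _ int])
  show "integrable lborel (\<lambda>x. exp (- (4/3)) * indicator (ball (0::real^'n) (\<epsilon>/2)) x :: real)"
  proof -
   have "integrable lborel (\<lambda>x. indicator (ball (0::real^'n) (\<epsilon>/2)) x :: real)"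
    using fb by (intro integrable_real_indicator) auto
   then show ?thesis by simp
  qed
  show "exp (- (4/3)) * indicator (ball (0::real^'n) (\<epsilon>/2)) x \<le> \<eta> x" for x
   using low[of x] nn[of x] by (cases "x \<in> ball 0 (\<epsilon>/2)") simp_all
 qed
 finally have c: "exp (- (4/3)) * ?m \<le> c" .
 have "exp (- (4/3)) * ?m > 0" using m by simp
 then have c0: "c > 0" using c by linarith
 define \<rho> where "\<rho> = (\<lambda>x. inverse c * \<eta> x)"
 show ?thesis
 proof (rule that[of \<rho>])
  have "bump_alg \<rho>" unfolding \<rho>_def by (intro bump_mult bump_const bump)
  then have "C_k k \<rho>" for k by (rule bump_alg_C_k)
  moreover have "\<rho> x = 0" if "norm x > \<epsilon>" for x using z[of x] that by (simp add: \<rho>_def)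
  ultimately show "smooth_compact \<rho>" unfolding smooth_compact_def by blast
  show "\<rho> x \<ge> 0" for x using nn c0 by (simp add: \<rho>_def)
  show "norm x \<ge> \<epsilon> ==> \<rho> x = 0" for x using z by (simp add: \<rho>_def)
  show "\<rho> (- x) = \<rho> x" for x by (simp add: \<rho>_def \<eta>_def)
  show "integrable lborel \<rho>" using int by (simp add: \<rho>_def)
  show "(\<integral>x. \<rho> x \<partial>lborel) = 1" using c0 by (simp add: \<rho>_def c_def)
  show "\<rho> x \<le> exp (4/3) / ?m" for x
  proof -
   have "\<rho> x \<le> inverse c * 1" unfolding \<rho>_def using le1 c0 by (intro mult_left_mono) auto
   also have "\<dots> \<le> inverse (exp (- (4/3)) * ?m)" using le_imp_inverse_le[OF c \<open>exp (- (4/3)) * ?m > 0\<close>] by (simp only: mult_1_right)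
   also have "\<dots> = exp (4/3) / ?m"
    unfolding inverse_mult_distrib exp_minus inverse_inverse_eq divide_inverse by (rule refl)
   finally show ?thesis .
  qed
 qed
qed

text \<open>The comparison is with the value \<open>u x\<close> itself, so the notion depends on the
  representative and not just on the class of \<open>u\<close>. Dividing by r^n instead of the
  volume changes the quotient by a constant factor only.\<close>

definition lebesgue_point :: "(real^'n => real) => real^'n => bool" where
 "lebesgue_point u x \<longleftrightarrow>
   ((\<lambda>r. (\<integral>y. \<bar>u y - u x\<bar> * indicator (ball x r) y \<partial>lborel) / r ^ CARD('n)) \<longlongrightarrow> 0) (at_right 0)"

lemma measure_ball: "r \<ge> 0 ==> measure lborel (ball (x::real^'n) r) = unit_ball_vol (real CARD('n)) * r ^ CARD('n)"
 using content_ball[of r x] by simp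

lemma integrable_diff_const_ball:
 fixes u :: "real^'n => real"
 assumes "integrable lborel u"
 shows "integrable lborel (\<lambda>y. \<bar>u y - c\<bar> * indicator (ball x r) y)"
proof -
 have "integrable lborel (\<lambda>y::real^'n. indicator (ball x r) y :: real)"
  by (intro integrable_real_indicator emeasure_bounded_finite) auto
 then have "integrable lborel (\<lambda>y. u y * indicator (ball x r) y - c * indicator (ball x r) y)"
  using assms by (intro Bochner_Integration.integrable_diff integrable_real_mult_indicator integrable_mult_right) auto
 then have "integrable lborel (\<lambda>y. \<bar>u y * indicator (ball x r) y - c * indicator (ball x r) y\<bar>)" by (rule integrable_abs)
 moreover have "\<bar>u y * indicator (ball x r) y - c * indicator (ball x r) y\<bar> = \<bar>u y - c\<bar> * indicator (ball x r) y" for y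
  by (simp add: indicator_def)
 ultimately show ?thesis by simp
qed

text \<open>The kernel has integral 1 and is at most a constant times e^(-n) on a ball of radius e,
  so the error is dominated by the mean oscillation of \<open>u\<close> around the value
  \<open>u x\<close>.\<close>

lemma mollifier_tendsto:
 fixes u :: "real^'n => real" and \<rho> :: "nat => real^'n => real"
 assumes u: "integrable lborel u" and x: "lebesgue_point u x" and e: "!!m. e m > 0" "e \<longlonglongrightarrow> 0"
  and \<rho>: "!!m. smooth_compact (\<rho> m)" "!!m x. \<rho> m x \<ge> 0" "!!m x. norm x \<ge> e m ==> \<rho> m x = 0"
   "!!m. integrable lborel (\<rho> m)" "!!m. (\<integral>x. \<rho> m x \<partial>lborel) = 1"
   "!!m x. \<rho> m x \<le> exp (4/3) / measure lborel (ball (0::real^'n) (e m/2))"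
 shows "(\<lambda>m. convolve u (\<rho> m) x) \<longlonglongrightarrow> u x"
proof -
 let ?n = "CARD('n)" and ?w = "unit_ball_vol (real CARD('n))"
 define C where "C = exp (4/3) * 2 ^ ?n / ?w"
 have w: "?w > 0" by simp
 let ?I = "\<lambda>r. (\<integral>y. \<bar>u y - u x\<bar> * indicator (ball x r) y \<partial>lborel)"
 have "filterlim e (at_right 0) sequentially"
  using e by (intro tendsto_imp_filterlim_at_right) auto
 from filterlim_compose[OF x[unfolded lebesgue_point_def] this]
 have "(\<lambda>m. ?I (e m) / e m ^ ?n) \<longlonglongrightarrow> 0" .
 then have lim: "(\<lambda>m. C * (?I (e m) / e m ^ ?n)) \<longlonglongrightarrow> 0" by (rule tendsto_mult_right_zero)
 have bound: "norm (convolve u (\<rho> m) x - u x) \<le> C * (?I (e m) / e m ^ ?n)" for m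
 proof -
  have [measurable]: "u \<in> borel_measurable borel" "\<rho> m \<in> borel_measurable borel"
   using u smooth_compact_measurable[OF \<rho>(1)] by auto
  have one: "(\<integral>y. \<rho> m (x - y) \<partial>lborel) = 1" "integrable lborel (\<lambda>y. \<rho> m (x - y))"
  proof -
   have l: "lborel = density (distr lborel borel (\<lambda>y. x + (- 1) *\<^sub>R y)) (\<lambda>_. ennreal (\<bar>- 1\<bar> ^ DIM(real^'n)))"
    by (rule lborel_affine) simp
   then have l: "lborel = distr lborel borel (\<lambda>y::real^'n. x - y)" by (simp add: density_1)
   have "(\<integral>y. \<rho> m y \<partial>lborel) = (\<integral>y. \<rho> m (x - y) \<partial>lborel)"
    by (subst l, subst integral_distr) auto
   then show "(\<integral>y. \<rho> m (x - y) \<partial>lborel) = 1" using \<rho>(5) by simp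
   have "integrable (distr lborel borel (\<lambda>y::real^'n. x - y)) (\<rho> m)" using \<rho>(4) l by metis
   then show "integrable lborel (\<lambda>y. \<rho> m (x - y))" by (subst (asm) integrable_distr_eq) auto
  qed
  have i1: "integrable lborel (\<lambda>y. u y * \<rho> m (x - y))"
   by (intro integrable_mult_smooth_compact u \<rho>(1)) measurable
  have "convolve u (\<rho> m) x - u x = (\<integral>y. u y * \<rho> m (x - y) - u x * \<rho> m (x - y) \<partial>lborel)"
   unfolding convolve_def using i1 one by simp
  also have "\<dots> = (\<integral>y. (u y - u x) * \<rho> m (x - y) \<partial>lborel)" by (simp add: left_diff_distrib)
  also have "\<bar>\<dots>\<bar> \<le> (\<integral>y. C / e m ^ ?n * (\<bar>u y - u x\<bar> * indicator (ball x (e m)) y) \<partial>lborel)"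
  proof (rule order_trans[OF integral_abs_bound integral_mono])
   have "integrable lborel (\<lambda>y. u y * \<rho> m (x - y) - u x * \<rho> m (x - y))" using i1 one by simp
   then show "integrable lborel (\<lambda>y. \<bar>(u y - u x) * \<rho> m (x - y)\<bar>)" by (simp add: left_diff_distrib)
   show "integrable lborel (\<lambda>y. C / e m ^ ?n * (\<bar>u y - u x\<bar> * indicator (ball x (e m)) y))"
    by (intro integrable_mult_right integrable_diff_const_ball u)
   fix y
   have "\<rho> m (x - y) \<le> C / e m ^ ?n * indicator (ball x (e m)) y"
   proof (cases "y \<in> ball x (e m)")
    case True
    have "\<rho> m (x - y) \<le> exp (4/3) / (?w * (e m / 2) ^ ?n)"
     using \<rho>(6)[of m "x - y"] e(1)[of m] by (simp add: measure_ball)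
    also have "\<dots> = C / e m ^ ?n" by (simp add: C_def power_divide field_simps)
    finally show ?thesis using True by simp
   next
    case False then show ?thesis using \<rho>(3)[of m "x - y"] by (simp add: dist_norm)
   qed
   then have "\<bar>u y - u x\<bar> * \<rho> m (x - y) \<le> \<bar>u y - u x\<bar> * (C / e m ^ ?n * indicator (ball x (e m)) y)"
    by (rule mult_left_mono) simp
   then show "\<bar>(u y - u x) * \<rho> m (x - y)\<bar> \<le> C / e m ^ ?n * (\<bar>u y - u x\<bar> * indicator (ball x (e m)) y)"
    using \<rho>(2)[of m "x - y"] by (simp add: abs_mult mult_ac)
  qed
  also have "\<dots> = C * (?I (e m) / e m ^ ?n)" by simp
  finally show ?thesis by simp
 qed
 have "(\<lambda>m. convolve u (\<rho> m) x - u x) \<longlonglongrightarrow> 0"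
  by (rule Lim_null_comparison[OF _ lim]) (use bound in auto)
 then show ?thesis by (simp add: LIM_zero_iff)
qed

section \<open>Integrals over pairs of points and along segments\<close>

lemma nn_integral_lborel_affine:
 fixes h :: "'a::euclidean_space => ennreal"
 assumes [measurable]: "h \<in> borel_measurable borel" and c: "c > 0"
 shows "(\<integral>\<^sup>+x. h (t + c *\<^sub>R x) \<partial>lborel) = ennreal (inverse (c ^ DIM('a))) * (\<integral>\<^sup>+x. h x \<partial>lborel)"
proof -
 have l: "lborel = density (distr lborel borel (\<lambda>x::'a. t + c *\<^sub>R x)) (\<lambda>_. ennreal (\<bar>c\<bar> ^ DIM('a)))"
  using c by (intro lborel_affine) simp
 have "(\<integral>\<^sup>+x. h x \<partial>lborel) = (\<integral>\<^sup>+x. h x \<partial>density (distr lborel borel (\<lambda>x::'a. t + c *\<^sub>R x)) (\<lambda>_. ennreal (\<bar>c\<bar> ^ DIM('a))))"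
  using l by simp
 also have "\<dots> = ennreal (c ^ DIM('a)) * (\<integral>\<^sup>+x. h (t + c *\<^sub>R x) \<partial>lborel)"
  using c by (simp add: nn_integral_density nn_integral_distr nn_integral_cmult)
 finally have eq: "(\<integral>\<^sup>+x. h x \<partial>lborel) = ennreal (c ^ DIM('a)) * (\<integral>\<^sup>+x. h (t + c *\<^sub>R x) \<partial>lborel)" .
 have "ennreal (inverse (c ^ DIM('a))) * ennreal (c ^ DIM('a)) = 1"
  using c by (simp add: ennreal_mult'[symmetric])
 then show ?thesis unfolding eq mult.assoc[symmetric] by simp
qed

text \<open>For each fixed interpolation parameter, one of the two endpoints carries weight at
 least one half, and integrating in that endpoint costs at most a factor \<open>2 ^ n\<close>.\<close>

lemma nn_integral_interpolation:
 fixes h :: "real^'n => ennreal"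
 assumes [measurable]: "h \<in> borel_measurable borel" and B: "convex B" "B \<in> sets borel" and s: "0 \<le> s" "s \<le> 1"
 shows "(\<integral>\<^sup>+p. \<integral>\<^sup>+q. h (p + s *\<^sub>R (q - p)) * indicator B q * indicator B p \<partial>lborel \<partial>lborel)
   \<le> 2 ^ CARD('n) * emeasure lborel B * (\<integral>\<^sup>+z. h z * indicator B z \<partial>lborel)"
proof -
 note [measurable] = B(2)
 let ?J = "\<integral>\<^sup>+z. h z * indicator B z \<partial>lborel"
 let ?F = "\<lambda>p q. h (p + s *\<^sub>R (q - p)) * indicator B q * indicator B p"
 have inv: "ennreal (inverse (c ^ CARD('n))) \<le> 2 ^ CARD('n)" if "c \<ge> 1/2" for c :: real
 proof -
  have "(1/2) ^ CARD('n) \<le> c ^ CARD('n)" using that by (intro power_mono) auto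
  then have "inverse (c ^ CARD('n)) \<le> inverse ((1/2) ^ CARD('n))" by (intro le_imp_inverse_le) auto
  then have "inverse (c ^ CARD('n)) \<le> 2 ^ CARD('n)" by (simp add: power_one_over)
  then have "ennreal (inverse (c ^ CARD('n))) \<le> ennreal (2 ^ CARD('n))" by (rule ennreal_leI)
  then show ?thesis by (simp add: ennreal_power[symmetric])
 qed
 have seg: "p + s *\<^sub>R (q - p) \<in> B" if "p \<in> B" "q \<in> B" for p q
 proof -
  have "(1 - s) *\<^sub>R p + s *\<^sub>R q \<in> B" using that B(1) s unfolding convex_alt by blast
  then show ?thesis by (simp add: algebra_simps)
 qed
 have one: "(\<integral>\<^sup>+y. h (t + c *\<^sub>R y) * indicator B (t + c *\<^sub>R y) \<partial>lborel) \<le> 2 ^ CARD('n) * ?J" if "c \<ge> 1/2" for c t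
 proof -
  have "(\<integral>\<^sup>+y. h (t + c *\<^sub>R y) * indicator B (t + c *\<^sub>R y) \<partial>lborel) = ennreal (inverse (c ^ CARD('n))) * ?J"
   using that nn_integral_lborel_affine[of "\<lambda>z. h z * indicator B z" c t] by simp
  also have "\<dots> \<le> 2 ^ CARD('n) * ?J" by (rule mult_right_mono[OF inv[OF that]]) simp
  finally show ?thesis .
 qed
 have fin: "(\<integral>\<^sup>+p. (2 ^ CARD('n) * ?J) * indicator B p \<partial>lborel) = 2 ^ CARD('n) * emeasure lborel B * ?J"
  using nn_integral_cmult_indicator[of B lborel "2 ^ CARD('n) * ?J"] by (simp add: mult_ac)
 show ?thesis
 proof (cases "s \<ge> 1/2")
  case True
  have "(\<integral>\<^sup>+q. ?F p q \<partial>lborel) \<le> (2 ^ CARD('n) * ?J) * indicator B p" for p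
  proof (cases "p \<in> B")
   case p: True
   have "(\<integral>\<^sup>+q. ?F p q \<partial>lborel) \<le> (\<integral>\<^sup>+q. h ((p - s *\<^sub>R p) + s *\<^sub>R q) * indicator B ((p - s *\<^sub>R p) + s *\<^sub>R q) \<partial>lborel)"
    using seg[OF p] p by (intro nn_integral_mono) (auto simp: indicator_def algebra_simps)
   also have "\<dots> \<le> 2 ^ CARD('n) * ?J" by (rule one[OF True])
   finally show ?thesis using p by simp
  qed simp
  then have "(\<integral>\<^sup>+p. \<integral>\<^sup>+q. ?F p q \<partial>lborel \<partial>lborel) \<le> (\<integral>\<^sup>+p. (2 ^ CARD('n) * ?J) * indicator B p \<partial>lborel)"
   by (intro nn_integral_mono)
  then show ?thesis unfolding fin .
 next
  case False
  then have s': "1 - s \<ge> 1/2" by simp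
  have "(\<integral>\<^sup>+p. ?F p q \<partial>lborel) \<le> (2 ^ CARD('n) * ?J) * indicator B q" for q
  proof (cases "q \<in> B")
   case q: True
   have "(\<integral>\<^sup>+p. ?F p q \<partial>lborel) \<le> (\<integral>\<^sup>+p. h (s *\<^sub>R q + (1 - s) *\<^sub>R p) * indicator B (s *\<^sub>R q + (1 - s) *\<^sub>R p) \<partial>lborel)"
    using seg[OF _ q] q by (intro nn_integral_mono) (auto simp: indicator_def algebra_simps)
   also have "\<dots> \<le> 2 ^ CARD('n) * ?J" by (rule one[OF s'])
   finally show ?thesis using q by simp
  qed simp
  then have "(\<integral>\<^sup>+q. \<integral>\<^sup>+p. ?F p q \<partial>lborel \<partial>lborel) \<le> (\<integral>\<^sup>+p. (2 ^ CARD('n) * ?J) * indicator B p \<partial>lborel)"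
   by (intro nn_integral_mono)
  moreover have "(\<integral>\<^sup>+q. \<integral>\<^sup>+p. ?F p q \<partial>lborel \<partial>lborel) = (\<integral>\<^sup>+p. \<integral>\<^sup>+q. ?F p q \<partial>lborel \<partial>lborel)"
   by (rule lborel_pair.Fubini') measurable
  ultimately show ?thesis unfolding fin by simp
 qed
qed

lemma partial_deriv_odd:
 fixes \<rho> :: "real^'n => real"
 assumes "smooth_compact \<rho>" and ev: "!!x. \<rho> (- x) = \<rho> x"
 shows "partial_deriv j \<rho> (- x) = - partial_deriv j \<rho> x"
proof -
 have "((\<lambda>x. - x) has_derivative (\<lambda>h. - h)) (at x)" by (auto intro!: derivative_eq_intros)
 from has_derivative_compose[OF this smooth_compact_has_derivative[OF assms(1)]]
 have "(\<rho> has_derivative (\<lambda>h. (\<chi> j. partial_deriv j \<rho> (- x)) \<bullet> (- h))) (at x)" by (simp add: ev)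
 from partial_derivI[OF this, of j] show ?thesis by (simp add: inner_axis)
qed

lemma integrable_product_lborel:
 fixes s u :: "real^'n => real" and k :: "real^'n => real^'n => real"
 assumes s: "integrable lborel s" and u: "integrable lborel u"
  and k: "case_prod k \<in> borel_measurable (borel \<Otimes>\<^sub>M borel)" "!!y z. \<bar>k y z\<bar> \<le> C"
 shows "integrable (lborel \<Otimes>\<^sub>M lborel) (\<lambda>(y, z). s y * u z * k y z)"
proof -
 have [measurable]: "s \<in> borel_measurable borel" "u \<in> borel_measurable borel" using s u by auto
 note [measurable] = k(1)
 have km: "(\<lambda>z. k y z) \<in> borel_measurable borel" for y
  using measurable_Pair2[OF k(1)] by (simp add: space_pair_measure)
 have "integrable (lborel \<Otimes>\<^sub>M lborel) (\<lambda>(y, z). s y * u z)"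
 proof (rule lborel_pair.Fubini_integrable)
  show "(\<lambda>(y, z). s y * u z) \<in> borel_measurable (lborel \<Otimes>\<^sub>M lborel)" by measurable
  have "(\<lambda>x. \<integral>y. norm (case (x, y) of (y, z) => s y * u z) \<partial>lborel) = (\<lambda>x. \<bar>s x\<bar> * (\<integral>z. \<bar>u z\<bar> \<partial>lborel))"
   by (simp add: abs_mult)
  then show "integrable lborel (\<lambda>x. \<integral>y. norm (case (x, y) of (y, z) => s y * u z) \<partial>lborel)"
   using s by simp
  show "AE x in lborel. integrable lborel (\<lambda>y. case (x, y) of (y, z) => s y * u z)"
   using u by simp
 qed
 then have "integrable (lborel \<Otimes>\<^sub>M lborel) (\<lambda>x. C * (case x of (y, z) => s y * u z))" by (rule integrable_mult_right)
 then show ?thesis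
 proof (rule Bochner_Integration.integrable_bound)
  show "(\<lambda>(y, z). s y * u z * k y z) \<in> borel_measurable (lborel \<Otimes>\<^sub>M lborel)" by measurable
  show "AE x in lborel \<Otimes>\<^sub>M lborel. norm (case x of (y, z) => s y * u z * k y z) \<le> norm (C * (case x of (y, z) => s y * u z))"
  proof (intro AE_I2, clarify)
   fix y z
   have "\<bar>s y * u z\<bar> * \<bar>k y z\<bar> \<le> \<bar>s y * u z\<bar> * \<bar>C\<bar>" using k(2)[of y z] by (intro mult_left_mono) auto
   then show "norm (s y * u z * k y z) \<le> norm (C * (s y * u z))" by (simp add: abs_mult mult_ac)
  qed
 qed
qed

text \<open>Testing with the mollified sign of the derivative turns the dual bound into an \<open>L\<^sup>1\<close> bound.\<close>

lemma mollified_derivative_bound: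
 fixes u :: "real^'n => real"
 assumes u: "integrable lborel u" and r: "r > 0"
  and H: "!!\<phi>. smooth_test_function (ball x (2 * r)) \<phi> ==> (\<forall>z. \<bar>\<phi> z\<bar> \<le> 1) ==>
    \<bar>(\<integral>z. u z * partial_deriv j \<phi> z \<partial>lborel) + a * (\<integral>z. \<phi> z \<partial>lborel)\<bar> \<le> K"
  and e: "e > 0" "e < r"
  and \<rho>: "smooth_compact \<rho>" "!!x. \<rho> x \<ge> 0" "!!x. norm x \<ge> e ==> \<rho> x = 0" "!!x. \<rho> (- x) = \<rho> x"
   "integrable lborel \<rho>" "(\<integral>x. \<rho> x \<partial>lborel) = 1"
 shows "(\<integral>\<^sup>+z. ennreal \<bar>convolve u (partial_deriv j \<rho>) z - a\<bar> * indicator (ball x r) z \<partial>lborel) \<le> ennreal K"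
proof -
 note \<rho>j = smooth_compact_partial[OF \<rho>(1), of j]
 let ?B = "ball x r" and ?d = "partial_deriv j \<rho>"
 let ?h = "\<lambda>y. convolve u ?d y - a"
 have hc: "continuous_on UNIV (convolve u ?d)"
  using convolve_C_k[OF u \<rho>j, of 0] by simp
 \<comment> \<open>The sign of the mollified derivative, cut off to the ball. Multiplied by
   \<open>?h\<close> it gives the integrand to be bounded; being discontinuous it has to be
   mollified before it can serve as a test function.\<close>
 define s :: "real^'n => real" where "s = (\<lambda>y. (if ?h y > 0 then 1 else if ?h y < 0 then - 1 else 0) * indicator ?B y)"
 have sm: "s \<in> borel_measurable borel"
 proof -
  have sg: "(\<lambda>t::real. if t > 0 then 1 else if t < 0 then - 1 else 0 :: real) \<in> borel_measurable borel" by measurable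
  have "?h \<in> borel_measurable borel" using hc by (intro borel_measurable_continuous_onI continuous_intros)
  from measurable_compose[OF this sg] show ?thesis
   unfolding s_def by (intro borel_measurable_times borel_measurable_indicator) auto
 qed
 note [measurable] = sm
 have [measurable]: "u \<in> borel_measurable borel" using u by simp
 note [measurable] = smooth_compact_measurable[OF \<rho>(1)] smooth_compact_measurable[OF \<rho>j]
 have s1: "\<bar>s y\<bar> \<le> 1" "y \<notin> ?B ==> s y = 0" for y by (auto simp: s_def)
 have indB: "integrable lborel (\<lambda>y::real^'n. indicator ?B y :: real)"
  by (intro integrable_real_indicator emeasure_bounded_finite) auto
 have si: "integrable lborel s"
  by (rule Bochner_Integration.integrable_bound[OF indB]) (use s1 in \<open>auto simp: indicator_def\<close>)
 define \<phi> where "\<phi> = convolve s \<rho>"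
 have shift: "(\<integral>z. \<rho> (z - y) \<partial>lborel) = 1" "(\<integral>z. \<rho> (y - z) \<partial>lborel) = 1" "integrable lborel (\<lambda>z. \<rho> (y - z))" for y
 proof -
  have l: "lborel = distr lborel borel (\<lambda>z::real^'n. z - y)"
  proof -
   have "(+) (- y) = (\<lambda>z. z - y)" by (simp add: fun_eq_iff)
   then show ?thesis using lborel_distr_plus[of "- y"] by simp
  qed
  have "(\<integral>z. \<rho> z \<partial>lborel) = (\<integral>z. \<rho> (z - y) \<partial>lborel)"
   by (subst l, subst integral_distr) auto
  then show 1: "(\<integral>z. \<rho> (z - y) \<partial>lborel) = 1" using \<rho>(6) by simp
  have e: "\<rho> (z - y) = \<rho> (y - z)" for z using \<rho>(4)[of "y - z"] by simp
  show "(\<integral>z. \<rho> (y - z) \<partial>lborel) = 1" using 1 by (simp add: e)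
  have "integrable (distr lborel borel (\<lambda>z::real^'n. z - y)) \<rho>" using \<rho>(5) l by metis
  then have "integrable lborel (\<lambda>z. \<rho> (z - y))" by (subst (asm) integrable_distr_eq) auto
  then show "integrable lborel (\<lambda>z. \<rho> (y - z))" by (simp add: e)
 qed
 \<comment> \<open>Mollification at scale e < r spreads the support from radius r to at most r + e,
   which is why the hypothesis is stated on the ball of radius 2r.\<close>
 have test: "smooth_test_function (ball x (2 * r)) \<phi>"
  unfolding smooth_test_function_def compact_support_in_def
 proof (intro conjI allI)
  show "C_k k \<phi>" for k unfolding \<phi>_def by (rule convolve_C_k[OF si \<rho>(1)])
  have "\<phi> z = 0" if "z \<notin> cball x (r + e)" for z
  proof -
   have "s y * \<rho> (z - y) = 0" for y
   proof (cases "y \<in> ?B")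
    case True
    then have "norm (z - y) \<ge> e" using that norm_triangle_ineq[of "z - y" "y - x"]
     by (auto simp: dist_norm norm_minus_commute)
    then show ?thesis using \<rho>(3) by simp
   qed (simp add: s1)
   then have "(\<lambda>y. s y * \<rho> (z - y)) = (\<lambda>_. 0)" by (rule ext)
   then show ?thesis unfolding \<phi>_def convolve_def by simp
  qed
  then have "{z. \<phi> z ~= 0} \<subseteq> cball x (r + e)" by blast
  then have sub: "closure {z. \<phi> z ~= 0} \<subseteq> cball x (r + e)" by (rule closure_minimal) simp
  then show "compact (closure {z. \<phi> z ~= 0})"
   using bounded_subset[OF bounded_cball sub] by (simp add: compact_eq_bounded_closed)
  show "closure {z. \<phi> z ~= 0} \<subseteq> ball x (2 * r)" using sub e by (auto simp: subset_eq)
 qed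
 have le1: "\<bar>\<phi> z\<bar> \<le> 1" for z
 proof -
  have "\<bar>\<phi> z\<bar> \<le> (\<integral>y. \<rho> (z - y) \<partial>lborel)"
   unfolding \<phi>_def convolve_def
  proof (rule order_trans[OF integral_abs_bound integral_mono])
   show "integrable lborel (\<lambda>y. \<bar>s y * \<rho> (z - y)\<bar>)"
    by (intro integrable_abs integrable_mult_smooth_compact si \<rho>(1)) measurable
   show "\<bar>s y * \<rho> (z - y)\<bar> \<le> \<rho> (z - y)" for y
    using s1(1)[of y] \<rho>(2)[of "z - y"] by (simp add: abs_mult mult_left_le_one_le)
  qed (rule shift)
  then show ?thesis using shift by simp
 qed
 have 1: "(\<integral>z. \<phi> z \<partial>lborel) = (\<integral>y. s y \<partial>lborel)"
 proof -
  have "integrable (lborel \<Otimes>\<^sub>M lborel) (\<lambda>(y, z). s y * \<rho> (z - y))"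
  proof (rule lborel_pair.Fubini_integrable)
   show "(\<lambda>(y, z). s y * \<rho> (z - y)) \<in> borel_measurable (lborel \<Otimes>\<^sub>M lborel)" by measurable
   have "(\<integral>z. norm (case (y, z) of (y, z) => s y * \<rho> (z - y)) \<partial>lborel) = \<bar>s y\<bar>" for y
    using \<rho>(2) shift by (simp add: abs_mult)
   then show "integrable lborel (\<lambda>y. \<integral>z. norm (case (y, z) of (y, z) => s y * \<rho> (z - y)) \<partial>lborel)"
    using si by simp
   have "\<rho> (z - y) = \<rho> (y - z)" for z y using \<rho>(4)[of "y - z"] by simp
   then show "AE y in lborel. integrable lborel (\<lambda>z. case (y, z) of (y, z) => s y * \<rho> (z - y))"
    using shift by simp
  qed
  from lborel_pair.Fubini_integral[OF this] show ?thesis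
   unfolding \<phi>_def convolve_def using shift by simp
 qed
 have odd: "?d (y - z) = - ?d (z - y)" for y z using partial_deriv_odd[OF \<rho>(1,4), of j "z - y"] by simp
 obtain D where D: "!!x. \<bar>?d x\<bar> \<le> D" using smooth_compact_bounded[OF \<rho>j] by blast
 \<comment> \<open>The derivative of the kernel is odd, so exchanging the integrations moves the
   mollified derivative from the test function to \<open>u\<close> at the price of a sign.\<close>
 have 2: "(\<integral>z. u z * partial_deriv j \<phi> z \<partial>lborel) = - (\<integral>y. s y * convolve u ?d y \<partial>lborel)"
 proof -
  have flip: "u z * (s y * ?d (z - y)) = - (s y * u z * ?d (y - z))" for y z using odd[of y z] by simp
  have i: "integrable (lborel \<Otimes>\<^sub>M lborel) (\<lambda>(y, z). s y * u z * ?d (y - z))"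
   by (rule integrable_product_lborel[OF si u, where C=D]) (use D in auto)
  have "(\<integral>z. u z * partial_deriv j \<phi> z \<partial>lborel) = (\<integral>z. u z * (\<integral>y. s y * ?d (z - y) \<partial>lborel) \<partial>lborel)"
   unfolding \<phi>_def partial_deriv_convolve[OF si \<rho>(1)] by (simp add: convolve_def)
  also have "\<dots> = (\<integral>z. (\<integral>y. u z * (s y * ?d (z - y)) \<partial>lborel) \<partial>lborel)" by simp
  also have "\<dots> = (\<integral>z. (\<integral>y. - (s y * u z * ?d (y - z)) \<partial>lborel) \<partial>lborel)"
   unfolding flip ..
  also have "\<dots> = - (\<integral>z. (\<integral>y. (s y * u z * ?d (y - z)) \<partial>lborel) \<partial>lborel)" by simp
  also have "\<dots> = - (\<integral>y. (\<integral>z. (s y * u z * ?d (y - z)) \<partial>lborel) \<partial>lborel)"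
   using lborel_pair.Fubini_integral[OF i] by simp
  also have "\<dots> = - (\<integral>y. s y * convolve u ?d y \<partial>lborel)"
   by (simp add: convolve_def mult.assoc)
  finally show ?thesis .
 qed
 have ib: "integrable lborel (\<lambda>y. s y * convolve u ?d y)"
 proof -
  have "integrable (lborel \<Otimes>\<^sub>M lborel) (\<lambda>(y, z). s y * u z * ?d (y - z))"
   by (rule integrable_product_lborel[OF si u, where C=D]) (use D in auto)
  from lborel_pair.integrable_fst'[OF this] show ?thesis by (simp add: convolve_def mult.assoc)
 qed
 have ia: "integrable lborel (\<lambda>y. s y * ?h y)" using ib si by (simp add: right_diff_distrib)
 have sh: "s y * ?h y = \<bar>?h y\<bar> * indicator ?B y" for y
  by (simp add: s_def)
 have "(\<integral>y. s y * ?h y \<partial>lborel) = - ((\<integral>z. u z * partial_deriv j \<phi> z \<partial>lborel) + a * (\<integral>z. \<phi> z \<partial>lborel))"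
  unfolding 1 2 right_diff_distrib using ib si by (simp add: mult.commute)
 then have "(\<integral>y. s y * ?h y \<partial>lborel) \<le> K" using H[OF test] le1 by force
 moreover have "(\<integral>\<^sup>+z. ennreal \<bar>?h z\<bar> * indicator ?B z \<partial>lborel) = (\<integral>\<^sup>+z. ennreal (s z * ?h z) \<partial>lborel)"
  unfolding sh by (intro nn_integral_cong) (simp add: indicator_def)
 moreover have "(\<integral>\<^sup>+z. ennreal (s z * ?h z) \<partial>lborel) = ennreal (\<integral>y. s y * ?h y \<partial>lborel)"
  by (rule nn_integral_eq_integral[OF ia]) (simp add: sh)
 ultimately show ?thesis by (simp add: ennreal_leI)
qed

text \<open>The fundamental theorem of calculus along the segment, with |q - p| at most 2r. The
  right-hand side integrates over the whole segment and so does not depend on \<open>t\<close>: one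
  quantity controls all intermediate points.\<close>

lemma segment_increment_bound:
 fixes w :: "real^'n => real" and G :: "real^'n => real^'n"
 assumes d: "!!x. (w has_derivative (\<lambda>h. G x \<bullet> h)) (at x)" and G: "continuous_on UNIV G"
  and pq: "p \<in> ball x r" "q \<in> ball x r" and t: "0 \<le> t" "t \<le> 1"
 shows "ennreal \<bar>w (p + t *\<^sub>R (q - p)) - w p\<bar> \<le>
  (\<Sum>j\<in>UNIV. \<integral>\<^sup>+s. ennreal (2 * r) * (ennreal \<bar>G (p + s *\<^sub>R (q - p)) $ j\<bar> * indicator {0..1} s) \<partial>lborel)"
proof -
 define F where "F = (\<lambda>s. w (p + s *\<^sub>R (q - p)))"
 define f where "f = (\<lambda>s. G (p + s *\<^sub>R (q - p)) \<bullet> (q - p))"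
 have r: "r > 0" using pq(1) by (metis ball_eq_empty empty_iff not_le)
 have Gc: "continuous_on UNIV (\<lambda>s. G (p + s *\<^sub>R (q - p)))"
  by (rule continuous_on_compose2[OF G]) (auto intro!: continuous_intros)
 have Gm: "(\<lambda>s. G (p + s *\<^sub>R (q - p))) \<in> borel_measurable borel"
  by (rule borel_measurable_continuous_onI[OF Gc])
 have Gj: "(\<lambda>s. G (p + s *\<^sub>R (q - p)) $ j) \<in> borel_measurable borel" for j
  using Gc by (intro borel_measurable_continuous_onI continuous_intros)
 have F': "(F has_real_derivative f s) (at s)" for s
 proof -
  have "((\<lambda>s. p + s *\<^sub>R (q - p)) has_derivative (\<lambda>s. s *\<^sub>R (q - p))) (at s)"
   by (auto intro!: derivative_eq_intros)
  from has_derivative_compose[OF this d]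
  show ?thesis unfolding has_field_derivative_def F_def f_def by (rule has_derivative_eq_rhs) (simp add: fun_eq_iff)
 qed
 have fc: "continuous_on UNIV f" unfolding f_def by (intro continuous_intros Gc)
 have fi: "isCont f s" for s using fc by (simp add: continuous_on_eq_continuous_at)
 have FTC: "(\<integral>s. f s * indicator {0..t} s \<partial>lborel) = F t - F 0"
  "has_bochner_integral lborel (\<lambda>s. f s * indicator {0..t} s) (F t - F 0)"
  using integral_FTC_Icc_real[OF t(1) F' fi] has_bochner_integral_FTC_Icc_real[OF t(1) F' fi] by auto
 then have int: "integrable lborel (\<lambda>s. f s * indicator {0..t} s)" by (simp add: has_bochner_integral_iff)
 have "ennreal \<bar>F t - F 0\<bar> \<le> (\<integral>\<^sup>+s. ennreal \<bar>f s * indicator {0..t} s\<bar> \<partial>lborel)"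
  using integral_norm_bound_ennreal[OF int] FTC(1) by simp
 also have "\<dots> \<le> (\<integral>\<^sup>+s. (\<Sum>j\<in>UNIV. ennreal (2 * r) * (ennreal \<bar>G (p + s *\<^sub>R (q - p)) $ j\<bar> * indicator {0..1} s)) \<partial>lborel)"
 proof (rule nn_integral_mono)
  fix s :: real
  show "ennreal \<bar>f s * indicator {0..t} s\<bar> \<le> (\<Sum>j\<in>UNIV. ennreal (2 * r) * (ennreal \<bar>G (p + s *\<^sub>R (q - p)) $ j\<bar> * indicator {0..1} s))"
  proof (cases "s \<in> {0..t}")
   case True
   have "\<bar>f s\<bar> \<le> (\<Sum>j\<in>UNIV. \<bar>G (p + s *\<^sub>R (q - p)) $ j * (q - p) $ j\<bar>)"
    unfolding f_def inner_vec_def by (simp add: sum_abs)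
   also have "\<dots> \<le> (\<Sum>j\<in>UNIV. 2 * r * \<bar>G (p + s *\<^sub>R (q - p)) $ j\<bar>)"
   proof (rule sum_mono)
    fix j
    have "\<bar>(q - p) $ j\<bar> \<le> norm (q - p)" by (rule component_le_norm_cart)
    also have "norm (q - p) \<le> 2 * r"
     using pq dist_triangle2[of q p x] by (simp add: dist_norm norm_minus_commute)
    finally have "\<bar>G (p + s *\<^sub>R (q - p)) $ j\<bar> * \<bar>(q - p) $ j\<bar> \<le> \<bar>G (p + s *\<^sub>R (q - p)) $ j\<bar> * (2 * r)"
     by (rule mult_left_mono) simp
    then show "\<bar>G (p + s *\<^sub>R (q - p)) $ j * (q - p) $ j\<bar> \<le> 2 * r * \<bar>G (p + s *\<^sub>R (q - p)) $ j\<bar>"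
     by (simp add: abs_mult mult_ac)
   qed
   finally have "ennreal \<bar>f s\<bar> \<le> ennreal (\<Sum>j\<in>UNIV. 2 * r * \<bar>G (p + s *\<^sub>R (q - p)) $ j\<bar>)" by (rule ennreal_leI)
   also have "\<dots> = (\<Sum>j\<in>UNIV. ennreal (2 * r * \<bar>G (p + s *\<^sub>R (q - p)) $ j\<bar>))"
    using r by (intro sum_ennreal[symmetric]) simp
   also have "\<dots> = (\<Sum>j\<in>UNIV. ennreal (2 * r) * ennreal \<bar>G (p + s *\<^sub>R (q - p)) $ j\<bar>)"
    using r by (intro sum.cong refl ennreal_mult) auto
   finally show ?thesis using True t by simp
  qed simp
 qed
 also have "\<dots> = (\<Sum>j\<in>UNIV. \<integral>\<^sup>+s. ennreal (2 * r) * (ennreal \<bar>G (p + s *\<^sub>R (q - p)) $ j\<bar> * indicator {0..1} s) \<partial>lborel)"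
  by (rule nn_integral_sum) (use Gj in measurable)
 finally show ?thesis by (simp add: F_def)
qed

text \<open>With the segment parameter integrated last, each slice is an interpolation integral
  whose bound is independent of the parameter.\<close>

lemma segment_majorant_integral:
 fixes h :: "real^'n => real"
 assumes h: "h \<in> borel_measurable borel"
  and K: "(\<integral>\<^sup>+z. ennreal \<bar>h z\<bar> * indicator (ball x r) z \<partial>lborel) \<le> ennreal K" and r: "r > 0" and K0: "K \<ge> 0"
 shows "(\<integral>\<^sup>+p. \<integral>\<^sup>+q. (\<integral>\<^sup>+s. ennreal (2 * r) * (ennreal \<bar>h (p + s *\<^sub>R (q - p))\<bar> * indicator {0..1} s) \<partial>lborel)
   * indicator (ball x r) q * indicator (ball x r) p \<partial>lborel \<partial>lborel)
  \<le> ennreal (2 * r * 2 ^ CARD('n) * measure lborel (ball x r) * K)"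
proof -
 let ?B = "ball x r"
 note [measurable] = h
 have [measurable]: "?B \<in> sets borel" by simp
 have em: "emeasure lborel ?B = ennreal (measure lborel ?B)"
  by (intro emeasure_eq_ennreal_measure) (use emeasure_bounded_finite[of ?B] in simp)
 let ?F = "\<lambda>p q s. ennreal (2 * r) * (ennreal \<bar>h (p + s *\<^sub>R (q - p))\<bar> * indicator {0..1} s) * indicator ?B q * indicator ?B p"
 have "(\<integral>\<^sup>+p. \<integral>\<^sup>+q. (\<integral>\<^sup>+s. ennreal (2 * r) * (ennreal \<bar>h (p + s *\<^sub>R (q - p))\<bar> * indicator {0..1} s) \<partial>lborel)
   * indicator ?B q * indicator ?B p \<partial>lborel \<partial>lborel) = (\<integral>\<^sup>+p. \<integral>\<^sup>+q. \<integral>\<^sup>+s. ?F p q s \<partial>lborel \<partial>lborel \<partial>lborel)"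
  by (simp add: nn_integral_multc)
 also have "\<dots> = (\<integral>\<^sup>+p. \<integral>\<^sup>+s. \<integral>\<^sup>+q. ?F p q s \<partial>lborel \<partial>lborel \<partial>lborel)"
  by (intro nn_integral_cong lborel_pair.Fubini'[symmetric]) measurable
 also have "\<dots> = (\<integral>\<^sup>+s. \<integral>\<^sup>+p. \<integral>\<^sup>+q. ?F p q s \<partial>lborel \<partial>lborel \<partial>lborel)"
  by (rule lborel_pair.Fubini'[symmetric]) measurable
 also have "\<dots> \<le> (\<integral>\<^sup>+s. ennreal (2 * r * 2 ^ CARD('n) * measure lborel ?B * K) * indicator {0..1} (s::real) \<partial>lborel)"
 proof (rule nn_integral_mono)
  fix s :: real
  show "(\<integral>\<^sup>+p. \<integral>\<^sup>+q. ?F p q s \<partial>lborel \<partial>lborel) \<le> ennreal (2 * r * 2 ^ CARD('n) * measure lborel ?B * K) * indicator {0..1} s"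
  proof (cases "s \<in> {0..1}")
   case True
   let ?H = "\<lambda>p q. ennreal \<bar>h (p + s *\<^sub>R (q - p))\<bar> * indicator ?B q * indicator ?B p"
   have "(\<integral>\<^sup>+p. \<integral>\<^sup>+q. ?F p q s \<partial>lborel \<partial>lborel) = (\<integral>\<^sup>+p. \<integral>\<^sup>+q. ennreal (2 * r) * ?H p q \<partial>lborel \<partial>lborel)"
    using True by (intro nn_integral_cong) (simp add: mult.assoc)
   also have "\<dots> = (\<integral>\<^sup>+p. ennreal (2 * r) * (\<integral>\<^sup>+q. ?H p q \<partial>lborel) \<partial>lborel)"
    by (intro nn_integral_cong nn_integral_cmult) measurable
   also have "\<dots> = ennreal (2 * r) * (\<integral>\<^sup>+p. \<integral>\<^sup>+q. ?H p q \<partial>lborel \<partial>lborel)"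
    by (intro nn_integral_cmult) measurable
   also have "\<dots> \<le> ennreal (2 * r) * (2 ^ CARD('n) * emeasure lborel ?B * (\<integral>\<^sup>+z. ennreal \<bar>h z\<bar> * indicator ?B z \<partial>lborel))"
    using True by (intro mult_left_mono nn_integral_interpolation) auto
   also have "\<dots> \<le> ennreal (2 * r) * (2 ^ CARD('n) * emeasure lborel ?B * ennreal K)"
    by (intro mult_left_mono K) auto
   also have "\<dots> = ennreal (2 * r * 2 ^ CARD('n) * measure lborel ?B * K)"
    unfolding em using r K0 by (simp add: ennreal_mult ennreal_power[symmetric] mult.assoc)
   finally show ?thesis using True by simp
  qed simp
 qed
 also have "\<dots> = ennreal (2 * r * 2 ^ CARD('n) * measure lborel ?B * K)"
  by (simp add: nn_integral_cmult_indicator)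
 finally show ?thesis .
qed

text \<open>Mollify, use the previous two lemmas, and pass to the limit by Fatou's lemma.\<close>

lemma segment_estimate:
 fixes u :: "real^'n => real" and a :: "real^'n"
 assumes u: "integrable lborel u" and r: "r > 0"
  and H: "!!\<phi> j. smooth_test_function (ball x (2 * r)) \<phi> ==> (\<forall>z. \<bar>\<phi> z\<bar> \<le> 1) ==>
    \<bar>(\<integral>z. u z * partial_deriv j \<phi> z \<partial>lborel) + a $ j * (\<integral>z. \<phi> z \<partial>lborel)\<bar> \<le> K"
  and K0: "K \<ge> 0"
 obtains \<Psi> :: "real^'n => real^'n => ennreal"
 where "case_prod \<Psi> \<in> borel_measurable (borel \<Otimes>\<^sub>M borel)"
  "(\<integral>\<^sup>+p. \<integral>\<^sup>+q. \<Psi> p q \<partial>lborel \<partial>lborel) \<le> ennreal (2 * r * CARD('n) * 2 ^ CARD('n) * measure lborel (ball x r) * K)"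
  "!!p q t. p \<in> ball x r ==> q \<in> ball x r ==> 0 \<le> t ==> t \<le> 1 ==> lebesgue_point u p ==> lebesgue_point u (p + t *\<^sub>R (q - p))
    ==> ennreal \<bar>u (p + t *\<^sub>R (q - p)) - u p - t * (a \<bullet> (q - p))\<bar> \<le> \<Psi> p q"
proof -
 let ?B = "ball x r"
 \<comment> \<open>Scales strictly between 0 and r, as the mollified bound requires, that tend to
   0.\<close>
 define e where "e = (\<lambda>m::nat. r / (real m + 2))"
 have e: "e m > 0" "e m < r" for m
 proof -
  have "0 \<le> r * real m" using r by simp
  then have "0 < r + r * real m" using r by linarith
  then show "e m > 0" "e m < r" using r by (auto simp: e_def field_simps)
 qed
 have elim: "e \<longlonglongrightarrow> 0"
 proof -
  have "(\<lambda>m. r * inverse (real (Suc (Suc m)))) \<longlonglongrightarrow> r * 0"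
   by (intro tendsto_mult_left LIMSEQ_Suc[OF LIMSEQ_inverse_real_of_nat])
  moreover have "e = (\<lambda>m. r * inverse (real (Suc (Suc m))))"
   by (simp add: e_def divide_inverse add.commute fun_eq_iff)
  ultimately show ?thesis by (simp only: mult_zero_right)
 qed
 have "\<exists>\<rho> :: nat => real^'n => real. \<forall>m. smooth_compact (\<rho> m) \<and> (\<forall>x. \<rho> m x \<ge> 0) \<and> (\<forall>x. norm x \<ge> e m --> \<rho> m x = 0) \<and>
   (\<forall>x. \<rho> m (- x) = \<rho> m x) \<and> integrable lborel (\<rho> m) \<and> (\<integral>x. \<rho> m x \<partial>lborel) = 1 \<and>
   (\<forall>x. \<rho> m x \<le> exp (4/3) / measure lborel (ball (0::real^'n) (e m/2)))"
  by (intro choice allI) (metis mollifier_exists[OF e(1)])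
 then obtain \<rho> :: "nat => real^'n => real" where \<rho>: "!!m. smooth_compact (\<rho> m)" "!!m x. \<rho> m x \<ge> 0" "!!m x. norm x \<ge> e m ==> \<rho> m x = 0"
   "!!m x. \<rho> m (- x) = \<rho> m x" "!!m. integrable lborel (\<rho> m)" "!!m. (\<integral>x. \<rho> m x \<partial>lborel) = 1"
   "!!m x. \<rho> m x \<le> exp (4/3) / measure lborel (ball (0::real^'n) (e m/2))" by blast
 define G where "G = (\<lambda>m z. (\<chi> j. convolve u (partial_deriv j (\<rho> m)) z - a $ j) :: real^'n)"
 \<comment> \<open>Subtracting the linear part turns the deviation of the mollification from its
   predicted increment into an increment of \<open>w\<close>, whose gradient is
   \<open>G\<close>.\<close>
 define w where "w = (\<lambda>m z. convolve u (\<rho> m) z - a \<bullet> z)"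
 have Gc: "continuous_on UNIV (G m)" for m
 proof -
  have c: "continuous_on UNIV (convolve u (partial_deriv j (\<rho> m)))" for j
   using convolve_C_k[OF u smooth_compact_partial[OF \<rho>(1)], of 0] by simp
  show ?thesis unfolding G_def by (intro continuous_intros c)
 qed
 have Gj: "(\<lambda>z. G m z $ j) \<in> borel_measurable borel" for m j
  by (intro borel_measurable_continuous_onI continuous_intros Gc)
 have wd: "(w m has_derivative (\<lambda>h. G m z \<bullet> h)) (at z)" for m z
 proof -
  have "(w m has_derivative (\<lambda>h. (\<chi> j. convolve u (partial_deriv j (\<rho> m)) z) \<bullet> h - a \<bullet> h)) (at z)"
   unfolding w_def
   by (intro has_derivative_diff convolve_has_derivative[OF u \<rho>(1)] bounded_linear_imp_has_derivative bounded_linear_inner_right)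
  moreover have "(\<chi> j. convolve u (partial_deriv j (\<rho> m)) z) \<bullet> h - a \<bullet> h = G m z \<bullet> h" for h
   unfolding inner_diff_left[symmetric] by (rule arg_cong[where f="\<lambda>v. v \<bullet> h"]) (simp add: G_def vec_eq_iff)
  ultimately show ?thesis by simp
 qed
 define S where "S = (\<lambda>m j p q. \<integral>\<^sup>+s. ennreal (2 * r) * (ennreal \<bar>G m (p + s *\<^sub>R (q - p)) $ j\<bar> * indicator {0..1} s) \<partial>lborel)"
 define T where "T = (\<lambda>m p q. (\<Sum>j\<in>UNIV. S m j p q * indicator ?B q * indicator ?B p))"
 \<comment> \<open>The majorants \<open>T m\<close> need not converge. Their lower limit keeps the
   integral bound, and it still dominates the limit of the increments at Lebesgue points.\<close>
 define \<Psi> where "\<Psi> = (\<lambda>p q. liminf (\<lambda>m. T m p q))"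
 have Sm: "(\<lambda>(p, q). S m j p q) \<in> borel_measurable (borel \<Otimes>\<^sub>M borel)" for m j
 proof -
  note [measurable] = Gj
  have "(\<lambda>z. S m j (fst z) (snd z)) \<in> borel_measurable (borel \<Otimes>\<^sub>M borel)" unfolding S_def by measurable
  then show ?thesis by (simp add: case_prod_beta')
 qed
 have Tm: "(\<lambda>(p, q). T m p q) \<in> borel_measurable (borel \<Otimes>\<^sub>M borel)" for m
 proof -
  note [measurable] = Sm
  have [measurable]: "?B \<in> sets borel" by simp
  have Tj: "(\<lambda>(p, q). S m j p q * indicator ?B q * indicator ?B p) \<in> borel_measurable (borel \<Otimes>\<^sub>M borel)" for j by measurable
  then have "(\<lambda>z. \<Sum>j\<in>UNIV. (case z of (p, q) => S m j p q * indicator ?B q * indicator ?B p)) \<in> borel_measurable (borel \<Otimes>\<^sub>M borel)"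
   by (intro borel_measurable_sum Tj)
  then show ?thesis unfolding T_def by (simp add: case_prod_beta')
 qed
 have sec: "(\<lambda>q. f p q) \<in> borel_measurable borel" if "(\<lambda>(p, q). f p q) \<in> borel_measurable (borel \<Otimes>\<^sub>M borel)"
  for f :: "real^'n => real^'n => ennreal" and p
  using measurable_Pair2[OF that, of p] by simp
 have intm: "(\<lambda>p. \<integral>\<^sup>+q. f p q \<partial>lborel) \<in> borel_measurable borel" if "(\<lambda>(p, q). f p q) \<in> borel_measurable (borel \<Otimes>\<^sub>M borel)"
  for f :: "real^'n => real^'n => ennreal"
  using lborel.borel_measurable_nn_integral[of "\<lambda>p q. f p q" borel] that by simp
 let ?C = "2 * r * CARD('n) * 2 ^ CARD('n) * measure lborel ?B * K"
 have Ti: "(\<integral>\<^sup>+p. \<integral>\<^sup>+q. T m p q \<partial>lborel \<partial>lborel) \<le> ennreal ?C" for m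
 proof -
  have Sm': "(\<lambda>(p, q). S m j p q * indicator ?B q * indicator ?B p) \<in> borel_measurable (borel \<Otimes>\<^sub>M borel)" for j
  proof -
   note [measurable] = Sm
   have [measurable]: "?B \<in> sets borel" by simp
   show ?thesis by measurable
  qed
  have "(\<integral>\<^sup>+p. \<integral>\<^sup>+q. T m p q \<partial>lborel \<partial>lborel) = (\<integral>\<^sup>+p. (\<Sum>j\<in>UNIV. \<integral>\<^sup>+q. S m j p q * indicator ?B q * indicator ?B p \<partial>lborel) \<partial>lborel)"
   unfolding T_def by (intro nn_integral_cong nn_integral_sum) (use sec[OF Sm'] in simp)
  also have "\<dots> = (\<Sum>j\<in>UNIV. \<integral>\<^sup>+p. \<integral>\<^sup>+q. S m j p q * indicator ?B q * indicator ?B p \<partial>lborel \<partial>lborel)"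
   by (intro nn_integral_sum) (use intm[OF Sm'] in simp)
  also have "\<dots> \<le> (\<Sum>j\<in>(UNIV::'n set). ennreal (2 * r * 2 ^ CARD('n) * measure lborel ?B * K))"
  proof (rule sum_mono)
   fix j
   have "(\<integral>\<^sup>+z. ennreal \<bar>G m z $ j\<bar> * indicator ?B z \<partial>lborel) \<le> ennreal K"
    unfolding G_def vec_lambda_beta
    by (rule mollified_derivative_bound[OF u r H e \<rho>(1-6)]) auto
   from segment_majorant_integral[OF Gj this r K0]
   show "(\<integral>\<^sup>+p. \<integral>\<^sup>+q. S m j p q * indicator ?B q * indicator ?B p \<partial>lborel \<partial>lborel)
     \<le> ennreal (2 * r * 2 ^ CARD('n) * measure lborel ?B * K)"
    unfolding S_def .
  qed
  also have "\<dots> = ennreal ?C"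
   using r K0 by (simp add: ennreal_of_nat_eq_real_of_nat ennreal_mult[symmetric] mult_ac)
  finally show ?thesis .
 qed
 show ?thesis
 proof (rule that[of \<Psi>])
  have "(\<lambda>z. liminf (\<lambda>m. case z of (p, q) => T m p q)) \<in> borel_measurable (borel \<Otimes>\<^sub>M borel)"
   by (intro borel_measurable_liminf Tm)
  then show "case_prod \<Psi> \<in> borel_measurable (borel \<Otimes>\<^sub>M borel)"
   unfolding \<Psi>_def by (simp add: case_prod_beta')
  have "(\<integral>\<^sup>+p. \<integral>\<^sup>+q. \<Psi> p q \<partial>lborel \<partial>lborel) \<le> (\<integral>\<^sup>+p. liminf (\<lambda>m. \<integral>\<^sup>+q. T m p q \<partial>lborel) \<partial>lborel)"
   unfolding \<Psi>_def by (intro nn_integral_mono nn_integral_liminf) (use sec[OF Tm] in simp)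
  also have "\<dots> \<le> liminf (\<lambda>m. \<integral>\<^sup>+p. \<integral>\<^sup>+q. T m p q \<partial>lborel \<partial>lborel)"
   by (intro nn_integral_liminf) (use intm[OF Tm] in simp)
  also have "\<dots> \<le> liminf (\<lambda>m::nat. ennreal ?C)"
   by (intro Liminf_mono always_eventually allI Ti)
  also have "\<dots> = ennreal ?C" by (simp add: Liminf_const)
  finally show "(\<integral>\<^sup>+p. \<integral>\<^sup>+q. \<Psi> p q \<partial>lborel \<partial>lborel) \<le> ennreal ?C" .
 next
  fix p q t assume pq: "p \<in> ?B" "q \<in> ?B" and t: "0 \<le> t" "t \<le> (1::real)"
   and lp: "lebesgue_point u p" "lebesgue_point u (p + t *\<^sub>R (q - p))"
  let ?z = "p + t *\<^sub>R (q - p)"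
  have lim: "(\<lambda>m. convolve u (\<rho> m) z) \<longlonglongrightarrow> u z" if "lebesgue_point u z" for z
   by (rule mollifier_tendsto[OF u that e(1) elim \<rho>(1-3,5-7)])
  have "(\<lambda>m. \<bar>convolve u (\<rho> m) ?z - convolve u (\<rho> m) p - t * (a \<bullet> (q - p))\<bar>) \<longlonglongrightarrow> \<bar>u ?z - u p - t * (a \<bullet> (q - p))\<bar>"
   by (intro tendsto_intros lim lp)
  then have "(\<lambda>m. ennreal \<bar>convolve u (\<rho> m) ?z - convolve u (\<rho> m) p - t * (a \<bullet> (q - p))\<bar>) \<longlonglongrightarrow> ennreal \<bar>u ?z - u p - t * (a \<bullet> (q - p))\<bar>"
   by (rule tendsto_ennrealI)
  then have "ennreal \<bar>u ?z - u p - t * (a \<bullet> (q - p))\<bar> = liminf (\<lambda>m. ennreal \<bar>convolve u (\<rho> m) ?z - convolve u (\<rho> m) p - t * (a \<bullet> (q - p))\<bar>)"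
   by (intro lim_imp_Liminf[symmetric]) auto
  also have "\<dots> \<le> \<Psi> p q"
   unfolding \<Psi>_def
  proof (intro Liminf_mono always_eventually allI)
   fix m
   have "convolve u (\<rho> m) ?z - convolve u (\<rho> m) p - t * (a \<bullet> (q - p)) = w m ?z - w m p"
    by (simp add: w_def inner_add_right)
   moreover have "ennreal \<bar>w m ?z - w m p\<bar> \<le> T m p q"
    using segment_increment_bound[OF wd Gc pq t] pq by (simp add: T_def S_def)
   ultimately show "ennreal \<bar>convolve u (\<rho> m) ?z - convolve u (\<rho> m) p - t * (a \<bullet> (q - p))\<bar> \<le> T m p q" by simp
  qed
  finally show "ennreal \<bar>u ?z - u p - t * (a \<bullet> (q - p))\<bar> \<le> \<Psi> p q" .
 qed
qed

text \<open>The scalar estimate is applied to each component with the corresponding row of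
  \<open>A\<close>; summing the majorants costs one more factor n.\<close>

lemma segment_estimate_vec:
 fixes g :: "real^'n => real^'n" and A :: "real^'n^'n" and r K :: real
 assumes g: "integrable lborel g" and r: "r > 0"
  and H: "!!\<phi> i j. smooth_test_function (ball x (2 * r)) \<phi> ==> (\<forall>z. \<bar>\<phi> z\<bar> \<le> 1) ==>
    \<bar>(\<integral>z. g z $ i * partial_deriv j \<phi> z \<partial>lborel) + A $ i $ j * (\<integral>z. \<phi> z \<partial>lborel)\<bar> \<le> K"
  and K0: "K \<ge> 0"
 obtains \<Psi> :: "real^'n => real^'n => ennreal"
 where "case_prod \<Psi> \<in> borel_measurable (borel \<Otimes>\<^sub>M borel)"
  "(\<integral>\<^sup>+p. \<integral>\<^sup>+q. \<Psi> p q \<partial>lborel \<partial>lborel) \<le> ennreal (CARD('n) * (2 * r * CARD('n) * 2 ^ CARD('n) * measure lborel (ball x r) * K))"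
  "!!p q t. p \<in> ball x r ==> q \<in> ball x r ==> 0 \<le> t ==> t \<le> 1 ==> (!!i. lebesgue_point (\<lambda>z. g z $ i) p) ==>
    (!!i. lebesgue_point (\<lambda>z. g z $ i) (p + t *\<^sub>R (q - p)))
    ==> ennreal (norm (g (p + t *\<^sub>R (q - p)) - g p - t *\<^sub>R (A *v (q - p)))) \<le> \<Psi> p q"
proof -
 let ?C = "2 * r * CARD('n) * 2 ^ CARD('n) * measure lborel (ball x r) * K"
 have C0: "?C \<ge> 0" using r K0 by simp
 have gi: "integrable lborel (\<lambda>z. g z $ i)" for i
  using integrable_bounded_linear[OF bounded_linear_vec_nth g] .
 define Q where "Q = (\<lambda>i (\<Psi>::real^'n => real^'n => ennreal). case_prod \<Psi> \<in> borel_measurable (borel \<Otimes>\<^sub>M borel) \<and>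
  (\<integral>\<^sup>+p. \<integral>\<^sup>+q. \<Psi> p q \<partial>lborel \<partial>lborel) \<le> ennreal ?C \<and>
  (\<forall>p q t. p \<in> ball x r --> q \<in> ball x r --> 0 \<le> t --> t \<le> 1 --> lebesgue_point (\<lambda>z. g z $ i) p --> lebesgue_point (\<lambda>z. g z $ i) (p + t *\<^sub>R (q - p))
    --> ennreal \<bar>g (p + t *\<^sub>R (q - p)) $ i - g p $ i - t * (A $ i \<bullet> (q - p))\<bar> \<le> \<Psi> p q))"
 have ex: "\<exists>\<Psi>. Q i \<Psi>" for i
 proof -
  obtain \<Psi> where "case_prod \<Psi> \<in> borel_measurable (borel \<Otimes>\<^sub>M borel)"
   "(\<integral>\<^sup>+p. \<integral>\<^sup>+q. \<Psi> p q \<partial>lborel \<partial>lborel) \<le> ennreal ?C"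
   "!!p q t. p \<in> ball x r ==> q \<in> ball x r ==> 0 \<le> t ==> t \<le> 1 ==> lebesgue_point (\<lambda>z. g z $ i) p ==> lebesgue_point (\<lambda>z. g z $ i) (p + t *\<^sub>R (q - p))
    ==> ennreal \<bar>g (p + t *\<^sub>R (q - p)) $ i - g p $ i - t * (A $ i \<bullet> (q - p))\<bar> \<le> \<Psi> p q"
   by (rule segment_estimate[where u="\<lambda>z. g z $ i" and a="A $ i" and x=x and r=r and K=K],
     rule gi, rule r, erule (1) H, rule K0, rule that, assumption+)
  then show ?thesis unfolding Q_def by (intro exI[of _ \<Psi>]) auto
 qed
 have "\<exists>\<Psi>. \<forall>i. Q i (\<Psi> i)" by (intro choice allI ex)
 then obtain \<Psi> where \<Psi>: "!!i. case_prod (\<Psi> i) \<in> borel_measurable (borel \<Otimes>\<^sub>M borel)"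
  "!!i. (\<integral>\<^sup>+p. \<integral>\<^sup>+q. \<Psi> i p q \<partial>lborel \<partial>lborel) \<le> ennreal ?C"
  "!!i p q t. p \<in> ball x r ==> q \<in> ball x r ==> 0 \<le> t ==> t \<le> 1 ==> lebesgue_point (\<lambda>z. g z $ i) p ==> lebesgue_point (\<lambda>z. g z $ i) (p + t *\<^sub>R (q - p))
    ==> ennreal \<bar>g (p + t *\<^sub>R (q - p)) $ i - g p $ i - t * (A $ i \<bullet> (q - p))\<bar> \<le> \<Psi> i p q" unfolding Q_def by blast
 have sec: "(\<lambda>q. \<Psi> i p q) \<in> borel_measurable borel" for p i using measurable_Pair2[OF \<Psi>(1), of p i] by simp
 have intm: "(\<lambda>p. \<integral>\<^sup>+q. \<Psi> i p q \<partial>lborel) \<in> borel_measurable borel" for i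
  using lborel.borel_measurable_nn_integral[of "\<Psi> i" borel] \<Psi>(1) by simp
 show ?thesis
 proof (rule that[of "\<lambda>p q. \<Sum>i\<in>UNIV. \<Psi> i p q"])
  have "(\<lambda>z. \<Sum>i\<in>UNIV. case_prod (\<Psi> i) z) \<in> borel_measurable (borel \<Otimes>\<^sub>M borel)"
   by (intro borel_measurable_sum \<Psi>(1))
  then show "(\<lambda>(p, q). \<Sum>i\<in>UNIV. \<Psi> i p q) \<in> borel_measurable (borel \<Otimes>\<^sub>M borel)" by (simp add: case_prod_beta')
  have "(\<integral>\<^sup>+p. \<integral>\<^sup>+q. (\<Sum>i\<in>UNIV. \<Psi> i p q) \<partial>lborel \<partial>lborel) = (\<integral>\<^sup>+p. (\<Sum>i\<in>UNIV. \<integral>\<^sup>+q. \<Psi> i p q \<partial>lborel) \<partial>lborel)"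
   by (intro nn_integral_cong nn_integral_sum) (use sec in simp)
  also have "\<dots> = (\<Sum>i\<in>UNIV. \<integral>\<^sup>+p. \<integral>\<^sup>+q. \<Psi> i p q \<partial>lborel \<partial>lborel)"
   by (intro nn_integral_sum) (use intm in simp)
  also have "\<dots> \<le> (\<Sum>i\<in>(UNIV::'n set). ennreal ?C)" by (intro sum_mono \<Psi>(2))
  also have "\<dots> = ennreal (CARD('n) * ?C)"
   unfolding ennreal_mult'[OF of_nat_0_le_iff] by (simp add: ennreal_of_nat_eq_real_of_nat)
  finally show "(\<integral>\<^sup>+p. \<integral>\<^sup>+q. (\<Sum>i\<in>UNIV. \<Psi> i p q) \<partial>lborel \<partial>lborel) \<le> ennreal (CARD('n) * ?C)" .
 next
  fix p q t assume a: "p \<in> ball x r" "q \<in> ball x r" "0 \<le> t" "t \<le> (1::real)" "!!i. lebesgue_point (\<lambda>z. g z $ i) p"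
    "!!i. lebesgue_point (\<lambda>z. g z $ i) (p + t *\<^sub>R (q - p))"
  have "ennreal (norm (g (p + t *\<^sub>R (q - p)) - g p - t *\<^sub>R (A *v (q - p))))
   \<le> ennreal (\<Sum>i\<in>UNIV. \<bar>(g (p + t *\<^sub>R (q - p)) - g p - t *\<^sub>R (A *v (q - p))) $ i\<bar>)"
   by (intro ennreal_leI norm_le_l1_cart)
  also have "\<dots> = (\<Sum>i\<in>UNIV. ennreal \<bar>(g (p + t *\<^sub>R (q - p)) - g p - t *\<^sub>R (A *v (q - p))) $ i\<bar>)"
   by (intro sum_ennreal[symmetric]) simp
  also have "\<dots> \<le> (\<Sum>i\<in>UNIV. \<Psi> i p q)"
   using \<Psi>(3)[OF a(1-4) a(5) a(6)] by (intro sum_mono) (simp add: matrix_vector_mul_component)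
  finally show "ennreal (norm (g (p + t *\<^sub>R (q - p)) - g p - t *\<^sub>R (A *v (q - p)))) \<le> (\<Sum>i\<in>UNIV. \<Psi> i p q)" .
 qed
qed

section \<open>Differentiation of measures\<close>

text \<open>Vitali's theorem extracts from the fine cover countably many disjoint closed balls that
  exhaust \<open>S\<close> up to a null set, and each finite subfamily has controlled volume. The
  packing hypothesis speaks of finite disjoint families rather than of a measure, so that it also
  fits a set function that is merely superadditive on balls.\<close>

lemma vitali_packing_bound:
 fixes S :: "(real^'n) set" and P :: "real^'n => real => bool"
 assumes fine: "!!x d. x \<in> S ==> d > 0 ==> \<exists>\<rho>. 0 < \<rho> \<and> \<rho> < d \<and> P x \<rho>"
  and packing: "!!F. finite F ==> (!!x \<rho>. (x, \<rho>) \<in> F ==> x \<in> S \<and> \<rho> > 0 \<and> P x \<rho>) ==>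
   pairwise (\<lambda>i j. disjnt (cball (fst i) (snd i)) (cball (fst j) (snd j))) F ==> (\<Sum>i\<in>F. snd i ^ CARD('n)) \<le> C"
 shows "\<exists>T. S \<subseteq> T \<and> T \<in> lmeasurable \<and> measure lebesgue T \<le> unit_ball_vol (real CARD('n)) * C"
proof -
 let ?w = "unit_ball_vol (real CARD('n))"
 let ?K = "{(x, \<rho>). x \<in> S \<and> 0 < \<rho> \<and> P x \<rho>}"
 let ?c = "\<lambda>i::(real^'n) \<times> real. cball (fst i) (snd i)"
 have Kpos: "0 < snd i" if "i \<in> ?K" for i using that by auto
 have Kfine: "\<exists>i. i \<in> ?K \<and> x \<in> cball (fst i) (snd i) \<and> snd i < d" if xd: "x \<in> S" "0 < d" for x d
 proof -
  obtain \<rho> where "0 < \<rho>" "\<rho> < d" "P x \<rho>" using fine[OF xd] by blast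
  then show ?thesis using xd by (intro exI[of _ "(x, \<rho>)"]) auto
 qed
 obtain F where F: "countable F" "F \<subseteq> ?K" "pairwise (\<lambda>i j. disjnt (?c i) (?c j)) F"
  "negligible (S - (\<Union>i\<in>F. ?c i))"
  by (rule Vitali_covering_theorem_cballs[of ?K snd S fst, OF Kpos Kfine]) auto
 have bound: "measure lebesgue (\<Union>i\<in>I. ?c i) \<le> ?w * C" if "I \<subseteq> F" "finite I" for I
 proof -
  have "measure lebesgue (\<Union>i\<in>I. ?c i) \<le> (\<Sum>i\<in>I. measure lebesgue (?c i))"
   by (rule measure_UNION_le) (use that in auto)
  also have "\<dots> = (\<Sum>i\<in>I. ?w * snd i ^ CARD('n))"
  proof (rule sum.cong[OF refl])
   fix i assume "i \<in> I"
   then have "snd i \<ge> 0" using that F(2) by force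
   then show "measure lebesgue (?c i) = ?w * snd i ^ CARD('n)"
    using content_cball[of "snd i" "fst i"] by (simp add: measure_completion)
  qed
  also have "\<dots> = ?w * (\<Sum>i\<in>I. snd i ^ CARD('n))" by (simp add: sum_distrib_left)
  also have "\<dots> \<le> ?w * C"
  proof (rule mult_left_mono)
   show "(\<Sum>i\<in>I. snd i ^ CARD('n)) \<le> C"
    using that F(2,3) by (intro packing) (auto intro: pairwise_subset)
  qed simp
  finally show ?thesis .
 qed
 let ?U = "\<Union>i\<in>F. ?c i"
 have U: "?U \<in> lmeasurable" "measure lebesgue ?U \<le> ?w * C"
  by (rule fmeasurable_UN_bound[OF F(1) _ bound] measure_UN_bound[OF F(1) _ bound]; simp)+
 have N: "S - ?U \<in> lmeasurable" "measure lebesgue (S - ?U) = 0"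
  using F(4) by (auto intro: negligible_imp_measurable negligible_imp_measure0)
 have le: "measure lebesgue ((S - ?U) \<union> ?U) \<le> measure lebesgue (S - ?U) + measure lebesgue ?U"
  by (intro measure_Un_le) (use U N in auto)
 show ?thesis
 proof (intro exI conjI)
  show "S \<subseteq> (S - ?U) \<union> ?U" by blast
  show "(S - ?U) \<union> ?U \<in> lmeasurable" using U N by (intro fmeasurable.Un)
  show "measure lebesgue ((S - ?U) \<union> ?U) \<le> ?w * C" using le U N by linarith
 qed
qed

text \<open>Lebesgue points, density points and the vanishing of the singular part all follow from this.\<close>

lemma measure_density_zero:
 fixes S :: "(real^'n) set"
 assumes fin: "finite_measure \<nu>" and sets: "sets \<nu> = sets borel" and S: "S \<in> sets borel" "emeasure \<nu> S = 0"
 shows "negligible {x\<in>S. \<not> ((\<lambda>r. measure \<nu> (cball x r) / r ^ CARD('n)) \<longlongrightarrow> 0) (at_right 0)}"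
proof -
 interpret finite_measure \<nu> by fact
 let ?w = "unit_ball_vol (real CARD('n))"
 let ?B = "\<lambda>k::nat. {x\<in>S. \<forall>d>0. \<exists>\<rho>. 0 < \<rho> \<and> \<rho> < d \<and> measure \<nu> (cball x \<rho>) * (real k + 1) \<ge> \<rho> ^ CARD('n)}"
 have w: "?w > 0" by simp
 then have w0: "?w ~= 0" by linarith
 have "negligible (?B k)" for k
  unfolding negligible_outer_le
 proof (intro allI impI)
  fix e :: real assume e: "e > 0"
  define e' where "e' = e / (?w * (real k + 1))"
  have e': "e' > 0" using e w by (simp add: e'_def)
  \<comment> \<open>Outer regularity puts the \<nu>-null set \<open>S\<close> in an open set of
    small measure. Disjoint balls inside it have measures that sum to at most \<open>e'\<close>, and
    each radius to the power n is at most k + 1 times the measure of its ball.\<close>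
  have "(INF U\<in>{U. S \<subseteq> U \<and> open U}. emeasure \<nu> U) < ennreal e'"
   using outer_regular[OF sets _ S(1)] S(2) e' emeasure_finite[of "space \<nu>"] by (simp add: )
  then obtain U where U: "S \<subseteq> U" "open U" "emeasure \<nu> U < ennreal e'"
   by (auto simp: INF_less_iff)
  have Um: "measure \<nu> U \<le> e'" using U(3) e' by (simp add: emeasure_eq_measure ennreal_less_iff less_imp_le)
  let ?P = "\<lambda>x \<rho>. cball x \<rho> \<subseteq> U \<and> measure \<nu> (cball x \<rho>) * (real k + 1) \<ge> \<rho> ^ CARD('n)"
  have "\<exists>T. ?B k \<subseteq> T \<and> T \<in> lmeasurable \<and> measure lebesgue T \<le> ?w * ((real k + 1) * e')"
  proof (rule vitali_packing_bound[where P="?P"])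
   fix x and d :: real assume x: "x \<in> ?B k" and d: "d > 0"
   obtain d' where d': "d' > 0" "cball x d' \<subseteq> U" using U x open_contains_cball by blast
   have md: "min d d' > 0" using d d' by simp
   have xx: "\<forall>d>0. \<exists>\<rho>. 0 < \<rho> \<and> \<rho> < d \<and> measure \<nu> (cball x \<rho>) * (real k + 1) \<ge> \<rho> ^ CARD('n)" using x by simp
   obtain \<rho> where \<rho>: "0 < \<rho>" "\<rho> < min d d'" "measure \<nu> (cball x \<rho>) * (real k + 1) \<ge> \<rho> ^ CARD('n)" using xx[rule_format, OF md] by blast
   have "cball x \<rho> \<subseteq> cball x d'" using \<rho> by (intro subset_cball) auto
   then show "\<exists>\<rho>>0. \<rho> < d \<and> ?P x \<rho>" using \<rho> d'(2) by (intro exI[of _ \<rho>]) auto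
  next
   fix F :: "((real^'n) \<times> real) set"
   assume F: "finite F" "!!x \<rho>. (x, \<rho>) \<in> F ==> x \<in> ?B k \<and> \<rho> > 0 \<and> ?P x \<rho>"
    "pairwise (\<lambda>i j. disjnt (cball (fst i) (snd i)) (cball (fst j) (snd j))) F"
   have FP: "?P (fst i) (snd i)" if "i \<in> F" for i using F(2)[of "fst i" "snd i"] that by simp
   have "(\<Sum>i\<in>F. snd i ^ CARD('n)) \<le> (\<Sum>i\<in>F. measure \<nu> (cball (fst i) (snd i)) * (real k + 1))"
    using FP by (intro sum_mono) blast
   also have "\<dots> = (real k + 1) * (\<Sum>i\<in>F. measure \<nu> (cball (fst i) (snd i)))"
    by (simp add: sum_distrib_left mult.commute)
   also have "(\<Sum>i\<in>F. measure \<nu> (cball (fst i) (snd i))) = measure \<nu> (\<Union>i\<in>F. cball (fst i) (snd i))"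
    using F(3) by (intro finite_measure_finite_Union[symmetric] F(1))
     (auto simp: sets disjoint_family_on_def pairwise_def disjnt_def)
   also have "\<dots> \<le> measure \<nu> U"
   proof (rule finite_measure_mono)
    show "(\<Union>i\<in>F. cball (fst i) (snd i)) \<subseteq> U" by (intro UN_least) (use FP in blast)
   qed (use U(2) in \<open>simp add: sets\<close>)
   finally show "(\<Sum>i\<in>F. snd i ^ CARD('n)) \<le> (real k + 1) * e'"
    using Um by (smt (verit) mult_left_mono of_nat_0_le_iff)
  qed
  moreover have "?w * ((real k + 1) * e') = e" by (simp add: e'_def w0)
  ultimately show "\<exists>T. ?B k \<subseteq> T \<and> T \<in> lmeasurable \<and> measure lebesgue T \<le> e" by simp
 qed
 then have "negligible (\<Union>k. ?B k)" by (intro negligible_countable_Union[of "range ?B", simplified]) auto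
 moreover have "{x\<in>S. \<not> ((\<lambda>r. measure \<nu> (cball x r) / r ^ CARD('n)) \<longlongrightarrow> 0) (at_right 0)} \<subseteq> (\<Union>k. ?B k)"
 proof
  fix x assume "x \<in> {x\<in>S. \<not> ((\<lambda>r. measure \<nu> (cball x r) / r ^ CARD('n)) \<longlongrightarrow> 0) (at_right 0)}"
  then have x: "x \<in> S" "\<not> ((\<lambda>r. measure \<nu> (cball x r) / r ^ CARD('n)) \<longlongrightarrow> 0) (at_right 0)" by auto
  obtain e where e: "e > 0" "\<not> (\<forall>\<^sub>F r in at_right 0. dist (measure \<nu> (cball x r) / r ^ CARD('n)) 0 < e)"
   using x(2) unfolding tendsto_iff by blast
  obtain k :: nat where k: "1 / e < real k" using reals_Archimedean2 by blast
  have "\<exists>\<rho>. 0 < \<rho> \<and> \<rho> < d \<and> measure \<nu> (cball x \<rho>) * (real k + 1) \<ge> \<rho> ^ CARD('n)" if d: "d > 0" for d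
  proof -
   have "\<not> (\<forall>\<rho>>0. \<rho> < d --> dist (measure \<nu> (cball x \<rho>) / \<rho> ^ CARD('n)) 0 < e)"
    using e(2) d unfolding eventually_at_right_field by auto
   then obtain \<rho> where \<rho>: "0 < \<rho>" "\<rho> < d" "measure \<nu> (cball x \<rho>) / \<rho> ^ CARD('n) \<ge> e"
    by (auto simp: not_less)
   have "\<rho> ^ CARD('n) \<le> measure \<nu> (cball x \<rho>) * (1 / e)"
    using \<rho> e(1) by (simp add: field_simps)
   also have "\<dots> \<le> measure \<nu> (cball x \<rho>) * (real k + 1)" using k by (intro mult_left_mono) auto
   finally show ?thesis using \<rho> by blast
  qed
  then show "x \<in> (\<Union>k. ?B k)" using x(1) by blast
 qed
 ultimately show ?thesis by (rule negligible_subset)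
qed

text \<open>For rational q close to u x, the region where |u - q| is at most 1/(k+1) contributes
  little to the mean oscillation. On the remaining region |u - q| is the density of a measure that
  does not charge \<open>S q k\<close>, so by \<open>measure_density_zero\<close> its contribution
  vanishes at almost every point of \<open>S q k\<close>. Countably many parameters suffice.\<close>

lemma AE_lebesgue_point:
 fixes u :: "real^'n => real"
 assumes u: "integrable lborel u"
 shows "negligible {x. \<not> lebesgue_point u x}"
proof -
 let ?w = "unit_ball_vol (real CARD('n))"
 have [measurable]: "u \<in> borel_measurable borel" using u by simp
 \<comment> \<open>The ball of radius \<open>N\<close> makes the measure finite; near
   \<open>x\<close> the truncation is invisible once \<open>N\<close> exceeds the norm of
   \<open>x\<close> by more than 1.\<close>
 define \<nu> where "\<nu> = (\<lambda>q (k::nat) (N::nat). density lborel (\<lambda>y. ennreal (\<bar>u y - q\<bar> * indicator (ball 0 N \<inter> {y. \<bar>u y - q\<bar> > 1 / (real k + 1)}) y)))"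
 define S where "S = (\<lambda>q (k::nat). {y. \<bar>u y - q\<bar> \<le> 1 / (real k + 1)})"
 define B where "B = (\<lambda>(q, k, N). {x\<in>S q k. \<not> ((\<lambda>r. measure (\<nu> q k N) (cball x r) / r ^ CARD('n)) \<longlongrightarrow> 0) (at_right 0)})"
 have indi: "integrable lborel (\<lambda>y. \<bar>u y - q\<bar> * indicator (A \<inter> {y. \<bar>u y - q\<bar> > 1 / (real k + 1)}) y)"
  if A: "A \<in> sets borel" "bounded A" for A q and k :: nat
 proof -
  obtain R where R: "A \<subseteq> ball 0 R" using bounded_subset_ballD[OF A(2)] by blast
  note [measurable] = A(1)
  show ?thesis
   by (rule Bochner_Integration.integrable_bound[OF integrable_diff_const_ball[OF u, of q 0 R]])
    (use R in \<open>auto simp: indicator_def subset_iff\<close>)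
 qed
 have [measurable]: "!!r. ball (0::real^'n) r \<in> sets borel" by simp
 have sets\<nu>: "sets (\<nu> q k N) = sets borel" for q k N by (simp add: \<nu>_def)
 have fin: "finite_measure (\<nu> q k N)" for q k N
 proof
  have "emeasure (\<nu> q k N) (space (\<nu> q k N)) = (\<integral>\<^sup>+y. ennreal (\<bar>u y - q\<bar> * indicator (ball 0 N \<inter> {y. \<bar>u y - q\<bar> > 1 / (real k + 1)}) y) \<partial>lborel)"
   unfolding \<nu>_def by (subst emeasure_density) auto
  also have "\<dots> = ennreal (\<integral>y. \<bar>u y - q\<bar> * indicator (ball 0 N \<inter> {y. \<bar>u y - q\<bar> > 1 / (real k + 1)}) y \<partial>lborel)"
   by (rule nn_integral_eq_integral[OF indi]) auto
  finally show "emeasure (\<nu> q k N) (space (\<nu> q k N)) ~= \<infinity>" by simp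
 qed
 have "negligible (B (q, k, N))" for q k N
  unfolding B_def prod.case
 proof (rule measure_density_zero[OF fin sets\<nu>])
  show "S q k \<in> sets borel" unfolding S_def by measurable
  then show "emeasure (\<nu> q k N) (S q k) = 0"
   unfolding \<nu>_def by (subst emeasure_density) (auto simp: S_def indicator_def nn_integral_0_iff_AE)
 qed
 then have "negligible (\<Union>z \<in> \<rat> \<times> UNIV \<times> UNIV. B z)"
  by (intro negligible_countable_Union) (auto simp: countable_rat)
 moreover have "{x. \<not> lebesgue_point u x} \<subseteq> (\<Union>z \<in> \<rat> \<times> UNIV \<times> UNIV. B z)"
 proof (rule subsetI, rule ccontr)
  fix x assume "x \<in> {x. \<not> lebesgue_point u x}" and nx: "x \<notin> (\<Union>z \<in> \<rat> \<times> UNIV \<times> UNIV. B z)"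
  then have x: "\<not> lebesgue_point u x" by simp
  have nB: "x \<notin> B (q, k, N)" if "q \<in> \<rat>" for q k N using nx that by blast
  have "((\<lambda>r. (\<integral>y. \<bar>u y - u x\<bar> * indicator (ball x r) y \<partial>lborel) / r ^ CARD('n)) \<longlongrightarrow> 0) (at_right 0)"
  proof (rule tendstoI)
   fix e :: real assume e: "e > 0"
   obtain k :: nat where k: "4 * ?w / e < real k" using reals_Archimedean2 by blast
   have "4 * ?w < e * real k" using k e by (simp add: field_simps)
   then have k': "2 * ?w / (real k + 1) < e / 2" using e by (simp add: field_simps)
   obtain q where q: "q \<in> \<rat>" "u x - 1 / (real k + 1) < q" "q < u x + 1 / (real k + 1)"
    using Rats_dense_in_real[of "u x - 1 / (real k + 1)" "u x + 1 / (real k + 1)"] by auto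
   obtain N :: nat where N: "norm x + 1 < real N" using reals_Archimedean2 by blast
   have xS: "x \<in> S q k" using q by (auto simp: S_def abs_le_iff)
   then have "((\<lambda>r. measure (\<nu> q k N) (cball x r) / r ^ CARD('n)) \<longlongrightarrow> 0) (at_right 0)"
    using nB[OF q(1), of k N] by (simp add: B_def)
   then have "\<forall>\<^sub>F r in at_right 0. dist (measure (\<nu> q k N) (cball x r) / r ^ CARD('n)) 0 < e / 2"
    using e by (intro tendstoD) auto
   moreover have "\<forall>\<^sub>F r in at_right (0::real). r < 1" "\<forall>\<^sub>F r in at_right (0::real). r > 0"
    by (auto simp: eventually_at_right_field intro: exI[of _ 1])
   ultimately show "\<forall>\<^sub>F r in at_right 0. dist ((\<integral>y. \<bar>u y - u x\<bar> * indicator (ball x r) y \<partial>lborel) / r ^ CARD('n)) 0 < e"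
   proof eventually_elim
    case (elim r)
    have sub: "ball x r \<subseteq> ball 0 N"
    proof
     fix y assume "y \<in> ball x r"
     then show "y \<in> ball 0 N" using elim(2) N norm_triangle_sub[of y x] by (simp add: dist_norm norm_minus_commute)
    qed
    let ?I = "\<lambda>y. \<bar>u y - q\<bar> * indicator (ball x r \<inter> {y. \<bar>u y - q\<bar> > 1 / (real k + 1)}) y"
    have ib: "integrable lborel (\<lambda>y. (2 / (real k + 1)) * indicator (ball x r) y :: real)"
    proof -
     have "integrable lborel (\<lambda>y. indicator (ball x r) y :: real)"
      by (intro integrable_real_indicator emeasure_bounded_finite) auto
     then show ?thesis by simp
    qed
    have ii: "integrable lborel ?I" by (rule indi) auto
    have le: "(\<integral>y. \<bar>u y - u x\<bar> * indicator (ball x r) y \<partial>lborel) \<le> (\<integral>y. (?I y + (2 / (real k + 1)) * indicator (ball x r) y) \<partial>lborel)"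
    proof (rule integral_mono[OF integrable_diff_const_ball[OF u] Bochner_Integration.integrable_add[OF ii ib]])
     fix y
     define c where "c = 1 / (real k + 1)"
     have c: "c \<ge> 0" "2 / (real k + 1) = c + c" by (simp_all add: c_def)
     have qx: "\<bar>q - u x\<bar> \<le> c" using q unfolding c_def[symmetric] by (simp add: abs_le_iff)
     show "\<bar>u y - u x\<bar> * indicator (ball x r) y \<le> ?I y + (2 / (real k + 1)) * indicator (ball x r) y"
     proof (cases "y \<in> ball x r")
      case True
      have "\<bar>u y - u x\<bar> \<le> \<bar>u y - q\<bar> + c" using qx by linarith
      then have "\<bar>u y - u x\<bar> \<le> (if \<bar>u y - q\<bar> > c then \<bar>u y - q\<bar> else 0) + (c + c)" using c by auto
      then show ?thesis using True unfolding c(2) c_def[symmetric] by (simp add: indicator_def split: if_splits)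
     qed (simp add: indicator_def)
    qed
    have eq: "(\<integral>y. (?I y + (2 / (real k + 1)) * indicator (ball x r) y) \<partial>lborel) = (\<integral>y. ?I y \<partial>lborel) + 2 / (real k + 1) * (?w * r ^ CARD('n))"
    proof -
     have "(\<integral>y. (2 / (real k + 1)) * indicator (ball x r) y \<partial>lborel) = 2 / (real k + 1) * (?w * r ^ CARD('n))"
      using elim(3) measure_ball[of r x] by simp
     then show ?thesis using Bochner_Integration.integral_add[OF ii ib] by simp
    qed
    have I\<nu>: "(\<integral>y. ?I y \<partial>lborel) \<le> measure (\<nu> q k N) (cball x r)"
    proof -
     interpret finite_measure "\<nu> q k N" by (rule fin)
     have "ennreal (\<integral>y. ?I y \<partial>lborel) = (\<integral>\<^sup>+y. ennreal (?I y) \<partial>lborel)"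
      by (rule nn_integral_eq_integral[symmetric, OF ii]) auto
     also have "\<dots> \<le> (\<integral>\<^sup>+y. ennreal (\<bar>u y - q\<bar> * indicator (ball 0 N \<inter> {y. \<bar>u y - q\<bar> > 1 / (real k + 1)}) y) * indicator (cball x r) y \<partial>lborel)"
      using sub by (intro nn_integral_mono) (auto simp: indicator_def)
     also have "\<dots> = emeasure (\<nu> q k N) (cball x r)"
      unfolding \<nu>_def by (subst emeasure_density) auto
     also have "\<dots> = ennreal (measure (\<nu> q k N) (cball x r))" by (rule emeasure_eq_measure)
     finally show ?thesis by simp
    qed
    have rn: "r ^ CARD('n) > 0" using elim(3) by simp
    have "(\<integral>y. \<bar>u y - u x\<bar> * indicator (ball x r) y \<partial>lborel) / r ^ CARD('n) \<le>
      (measure (\<nu> q k N) (cball x r) + 2 / (real k + 1) * (?w * r ^ CARD('n))) / r ^ CARD('n)"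
     using le eq I\<nu> rn by (intro divide_right_mono) auto
    also have "\<dots> = measure (\<nu> q k N) (cball x r) / r ^ CARD('n) + 2 * ?w / (real k + 1)"
     using elim(3) by (simp add: add_divide_distrib)
    also have "\<dots> < e / 2 + e / 2"
    proof (rule add_strict_mono[OF _ k'])
     show "measure (\<nu> q k N) (cball x r) / r ^ CARD('n) < e / 2"
      using elim(1) unfolding dist_real_def by linarith
    qed
    finally have "(\<integral>y. \<bar>u y - u x\<bar> * indicator (ball x r) y \<partial>lborel) / r ^ CARD('n) < e" by simp
    moreover have "(\<integral>y. \<bar>u y - u x\<bar> * indicator (ball x r) y \<partial>lborel) / r ^ CARD('n) \<ge> 0"
     using rn by (intro divide_nonneg_pos integral_nonneg_AE) auto
    ultimately show ?case by simp
   qed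
  qed
  then show False using x by (simp add: lebesgue_point_def)
 qed
 ultimately show ?thesis by (rule negligible_subset)
qed

text \<open>For a continuous representative every point qualifies, not just almost every one. The
  maps f_k profit from this: the segment estimate holds for them along entire segments.\<close>

lemma lebesgue_point_continuous:
 fixes u :: "real^'n => real"
 assumes u: "integrable lborel u" and c: "isCont u x"
 shows "lebesgue_point u x"
 unfolding lebesgue_point_def
proof (rule tendstoI)
 let ?w = "unit_ball_vol (real CARD('n))"
 fix e :: real assume e: "e > 0"
 define e' where "e' = e / (2 * ?w)"
 have e': "e' > 0" using e by (simp add: e'_def)
 obtain d where d: "d > 0" "!!y. dist y x < d ==> dist (u y) (u x) < e'"
  using c e' unfolding continuous_at_eps_delta by blast
 have "\<forall>\<^sub>F r in at_right (0::real). r < d" "\<forall>\<^sub>F r in at_right (0::real). r > 0"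
  using d(1) by (auto simp: eventually_at_right_field)
 then show "\<forall>\<^sub>F r in at_right 0. dist ((\<integral>y. \<bar>u y - u x\<bar> * indicator (ball x r) y \<partial>lborel) / r ^ CARD('n)) 0 < e"
 proof eventually_elim
  case (elim r)
  have rn: "r ^ CARD('n) > 0" using elim(2) by simp
  have ib: "integrable lborel (\<lambda>y. e' * indicator (ball x r) y :: real)"
  proof -
   have "integrable lborel (\<lambda>y. indicator (ball x r) y :: real)"
    by (intro integrable_real_indicator emeasure_bounded_finite) auto
   then show ?thesis by simp
  qed
  have "(\<integral>y. \<bar>u y - u x\<bar> * indicator (ball x r) y \<partial>lborel) \<le> (\<integral>y. e' * indicator (ball x r) y \<partial>lborel)"
  proof (rule integral_mono[OF integrable_diff_const_ball[OF u] ib])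
   fix y show "\<bar>u y - u x\<bar> * indicator (ball x r) y \<le> e' * indicator (ball x r) y"
    using d(2)[of y] elim(1) by (cases "y \<in> ball x r") (auto simp: dist_real_def dist_commute)
  qed
  also have "\<dots> = e' * (?w * r ^ CARD('n))" using elim(2) measure_ball[of r x] by simp
  finally have "(\<integral>y. \<bar>u y - u x\<bar> * indicator (ball x r) y \<partial>lborel) / r ^ CARD('n) \<le> e' * ?w"
   using rn by (simp add: field_simps)
  also have "\<dots> < e" using e by (simp add: e'_def)
  finally show ?case using rn by (simp add: divide_nonneg_pos integral_nonneg_AE)
 qed
qed

text \<open>A hole of radius \<delta> r at distance at most r from x fills a fixed fraction of a
  ball around x. Up to a null set, however, the complement of the closure of \<open>S\<close> has
  density zero at points of that closure. The closure is used because \<open>S\<close> is an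
  arbitrary set.\<close>

lemma negligible_porous_points:
 fixes S :: "(real^'n) set"
 shows "negligible {x\<in>S. \<not> (\<forall>\<delta>>0. \<exists>r0>0. \<forall>r y. 0 < r \<and> r < r0 \<and> dist x y \<le> r --> ball y (\<delta> * r) \<inter> S ~= {})}"
proof -
 let ?w = "unit_ball_vol (real CARD('n))"
 let ?C = "closure S"
 define \<nu> where "\<nu> = (\<lambda>N::nat. density lborel (indicator (ball (0::real^'n) N - ?C)))"
 have sets\<nu>: "sets (\<nu> N) = sets borel" for N by (simp add: \<nu>_def)
 have [measurable]: "closure S \<in> sets borel" "!!r. ball (0::real^'n) r \<in> sets borel" by simp_all
 have em: "emeasure (\<nu> N) A = emeasure lborel (A \<inter> (ball 0 N - ?C))" if "A \<in> sets borel" for A N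
  using that unfolding \<nu>_def by (subst emeasure_density) (auto simp: nn_integral_indicator[symmetric] indicator_inter_arith mult.commute)
 have fin: "finite_measure (\<nu> N)" for N
 proof
  have "emeasure lborel (space (\<nu> N) \<inter> (ball 0 N - ?C)) \<le> emeasure lborel (ball (0::real^'n) N)"
   by (rule emeasure_mono) auto
  also have "\<dots> < \<infinity>" by (intro emeasure_bounded_finite) simp
  finally show "emeasure (\<nu> N) (space (\<nu> N)) ~= \<infinity>" using em[of "space (\<nu> N)" N] by (simp add: \<nu>_def)
 qed
 let ?B = "\<lambda>N. {x\<in>?C. \<not> ((\<lambda>r. measure (\<nu> N) (cball x r) / r ^ CARD('n)) \<longlongrightarrow> 0) (at_right 0)}"
 have "negligible (?B N)" for N
  by (rule measure_density_zero[OF fin sets\<nu>]) (auto simp: em Int_Diff)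
 then have "negligible (\<Union>N. ?B N)" by (intro negligible_countable_Union[of "range ?B", simplified]) auto
 moreover have "{x\<in>S. \<not> (\<forall>\<delta>>0. \<exists>r0>0. \<forall>r y. 0 < r \<and> r < r0 \<and> dist x y \<le> r --> ball y (\<delta> * r) \<inter> S ~= {})} \<subseteq> (\<Union>N. ?B N)"
 proof (rule subsetI, rule ccontr)
  fix x
  assume xx: "x \<in> {x\<in>S. \<not> (\<forall>\<delta>>0. \<exists>r0>0. \<forall>r y. 0 < r \<and> r < r0 \<and> dist x y \<le> r --> ball y (\<delta> * r) \<inter> S ~= {})}"
   and nx: "x \<notin> (\<Union>N. ?B N)"
  note x = conjunct1[OF xx[unfolded mem_Collect_eq]] conjunct2[OF xx[unfolded mem_Collect_eq]]
  have xB: "x \<notin> ?B N" for N using nx by blast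
  have xC: "x \<in> ?C" using x(1) closure_subset by blast
  obtain \<delta>0 where \<delta>0: "\<delta>0 > 0" "\<not> (\<exists>r0>0. \<forall>r y. 0 < r \<and> r < r0 \<and> dist x y \<le> r --> ball y (\<delta>0 * r) \<inter> S ~= {})" using x(2) by blast
  define \<delta> where "\<delta> = min \<delta>0 1"
  have \<delta>: "0 < \<delta>" "\<delta> \<le> 1" "\<delta> \<le> \<delta>0" using \<delta>0 by (auto simp: \<delta>_def)
  obtain N :: nat where N: "norm x + 2 < real N" using reals_Archimedean2 by blast
  have lim: "((\<lambda>r. measure (\<nu> N) (cball x r) / r ^ CARD('n)) \<longlongrightarrow> 0) (at_right 0)" using xB[of N] xC by blast
  \<comment> \<open>The relative volume of the hole: the ball of radius \<delta> r fits into the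
    ball of radius 2r around \<open>x\<close>.\<close>
  define e where "e = ?w * (\<delta> / 2) ^ CARD('n)"
  have e: "e > 0" using \<delta> by (simp add: e_def)
  then have "\<forall>\<^sub>F r in at_right 0. dist (measure (\<nu> N) (cball x r) / r ^ CARD('n)) 0 < e" using tendstoD[OF lim] by blast
  then obtain d where d: "d > 0" "!!r. 0 < r ==> r < d ==> measure (\<nu> N) (cball x r) / r ^ CARD('n) < e"
   unfolding eventually_at_right_field by auto
  define r0 where "r0 = min (d / 2) 1"
  have "r0 > 0" using d by (simp add: r0_def)
  then obtain r y where r: "0 < r" "r < r0" "dist x y \<le> r" "ball y (\<delta>0 * r) \<inter> S = {}" using \<delta>0(2) by blast
  have "ball y (\<delta> * r) \<inter> S = {}"
   using r \<delta> subset_ball[of "\<delta> * r" "\<delta>0 * r" y] mult_right_mono[of \<delta> \<delta>0 r] by auto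
  then have disj: "ball y (\<delta> * r) \<inter> ?C = {}" by (simp add: open_Int_closure_eq_empty)
  have \<delta>r: "\<delta> * r \<le> r" using \<delta> r by (simp add: mult_left_le_one_le)
  have sub: "ball y (\<delta> * r) \<subseteq> cball x (2 * r)" "ball y (\<delta> * r) \<subseteq> ball 0 N"
  proof -
   show 1: "ball y (\<delta> * r) \<subseteq> cball x (2 * r)"
   proof
    fix z assume "z \<in> ball y (\<delta> * r)"
    then have "dist y z \<le> r" using \<delta>r by simp
    then show "z \<in> cball x (2 * r)" using r(3) dist_triangle[of x z y] by simp
   qed
   have "r < 1" using r by (simp add: r0_def)
   then have "norm z < N" if "z \<in> cball x (2 * r)" for z
    using that N norm_triangle_sub[of z x] by (simp add: dist_norm norm_minus_commute)
   then show "ball y (\<delta> * r) \<subseteq> ball 0 N" using 1 by auto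
  qed
  interpret finite_measure "\<nu> N" by (rule fin)
  have "ennreal (?w * (\<delta> * r) ^ CARD('n)) = emeasure lborel (ball y (\<delta> * r))"
   using \<delta> r measure_ball[of "\<delta> * r" y] emeasure_bounded_finite[of "ball y (\<delta> * r)"]
   by (simp add: emeasure_eq_ennreal_measure)
  also have "\<dots> \<le> emeasure lborel (cball x (2 * r) \<inter> (ball 0 N - ?C))"
   using sub disj by (intro emeasure_mono) auto
  also have "\<dots> = emeasure (\<nu> N) (cball x (2 * r))" by (simp add: em)
  also have "\<dots> = ennreal (measure (\<nu> N) (cball x (2 * r)))" by (rule emeasure_eq_measure)
  finally have "?w * (\<delta> * r) ^ CARD('n) \<le> measure (\<nu> N) (cball x (2 * r))" by simp
  also have "\<dots> < e * (2 * r) ^ CARD('n)"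
   using d(2)[of "2 * r"] r by (simp add: r0_def field_simps)
  also have "\<dots> = ?w * (\<delta> * r) ^ CARD('n)"
  proof -
   have "e * (2 * r) ^ CARD('n) = ?w * ((\<delta> / 2) * (2 * r)) ^ CARD('n)"
    unfolding e_def power_mult_distrib by (simp only: mult.assoc)
   moreover have "(\<delta> / 2) * (2 * r) = \<delta> * r" by simp
   ultimately show ?thesis by (simp only:)
  qed
  finally show False by simp
 qed
 ultimately show ?thesis by (rule negligible_subset)
qed

section \<open>Signed measures and functions of bounded variation\<close>

lemma ennreal_sum_le: "ennreal (\<Sum>i\<in>I. f i) \<le> (\<Sum>i\<in>I. ennreal (f i))"
proof (cases "finite I")
 case True
 then show ?thesis
 proof (induction I)
  case (insert i I)
  have "ennreal (f i + (\<Sum>i\<in>I. f i)) \<le> ennreal (max 0 (f i) + max 0 (\<Sum>i\<in>I. f i))"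
   by (intro ennreal_leI) auto
  also have "\<dots> = ennreal (f i) + ennreal (\<Sum>i\<in>I. f i)"
   by (subst ennreal_plus) (auto simp: max_def ennreal_neg)
  finally show ?case using insert by (simp add: add_mono order_trans[OF _ add_left_mono])
 qed simp
qed simp

lemma vector_measure_Un:
 assumes v: "vector_measure M \<nu>" and CD: "C \<in> sets M" "D \<in> sets M" "C \<inter> D = {}"
 shows "\<nu> (C \<union> D) = \<nu> C + \<nu> D"
proof -
 have r: "range (binaryset C D) \<subseteq> sets M" using CD by (auto simp: range_binaryset_eq)
 have d: "disjoint_family (binaryset C D)"
  using CD(3) by (auto simp: disjoint_family_on_def binaryset_def)
 have "(\<lambda>i. \<nu> (binaryset C D i)) sums \<nu> (\<Union>i. binaryset C D i)"
  using v r d unfolding vector_measure_def by blast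
 then have 1: "(\<lambda>i. \<nu> (binaryset C D i)) sums \<nu> (C \<union> D)" by (simp add: UN_binaryset_eq)
 have "\<nu> (binaryset C D i) = 0" if "i \<notin> {..<2}" for i
  using that v by (auto simp: binaryset_def vector_measure_def)
 then have "(\<lambda>i. \<nu> (binaryset C D i)) sums (\<Sum>i<2. \<nu> (binaryset C D i))"
  by (intro sums_finite) auto
 moreover have "(\<Sum>i<2. \<nu> (binaryset C D i)) = \<nu> C + \<nu> D"
  by (simp add: numeral_2_eq_2 binaryset_def)
 ultimately show ?thesis using 1 sums_unique2 by fastforce
qed

lemma vector_measure_uminus:
 fixes \<nu> :: "'a set => 'b::real_normed_vector"
 shows "vector_measure M \<nu> ==> vector_measure M (\<lambda>A. - \<nu> A)"
 unfolding vector_measure_def by (auto intro: sums_minus)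

text \<open>A uniform bound on the values is what is kept of finite total variation; it makes both
  Jordan parts finite measures.\<close>

locale bounded_signed_measure =
 fixes M :: "'a measure" and \<nu> :: "'a set => real" and B :: real
 assumes vm: "vector_measure M \<nu>" and bdd: "!!A. A \<in> sets M ==> \<bar>\<nu> A\<bar> \<le> B"
begin

lemma nu_empty: "\<nu> {} = 0" using vm by (simp add: vector_measure_def)

abbreviation pfun :: "'a set => ennreal" where
 "pfun A \<equiv> (SUP B \<in> {B \<in> sets M. B \<subseteq> A}. ennreal (\<nu> B))"

lemma pfun_superadd:
 assumes "A1 \<inter> A2 = {}"
 shows "pfun A1 + pfun A2 \<le> pfun (A1 \<union> A2)"
proof -
 have *: "ennreal (\<nu> C) + ennreal (\<nu> D) \<le> pfun (A1 \<union> A2)"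
  if C: "C \<in> sets M" "C \<subseteq> A1" and D: "D \<in> sets M" "D \<subseteq> A2" for C D
 proof -
  \<comment> \<open>Sets of negative value are replaced by the empty set, in line with the
    truncation of negative reals by \<open>ennreal\<close>.\<close>
  define C' where "C' = (if \<nu> C \<ge> 0 then C else {})"
  define D' where "D' = (if \<nu> D \<ge> 0 then D else {})"
  have CD: "C' \<in> sets M" "D' \<in> sets M" "C' \<inter> D' = {}" "C' \<union> D' \<subseteq> A1 \<union> A2" "\<nu> C' \<ge> 0" "\<nu> D' \<ge> 0"
   using C D assms by (auto simp: C'_def D'_def nu_empty)
  have "ennreal (\<nu> C) + ennreal (\<nu> D) = ennreal (\<nu> C') + ennreal (\<nu> D')"
   by (simp add: C'_def D'_def nu_empty ennreal_neg)
  also have "\<dots> = ennreal (\<nu> (C' \<union> D'))"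
   using CD by (simp add: vector_measure_Un[OF vm] ennreal_plus)
  also have "\<dots> \<le> pfun (A1 \<union> A2)" using CD by (intro SUP_upper) auto
  finally show ?thesis .
 qed
 have ne: "{B \<in> sets M. B \<subseteq> A} ~= {}" for A by auto
 have 1: "ennreal (\<nu> C) + pfun A2 \<le> pfun (A1 \<union> A2)" if C: "C \<in> sets M" "C \<subseteq> A1" for C
 proof -
  have "pfun A2 + ennreal (\<nu> C) = (SUP D \<in> {B \<in> sets M. B \<subseteq> A2}. ennreal (\<nu> D) + ennreal (\<nu> C))"
   by (rule ennreal_SUP_add_left[symmetric, OF ne])
  also have "\<dots> \<le> pfun (A1 \<union> A2)" using *[OF C] by (intro SUP_least) (auto simp: add.commute)
  finally show ?thesis by (simp add: add.commute)
 qed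
 have "pfun A1 + pfun A2 = (SUP C \<in> {B \<in> sets M. B \<subseteq> A1}. ennreal (\<nu> C) + pfun A2)"
  by (rule ennreal_SUP_add_left[symmetric, OF ne])
 also have "\<dots> \<le> pfun (A1 \<union> A2)" using 1 by (intro SUP_least) auto
 finally show ?thesis .
qed

lemma pfun_empty: "pfun {} = 0"
proof -
 have "{B \<in> sets M. B \<subseteq> {}} = {{}}" by auto
 then show ?thesis by (simp add: nu_empty)
qed

text \<open>The supremum has to be shown countably additive. Superadditivity on disjoint sets gives
  one inequality; for the other, a competitor \<open>C\<close> is cut along the sequence and
  countable additivity of \<open>\<nu>\<close> applies.\<close>

lemma emeasure_positive_variation:
 assumes "A \<in> sets M"
 shows "emeasure (positive_variation M \<nu>) A = pfun A"
 unfolding positive_variation_def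
proof (rule emeasure_measure_of_sigma)
 show "sigma_algebra (space M) (sets M)" by (rule sets.sigma_algebra_axioms)
 show "positive (sets M) pfun" by (simp only: positive_def pfun_empty)
 show "countably_additive (sets M) pfun"
  unfolding countably_additive_def
 proof (intro allI impI)
  fix A :: "nat => 'a set" assume A: "range A \<subseteq> sets M" "disjoint_family A" "(\<Union>i. A i) \<in> sets M"
  show "(suminf (\<lambda>i. pfun (A i))) = pfun (\<Union>i. A i)"
  proof (rule antisym)
   have fin: "(\<Sum>i<n. pfun (A i)) \<le> pfun (\<Union>i<n. A i)" for n
   proof (induction n)
    case (Suc n)
    have "A i \<inter> A n = {}" if "i < n" for i using A(2) that by (auto simp: disjoint_family_on_def)
    then have disj: "(\<Union>i<n. A i) \<inter> A n = {}" by blast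
    have "(\<Sum>i<Suc n. pfun (A i)) = (\<Sum>i<n. pfun (A i)) + pfun (A n)" by (rule sum.lessThan_Suc)
    also have "\<dots> \<le> pfun (\<Union>i<n. A i) + pfun (A n)" by (rule add_right_mono[OF Suc])
    also have "\<dots> \<le> pfun ((\<Union>i<n. A i) \<union> A n)" by (rule pfun_superadd[OF disj])
    also have "(\<Union>i<n. A i) \<union> A n = (\<Union>i<Suc n. A i)" by (auto simp: lessThan_Suc)
    finally show ?case .
   qed (simp add: pfun_empty)
   have mono: "pfun (\<Union>i<n. A i) \<le> pfun (\<Union>i. A i)" for n
    by (rule SUP_subset_mono) auto
   show "(suminf (\<lambda>i. pfun (A i))) \<le> pfun (\<Union>i. A i)"
    using order_trans[OF fin mono] by (intro suminf_le_const) auto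
  next
   show "pfun (\<Union>i. A i) \<le> (suminf (\<lambda>i. pfun (A i)))"
   proof (rule SUP_least)
    fix C assume "C \<in> {B \<in> sets M. B \<subseteq> (\<Union>i. A i)}"
    then have C: "C \<in> sets M" "C \<subseteq> (\<Union>i. A i)" by auto
    have "range (\<lambda>i. C \<inter> A i) \<subseteq> sets M" "disjoint_family (\<lambda>i. C \<inter> A i)"
     using A C by (auto simp: disjoint_family_on_def)
    then have "(\<lambda>i. \<nu> (C \<inter> A i)) sums \<nu> (\<Union>i. C \<inter> A i)"
     using vm unfolding vector_measure_def by blast
    moreover have "(\<Union>i. C \<inter> A i) = C" using C by auto
    ultimately have "(\<lambda>n. \<Sum>i<n. \<nu> (C \<inter> A i)) \<longlonglongrightarrow> \<nu> C" by (simp add: sums_def)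
    then have "(\<lambda>n. ennreal (\<Sum>i<n. \<nu> (C \<inter> A i))) \<longlonglongrightarrow> ennreal (\<nu> C)" by (rule tendsto_ennrealI)
    moreover have "ennreal (\<Sum>i<n. \<nu> (C \<inter> A i)) \<le> (suminf (\<lambda>i. pfun (A i)))" for n
    proof -
     have "ennreal (\<Sum>i<n. \<nu> (C \<inter> A i)) \<le> (\<Sum>i<n. ennreal (\<nu> (C \<inter> A i)))" by (rule ennreal_sum_le)
     also have "\<dots> \<le> (\<Sum>i<n. pfun (A i))"
      using A C by (intro sum_mono SUP_upper) auto
     also have "\<dots> \<le> (suminf (\<lambda>i. pfun (A i)))" by (intro sum_le_suminf) auto
     finally show ?thesis .
    qed
    ultimately show "ennreal (\<nu> C) \<le> (suminf (\<lambda>i. pfun (A i)))"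
     by (intro LIMSEQ_le_const2) auto
   qed
  qed
 qed
qed (rule assms)

lemma sets_positive_variation: "sets (positive_variation M \<nu>) = sets M"
 and space_positive_variation: "space (positive_variation M \<nu>) = space M"
 unfolding positive_variation_def by (simp_all add: sets.space_closed sets.sigma_sets_eq)

lemma finite_positive_variation: "finite_measure (positive_variation M \<nu>)"
proof
 have "pfun (space M) \<le> ennreal B"
  using bdd by (intro SUP_least ennreal_leI) (auto simp: abs_le_iff)
 then show "emeasure (positive_variation M \<nu>) (space (positive_variation M \<nu>)) ~= \<infinity>"
  unfolding space_positive_variation emeasure_positive_variation[OF sets.top]
  using ennreal_less_top le_less_trans by (metis infinity_ennreal_def order_less_irrefl)
qed

lemma uminus_bounded_signed_measure: "bounded_signed_measure M (\<lambda>A. - \<nu> A) B"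
 using vm bdd by unfold_locales (auto intro: vector_measure_uminus)

text \<open>For C inside A the value of \<open>\<nu>\<close> on C is that on A minus that on A - C,
  and so at most \<open>\<nu> A\<close> plus the negative variation of A; the other inequality is
  symmetric.\<close>

lemma jordan_decomposition:
 assumes A: "A \<in> sets M"
 shows "measure (positive_variation M \<nu>) A - measure (positive_variation M (\<lambda>A. - \<nu> A)) A = \<nu> A"
proof -
 interpret N: bounded_signed_measure M "\<lambda>A. - \<nu> A" B by (rule uminus_bounded_signed_measure)
 interpret P: finite_measure "positive_variation M \<nu>" by (rule finite_positive_variation)
 interpret Q: finite_measure "positive_variation M (\<lambda>A. - \<nu> A)" by (rule N.finite_positive_variation)
 let ?p = "measure (positive_variation M \<nu>) A" and ?q = "measure (positive_variation M (\<lambda>A. - \<nu> A)) A"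
 have p: "ennreal ?p = pfun A" using P.emeasure_eq_measure emeasure_positive_variation[OF A] by metis
 have q: "ennreal ?q = N.pfun A" using Q.emeasure_eq_measure N.emeasure_positive_variation[OF A] by metis
 have pu: "\<nu> C \<le> ?p" if "C \<in> sets M" "C \<subseteq> A" for C
 proof -
  have "ennreal (\<nu> C) \<le> ennreal ?p" unfolding p using that by (intro SUP_upper) auto
  then show ?thesis using ennreal_le_iff2 measure_nonneg by (metis linear order_trans)
 qed
 have qu: "- \<nu> C \<le> ?q" if "C \<in> sets M" "C \<subseteq> A" for C
 proof -
  have "ennreal (- \<nu> C) \<le> ennreal ?q" unfolding q using that by (intro SUP_upper) auto
  then show ?thesis using ennreal_le_iff2 measure_nonneg by (metis linear order_trans)
 qed
 have split: "\<nu> C + \<nu> (A - C) = \<nu> A" if "C \<in> sets M" "C \<subseteq> A" for C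
 proof -
  have "C \<union> (A - C) = A" using that by auto
  then show ?thesis using vector_measure_Un[OF vm, of C "A - C"] that A by auto
 qed
 have "pfun A \<le> ennreal (\<nu> A + ?q)"
 proof (rule SUP_least, rule ennreal_leI)
  fix C assume "C \<in> {B \<in> sets M. B \<subseteq> A}"
  then show "\<nu> C \<le> \<nu> A + ?q" using split[of C] qu[of "A - C"] A by auto
 qed
 then have "ennreal ?p \<le> ennreal (\<nu> A + ?q)" unfolding p .
 moreover have "\<nu> A + ?q \<ge> 0" using qu[OF A] by auto
 ultimately have 1: "?p \<le> \<nu> A + ?q" by simp
 have "N.pfun A \<le> ennreal (?p - \<nu> A)"
 proof (rule SUP_least, rule ennreal_leI)
  fix C assume "C \<in> {B \<in> sets M. B \<subseteq> A}"
  then show "- \<nu> C \<le> ?p - \<nu> A" using split[of C] pu[of "A - C"] A by auto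
 qed
 then have "ennreal ?q \<le> ennreal (?p - \<nu> A)" unfolding q .
 moreover have "?p - \<nu> A \<ge> 0" using pu[OF A] by auto
 ultimately have 2: "?q \<le> ?p - \<nu> A" by simp
 show ?thesis using 1 2 by linarith
qed

end

text \<open>Round the integrand to multiples of a small step.\<close>

lemma integral_linear_relation:
 fixes P :: "'i => 'a measure" and c :: "'i => real"
 assumes I: "finite I" and fin: "!!i. i \<in> I ==> finite_measure (P i)" and sets: "!!i. i \<in> I ==> sets (P i) = sets M"
  and rel: "!!A. A \<in> sets M ==> (\<Sum>i\<in>I. c i * measure (P i) A) = 0"
  and \<phi>: "\<phi> \<in> borel_measurable M" "!!x. \<bar>\<phi> x\<bar> \<le> (B::real)"
 shows "(\<Sum>i\<in>I. c i * (\<integral>x. \<phi> x \<partial>P i)) = 0"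
proof -
 note [measurable] = \<phi>(1)
 define T where "T = (\<Sum>i\<in>I. \<bar>c i\<bar> * measure (P i) (space M))"
 have T0: "T \<ge> 0" unfolding T_def by (intro sum_nonneg) auto
 have main: "\<bar>\<Sum>i\<in>I. c i * (\<integral>x. \<phi> x \<partial>P i)\<bar> \<le> e * T" if e: "e > 0" for e
 proof -
  \<comment> \<open>Bounds the range of the floor function, so that the rounded integrand takes
    finitely many values and the relation can be summed over its level sets.\<close>
  define N where "N = \<lceil>(\<bar>B\<bar> + 1) / e\<rceil>"
  define s where "s = (\<lambda>x. e * real_of_int \<lfloor>\<phi> x / e\<rfloor>)"
  define A where "A = (\<lambda>k. {x\<in>space M. \<lfloor>\<phi> x / e\<rfloor> = k})"
  have A: "A k \<in> sets M" for k unfolding A_def by measurable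
  have fl: "\<lfloor>\<phi> x / e\<rfloor> \<in> {-N - 1..N}" for x
  proof -
   have "\<bar>\<phi> x / e\<bar> \<le> (\<bar>B\<bar> + 1) / e" using \<phi>(2)[of x] e by (simp add: divide_right_mono)
   then have "\<bar>\<phi> x / e\<bar> \<le> N" unfolding N_def by (meson le_of_int_ceiling order_trans)
   from abs_le_D1[OF this] abs_le_D2[OF this] have "\<lfloor>\<phi> x / e\<rfloor> \<le> N" "- N - 1 \<le> \<lfloor>\<phi> x / e\<rfloor>" by linarith+
   then show ?thesis by simp
  qed
  have sd: "s x = (\<Sum>k\<in>{-N - 1..N}. (e * real_of_int k) * indicator (A k) x)" if "x \<in> space M" for x
  proof -
   have "(\<Sum>k\<in>{-N - 1..N}. (e * real_of_int k) * indicator (A k) x) = (\<Sum>k\<in>{-N - 1..N}. if k = \<lfloor>\<phi> x / e\<rfloor> then e * real_of_int k else 0)"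
    using that by (intro sum.cong) (auto simp: A_def indicator_def)
   also have "\<dots> = s x" using fl[of x] unfolding s_def by (subst sum.delta) auto
   finally show ?thesis by simp
  qed
  have close: "\<bar>\<phi> x - s x\<bar> \<le> e" for x
  proof -
   have "\<bar>\<phi> x / e - real_of_int \<lfloor>\<phi> x / e\<rfloor>\<bar> \<le> 1" by linarith
   then have "e * \<bar>\<phi> x / e - real_of_int \<lfloor>\<phi> x / e\<rfloor>\<bar> \<le> e * 1" using e by (intro mult_left_mono) auto
   moreover have "e * \<bar>\<phi> x / e - real_of_int \<lfloor>\<phi> x / e\<rfloor>\<bar> = \<bar>\<phi> x - s x\<bar>"
   proof -
    have "e * (\<phi> x / e - real_of_int \<lfloor>\<phi> x / e\<rfloor>) = \<phi> x - s x" using e by (simp add: s_def right_diff_distrib)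
    moreover have "\<bar>e * (\<phi> x / e - real_of_int \<lfloor>\<phi> x / e\<rfloor>)\<bar> = e * \<bar>\<phi> x / e - real_of_int \<lfloor>\<phi> x / e\<rfloor>\<bar>"
     using e by (simp add: abs_mult)
    ultimately show ?thesis by simp
   qed
   ultimately show ?thesis by simp
  qed
  have sm[measurable]: "s \<in> borel_measurable M" unfolding s_def by measurable
  have i1: "integrable (P i) \<phi>" "integrable (P i) s" if "i \<in> I" for i
  proof -
   interpret finite_measure "P i" by (rule fin[OF that])
   have m: "\<phi> \<in> borel_measurable (P i)" "s \<in> borel_measurable (P i)"
    by (simp_all add: measurable_cong_sets[OF sets[OF that] refl] \<phi>(1) sm)
   show "integrable (P i) \<phi>" using \<phi>(2) m by (intro integrable_const_bound[of _ B]) auto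
   have "\<bar>s x\<bar> \<le> \<bar>B\<bar> + e" for x using close[of x] \<phi>(2)[of x] by linarith
   then show "integrable (P i) s" using m by (intro integrable_const_bound[of _ "\<bar>B\<bar> + e"]) auto
  qed
  have si: "(\<integral>x. s x \<partial>P i) = (\<Sum>k\<in>{-N - 1..N}. (e * real_of_int k) * measure (P i) (A k))" if i: "i \<in> I" for i
  proof -
   interpret finite_measure "P i" by (rule fin[OF i])
   have sp: "space (P i) = space M" using sets_eq_imp_space_eq[OF sets[OF i]] .
   have "(\<integral>x. s x \<partial>P i) = (\<integral>x. (\<Sum>k\<in>{-N - 1..N}. (e * real_of_int k) * indicator (A k) x) \<partial>P i)"
    by (intro Bochner_Integration.integral_cong refl) (simp add: sd sp)
   also have "\<dots> = (\<Sum>k\<in>{-N - 1..N}. \<integral>x. (e * real_of_int k) * indicator (A k) x \<partial>P i)"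
    using A sets[OF i] by (intro Bochner_Integration.integral_sum integrable_mult_right integrable_real_indicator) (auto simp: emeasure_eq_measure)
   also have "\<dots> = (\<Sum>k\<in>{-N - 1..N}. (e * real_of_int k) * measure (P i) (A k))"
    using A sets[OF i] sets.sets_into_space[OF A] by (intro sum.cong refl) (simp add: sp Int_absorb2)
   finally show ?thesis .
  qed
  have "(\<Sum>i\<in>I. c i * (\<integral>x. s x \<partial>P i)) = (\<Sum>i\<in>I. \<Sum>k\<in>{-N - 1..N}. (e * real_of_int k) * (c i * measure (P i) (A k)))"
   by (intro sum.cong refl) (simp add: si sum_distrib_left mult_ac)
  also have "\<dots> = (\<Sum>k\<in>{-N - 1..N}. (e * real_of_int k) * (\<Sum>i\<in>I. c i * measure (P i) (A k)))"
   by (subst sum.swap) (simp add: sum_distrib_left)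
  also have "\<dots> = 0" by (simp add: rel[OF A])
  finally have z: "(\<Sum>i\<in>I. c i * (\<integral>x. s x \<partial>P i)) = 0" .
  have "(\<Sum>i\<in>I. c i * (\<integral>x. \<phi> x \<partial>P i)) = (\<Sum>i\<in>I. c i * (\<integral>x. \<phi> x - s x \<partial>P i))"
   using z i1 by (simp add: right_diff_distrib sum_subtractf)
  also have "\<bar>\<dots>\<bar> \<le> (\<Sum>i\<in>I. \<bar>c i\<bar> * (e * measure (P i) (space M)))"
  proof (rule order_trans[OF sum_abs sum_mono])
   fix i assume i: "i \<in> I"
   interpret finite_measure "P i" by (rule fin[OF i])
   have sp: "space (P i) = space M" using sets_eq_imp_space_eq[OF sets[OF i]] .
   have "\<bar>\<integral>x. \<phi> x - s x \<partial>P i\<bar> \<le> (\<integral>x. \<bar>\<phi> x - s x\<bar> \<partial>P i)" by (rule integral_abs_bound)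
   also have "\<dots> \<le> (\<integral>x. e \<partial>P i)" using i1[OF i] close by (intro integral_mono) auto
   also have "\<dots> = e * measure (P i) (space M)" by (simp add: sp)
   finally show "\<bar>c i * (\<integral>x. \<phi> x - s x \<partial>P i)\<bar> \<le> \<bar>c i\<bar> * (e * measure (P i) (space M))"
    by (simp add: abs_mult mult_left_mono)
  qed
  also have "\<dots> = e * T" by (simp add: T_def sum_distrib_left mult_ac)
  finally show ?thesis .
 qed
 have "\<bar>\<Sum>i\<in>I. c i * (\<integral>x. \<phi> x \<partial>P i)\<bar> \<le> 0 + e" if e: "e > 0" for e
 proof -
  have "e / (T + 1) * T \<le> e" using e T0 by (simp add: field_simps)
  moreover have "e / (T + 1) > 0" using e T0 by simp
  ultimately show ?thesis using main[of "e / (T + 1)"] by linarith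
 qed
 then have "\<bar>\<Sum>i\<in>I. c i * (\<integral>x. \<phi> x \<partial>P i)\<bar> \<le> 0" by (rule field_le_epsilon)
 then show ?thesis by simp
qed

lemma total_variation_ge:
 assumes "vector_measure M \<mu>" "A \<in> sets M" "C \<in> sets M" "C \<subseteq> A"
 shows "ennreal (norm (\<mu> C)) \<le> total_variation M \<mu> A"
proof -
 have "ennreal (norm (\<mu> C)) \<le> (suminf (\<lambda>i. ennreal (norm (\<mu> (binaryset C (A - C) i)))))"
 proof -
  have "(\<Sum>i<1. ennreal (norm (\<mu> (binaryset C (A - C) i)))) \<le> (suminf (\<lambda>i. ennreal (norm (\<mu> (binaryset C (A - C) i)))))"
   by (rule sum_le_suminf) auto
  then show ?thesis by (simp add: binaryset_def)
 qed
 also have "\<dots> \<le> total_variation M \<mu> A"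
  unfolding total_variation_def
 proof (rule SUP_upper, intro CollectI conjI)
  show "range (binaryset C (A - C)) \<subseteq> sets M" using assms by (simp add: range_binaryset_eq)
  show "disjoint_family (binaryset C (A - C))" by (auto simp: disjoint_family_on_def binaryset_def)
  show "(\<Union>i. binaryset C (A - C) i) = A" using assms(4) by (auto simp: UN_binaryset_eq)
 qed
 finally show ?thesis .
qed

lemma vector_measure_component:
 fixes \<mu> :: "'a set => real^'n^'n"
 assumes "vector_measure M \<mu>" shows "vector_measure M (\<lambda>A. \<mu> A $ i $ j)"
proof -
 have bl: "bounded_linear (\<lambda>v::real^'n^'n. v $ i $ j)"
  using bounded_linear_compose[OF bounded_linear_vec_nth bounded_linear_vec_nth] .
 show ?thesis
  using assms unfolding vector_measure_def by (auto intro: bounded_linear.sums[OF bl])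
qed

lemma component_bounded_signed_measure:
 fixes \<mu> :: "'a set => real^'n^'n"
 assumes v: "vector_measure M \<mu>" and f: "total_variation M \<mu> (space M) < \<infinity>"
 shows "bounded_signed_measure M (\<lambda>A. \<mu> A $ i $ j) (enn2real (total_variation M \<mu> (space M)))"
proof
 show "vector_measure M (\<lambda>A. \<mu> A $ i $ j)" by (rule vector_measure_component[OF v])
 fix A assume A: "A \<in> sets M"
 have "ennreal (norm (\<mu> A)) \<le> total_variation M \<mu> (space M)"
  using A sets.sets_into_space by (intro total_variation_ge v) auto
 then have "norm (\<mu> A) \<le> enn2real (total_variation M \<mu> (space M))"
  using f by (metis enn2real_ennreal enn2real_mono infinity_ennreal_def norm_ge_zero)
 moreover have "\<bar>\<mu> A $ i $ j\<bar> \<le> norm (\<mu> A)"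
  by (rule order_trans[OF component_le_norm_cart Finite_Cartesian_Product.norm_nth_le])
 ultimately show "\<bar>\<mu> A $ i $ j\<bar> \<le> enn2real (total_variation M \<mu> (space M))" by linarith
qed

section \<open>Borel representatives and integration against signed measures\<close>

lemma integral_lebesgue_on:
 fixes h :: "'a::euclidean_space => 'b::euclidean_space"
 assumes "\<Omega> \<in> sets lebesgue"
 shows "(LINT x|lebesgue_on \<Omega>. h x) = (\<integral>x. indicator \<Omega> x *\<^sub>R h x \<partial>lebesgue)"
 using assms by (simp add: integral_restrict_space)

text \<open>Functions in \<open>BV\<close> are measurable only for the completed measure on
  \<open>\<Omega>\<close>, while mollification and Fubini work with Borel functions on the whole
  space. Such a \<open>u\<close> is a Borel version of \<open>g\<close> extended by 0.\<close>

definition represents :: "(real^'n) set => (real^'n => 'b::euclidean_space) => (real^'n => 'b) => bool" where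
 "represents \<Omega> g u \<longleftrightarrow> integrable lborel u \<and> (\<forall>x. x \<notin> \<Omega> --> u x = 0) \<and> negligible {x\<in>\<Omega>. u x ~= g x}"

lemma represents_exists:
 fixes g :: "real^'n => 'b::euclidean_space"
 assumes \<Omega>: "\<Omega> \<in> sets borel" and g: "integrable (lebesgue_on \<Omega>) g"
 obtains u where "represents \<Omega> g u"
proof -
 have \<Omega>l: "\<Omega> \<in> sets lebesgue" using \<Omega> by simp
 let ?g = "\<lambda>x. indicator \<Omega> x *\<^sub>R g x"
 have gi: "integrable lebesgue ?g" using g \<Omega>l by (simp add: integrable_restrict_space)
 have "\<exists>h. h \<in> borel_measurable lborel \<and> (AE x in lborel. ?g x \<bullet> b = h x)" for b
 proof -
  have "(\<lambda>x. ?g x \<bullet> b) \<in> borel_measurable (completion lborel)" using gi by (intro borel_measurable_inner) auto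
  from completion_ex_borel_measurable_real[OF this] show ?thesis by blast
 qed
 then obtain h where h: "!!b. h b \<in> borel_measurable lborel" "!!b. AE x in lborel. ?g x \<bullet> b = h b x" by metis
 define u where "u = (\<lambda>x. indicator \<Omega> x *\<^sub>R (\<Sum>b\<in>Basis. h b x *\<^sub>R b))"
 have um: "u \<in> borel_measurable lborel"
  unfolding u_def using \<Omega> h(1) by (intro borel_measurable_scaleR borel_measurable_indicator borel_measurable_sum) auto
 have "AE x in lborel. \<forall>b\<in>Basis. ?g x \<bullet> b = h b x"
  by (rule AE_finite_allI[OF finite_Basis]) (rule h(2))
 then have AE: "AE x in lborel. u x = ?g x"
 proof (rule AE_mp, intro AE_I2 impI)
  fix x assume *: "\<forall>b\<in>Basis. ?g x \<bullet> b = h b x"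
  have "(\<Sum>b\<in>Basis. h b x *\<^sub>R b) = (\<Sum>b\<in>Basis. (?g x \<bullet> b) *\<^sub>R b)" using * by (intro sum.cong) auto
  then show "u x = ?g x" by (simp add: u_def euclidean_representation indicator_def)
 qed
 have "integrable lebesgue u"
  using AE gi um by (subst integrable_cong_AE[of u lebesgue ?g]) (auto intro: measurable_completion AE_completion)
 then have ui: "integrable lborel u" using um by (simp add: integrable_completion)
 have "AE x in lebesgue. \<not> (x \<in> \<Omega> \<and> u x ~= g x)"
  using AE_completion[OF AE] by (rule AE_mp) (auto simp: indicator_def)
 then have "negligible {x. x \<in> \<Omega> \<and> u x ~= g x}"
  unfolding negligible_iff_null_sets using AE_iff_null_sets[of "{x. x \<in> \<Omega> \<and> u x ~= g x}" lebesgue]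
  by (subst (asm) eventually_ae_filter) (auto intro: completion.complete2)
 then have "represents \<Omega> g u" unfolding represents_def using ui by (auto simp: u_def)
 then show ?thesis using that by blast
qed

text \<open>Nothing is changed on a null set here: the representative agrees with \<open>g\<close>
  at every point of \<open>\<Omega>\<close>, so estimates at its Lebesgue points are estimates for
  \<open>g\<close> itself.\<close>

lemma represents_continuous:
 fixes g :: "real^'n => 'b::euclidean_space"
 assumes \<Omega>: "open \<Omega>" and g: "integrable (lebesgue_on \<Omega>) g" and c: "continuous_on \<Omega> g"
 shows "represents \<Omega> g (\<lambda>x. indicator \<Omega> x *\<^sub>R g x)"
proof -
 have m: "(\<lambda>x. indicator \<Omega> x *\<^sub>R g x) \<in> borel_measurable borel"
  using \<Omega> c by (intro borel_measurable_continuous_on_indicator) auto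
 have "integrable lebesgue (\<lambda>x. indicator \<Omega> x *\<^sub>R g x)" using g \<Omega> by (simp add: integrable_restrict_space)
 then have "integrable lborel (\<lambda>x. indicator \<Omega> x *\<^sub>R g x)" using m by (simp add: integrable_completion)
 moreover have "{x\<in>\<Omega>. indicator \<Omega> x *\<^sub>R g x ~= g x} = {}" by auto
 ultimately show ?thesis unfolding represents_def by (simp only: negligible_empty) auto
qed

lemma borel_measurable_complete_AE:
 assumes M: "complete_measure M" and f: "f \<in> borel_measurable M" and ae: "AE x in M. f x = g x"
 shows "g \<in> borel_measurable M"
proof (rule measurableI)
 interpret complete_measure M by fact
 fix A :: "'b set" assume A: "A \<in> sets borel"
 show "g -` A \<inter> space M \<in> sets M"
 proof (rule in_sets_AE)
  show "AE x in M. x \<in> f -` A \<inter> space M \<longleftrightarrow> x \<in> g -` A \<inter> space M"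
   using ae by (rule AE_mp) (auto intro!: AE_I2)
  show "f -` A \<inter> space M \<in> sets M" by (rule measurable_sets[OF f A])
 qed simp
qed simp

lemma integral_indicator_sets:
 "A \<in> sets P ==> (\<integral>x. indicator A x \<partial>P) = measure P A"
 using sets.sets_into_space[of A P] by (simp add: Int_absorb2)

text \<open>The comparison passes through the completed measure, where almost everywhere equality
  with a Borel function already makes the other integrand measurable.\<close>

lemma represents_integral:
 fixes g :: "real^'n => real^'n" and k :: "real^'n => real"
 assumes \<Omega>: "\<Omega> \<in> sets borel" and r: "represents \<Omega> g u" and k: "k \<in> borel_measurable borel"
 shows "(LINT x|lebesgue_on \<Omega>. g x $ i * k x) = (\<integral>x. u x $ i * k x \<partial>lborel)"
proof -
 have N: "negligible {x\<in>\<Omega>. u x ~= g x}" and z: "!!x. x \<notin> \<Omega> ==> u x = 0" using r by (auto simp: represents_def)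
 have "integrable lborel (\<lambda>x. u x $ i)"
  using r integrable_bounded_linear[OF bounded_linear_vec_nth] unfolding represents_def by blast
 then have ui: "(\<lambda>x. u x $ i) \<in> borel_measurable borel" by simp
 have m: "(\<lambda>x. u x $ i * k x) \<in> borel_measurable borel" by (intro borel_measurable_times ui k)
 have AE: "AE x in lebesgue. u x $ i * k x = indicator \<Omega> x *\<^sub>R (g x $ i * k x)"
 proof (rule AE_I')
  show "{x\<in>\<Omega>. u x ~= g x} \<in> null_sets lebesgue" using N by (simp add: negligible_iff_null_sets)
  show "{x \<in> space lebesgue. u x $ i * k x ~= indicator \<Omega> x *\<^sub>R (g x $ i * k x)} \<subseteq> {x\<in>\<Omega>. u x ~= g x}"
   using z by (auto simp: indicator_def split: if_splits)
 qed
 have m': "(\<lambda>x. u x $ i * k x) \<in> borel_measurable lebesgue" using m by (simp add: measurable_completion)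
 have "(\<integral>x. u x $ i * k x \<partial>lborel) = (\<integral>x. u x $ i * k x \<partial>lebesgue)"
  using m by (simp add: integral_completion)
 also have "\<dots> = (\<integral>x. indicator \<Omega> x *\<^sub>R (g x $ i * k x) \<partial>lebesgue)"
  by (rule integral_cong_AE[OF m' borel_measurable_complete_AE[OF completion.complete_measure_axioms m' AE] AE])
 finally show ?thesis using \<Omega> by (simp add: integral_lebesgue_on)
qed

context
 fixes \<Omega> :: "(real^'n) set"
 assumes \<Omega>: "open \<Omega>"
begin

abbreviation (input) MM where "MM \<equiv> borel_on \<Omega>"

lemma sets_MM: "A \<in> sets (borel_on \<Omega>) \<longleftrightarrow> A \<subseteq> \<Omega> \<and> A \<in> sets borel"
 using \<Omega> by (auto simp: sets_restrict_space_iff)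

lemma space_MM: "space (borel_on \<Omega>) = \<Omega>" by (simp add: space_restrict_space)

lemma signed_integral_bound:
 assumes \<nu>: "bounded_signed_measure (borel_on \<Omega>) \<nu> B"
  and \<phi>: "\<phi> \<in> borel_measurable borel" "!!x. \<bar>\<phi> x\<bar> \<le> C" "!!x. x \<notin> U ==> \<phi> x = 0"
  and U: "U \<in> sets (borel_on \<Omega>)"
 shows "\<bar>signed_integral (borel_on \<Omega>) \<nu> \<phi>\<bar> \<le>
   C * (measure (positive_variation (borel_on \<Omega>) \<nu>) U + measure (positive_variation (borel_on \<Omega>) (\<lambda>A. - \<nu> A)) U)"
proof -
 interpret bounded_signed_measure MM \<nu> B by fact
 interpret N: bounded_signed_measure MM "\<lambda>A. - \<nu> A" B by (rule uminus_bounded_signed_measure)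
 have C: "C \<ge> 0" using \<phi>(2)[of undefined] by linarith
 have one: "\<bar>\<integral>x. \<phi> x \<partial>P\<bar> \<le> C * measure P U" if P: "finite_measure P" "sets P = sets MM" for P
 proof -
  interpret finite_measure P by (rule P(1))
  have m: "\<phi> \<in> borel_measurable P" using \<phi>(1) by (simp add: measurable_cong_sets[OF P(2) refl] measurable_restrict_space1)
  have i: "integrable P \<phi>" using \<phi>(2) m by (intro integrable_const_bound[of _ C]) auto
  have iU: "integrable P (\<lambda>x. C * indicator U x)"
   using U P(2) by (intro integrable_mult_right integrable_real_indicator) (auto simp: emeasure_eq_measure)
  have "\<bar>\<integral>x. \<phi> x \<partial>P\<bar> \<le> (\<integral>x. \<bar>\<phi> x\<bar> \<partial>P)" by (rule integral_abs_bound)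
  also have "\<dots> \<le> (\<integral>x. C * indicator U x \<partial>P)"
   using i iU \<phi>(2,3) C by (intro integral_mono) (auto simp: indicator_def)
  also have "\<dots> = C * measure P U"
   using U P(2) sets.sets_into_space[of U P] by (simp add: Int_absorb2)
  finally show ?thesis .
 qed
 show ?thesis
  using one[OF finite_positive_variation sets_positive_variation] one[OF N.finite_positive_variation N.sets_positive_variation]
  unfolding signed_integral_def by (simp add: distrib_left)
qed

text \<open>Inner and outer regularity produce an almost optimal continuous test function.\<close>

lemma positive_variation_dual:
 assumes \<nu>: "bounded_signed_measure (borel_on \<Omega>) \<nu> B"
  and U: "open U" "U \<subseteq> \<Omega>" and C0: "C \<ge> 0"
  and dual: "!!\<phi>. continuous_on UNIV \<phi> ==> compact_support_in U \<phi> ==> (\<forall>x. \<bar>\<phi> x\<bar> \<le> 1) ==>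
    \<bar>signed_integral (borel_on \<Omega>) \<nu> \<phi>\<bar> \<le> C"
 shows "measure (positive_variation (borel_on \<Omega>) \<nu>) U \<le> C"
proof -
 interpret bounded_signed_measure MM \<nu> B by fact
 interpret N: bounded_signed_measure MM "\<lambda>A. - \<nu> A" B by (rule uminus_bounded_signed_measure)
 let ?p = "positive_variation MM \<nu>" and ?n = "positive_variation MM (\<lambda>A. - \<nu> A)"
 interpret p: finite_measure ?p by (rule finite_positive_variation)
 interpret n: finite_measure ?n by (rule N.finite_positive_variation)
 have Um: "U \<in> sets MM" using U by (simp add: sets_MM)
 have meas: "(\<lambda>x. x) \<in> measurable P borel" if "sets P = sets MM" for P :: "(real^'n) measure"
  unfolding measurable_cong_sets[OF that refl] by (intro measurable_restrict_space1) simp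
 \<comment> \<open>The regularity theorems concern measures on all Borel sets, so the two variations
   on \<open>\<Omega>\<close> are pushed forward to the whole space.\<close>
 define p' where "p' = distr ?p borel (\<lambda>x. x)"
 define n' where "n' = distr ?n borel (\<lambda>x. x)"
 interpret p': finite_measure p' unfolding p'_def by (rule p.finite_measure_distr[OF meas[OF sets_positive_variation]])
 interpret n': finite_measure n' unfolding n'_def by (rule n.finite_measure_distr[OF meas[OF N.sets_positive_variation]])
 have sp': "sets p' = sets borel" "sets n' = sets borel" by (simp_all add: p'_def n'_def)
 have pm: "measure p' A = measure ?p A" "measure n' A = measure ?n A" if "A \<in> sets MM" for A
 proof -
  have A: "A \<in> sets borel" "A \<subseteq> \<Omega>" using that by (auto simp: sets_MM)
  show "measure p' A = measure ?p A" unfolding p'_def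
   using A by (subst measure_distr[OF meas[OF sets_positive_variation]]) (auto simp: space_positive_variation space_MM Int_absorb2)
  show "measure n' A = measure ?n A" unfolding n'_def
   using A by (subst measure_distr[OF meas[OF N.sets_positive_variation]]) (auto simp: N.space_positive_variation space_MM Int_absorb2)
 qed
 \<comment> \<open>The supremum defining the positive variation runs over such sets
   \<open>D\<close>. Inner regularity at \<open>D\<close> and outer regularity at the compact set
   inside it each cost an error \<open>e\<close>; the factor 5 leaves room.\<close>
 have key: "\<nu> D \<le> C + 5 * e" if D: "D \<in> sets MM" "D \<subseteq> U" and e: "e > 0" for D e
 proof -
  have Db: "D \<in> sets borel" using D by (simp add: sets_MM)
  have inner: "\<exists>K. K \<subseteq> D \<and> compact K \<and> measure q D - e < measure q K" if q: "finite_measure q" "sets q = sets borel" for q :: "(real^'n) measure"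
  proof (rule ccontr)
   interpret finite_measure q by (rule q(1))
   assume "\<not> ?thesis"
   then have le: "measure q K \<le> measure q D - e" if "K \<subseteq> D" "compact K" for K using that by (meson not_less)
   have "emeasure q D = (SUP K\<in>{K. K \<subseteq> D \<and> compact K}. emeasure q K)"
    using inner_regular[OF q(2) _ Db] emeasure_finite by simp
   also have "\<dots> \<le> ennreal (measure q D - e)"
    using le by (intro SUP_least) (auto simp: emeasure_eq_measure ennreal_leI)
   finally have "ennreal (measure q D) \<le> ennreal (measure q D - e)" by (simp add: emeasure_eq_measure)
   moreover have "measure q D - e \<ge> 0" using le[of "{}"] by simp
   ultimately show False using e by simp
  qed
  obtain Kp where Kp: "Kp \<subseteq> D" "compact Kp" "measure p' D - e < measure p' Kp"
   using inner[OF p'.finite_measure_axioms sp'(1)] by blast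
  obtain Kn where Kn: "Kn \<subseteq> D" "compact Kn" "measure n' D - e < measure n' Kn"
   using inner[OF n'.finite_measure_axioms sp'(2)] by blast
  define K where "K = Kp \<union> Kn"
  have K: "K \<subseteq> D" "compact K" using Kp Kn by (auto simp: K_def)
  have Kb: "K \<in> sets borel" using K(2) by (simp add: borel_compact)
  have KM: "K \<in> sets MM" using K(1) D(1) Kb by (auto simp: sets_MM)
  have Kpm: "measure p' D - e < measure p' K"
   using Kp(3) p'.finite_measure_mono[of Kp K] Kb by (simp add: K_def sp')
  have Knm: "measure n' K \<le> measure n' D"
   using K(1) Db by (intro n'.finite_measure_mono) (auto simp: sp')
  have \<nu>D: "\<nu> D = measure p' D - measure n' D" using jordan_decomposition[OF D(1)] pm[OF D(1)] by simp
  show ?thesis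
  proof (cases "K = {}")
   case True
   then have "measure p' D < e" using Kpm by simp
   then show ?thesis using \<nu>D C0 e measure_nonneg[of n' D] by linarith
  next
   case False
   have outer: "\<exists>V. K \<subseteq> V \<and> open V \<and> measure n' V < measure n' K + e"
   proof -
    have eq: "emeasure n' K = (INF V\<in>{V. K \<subseteq> V \<and> open V}. emeasure n' V)"
     using outer_regular[OF sp'(2) _ Kb] n'.emeasure_finite by simp
    have "(INF V\<in>{V. K \<subseteq> V \<and> open V}. emeasure n' V) < ennreal (measure n' K + e)"
     unfolding eq[symmetric] unfolding n'.emeasure_eq_measure using e by (simp add: ennreal_less_iff)
    then obtain V where "K \<subseteq> V" "open V" "emeasure n' V < ennreal (measure n' K + e)"
     by (auto simp: INF_less_iff)
    then show ?thesis by (auto simp: n'.emeasure_eq_measure ennreal_less_iff)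
   qed
   then obtain V where V: "K \<subseteq> V" "open V" "measure n' V < measure n' K + e" by blast
   have "K \<subseteq> V \<inter> U" "open (V \<inter> U)" using V K D U by auto
   then obtain d where d: "d > 0" "(\<Union>x\<in>K. ball x d) \<subseteq> V \<inter> U"
    using compact_subset_open_imp_ball_epsilon_subset[OF K(2)] by metis
   \<comment> \<open>A tent function that is 1 on \<open>K\<close> and supported within distance d/2
     of it, inside \<open>V \<inter> U\<close>, where the negative variation hardly exceeds that of
     \<open>K\<close>.\<close>
   define \<phi> where "\<phi> = (\<lambda>x. max 0 (1 - infdist x K / (d / 2)))"
   have \<phi>c: "continuous_on UNIV \<phi>" unfolding \<phi>_def by (intro continuous_intros) (use d in auto)
   have \<phi>1: "\<phi> x = 1" if "x \<in> K" for x using that by (simp add: \<phi>_def)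
   have \<phi>01: "0 \<le> \<phi> x" "\<phi> x \<le> 1" for x using d infdist_nonneg[of x K] by (auto simp: \<phi>_def)
   have abs1: "\<bar>\<phi> x\<bar> \<le> 1" for x using \<phi>01[of x] by simp
   let ?W = "{x. infdist x K \<le> d / 2}"
   have \<phi>0: "\<phi> x = 0" if "x \<notin> ?W" for x using that d by (simp add: \<phi>_def field_simps)
   have Wc: "compact ?W" by (rule compact_infdist_le[OF False K(2)]) (use d in simp)
   have Wsub: "?W \<subseteq> V \<inter> U"
   proof
    fix x assume "x \<in> ?W"
    then have "infdist x K < d" using d by simp
    obtain y where "y \<in> K" "infdist x K = dist x y"
     using infdist_attains_inf[OF compact_imp_closed[OF K(2)] False] by blast
    then have "x \<in> (\<Union>x\<in>K. ball x d)" using \<open>infdist x K < d\<close> by (auto simp: dist_commute)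
    then show "x \<in> V \<inter> U" using d(2) by blast
   qed
   have cl: "closure {x. \<phi> x ~= 0} \<subseteq> ?W" using \<phi>0 Wc by (intro closure_minimal) (auto simp: compact_imp_closed)
   have supp: "compact_support_in U \<phi>"
    unfolding compact_support_in_def
   proof
    show "compact (closure {x. \<phi> x ~= 0})"
     using bounded_subset[OF compact_imp_bounded[OF Wc] cl] by (simp add: compact_eq_bounded_closed)
    show "closure {x. \<phi> x ~= 0} \<subseteq> U" using cl Wsub by blast
   qed
   have "\<bar>signed_integral MM \<nu> \<phi>\<bar> \<le> C" using dual[OF \<phi>c supp] abs1 by blast
   then have 1: "(\<integral>x. \<phi> x \<partial>?p) - (\<integral>x. \<phi> x \<partial>?n) \<le> C" unfolding signed_integral_def by linarith
   have \<phi>m: "\<phi> \<in> borel_measurable P" if "sets P = sets MM" for P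
    using borel_measurable_continuous_onI[OF \<phi>c] by (simp add: measurable_cong_sets[OF that refl] measurable_restrict_space1)
   have ip: "integrable ?p \<phi>" using \<phi>01 \<phi>m[OF sets_positive_variation] by (intro p.integrable_const_bound[of _ 1]) auto
   have inn: "integrable ?n \<phi>" using \<phi>01 \<phi>m[OF N.sets_positive_variation] by (intro n.integrable_const_bound[of _ 1]) auto
   have 2: "measure ?p K \<le> (\<integral>x. \<phi> x \<partial>?p)"
   proof -
    have KP: "K \<in> sets ?p" using KM by (simp add: sets_positive_variation)
    have iK: "integrable ?p (\<lambda>x. indicator K x :: real)"
     by (rule integrable_real_indicator[OF KP]) (simp add: p.emeasure_eq_measure)
    have "(\<integral>x. indicator K x \<partial>?p) \<le> (\<integral>x. \<phi> x \<partial>?p)"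
    proof (rule integral_mono[OF iK ip])
     fix x show "indicator K x \<le> \<phi> x" by (cases "x \<in> K") (simp_all add: \<phi>1 \<phi>01)
    qed
    then show ?thesis by (simp only: integral_indicator_sets[OF KP])
   qed
   have VU: "V \<inter> U \<in> sets MM" using U V by (auto simp: sets_MM)
   have 3: "(\<integral>x. \<phi> x \<partial>?n) \<le> measure ?n (V \<inter> U)"
   proof -
    have KP: "V \<inter> U \<in> sets ?n" using VU by (simp only: N.sets_positive_variation)
    have iK: "integrable ?n (\<lambda>x. indicator (V \<inter> U) x :: real)"
     by (rule integrable_real_indicator[OF KP]) (simp add: n.emeasure_eq_measure)
    have "(\<integral>x. \<phi> x \<partial>?n) \<le> (\<integral>x. indicator (V \<inter> U) x \<partial>?n)"
    proof (rule integral_mono[OF inn iK])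
     fix x show "\<phi> x \<le> indicator (V \<inter> U) x"
     proof (cases "x \<in> V \<inter> U")
      case False
      then have "x \<notin> ?W" using Wsub by blast
      then show ?thesis using \<phi>0 by simp
     qed (use \<phi>01 in simp)
    qed
    then show ?thesis by (simp only: integral_indicator_sets[OF KP])
   qed
   have "measure n' (V \<inter> U) \<le> measure n' V" using V(2) by (intro n'.finite_measure_mono) (auto simp: sp')
   then have "measure ?n (V \<inter> U) \<le> measure n' K + e" using V(3) pm(2)[OF VU] by simp
   then show ?thesis
    using 1 2 3 pm(1)[OF KM] Kpm Knm \<nu>D e by linarith
  qed
 qed
 have "\<nu> D \<le> C" if "D \<in> sets MM" "D \<subseteq> U" for D
 proof (rule field_le_epsilon)
  fix e :: real assume "e > 0"
  then show "\<nu> D \<le> C + e" using key[OF that, of "e / 5"] by simp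
 qed
 then have "emeasure ?p U \<le> ennreal C"
  unfolding emeasure_positive_variation[OF Um] by (intro SUP_least ennreal_leI) auto
 then show ?thesis using C0 by (simp add: p.emeasure_eq_measure)
qed

end

section \<open>Uniform mass bounds for weakly-* convergent sequences\<close>

lemma banach_steinhaus_real:
 fixes T :: "nat => 'a::{real_normed_vector, complete_space} => real"
 assumes bl: "!!k. bounded_linear (T k)" and pw: "!!x. \<exists>b. \<forall>k. \<bar>T k x\<bar> \<le> b"
 obtains C where "C \<ge> 0" "!!k x. \<bar>T k x\<bar> \<le> C * norm x"
proof -
 define F where "F = (\<lambda>m::nat. {x. \<forall>k. \<bar>T k x\<bar> \<le> real m})"
 have Fcl: "closed (F m)" for m
 proof -
  have "F m = (\<Inter>k. {x. \<bar>T k x\<bar> \<le> real m})" by (auto simp: F_def)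
  moreover have "closed {x. \<bar>T k x\<bar> \<le> real m}" for k
   by (intro closed_Collect_le continuous_intros linear_continuous_on bl)
  ultimately show ?thesis by auto
 qed
 have FU: "(\<Union>m. F m) = UNIV"
 proof -
  have "\<exists>m. x \<in> F m" for x
  proof -
   obtain b where b: "!!k. \<bar>T k x\<bar> \<le> b" using pw by blast
   obtain m :: nat where "b \<le> m" using real_arch_simple by blast
   have "\<bar>T k x\<bar> \<le> real m" for k using b[of k] \<open>b \<le> m\<close> by linarith
   then show ?thesis by (auto simp: F_def)
  qed
  then show ?thesis by auto
 qed
 \<comment> \<open>By Baire, one of the closed sets of uniform boundedness contains a ball;
   linearity then spreads the bound to the whole space.\<close>
 have "\<exists>m. interior (F m) ~= {}"
 proof (rule ccontr)
  assume "\<not> ?thesis"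
  then have "euclidean interior_of (\<Union>(range F)) = {}"
   using completely_metrizable_space_euclidean Fcl
   by (intro Baire_category_alt) auto
  then show False using FU by simp
 qed
 then obtain m x0 where "x0 \<in> interior (F m)" by blast
 then obtain r where r: "r > 0" "ball x0 r \<subseteq> F m" using mem_interior by blast
 show ?thesis
 proof (rule that[of "4 * real m / r"])
  show "4 * real m / r \<ge> 0" using r by simp
  fix k x
  interpret bounded_linear "T k" by (rule bl)
  show "\<bar>T k x\<bar> \<le> 4 * real m / r * norm x"
  proof (cases "x = 0")
   case False
   \<comment> \<open>A step of half the radius \<open>r\<close> in the direction of
     \<open>x\<close>: the difference of two values bounded by \<open>m\<close> gives |c T(x)| at
     most 2m, whence the constant 4m/r.\<close>
   define c where "c = r / (2 * norm x)"
   have c: "c > 0" using False r by (simp add: c_def)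
   have "x0 + c *\<^sub>R x \<in> ball x0 r" using False r by (simp add: dist_norm c_def)
   then have 1: "\<bar>T k (x0 + c *\<^sub>R x)\<bar> \<le> m" using r(2) by (auto simp: F_def)
   have 2: "\<bar>T k x0\<bar> \<le> m" using r by (auto simp: F_def subset_eq)
   have "c * T k x = T k (x0 + c *\<^sub>R x) - T k x0" by (simp add: add scaleR)
   then have "c * \<bar>T k x\<bar> \<le> 2 * m" using 1 2 c by (simp add: abs_mult[symmetric] abs_le_iff flip: abs_of_pos) linarith
   then have "\<bar>T k x\<bar> \<le> 2 * m / c" using c by (simp add: field_simps)
   also have "\<dots> = 4 * real m / r * norm x" using False r by (simp add: c_def)
   finally show ?thesis .
  qed (simp add: zero)
 qed
qed

text \<open>Summing the variations of the entries gives a quantity comparable with the total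
  variation of the matrix measure on \<open>U\<close>, in which every summand is a finite measure
  coming from a scalar Jordan decomposition.\<close>

definition BV_mass :: "(real^'n) set => (real^'n => real^'n) => (real^'n) set => real" where
 "BV_mass \<Omega> g U = (\<Sum>i\<in>UNIV. \<Sum>j\<in>UNIV.
   measure (positive_variation (borel_on \<Omega>) (\<lambda>A. BV_derivative \<Omega> g A $ i $ j)) U +
   measure (positive_variation (borel_on \<Omega>) (\<lambda>A. - BV_derivative \<Omega> g A $ i $ j)) U)"

lemma BV_derivative_is_measure_derivative: "g \<in> BV \<Omega> ==> is_measure_derivative \<Omega> g (BV_derivative \<Omega> g)"
 unfolding BV_def BV_derivative_def by (metis (mono_tags, lifting) mem_Collect_eq someI_ex)

lemma BV_derivative_bounded:
 assumes "g \<in> BV \<Omega>"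
 shows "bounded_signed_measure (borel_on \<Omega>) (\<lambda>A. BV_derivative \<Omega> g A $ i $ j)
   (enn2real (total_variation (borel_on \<Omega>) (BV_derivative \<Omega> g) \<Omega>))"
 using BV_derivative_is_measure_derivative[OF assms]
  component_bounded_signed_measure[of "borel_on \<Omega>" "BV_derivative \<Omega> g" i j]
 by (simp add: is_measure_derivative_def space_restrict_space)

lemma BV_mass_test_bound:
 assumes \<Omega>: "open \<Omega>" and g: "g \<in> BV \<Omega>" and U: "open U" "U \<subseteq> \<Omega>"
  and \<phi>: "smooth_test_function U \<phi>" "\<forall>x. \<bar>\<phi> x\<bar> \<le> 1"
 shows "\<bar>LINT x|lebesgue_on \<Omega>. g x $ i * partial_deriv j \<phi> x\<bar> \<le> BV_mass \<Omega> g U"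
proof -
 have t: "smooth_test_function \<Omega> \<phi>"
  using \<phi>(1) U(2) unfolding smooth_test_function_def compact_support_in_def by blast
 have eq: "(LINT x|lebesgue_on \<Omega>. g x $ i * partial_deriv j \<phi> x) =
    - signed_integral (borel_on \<Omega>) (\<lambda>A. BV_derivative \<Omega> g A $ i $ j) \<phi>"
  using BV_derivative_is_measure_derivative[OF g] t unfolding is_measure_derivative_def by blast
 have "continuous_on UNIV \<phi>" using \<phi>(1) C_k.simps(1)[of \<phi>] unfolding smooth_test_function_def by blast
 then have m: "\<phi> \<in> borel_measurable borel" by (rule borel_measurable_continuous_onI)
 have z: "\<phi> x = 0" if "x \<notin> U" for x
  using \<phi>(1) that closure_subset[of "{x. \<phi> x ~= 0}"] unfolding smooth_test_function_def compact_support_in_def by blast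
 let ?t = "\<lambda>i j. measure (positive_variation (borel_on \<Omega>) (\<lambda>A. BV_derivative \<Omega> g A $ i $ j)) U +
   measure (positive_variation (borel_on \<Omega>) (\<lambda>A. - BV_derivative \<Omega> g A $ i $ j)) U"
 have "\<bar>signed_integral (borel_on \<Omega>) (\<lambda>A. BV_derivative \<Omega> g A $ i $ j) \<phi>\<bar> \<le> 1 * ?t i j"
  using signed_integral_bound[OF \<Omega> BV_derivative_bounded[OF g] m _ z, of 1] \<phi>(2) U by (simp add: sets_MM[OF \<Omega>])
 also have "\<dots> \<le> (\<Sum>j\<in>UNIV. ?t i j)" by (simp add: member_le_sum[of j UNIV "?t i"])
 also have "\<dots> \<le> BV_mass \<Omega> g U"
  unfolding BV_mass_def by (rule member_le_sum[of i UNIV "\<lambda>i. \<Sum>j\<in>UNIV. ?t i j"]) (auto intro!: sum_nonneg)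
 finally show ?thesis unfolding eq by simp
qed

lemma BV_mass_nonneg: "BV_mass \<Omega> g U \<ge> 0"
 unfolding BV_mass_def by (intro sum_nonneg add_nonneg_nonneg measure_nonneg)

lemma BV_mass_superadditive:
 assumes \<Omega>: "open \<Omega>" and g: "g \<in> BV \<Omega>" and F: "finite F" "!!i. i \<in> F ==> A i \<in> sets borel"
  "disjoint_family_on A F" "!!i. i \<in> F ==> A i \<subseteq> U" and U: "U \<in> sets borel" "U \<subseteq> \<Omega>"
 shows "(\<Sum>i\<in>F. BV_mass \<Omega> g (A i)) \<le> BV_mass \<Omega> g U"
proof -
 have one: "(\<Sum>i\<in>F. measure P (A i)) \<le> measure P U" if "finite_measure P" "sets P = sets (borel_on \<Omega>)" for P
 proof -
  interpret finite_measure P by (rule that(1))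
  have "A i \<in> sets P" if i: "i \<in> F" for i
   using F(2)[OF i] F(4)[OF i] U(2) \<open>sets P = _\<close> by (simp add: sets_MM[OF \<Omega>])
  moreover have "U \<in> sets P" using U that(2) by (simp add: sets_MM[OF \<Omega>])
  ultimately show ?thesis
   using F by (subst finite_measure_finite_Union[symmetric]) (auto intro!: finite_measure_mono)
 qed
 have sum4: "(\<Sum>l\<in>F. \<Sum>i\<in>UNIV. \<Sum>j\<in>UNIV. f i j l) = (\<Sum>i\<in>UNIV. \<Sum>j\<in>UNIV. \<Sum>l\<in>F. f i j l)" for f :: "'a => 'a => 'b => real"
  by (subst sum.swap, rule sum.cong[OF refl], rule sum.swap)
 show ?thesis
  unfolding BV_mass_def sum4
 proof (intro sum_mono)
  fix i j
  interpret bounded_signed_measure "borel_on \<Omega>" "\<lambda>A. BV_derivative \<Omega> g A $ i $ j" "enn2real (total_variation (borel_on \<Omega>) (BV_derivative \<Omega> g) \<Omega>)"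
   by (rule BV_derivative_bounded[OF g])
  interpret N: bounded_signed_measure "borel_on \<Omega>" "\<lambda>A. - BV_derivative \<Omega> g A $ i $ j" "enn2real (total_variation (borel_on \<Omega>) (BV_derivative \<Omega> g) \<Omega>)"
   by (rule uminus_bounded_signed_measure)
  show "(\<Sum>l\<in>F. measure (positive_variation (borel_on \<Omega>) (\<lambda>A. BV_derivative \<Omega> g A $ i $ j)) (A l) +
    measure (positive_variation (borel_on \<Omega>) (\<lambda>A. - BV_derivative \<Omega> g A $ i $ j)) (A l))
   \<le> measure (positive_variation (borel_on \<Omega>) (\<lambda>A. BV_derivative \<Omega> g A $ i $ j)) U +
    measure (positive_variation (borel_on \<Omega>) (\<lambda>A. - BV_derivative \<Omega> g A $ i $ j)) U"
   unfolding sum.distrib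
   by (intro add_mono one finite_positive_variation sets_positive_variation N.finite_positive_variation N.sets_positive_variation)
 qed
qed

text \<open>Convergence on each test function bounds the functionals pointwise only; uniform
  boundedness needs a complete space. Multiplication by a fixed cutoff lets all bounded continuous
  functions be tested, and duality turns the resulting norm bound into a bound on the variations of
  the ball where the cutoff is 1.\<close>

lemma weak_star_bounded_mass:
 assumes \<Omega>: "open \<Omega>" and w: "BV_weak_star_limit \<Omega> fs f" and b: "cball x r \<subseteq> \<Omega>"
 shows "\<exists>C. \<forall>k. BV_mass \<Omega> (fs k) (ball x r) \<le> C"
proof (cases "r > 0")
 case True
 let ?M = "borel_on \<Omega>"
 have fk: "fs k \<in> BV \<Omega>" for k using w by (simp add: BV_weak_star_limit_def)
 let ?\<nu> = "\<lambda>k i j A. BV_derivative \<Omega> (fs k) A $ i $ j"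
 obtain d where d: "d > 0" "(\<Union>y\<in>cball x r. ball y d) \<subseteq> \<Omega>"
  using compact_subset_open_imp_ball_epsilon_subset[OF compact_cball \<Omega> b] by blast
 \<comment> \<open>Equal to 1 on the closed ball of radius r and to 0 from radius r + d/2 on, hence
   compactly supported in \<open>\<Omega>\<close>.\<close>
 define \<kappa> where "\<kappa> = (\<lambda>y. max 0 (min 1 ((r + d / 2 - dist x y) / (d / 2))))"
 have \<kappa>c: "continuous_on UNIV \<kappa>" unfolding \<kappa>_def using d by (intro continuous_intros) auto
 have \<kappa>01: "0 \<le> \<kappa> y" "\<kappa> y \<le> 1" for y by (auto simp: \<kappa>_def)
 have \<kappa>1: "\<kappa> y = 1" if "y \<in> ball x r" for y using that d by (simp add: \<kappa>_def field_simps)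
 have cb: "cball x (r + d / 2) \<subseteq> \<Omega>"
 proof
  fix y assume y: "y \<in> cball x (r + d / 2)"
  show "y \<in> \<Omega>"
  proof (cases "y \<in> cball x r")
   case False
   \<comment> \<open>The point where the segment from \<open>x\<close> to \<open>y\<close> crosses
     the sphere of radius r; its distance to \<open>y\<close> is less than d.\<close>
   define z where "z = x + (r / dist x y) *\<^sub>R (y - x)"
   have xy: "dist x y > r" using False by simp
   then have ne: "x ~= y" using True by auto
   have "dist x z = r" using xy True ne by (simp add: z_def dist_norm norm_minus_commute)
   moreover have "dist z y = dist x y - r"
   proof -
    have "z - y = (r / dist x y - 1) *\<^sub>R (y - x)" by (simp add: z_def algebra_simps)
    then have "dist z y = \<bar>r / dist x y - 1\<bar> * dist x y" by (simp add: dist_norm norm_minus_commute)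
    also have "\<dots> = dist x y - r" using xy True ne by (simp add: abs_if field_simps)
    finally show ?thesis .
   qed
   ultimately have "y \<in> (\<Union>y\<in>cball x r. ball y d)" using y d by (intro UN_I[of z]) auto
   then show ?thesis using d by blast
  qed (use b in blast)
 qed
 have \<kappa>s: "compact_support_in \<Omega> (\<lambda>y. \<kappa> y * h y)" for h :: "real^'a => real"
 proof -
  have "{y. \<kappa> y * h y ~= 0} \<subseteq> cball x (r + d / 2)" using d by (auto simp: \<kappa>_def field_simps max_def min_def split: if_splits)
  then have cl: "closure {y. \<kappa> y * h y ~= 0} \<subseteq> cball x (r + d / 2)" by (rule closure_minimal) simp
  then show ?thesis unfolding compact_support_in_def
   using bounded_subset[OF bounded_cball cl] cb by (auto simp: compact_eq_bounded_closed)
 qed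
 have entry: "\<exists>C\<ge>0. \<forall>k \<phi>. continuous_on UNIV \<phi> --> compact_support_in (ball x r) \<phi> --> (\<forall>y. \<bar>\<phi> y\<bar> \<le> 1) -->
   \<bar>signed_integral ?M (?\<nu> k i j) \<phi>\<bar> \<le> C" for i j
 proof -
  define T where "T = (\<lambda>k (\<psi>::(real^'a) \<Rightarrow>\<^sub>C real). signed_integral ?M (?\<nu> k i j) (\<lambda>y. \<kappa> y * apply_bcontfun \<psi> y))"
  have cm: "continuous_on UNIV (\<lambda>y. \<kappa> y * apply_bcontfun \<psi> y)" for \<psi> :: "(real^'a) \<Rightarrow>\<^sub>C real"
   by (intro continuous_intros \<kappa>c) auto
  have cb: "\<bar>\<kappa> y * apply_bcontfun \<psi> y\<bar> \<le> norm \<psi>" for \<psi> :: "(real^'a) \<Rightarrow>\<^sub>C real" and y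
   using \<kappa>01[of y] norm_bounded[of \<psi> y] by (simp add: abs_mult) (meson abs_ge_zero mult_left_le_one_le order_trans)
  have bl: "bounded_linear (T k)" for k
  proof -
   interpret bounded_signed_measure ?M "?\<nu> k i j" "enn2real (total_variation ?M (BV_derivative \<Omega> (fs k)) \<Omega>)"
    by (rule BV_derivative_bounded[OF fk])
   interpret N: bounded_signed_measure ?M "\<lambda>A. - ?\<nu> k i j A" "enn2real (total_variation ?M (BV_derivative \<Omega> (fs k)) \<Omega>)"
    by (rule uminus_bounded_signed_measure)
   have int: "integrable P (\<lambda>y. \<kappa> y * apply_bcontfun \<psi> y)" if P: "finite_measure P" "sets P = sets ?M" for P and \<psi> :: "(real^'a) \<Rightarrow>\<^sub>C real"
   proof -
    interpret finite_measure P by (rule P(1))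
    have "(\<lambda>y. \<kappa> y * apply_bcontfun \<psi> y) \<in> borel_measurable P"
     using borel_measurable_continuous_onI[OF cm] by (simp add: measurable_cong_sets[OF P(2) refl] measurable_restrict_space1)
    then show ?thesis using cb by (intro integrable_const_bound[of _ "norm \<psi>"]) auto
   qed
   note i1 = int[OF finite_positive_variation sets_positive_variation]
   note i2 = int[OF N.finite_positive_variation N.sets_positive_variation]
   show ?thesis
   proof (rule bounded_linear_intro)
    show "T k (a + b) = T k a + T k b" for a b
     unfolding T_def signed_integral_def plus_bcontfun.rep_eq distrib_left
     using i1 i2 by simp
    show "T k (c *\<^sub>R a) = c *\<^sub>R T k a" for c a
    proof -
     have "(\<lambda>y. \<kappa> y * (c * apply_bcontfun a y)) = (\<lambda>y. c * (\<kappa> y * apply_bcontfun a y))" by (simp add: mult_ac)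
     then show ?thesis
      unfolding T_def signed_integral_def scaleR_bcontfun.rep_eq
      by (simp add: right_diff_distrib)
    qed
    show "norm (T k a) \<le> norm a * (measure (positive_variation ?M (?\<nu> k i j)) \<Omega> + measure (positive_variation ?M (\<lambda>A. - ?\<nu> k i j A)) \<Omega>)" for a
    proof -
     have z: "\<kappa> y * apply_bcontfun a y = 0" if "y \<notin> \<Omega>" for y
     proof -
      have "\<kappa> y = 0" using that cb \<kappa>s[of "\<lambda>_. 1"] closure_subset[of "{y. \<kappa> y * 1 ~= 0}"] unfolding compact_support_in_def by auto
      then show ?thesis by simp
     qed
     show ?thesis
      using signed_integral_bound[OF \<Omega> BV_derivative_bounded[OF fk] borel_measurable_continuous_onI[OF cm] cb z] \<Omega>
      unfolding T_def by (simp add: sets_MM[OF \<Omega>])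
    qed
   qed
  qed
  have pw: "\<exists>b. \<forall>k. \<bar>T k \<psi>\<bar> \<le> b" for \<psi>
  proof -
   let ?h = "\<lambda>y. \<kappa> y * apply_bcontfun \<psi> y"
   \<comment> \<open>The convergence hypothesis speaks of matrix-valued test functions; one
     supported in a single entry isolates the entry (i, j) of the derivative.\<close>
   let ?m = "\<lambda>y. (\<chi> a b. if a = i \<and> b = j then ?h y else 0) :: real^'a^'a"
   have hc: "continuous_on UNIV ?m"
   proof -
    have hcab: "continuous_on UNIV (\<lambda>y. if a = i \<and> b = j then ?h y else 0)" for a b
     using cm by (cases "a = i \<and> b = j") auto
    show ?thesis by (intro continuous_on_vec_lambda hcab)
   qed
   have "{y. ?m y ~= 0} = {y. ?h y ~= 0}" by (auto simp: vec_eq_iff)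
   then have hs: "compact_support_in \<Omega> ?m" using \<kappa>s[of "apply_bcontfun \<psi>"] unfolding compact_support_in_def by simp
   have mi: "matrix_integral ?M \<mu> ?m = signed_integral ?M (\<lambda>A. \<mu> A $ i $ j) ?h" for \<mu>
   proof -
    have "matrix_integral ?M \<mu> ?m = (\<Sum>a\<in>UNIV. \<Sum>b\<in>UNIV. if b = j then (if a = i then signed_integral ?M (\<lambda>A. \<mu> A $ i $ j) ?h else 0) else 0)"
     unfolding matrix_integral_def by (intro sum.cong refl) (auto simp: signed_integral_def)
    then show ?thesis by simp
   qed
   have "(\<lambda>k. matrix_integral ?M (BV_derivative \<Omega> (fs k)) ?m) \<longlonglongrightarrow> matrix_integral ?M (BV_derivative \<Omega> f) ?m"
    using w hc hs unfolding BV_weak_star_limit_def by blast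
   then have "Bseq (\<lambda>k. T k \<psi>)" unfolding mi T_def by (intro convergent_imp_Bseq convergentI)
   then show ?thesis unfolding Bseq_def by auto
  qed
  obtain C where C: "C \<ge> 0" "!!k \<psi>. \<bar>T k \<psi>\<bar> \<le> C * norm \<psi>" using banach_steinhaus_real[OF bl pw] by blast
  have "\<bar>signed_integral ?M (?\<nu> k i j) \<phi>\<bar> \<le> C"
   if \<phi>: "continuous_on UNIV \<phi>" "compact_support_in (ball x r) \<phi>" "\<forall>y. \<bar>\<phi> y\<bar> \<le> 1" for k \<phi>
  proof -
   have "\<phi> \<in> bcontfun" using \<phi> by (intro bcontfun_normI[of _ 1]) auto
   then have ap: "apply_bcontfun (Bcontfun \<phi>) = \<phi>" by (rule Bcontfun_inverse)
   have n1: "norm (Bcontfun \<phi>) \<le> 1" using \<phi>(3) ap by (intro norm_bound) auto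
   have "\<kappa> y * \<phi> y = \<phi> y" for y
   proof (cases "y \<in> ball x r")
    case False
    then have "\<phi> y = 0" using \<phi>(2) closure_subset[of "{x. \<phi> x ~= 0}"] unfolding compact_support_in_def by blast
    then show ?thesis by simp
   qed (simp add: \<kappa>1)
   then have e: "(\<lambda>y. \<kappa> y * \<phi> y) = \<phi>" by (rule ext)
   have "T k (Bcontfun \<phi>) = signed_integral ?M (?\<nu> k i j) \<phi>" unfolding T_def ap e ..
   then show ?thesis using C(2)[of k "Bcontfun \<phi>"] n1 C(1) by (metis mult_left_le order_trans)
  qed
  then show ?thesis using C(1) by blast
 qed
 then obtain C where C: "!!i j. C i j \<ge> 0" "!!i j k \<phi>. continuous_on UNIV \<phi> ==> compact_support_in (ball x r) \<phi> ==> (\<forall>y. \<bar>\<phi> y\<bar> \<le> 1) ==>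
   \<bar>signed_integral ?M (?\<nu> k i j) \<phi>\<bar> \<le> C i j" by metis
 have br: "open (ball x r)" "ball x r \<subseteq> \<Omega>" using b by (auto simp: subset_eq)
 have "BV_mass \<Omega> (fs k) (ball x r) \<le> (\<Sum>i\<in>UNIV. \<Sum>j\<in>UNIV. C i j + C i j)" for k
  unfolding BV_mass_def
 proof (intro sum_mono add_mono)
  fix i j
  interpret bounded_signed_measure ?M "?\<nu> k i j" "enn2real (total_variation ?M (BV_derivative \<Omega> (fs k)) \<Omega>)"
   by (rule BV_derivative_bounded[OF fk])
  show "measure (positive_variation ?M (?\<nu> k i j)) (ball x r) \<le> C i j"
   by (rule positive_variation_dual[OF \<Omega> bounded_signed_measure_axioms br C(1) C(2)]) auto
  have neg: "signed_integral ?M (\<lambda>A. - ?\<nu> k i j A) \<phi> = - signed_integral ?M (?\<nu> k i j) \<phi>" for \<phi>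
   by (simp add: signed_integral_def)
  show "measure (positive_variation ?M (\<lambda>A. - ?\<nu> k i j A)) (ball x r) \<le> C i j"
   by (rule positive_variation_dual[OF \<Omega> uminus_bounded_signed_measure br C(1)]) (use C(2) in \<open>simp add: neg\<close>)
 qed
 then show ?thesis by blast
next
 case False
 then have e: "ball x r = {}" by simp
 show ?thesis unfolding e by (intro exI[of _ 0]) (simp add: BV_mass_def)
qed

section \<open>Lebesgue decomposition and the density of the derivative\<close>

lemma maximal_null_set:
 assumes p: "finite_measure p" and sets: "sets p = sets L"
 shows "\<exists>N\<in>null_sets L. \<forall>E\<in>null_sets L. emeasure p (E - N) = 0"
proof -
 interpret finite_measure p by fact
 let ?X = "measure p ` null_sets L"
 have bdd: "bdd_above ?X" using bounded_measure by (intro bdd_aboveI[of _ "measure p (space p)"]) auto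
 have ne: "?X ~= {}" by auto
 have "\<exists>E. E \<in> null_sets L \<and> Sup ?X - 1 / (real k + 1) < measure p E" for k :: nat
 proof -
  have "Sup ?X - 1 / (real k + 1) < Sup ?X" by simp
  then show ?thesis using less_cSup_iff[OF ne bdd] by auto
 qed
 then obtain E where E: "!!k. E k \<in> null_sets L" "!!k. Sup ?X - 1 / (real k + 1) < measure p (E k)" by metis
 \<comment> \<open>This union attains the supremum of \<open>p\<close> over the null sets of
   \<open>L\<close>. Adding another null set cannot increase the measure, so its part outside
   \<open>N\<close> has \<open>p\<close>-measure zero.\<close>
 define N where "N = (\<Union>k. E k)"
 have N: "N \<in> null_sets L" unfolding N_def using E(1) by auto
 have sN: "Sup ?X \<le> measure p N"
 proof (rule field_le_epsilon)
  fix e :: real assume e: "e > 0"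
  obtain k :: nat where k: "1 / e < real k" using reals_Archimedean2 by blast
  have "1 / (real k + 1) \<le> e" using k e by (simp add: field_simps)
  moreover have "measure p (E k) \<le> measure p N"
   using N sets by (intro finite_measure_mono) (auto simp: N_def null_sets_def)
  ultimately show "Sup ?X \<le> measure p N + e" using E(2)[of k] by linarith
 qed
 have "emeasure p (F - N) = 0" if F: "F \<in> null_sets L" for F
 proof -
  have FN: "F \<in> sets p" "N \<in> sets p" using F N sets by (auto simp: null_sets_def)
  have "measure p (N \<union> (F - N)) = measure p N + measure p (F - N)"
   using FN by (intro finite_measure_Union) auto
  moreover have "measure p (N \<union> (F - N)) \<le> Sup ?X"
  proof (rule cSup_upper[OF _ bdd])
   have "N \<union> (F - N) \<in> null_sets L" using N F by auto
   then show "measure p (N \<union> (F - N)) \<in> ?X" by (rule imageI)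
  qed
  ultimately have "measure p (F - N) \<le> 0" using sN by linarith
  then show ?thesis by (simp add: emeasure_eq_measure measure_le_0_iff)
 qed
 then show ?thesis using N by blast
qed

text \<open>Outside \<open>N\<close> the measure \<open>p\<close> is absolutely continuous, so
  Radon-Nikodym applies on \<open>\<Omega>\<close>; the density is made real-valued and extended by
  0 to the whole space.\<close>

lemma real_density_off_null_set:
 fixes \<Omega> :: "(real^'n) set"
 assumes \<Omega>: "open \<Omega>" and p: "finite_measure p" and sets: "sets p = sets (borel_on \<Omega>)"
  and N: "N \<in> sets (borel_on \<Omega>)"
  and ac: "!!E. E \<in> sets (borel_on \<Omega>) ==> emeasure lborel E = 0 ==> emeasure p (E - N) = 0"
 obtains f :: "real^'n => real" where "integrable lborel f" "!!x. f x \<ge> 0"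
  "!!A. A \<in> sets (borel_on \<Omega>) ==> measure p (A - N) = (\<integral>x. indicator A x * f x \<partial>lborel)"
proof -
 interpret finite_measure p by fact
 let ?L = "restrict_space lborel \<Omega>"
 have \<Omega>b: "\<Omega> \<inter> space lborel \<in> sets lborel" "\<Omega> \<in> sets lborel" using \<Omega> by auto
 have sL: "sets ?L = sets (borel_on \<Omega>)" by (simp add: sets_restrict_space)
 have eL: "emeasure ?L A = emeasure lborel A" if "A \<in> sets ?L" for A
  using that \<Omega>b by (subst emeasure_restrict_space) (auto simp: sets_restrict_space)
 interpret L: sigma_finite_measure ?L
  using \<Omega>b by (intro sigma_finite_measure_restrict_space lborel.sigma_finite_measure_axioms) auto
 have sp: "space p = \<Omega>" using sets_eq_imp_space_eq[OF sets] by (simp add: space_restrict_space)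
 have Np: "N \<in> sets p" using N sets by simp
 define q where "q = density p (indicator (space p - N))"
 have sq: "sets q = sets ?L" by (simp add: q_def sets sL)
 have eq: "emeasure q A = emeasure p (A - N)" if "A \<in> sets p" for A
 proof -
  have "emeasure q A = (\<integral>\<^sup>+x. indicator (space p - N) x * indicator A x \<partial>p)"
   unfolding q_def using that Np by (subst emeasure_density) auto
  also have "\<dots> = (\<integral>\<^sup>+x. indicator (A - N) x \<partial>p)"
   using sets.sets_into_space[OF that] by (intro nn_integral_cong) (auto simp: indicator_def)
  also have "\<dots> = emeasure p (A - N)" using that Np by (intro nn_integral_indicator) auto
  finally show ?thesis .
 qed
 have acq: "absolutely_continuous ?L q"
  unfolding absolutely_continuous_def
 proof
  fix E assume "E \<in> null_sets ?L"
  then have E: "E \<in> sets ?L" "emeasure lborel E = 0" using eL by (auto simp: null_sets_def)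
  then show "E \<in> null_sets q" using ac[of E] eq[of E] by (auto simp: null_sets_def sq sL sets)
 qed
 obtain h where h: "h \<in> borel_measurable ?L" "density ?L h = q" using L.Radon_Nikodym[OF acq sq] by blast
 have hA: "(\<integral>\<^sup>+x. h x * indicator A x \<partial>?L) = emeasure p (A - N)" if "A \<in> sets p" for A
  using emeasure_density[OF h(1), of A] that h(2) eq[OF that] by (simp add: sets sL)
 define f where "f = (\<lambda>x. indicator \<Omega> x * enn2real (h x))"
 have top: "(\<integral>\<^sup>+x. h x \<partial>?L) < \<infinity>"
 proof -
  have "(\<integral>\<^sup>+x. h x \<partial>?L) = (\<integral>\<^sup>+x. h x * indicator (space p) x \<partial>?L)"
   by (intro nn_integral_cong) (simp add: sp space_restrict_space)
  also have "\<dots> = emeasure p (space p - N)" by (rule hA) simp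
  also have "\<dots> < \<infinity>" using emeasure_finite[of "space p - N"] by (simp add: less_top[symmetric])
  finally show ?thesis .
 qed
 have fin: "AE x in ?L. h x ~= \<infinity>" using h(1) top by (intro nn_integral_PInf_AE) auto
 have em: "(\<lambda>x. enn2real (h x)) \<in> borel_measurable ?L" using h(1) by measurable
 have fm: "f \<in> borel_measurable lborel"
  using em \<Omega>b by (simp add: f_def borel_measurable_restrict_space_iff mult.commute)
 have key: "(\<integral>\<^sup>+x. ennreal (indicator A x * f x) \<partial>lborel) = emeasure p (A - N)" if A: "A \<in> sets p" for A
 proof -
  have A\<Omega>: "A \<subseteq> \<Omega>" using sets.sets_into_space[OF A] sp by simp
  have "(\<integral>\<^sup>+x. ennreal (indicator A x * f x) \<partial>lborel) = (\<integral>\<^sup>+x. ennreal (enn2real (h x)) * indicator A x * indicator \<Omega> x \<partial>lborel)"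
   using A\<Omega> by (intro nn_integral_cong) (auto simp: f_def indicator_def)
  also have "\<dots> = (\<integral>\<^sup>+x. ennreal (enn2real (h x)) * indicator A x \<partial>?L)"
   using \<Omega>b by (simp add: nn_integral_restrict_space)
  also have "\<dots> = (\<integral>\<^sup>+x. h x * indicator A x \<partial>?L)"
   using fin by (intro nn_integral_cong_AE) (auto elim!: AE_mp simp: less_top)
  finally show ?thesis using hA[OF A] by simp
 qed
 show ?thesis
 proof (rule that[of f])
  have f0: "f x \<ge> 0" for x by (simp add: f_def)
  then show "f x \<ge> 0" for x .
  have fi: "integrable lborel (\<lambda>x. indicator A x * f x)" if A: "A \<in> sets p" for A
  proof (rule integrableI_nonneg)
   have "A \<in> sets lborel" using A sets \<Omega> by (auto simp: sets_restrict_space_iff)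
   then show "(\<lambda>x. indicator A x * f x) \<in> borel_measurable lborel" using fm by (intro borel_measurable_times borel_measurable_indicator)
   show "(\<integral>\<^sup>+x. ennreal (indicator A x * f x) \<partial>lborel) < \<infinity>"
    unfolding key[OF A] using emeasure_finite[of "A - N"] by (simp add: less_top[symmetric])
  qed (simp add: f0)
  have "\<Omega> \<in> sets p" using sp by (metis sets.top)
  moreover have "(\<lambda>x. indicator \<Omega> x * f x) = f" by (auto simp: f_def indicator_def)
  ultimately show "integrable lborel f" using fi[of \<Omega>] by simp
  fix A assume "A \<in> sets (borel_on \<Omega>)"
  then have A: "A \<in> sets p" using sets by simp
  have "ennreal (measure p (A - N)) = (\<integral>\<^sup>+x. ennreal (indicator A x * f x) \<partial>lborel)"
   using key[OF A] by (simp add: emeasure_eq_measure)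
  also have "\<dots> = ennreal (\<integral>x. indicator A x * f x \<partial>lborel)"
   by (rule nn_integral_eq_integral[OF fi[OF A]]) (simp add: f0)
  finally show "measure p (A - N) = (\<integral>x. indicator A x * f x \<partial>lborel)"
   using f0 by (subst (asm) ennreal_inj) (auto intro!: integral_nonneg_AE)
 qed
qed

lemma bounded_linear_matrix_entry: "bounded_linear (\<lambda>v::real^'n^'m. v $ i $ j)"
 using bounded_linear_compose[OF bounded_linear_vec_nth bounded_linear_vec_nth] .

lemma integral_lebesgue_on_borel:
 fixes G :: "'a::euclidean_space => 'b::euclidean_space"
 assumes "G \<in> borel_measurable borel" "A \<in> sets borel"
 shows "(LINT x|lebesgue_on A. G x) = (\<integral>x. indicator A x *\<^sub>R G x \<partial>lborel)"
proof -
 have "(\<lambda>x. indicator A x *\<^sub>R G x) \<in> borel_measurable lborel"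
  using assms by (intro borel_measurable_scaleR borel_measurable_indicator) auto
 then show ?thesis using assms by (simp add: integral_lebesgue_on integral_completion)
qed

text \<open>The gradient is a choice, so its defining property has to be shown satisfiable. This
  amounts to the Lebesgue decomposition of the Jordan parts of all entries, with one common null
  set.\<close>

lemma is_BV_gradient_BV_gradient:
 fixes g :: "real^'n => real^'n"
 assumes \<Omega>: "open \<Omega>" and g: "g \<in> BV \<Omega>"
 shows "is_BV_gradient \<Omega> g (BV_gradient \<Omega> g)"
proof -
 let ?M = "borel_on \<Omega>" and ?\<mu> = "BV_derivative \<Omega> g"
 let ?L = "restrict_space lborel \<Omega>"
 let ?p = "\<lambda>i j. positive_variation ?M (\<lambda>A. ?\<mu> A $ i $ j)"
 let ?n = "\<lambda>i j. positive_variation ?M (\<lambda>A. - ?\<mu> A $ i $ j)"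
 have vm: "vector_measure ?M ?\<mu>"
  using BV_derivative_is_measure_derivative[OF g] by (simp add: is_measure_derivative_def)
 have sL: "sets ?L = sets ?M" by (simp add: sets_restrict_space)
 have eL: "emeasure ?L A = emeasure lborel A" if "A \<in> sets ?M" for A
  using that \<Omega> by (subst emeasure_restrict_space) (auto simp: sets_restrict_space)
 have nL: "E \<in> null_sets ?L \<longleftrightarrow> E \<in> sets ?M \<and> emeasure lborel E = 0" for E
  using eL by (auto simp: null_sets_def sL)
 have jd: "?\<mu> A $ i $ j = measure (?p i j) A - measure (?n i j) A" if "A \<in> sets ?M" for A i j
  using bounded_signed_measure.jordan_decomposition[OF BV_derivative_bounded[OF g] that] by simp
 have pf: "finite_measure (?p i j)" "sets (?p i j) = sets ?M" "finite_measure (?n i j)" "sets (?n i j) = sets ?M" for i j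
 proof -
  interpret bounded_signed_measure ?M "\<lambda>A. ?\<mu> A $ i $ j" "enn2real (total_variation ?M ?\<mu> \<Omega>)"
   by (rule BV_derivative_bounded[OF g])
  interpret N: bounded_signed_measure ?M "\<lambda>A. - ?\<mu> A $ i $ j" "enn2real (total_variation ?M ?\<mu> \<Omega>)"
   by (rule uminus_bounded_signed_measure)
  show "finite_measure (?p i j)" "sets (?p i j) = sets ?M" "finite_measure (?n i j)" "sets (?n i j) = sets ?M"
   by (rule finite_positive_variation sets_positive_variation N.finite_positive_variation N.sets_positive_variation)+
 qed
 have "\<exists>N\<in>null_sets ?L. \<forall>E\<in>null_sets ?L. emeasure (?p i j) (E - N) = 0" for i j
  by (rule maximal_null_set[OF pf(1)]) (simp add: pf(2) sL)
 then obtain Np where Np: "!!i j. Np i j \<in> null_sets ?L" "!!i j E. E \<in> null_sets ?L ==> emeasure (?p i j) (E - Np i j) = 0"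
  by metis
 have "\<exists>N\<in>null_sets ?L. \<forall>E\<in>null_sets ?L. emeasure (?n i j) (E - N) = 0" for i j
  by (rule maximal_null_set[OF pf(3)]) (simp add: pf(4) sL)
 then obtain Nn where Nn: "!!i j. Nn i j \<in> null_sets ?L" "!!i j E. E \<in> null_sets ?L ==> emeasure (?n i j) (E - Nn i j) = 0"
  by metis
 \<comment> \<open>One null set absorbs the singular parts of both variations of every
   entry.\<close>
 define N where "N = (\<Union>i. \<Union>j. Np i j \<union> Nn i j)"
 have "N \<in> null_sets ?L" unfolding N_def
  by (intro null_sets_UN' countable_finite finite null_sets.Un Np(1) Nn(1))
 then have N: "N \<in> sets ?M" "emeasure lborel N = 0" by (simp_all add: nL)
 have acp: "emeasure (?p i j) (E - N) = 0" "emeasure (?n i j) (E - N) = 0" if E: "E \<in> sets ?M" "emeasure lborel E = 0" for E i j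
 proof -
  have En: "E \<in> null_sets ?L" using E by (simp add: nL)
  have s: "Np i j \<in> sets ?M" "Nn i j \<in> sets ?M" using Np(1) Nn(1) by (simp_all add: nL)
  have "E - N \<subseteq> E - Np i j" "E - N \<subseteq> E - Nn i j" by (auto simp: N_def)
  then show "emeasure (?p i j) (E - N) = 0" "emeasure (?n i j) (E - N) = 0"
   using emeasure_mono[of "E - N" "E - Np i j" "?p i j"] emeasure_mono[of "E - N" "E - Nn i j" "?n i j"]
    Np(2)[OF En, of i j] Nn(2)[OF En, of i j] s E by (auto simp: pf)
 qed
 have "\<exists>f. integrable lborel f \<and> (\<forall>A\<in>sets ?M. measure (?p i j) (A - N) = (\<integral>x. indicator A x * f x \<partial>lborel))" for i j
  by (rule real_density_off_null_set[OF \<Omega> pf(1,2) N(1) acp(1)]) auto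
 note ex_p = this
 define fp where "fp = (\<lambda>i j. SOME f. integrable lborel f \<and> (\<forall>A\<in>sets ?M. measure (?p i j) (A - N) = (\<integral>x. indicator A x * f x \<partial>lborel)))"
 have fp: "integrable lborel (fp i j)"
  "A \<in> sets ?M ==> measure (?p i j) (A - N) = (\<integral>x. indicator A x * fp i j x \<partial>lborel)" for i j A
 proof -
  have e: "integrable lborel (fp i j) \<and> (\<forall>A\<in>sets ?M. measure (?p i j) (A - N) = (\<integral>x. indicator A x * fp i j x \<partial>lborel))"
   unfolding fp_def by (rule someI_ex[OF ex_p])
  show "integrable lborel (fp i j)" by (rule conjunct1[OF e])
  show "A \<in> sets ?M ==> measure (?p i j) (A - N) = (\<integral>x. indicator A x * fp i j x \<partial>lborel)"
   by (rule bspec[OF conjunct2[OF e]])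
 qed
 have "\<exists>f. integrable lborel f \<and> (\<forall>A\<in>sets ?M. measure (?n i j) (A - N) = (\<integral>x. indicator A x * f x \<partial>lborel))" for i j
  by (rule real_density_off_null_set[OF \<Omega> pf(3,4) N(1) acp(2)]) auto
 note ex_n = this
 define fn where "fn = (\<lambda>i j. SOME f. integrable lborel f \<and> (\<forall>A\<in>sets ?M. measure (?n i j) (A - N) = (\<integral>x. indicator A x * f x \<partial>lborel)))"
 have fn: "integrable lborel (fn i j)"
  "A \<in> sets ?M ==> measure (?n i j) (A - N) = (\<integral>x. indicator A x * fn i j x \<partial>lborel)" for i j A
 proof -
  have e: "integrable lborel (fn i j) \<and> (\<forall>A\<in>sets ?M. measure (?n i j) (A - N) = (\<integral>x. indicator A x * fn i j x \<partial>lborel))"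
   unfolding fn_def by (rule someI_ex[OF ex_n])
  show "integrable lborel (fn i j)" by (rule conjunct1[OF e])
  show "A \<in> sets ?M ==> measure (?n i j) (A - N) = (\<integral>x. indicator A x * fn i j x \<partial>lborel)"
   by (rule bspec[OF conjunct2[OF e]])
 qed
 define G where "G = (\<lambda>x. (\<chi> i j. fp i j x - fn i j x) :: real^'n^'n)"
 have Gi: "integrable lborel G"
 proof -
  have "G x = (\<Sum>i\<in>UNIV. \<Sum>j\<in>UNIV. (fp i j x - fn i j x) *\<^sub>R (\<chi> a b. if a = i then (if b = j then 1 else 0) else 0))" for x
  proof -
   have "(\<Sum>i\<in>UNIV. \<Sum>j\<in>UNIV. (fp i j x - fn i j x) *\<^sub>R ((\<chi> a b. if a = i then (if b = j then 1 else 0) else 0) :: real^'n^'n)) $ a $ b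
     = (\<Sum>i\<in>UNIV. if a = i then (\<Sum>j\<in>UNIV. if b = j then fp i j x - fn i j x else 0) else 0)" for a b
    unfolding sum_component vector_scaleR_component vec_lambda_beta
    by (intro sum.cong refl) (simp add: mult_delta_right)
   then show ?thesis by (simp add: vec_eq_iff G_def)
  qed
  then have eq: "G = (\<lambda>x. \<Sum>i\<in>UNIV. \<Sum>j\<in>UNIV. (fp i j x - fn i j x) *\<^sub>R (\<chi> a b. if a = i then (if b = j then 1 else 0) else 0))"
   by (rule ext)
  show ?thesis unfolding eq
   by (intro Bochner_Integration.integrable_sum integrable_scaleR_left Bochner_Integration.integrable_diff fp(1) fn(1))
 qed
 have Gm: "G \<in> borel_measurable borel" using Gi by simp
 have "is_BV_gradient \<Omega> g G"
  unfolding is_BV_gradient_def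
 proof (intro conjI exI)
  have "integrable lborel (\<lambda>x. indicator \<Omega> x *\<^sub>R G x)"
   using \<Omega> Gi by (intro integrable_mult_indicator) auto
  then have "integrable lebesgue (\<lambda>x. indicator \<Omega> x *\<^sub>R G x)"
   using integrable_completion[OF borel_measurable_integrable] by blast
  then show "integrable (lebesgue_on \<Omega>) G" using \<Omega> by (simp add: integrable_restrict_space)
  show "\<forall>A\<in>sets ?M. ?\<mu> (A - N) = (LINT x|lebesgue_on A. G x)"
  proof
   fix A assume A: "A \<in> sets ?M"
   then have Ab: "A \<in> sets borel" using \<Omega> by (simp add: sets_MM)
   have AN: "A - N \<in> sets ?M" using A N by auto
   have iG: "integrable lborel (\<lambda>x. indicator A x *\<^sub>R G x)" using Ab Gi by (intro integrable_mult_indicator) auto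
   have "?\<mu> (A - N) $ i $ j = (LINT x|lebesgue_on A. G x) $ i $ j" for i j
   proof -
    have ip: "integrable lborel (\<lambda>x. indicator A x * fp i j x)" "integrable lborel (\<lambda>x. indicator A x * fn i j x)"
     using integrable_mult_indicator[of A lborel "fp i j"] integrable_mult_indicator[of A lborel "fn i j"] Ab fp(1) fn(1) by auto
    have "(LINT x|lebesgue_on A. G x) $ i $ j = (\<integral>x. (indicator A x *\<^sub>R G x) $ i $ j \<partial>lborel)"
     unfolding integral_lebesgue_on_borel[OF Gm Ab] by (rule integral_bounded_linear[OF bounded_linear_matrix_entry iG, symmetric])
    also have "\<dots> = (\<integral>x. indicator A x * fp i j x - indicator A x * fn i j x \<partial>lborel)"
     by (simp add: G_def right_diff_distrib)
    also have "\<dots> = measure (?p i j) (A - N) - measure (?n i j) (A - N)"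
     using ip fp(2)[OF A] fn(2)[OF A] by simp
    finally show ?thesis using jd[OF AN] by simp
   qed
   then show "?\<mu> (A - N) = (LINT x|lebesgue_on A. G x)" by (simp add: vec_eq_iff)
  qed
  \<comment> \<open>The decomposition is by restriction: the absolutely continuous part lives off
    \<open>N\<close>, the singular part on \<open>N\<close>.\<close>
  show "lebesgue_decomposition \<Omega> ?\<mu> (\<lambda>A. ?\<mu> (A - N)) (\<lambda>A. ?\<mu> (A \<inter> N))"
   unfolding lebesgue_decomposition_def
  proof (intro conjI ballI impI bexI[of _ N] N)
   have m0: "?\<mu> {} = 0" using vm by (simp add: vector_measure_def)
   show "vector_measure ?M (\<lambda>A. ?\<mu> (A - N))"
    unfolding vector_measure_def
   proof (intro conjI allI impI)
    fix A :: "nat => (real^'n) set" assume A: "range A \<subseteq> sets ?M" "disjoint_family A"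
    have "range (\<lambda>i. A i - N) \<subseteq> sets ?M" "disjoint_family (\<lambda>i. A i - N)"
     using A N by (auto simp: disjoint_family_on_def)
    then have "(\<lambda>i. ?\<mu> (A i - N)) sums ?\<mu> (\<Union>i. A i - N)" using vm unfolding vector_measure_def by blast
    then show "(\<lambda>i. ?\<mu> (A i - N)) sums ?\<mu> ((\<Union>i. A i) - N)" by simp
   qed (simp add: m0)
   show "vector_measure ?M (\<lambda>A. ?\<mu> (A \<inter> N))"
    unfolding vector_measure_def
   proof (intro conjI allI impI)
    fix A :: "nat => (real^'n) set" assume A: "range A \<subseteq> sets ?M" "disjoint_family A"
    have "range (\<lambda>i. A i \<inter> N) \<subseteq> sets ?M" "disjoint_family (\<lambda>i. A i \<inter> N)"
     using A N by (auto simp: disjoint_family_on_def)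
    then have "(\<lambda>i. ?\<mu> (A i \<inter> N)) sums ?\<mu> (\<Union>i. A i \<inter> N)" using vm unfolding vector_measure_def by blast
    then show "(\<lambda>i. ?\<mu> (A i \<inter> N)) sums ?\<mu> ((\<Union>i. A i) \<inter> N)" by simp
   qed (simp add: m0)
   show "?\<mu> A = ?\<mu> (A - N) + ?\<mu> (A \<inter> N)" if A: "A \<in> sets ?M" for A
   proof -
    have "(A - N) \<union> (A \<inter> N) = A" by blast
    then show ?thesis using vector_measure_Un[OF vm, of "A - N" "A \<inter> N"] A N by auto
   qed
   show "?\<mu> (A - N) = 0" if A: "A \<in> sets ?M" "emeasure lborel A = 0" for A
   proof -
    have "A - N \<in> sets ?M" using A N by auto
    then have "?\<mu> (A - N) $ i $ j = 0" for i j
     using jd[of "A - N" i j] acp[OF A, of i j] by (simp add: measure_def)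
    then show ?thesis by (simp add: vec_eq_iff)
   qed
   show "total_variation ?M (\<lambda>A. ?\<mu> (A \<inter> N)) (\<Omega> - N) = 0"
   proof -
    have z: "(suminf (\<lambda>i. ennreal (norm (?\<mu> (P i \<inter> N))))) = 0" if "(\<Union>i. P i) = \<Omega> - N" for P :: "nat => (real^'n) set"
    proof -
     have "P i \<inter> N = {}" for i using that by blast
     then show ?thesis by (simp add: m0)
    qed
    have "total_variation ?M (\<lambda>A. ?\<mu> (A \<inter> N)) (\<Omega> - N) \<le> 0"
     unfolding total_variation_def
    proof (rule SUP_least)
     fix P :: "nat => (real^'n) set"
     assume "P \<in> {P. range P \<subseteq> sets ?M \<and> disjoint_family P \<and> \<Union> (range P) = \<Omega> - N}"
     then have "\<Union> (range P) = \<Omega> - N" unfolding mem_Collect_eq by (elim conjE)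
     then have "(suminf (\<lambda>i. ennreal (norm (?\<mu> (P i \<inter> N))))) = 0" by (rule z)
     then show "(suminf (\<lambda>i. ennreal (norm (?\<mu> (P i \<inter> N))))) \<le> 0" by (rule eq_refl)
    qed
    then show ?thesis by simp
   qed
  qed
 qed
 then show ?thesis unfolding BV_gradient_def by (rule someI[where P = "is_BV_gradient \<Omega> g"])
qed

lemma restricted_density:
 fixes \<Omega> :: "(real^'n) set" and h :: "real^'n => real"
 assumes \<Omega>: "open \<Omega>" and h: "integrable lborel h" "!!x. h x \<ge> 0" "\<forall>x. x \<notin> \<Omega> --> h x = 0"
 defines "D \<equiv> restrict_space (density lborel (\<lambda>x. ennreal (h x))) \<Omega>"
 shows "finite_measure D" "sets D = sets (borel_on \<Omega>)"
  "k \<in> borel_measurable borel ==> (\<integral>x. k x \<partial>D) = (\<integral>x. h x * k x \<partial>lborel)"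
proof -
 have [measurable]: "h \<in> borel_measurable borel" using h(1) by simp
 have "(\<integral>\<^sup>+x. ennreal (h x) \<partial>lborel) < \<infinity>"
  using h(1,2) by (simp add: integrable_iff_bounded)
 then have "finite_measure (density lborel (\<lambda>x. ennreal (h x)))"
  by (intro finite_measureI) (simp add: emeasure_density less_top)
 then show "finite_measure D" unfolding D_def using \<Omega> by (intro finite_measure_restrict_space) auto
 show "sets D = sets (borel_on \<Omega>)" by (simp add: D_def sets_restrict_space)
 assume k: "k \<in> borel_measurable borel"
 have "(\<integral>x. k x \<partial>D) = (\<integral>x. indicator \<Omega> x *\<^sub>R k x \<partial>density lborel (\<lambda>x. ennreal (h x)))"
  unfolding D_def using \<Omega> by (subst integral_restrict_space) auto
 also have "\<dots> = (\<integral>x. h x *\<^sub>R (indicator \<Omega> x *\<^sub>R k x) \<partial>lborel)"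
  using \<Omega> k h(2) by (intro integral_density) auto
 also have "\<dots> = (\<integral>x. h x * k x \<partial>lborel)"
  using h(3) by (intro Bochner_Integration.integral_cong) (auto simp: indicator_def)
 finally show "(\<integral>x. k x \<partial>D) = (\<integral>x. h x * k x \<partial>lborel)" .
qed

text \<open>The Jordan parts of a sum are in general not the sums of the Jordan parts. The identity
  of signed values on sets is instead written as a vanishing linear combination of six finite
  measures, and \<open>integral_linear_relation\<close> passes it on to bounded integrands.\<close>

lemma signed_integral_decomposition:
 fixes \<Omega> :: "(real^'n) set"
 assumes \<Omega>: "open \<Omega>" and \<nu>: "bounded_signed_measure (borel_on \<Omega>) \<nu> B"
  and \<sigma>: "bounded_signed_measure (borel_on \<Omega>) \<sigma> B'"
  and h: "integrable lborel h" "!!x. x \<notin> \<Omega> ==> h x = 0"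
  and dec: "!!A. A \<in> sets (borel_on \<Omega>) ==> \<nu> A = (\<integral>x. h x * indicator A x \<partial>lborel) + \<sigma> A"
  and \<phi>: "\<phi> \<in> borel_measurable borel" "!!x. \<bar>\<phi> x\<bar> \<le> (C::real)"
 shows "signed_integral (borel_on \<Omega>) \<nu> \<phi> = (\<integral>x. h x * \<phi> x \<partial>lborel) + signed_integral (borel_on \<Omega>) \<sigma> \<phi>"
proof -
 let ?M = "borel_on \<Omega>"
 interpret p: bounded_signed_measure ?M \<nu> B by fact
 interpret n: bounded_signed_measure ?M "\<lambda>A. - \<nu> A" B by (rule p.uminus_bounded_signed_measure)
 interpret s: bounded_signed_measure ?M \<sigma> B' by fact
 interpret t: bounded_signed_measure ?M "\<lambda>A. - \<sigma> A" B' by (rule s.uminus_bounded_signed_measure)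
 define D where "D = (\<lambda>h::real^'n => real. restrict_space (density lborel (\<lambda>x. ennreal (h x))) \<Omega>)"
 have D: "restrict_space (density lborel (\<lambda>x. ennreal (h x))) \<Omega> = D h" for h by (simp add: D_def)
 define a where "a = (\<lambda>x. max 0 (h x))"
 define b where "b = (\<lambda>x. max 0 (- h x))"
 have hm: "h \<in> borel_measurable borel" using h(1) by simp
 have ab: "integrable lborel a" "integrable lborel b"
  unfolding a_def b_def using h(1) by (auto intro!: integrable_max)
 have a0: "a x \<ge> 0" "b x \<ge> 0" "a x - b x = h x" for x by (auto simp: a_def b_def)
 have az: "\<forall>x. x \<notin> \<Omega> --> a x = 0" "\<forall>x. x \<notin> \<Omega> --> b x = 0" using h(2) by (auto simp: a_def b_def)
 note da = restricted_density[OF \<Omega> ab(1) a0(1) az(1), unfolded D]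
 note db = restricted_density[OF \<Omega> ab(2) a0(2) az(2), unfolded D]
 have int: "integrable lborel (\<lambda>x. a x * k x)" "integrable lborel (\<lambda>x. b x * k x)"
  if "k \<in> borel_measurable borel" "!!x. \<bar>k x\<bar> \<le> (E::real)" for k E
 proof -
  have "integrable lborel (\<lambda>x. c x * k x)" if c: "integrable lborel c" for c
  proof (rule Bochner_Integration.integrable_bound)
   show "integrable lborel (\<lambda>x. E * c x)" using c by simp
   show "(\<lambda>x. c x * k x) \<in> borel_measurable lborel" using c \<open>k \<in> _\<close> by auto
   have E: "E \<ge> 0" using \<open>!!x. \<bar>k x\<bar> \<le> E\<close>[of undefined] by linarith
   show "AE x in lborel. norm (c x * k x) \<le> norm (E * c x)"
    using \<open>!!x. \<bar>k x\<bar> \<le> E\<close> E by (intro AE_I2) (simp add: abs_mult mult.commute[of E] mult_left_mono)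
  qed
  then show "integrable lborel (\<lambda>x. a x * k x)" "integrable lborel (\<lambda>x. b x * k x)" using ab by auto
 qed
 have split: "(\<integral>x. k x \<partial>D a) - (\<integral>x. k x \<partial>D b) = (\<integral>x. h x * k x \<partial>lborel)"
  if k: "k \<in> borel_measurable borel" "!!x. \<bar>k x\<bar> \<le> (E::real)" for k E
 proof -
  have "(\<integral>x. a x * k x - b x * k x \<partial>lborel) = (\<integral>x. h x * k x \<partial>lborel)"
   by (rule Bochner_Integration.integral_cong) (simp_all add: a0(3)[symmetric] left_diff_distrib)
  then show ?thesis using int[OF k] by (simp add: da(3)[OF k(1)] db(3)[OF k(1)])
 qed
 \<comment> \<open>Two variations of \<open>\<nu>\<close>, the measures with the positive and
   negative part of \<open>h\<close> as densities, and two variations of \<open>\<sigma>\<close>;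
   \<open>c\<close> carries their signs with the right-hand side moved over.\<close>
 define P where "P = (\<lambda>i::nat. [positive_variation ?M \<nu>, positive_variation ?M (\<lambda>A. - \<nu> A), D a, D b,
   positive_variation ?M \<sigma>, positive_variation ?M (\<lambda>A. - \<sigma> A)] ! i)"
 define c where "c = (\<lambda>i::nat. [1, -1, -1, 1, -1, 1 :: real] ! i)"
 have I: "{..<6::nat} = {0, 1, 2, 3, 4, 5}" by auto
 have "(\<Sum>i<6. c i * (\<integral>x. \<phi> x \<partial>P i)) = 0"
 proof (rule integral_linear_relation)
  show "finite {..<6::nat}" by simp
  have "\<forall>i\<in>{..<6}. finite_measure (P i) \<and> sets (P i) = sets ?M"
   unfolding I by (simp add: P_def p.finite_positive_variation n.finite_positive_variation s.finite_positive_variation t.finite_positive_variation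
    p.sets_positive_variation n.sets_positive_variation s.sets_positive_variation t.sets_positive_variation da(1,2) db(1,2))
  note PP = this
  show "finite_measure (P i)" if "i \<in> {..<6}" for i using PP[rule_format, OF that] by (rule conjunct1)
  show "sets (P i) = sets ?M" if "i \<in> {..<6}" for i using PP[rule_format, OF that] by (rule conjunct2)
  show "\<phi> \<in> borel_measurable ?M" using \<phi>(1) by (simp add: measurable_restrict_space1)
  show "\<bar>\<phi> x\<bar> \<le> C" for x by (rule \<phi>(2))
  fix A assume A: "A \<in> sets ?M"
  then have Ab: "A \<in> sets borel" by (simp add: sets_MM[OF \<Omega>])
  have sa: "A \<in> sets (D a)" "A \<in> sets (D b)" using A by (simp_all add: da(2) db(2))
  have "measure (D a) A - measure (D b) A = (\<integral>x. h x * indicator A x \<partial>lborel)"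
   using split[of "indicator A" 1, OF borel_measurable_indicator[OF Ab]]
   unfolding integral_indicator_sets[OF sa(1)] integral_indicator_sets[OF sa(2)] by (simp add: Ab)
  then show "(\<Sum>i<6. c i * measure (P i) A) = 0"
   using p.jordan_decomposition[OF A] s.jordan_decomposition[OF A] dec[OF A]
   unfolding I by (simp add: P_def c_def)
 qed
 then show ?thesis using split[OF \<phi>] unfolding I signed_integral_def by (simp add: P_def c_def)
qed

text \<open>
 The dual formulation of \<open>\<bar>Du - A \<L>\<bar>(ball x (2r)) = o(r\<^sup>n)\<close>.
\<close>

definition differential_point :: "(real^'n => real^'n) => real^'n^'n => real^'n => bool" where
 "differential_point u A x \<longleftrightarrow> (\<forall>\<epsilon>>0. \<exists>r0>0. \<forall>r. 0 < r \<and> r < r0 -->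
   (\<forall>\<phi> i j. smooth_test_function (ball x (2 * r)) \<phi> --> (\<forall>z. \<bar>\<phi> z\<bar> \<le> 1) -->
    \<bar>(\<integral>z. u z $ i * partial_deriv j \<phi> z \<partial>lborel) + A $ i $ j * (\<integral>z. \<phi> z \<partial>lborel)\<bar> \<le> \<epsilon> * r ^ CARD('n)))"

text \<open>The singular part is expressed as the restriction of an entry of the derivative itself
  to a null set, since such a restriction is again a bounded signed measure.\<close>

lemma BV_singular_part:
 fixes g :: "real^'n => real^'n"
 assumes \<Omega>: "open \<Omega>" and g: "g \<in> BV \<Omega>" and Gt: "represents \<Omega> (BV_gradient \<Omega> g) Gt"
 shows "\<exists>N. N \<in> sets (borel_on \<Omega>) \<and> emeasure lborel N = 0 \<and>
  (\<forall>A\<in>sets (borel_on \<Omega>).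
   BV_derivative \<Omega> g A $ i $ j = (\<integral>x. Gt x $ i $ j * indicator A x \<partial>lborel) + BV_derivative \<Omega> g (A \<inter> N) $ i $ j)"
proof -
 let ?M = "borel_on \<Omega>" and ?\<mu> = "BV_derivative \<Omega> g"
 have vm: "vector_measure ?M ?\<mu>"
  using BV_derivative_is_measure_derivative[OF g] by (simp add: is_measure_derivative_def)
 obtain \<mu>a \<mu>s where d: "lebesgue_decomposition \<Omega> ?\<mu> \<mu>a \<mu>s"
  and \<mu>a: "!!A. A \<in> sets ?M ==> \<mu>a A = (LINT x|lebesgue_on A. BV_gradient \<Omega> g x)"
  using is_BV_gradient_BV_gradient[OF \<Omega> g] unfolding is_BV_gradient_def by blast
 obtain N where N: "N \<in> sets ?M" "emeasure lborel N = 0" "total_variation ?M \<mu>s (\<Omega> - N) = 0"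
  and vs: "vector_measure ?M \<mu>s" and dec: "!!A. A \<in> sets ?M ==> ?\<mu> A = \<mu>a A + \<mu>s A"
  using d unfolding lebesgue_decomposition_def by blast
 have Gti: "integrable lborel Gt" and neg: "negligible {x\<in>\<Omega>. Gt x ~= BV_gradient \<Omega> g x}"
  using Gt by (auto simp: represents_def)
 have Gtm: "Gt \<in> borel_measurable borel" using Gti by simp
 have key: "?\<mu> A $ i $ j = (\<integral>x. Gt x $ i $ j * indicator A x \<partial>lborel) + ?\<mu> (A \<inter> N) $ i $ j" if A: "A \<in> sets ?M" for A
 proof -
  have Ab: "A \<in> sets borel" "A \<subseteq> \<Omega>" using A by (simp_all add: sets_MM[OF \<Omega>])
  have Nb: "N \<in> sets borel" using N by (simp add: sets_MM[OF \<Omega>])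
  have AN: "A - N \<in> sets ?M" "A \<inter> N \<in> sets ?M" using A N by auto
  have ANb: "A - N \<in> sets borel" using Ab Nb by auto
  have "(A - N) \<union> (A \<inter> N) = A" by blast
  then have m1: "?\<mu> A = ?\<mu> (A - N) + ?\<mu> (A \<inter> N)"
   using vector_measure_Un[OF vm AN] by auto
  have "\<Omega> - N \<in> sets ?M" using N \<Omega> Nb by (auto simp: sets_MM[OF \<Omega>])
  then have "ennreal (norm (\<mu>s (A - N))) \<le> 0"
   using total_variation_ge[OF vs, of "\<Omega> - N" "A - N"] AN(1) Ab(2) N(3) by auto
  then have "\<mu>s (A - N) = 0" by (simp add: ennreal_le_iff)
  moreover have m: "(\<lambda>x. indicator A x *\<^sub>R Gt x) \<in> borel_measurable lebesgue"
   using Gtm Ab by (intro measurable_completion) auto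
  moreover have AE: "AE x in lebesgue. indicator (A - N) x *\<^sub>R BV_gradient \<Omega> g x = indicator A x *\<^sub>R Gt x"
  proof (rule AE_I')
   show "{x\<in>\<Omega>. Gt x ~= BV_gradient \<Omega> g x} \<union> N \<in> null_sets lebesgue"
    using neg N(1,2) Nb by (intro null_sets.Un) (auto simp: negligible_iff_null_sets intro!: null_sets_completionI)
   show "{x \<in> space lebesgue. indicator (A - N) x *\<^sub>R BV_gradient \<Omega> g x ~= indicator A x *\<^sub>R Gt x}
     \<subseteq> {x\<in>\<Omega>. Gt x ~= BV_gradient \<Omega> g x} \<union> N"
    using Ab by (auto simp: indicator_def split: if_splits)
  qed
  moreover have AE': "AE x in lebesgue. indicator A x *\<^sub>R Gt x = indicator (A - N) x *\<^sub>R BV_gradient \<Omega> g x"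
   using AE by (rule AE_mp) (auto intro!: AE_I2)
  ultimately have "?\<mu> (A - N) = (LINT x|lebesgue_on (A - N). BV_gradient \<Omega> g x)"
   using dec[OF AN(1)] \<mu>a[OF AN(1)] by simp
  also have "\<dots> = (\<integral>x. indicator (A - N) x *\<^sub>R BV_gradient \<Omega> g x \<partial>lebesgue)"
   using ANb by (intro integral_lebesgue_on) auto
  also have "\<dots> = (\<integral>x. indicator A x *\<^sub>R Gt x \<partial>lebesgue)"
   by (rule integral_cong_AE[OF borel_measurable_complete_AE[OF completion.complete_measure_axioms m AE'] m AE])
  also have "\<dots> = (\<integral>x. indicator A x *\<^sub>R Gt x \<partial>lborel)"
   using Gtm Ab by (intro integral_completion) auto
  finally have "?\<mu> (A - N) $ i $ j = (\<integral>x. indicator A x *\<^sub>R Gt x \<partial>lborel) $ i $ j" by simp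
  also have "\<dots> = (\<integral>x. (indicator A x *\<^sub>R Gt x) $ i $ j \<partial>lborel)"
   using Ab(1) by (intro integral_bounded_linear[OF bounded_linear_matrix_entry, symmetric] integrable_mult_indicator Gti) simp
  finally show ?thesis using m1 by (simp add: mult.commute)
 qed
 show ?thesis by (intro exI[of _ N] conjI ballI N(1,2) key)
qed

lemma bounded_signed_measure_restrict:
 assumes "bounded_signed_measure M \<nu> B" and N: "N \<in> sets M"
 shows "bounded_signed_measure M (\<lambda>A. \<nu> (A \<inter> N)) B"
proof -
 interpret bounded_signed_measure M \<nu> B by fact
 show ?thesis
 proof
  show "vector_measure M (\<lambda>A. \<nu> (A \<inter> N))"
   unfolding vector_measure_def
  proof (intro conjI allI impI)
   show "\<nu> ({} \<inter> N) = 0" using vm by (simp add: vector_measure_def)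
   fix A :: "nat => 'a set" assume A: "range A \<subseteq> sets M" "disjoint_family A"
   have "range (\<lambda>i. A i \<inter> N) \<subseteq> sets M" "disjoint_family (\<lambda>i. A i \<inter> N)"
    using A N by (auto simp: disjoint_family_on_def)
   then have "(\<lambda>i. \<nu> (A i \<inter> N)) sums \<nu> (\<Union>i. A i \<inter> N)" using vm unfolding vector_measure_def by blast
   then show "(\<lambda>i. \<nu> (A i \<inter> N)) sums \<nu> (\<Union> (range A) \<inter> N)" by simp
  qed
  show "\<bar>\<nu> (A \<inter> N)\<bar> \<le> B" if "A \<in> sets M" for A using that N by (intro bdd) auto
 qed
qed

text \<open>The variation of the part restricted to \<open>N\<close> does not charge the complement
  of \<open>N\<close>, so it has density zero at almost every point there. It lives on
  \<open>\<Omega>\<close> and is pushed forward to the whole space, where balls may stick out of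
  \<open>\<Omega>\<close>. Applied to \<open>- \<nu>\<close> the lemma covers the negative
  variation.\<close>

lemma singular_part_density_zero:
 fixes \<Omega> :: "(real^'n) set"
 assumes \<Omega>: "open \<Omega>" and \<nu>: "bounded_signed_measure (borel_on \<Omega>) \<nu> B" and N: "N \<in> sets (borel_on \<Omega>)"
 defines "P \<equiv> positive_variation (borel_on \<Omega>) (\<lambda>A. \<nu> (A \<inter> N))"
 shows "negligible {x\<in>\<Omega> - N. \<not> ((\<lambda>r. measure P (cball x r \<inter> \<Omega>) / r ^ CARD('n)) \<longlongrightarrow> 0) (at_right 0)}"
proof -
 let ?M = "borel_on \<Omega>"
 interpret s: bounded_signed_measure ?M "\<lambda>A. \<nu> (A \<inter> N)" B by (rule bounded_signed_measure_restrict[OF \<nu> N])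
 have P: "finite_measure P" "sets P = sets ?M" "space P = \<Omega>"
  unfolding P_def using s.finite_positive_variation s.sets_positive_variation s.space_positive_variation
  by (simp_all add: space_MM[OF \<Omega>])
 have Nb: "N \<in> sets borel" "N \<subseteq> \<Omega>" using N by (simp_all add: sets_MM[OF \<Omega>])
 have im: "(\<lambda>x. x) \<in> measurable P borel"
  unfolding measurable_def using \<Omega> by (auto simp: P sets_MM[OF \<Omega>])
 define Q where "Q = distr P borel (\<lambda>x. x)"
 have mQ: "measure Q A = measure P (A \<inter> \<Omega>)" if "A \<in> sets borel" for A
  using measure_distr[OF im that] by (simp add: Q_def P(3) vimage_def)
 have eQ: "emeasure Q A = emeasure P (A \<inter> \<Omega>)" if "A \<in> sets borel" for A
  using emeasure_distr[OF im that] by (simp add: Q_def P(3) vimage_def)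
 have "negligible {x\<in>\<Omega> - N. \<not> ((\<lambda>r. measure Q (cball x r) / r ^ CARD('n)) \<longlongrightarrow> 0) (at_right 0)}"
 proof (rule measure_density_zero)
  show "finite_measure Q" unfolding Q_def by (rule finite_measure.finite_measure_distr[OF P(1) im])
  show "sets Q = sets borel" by (simp add: Q_def)
  show ON: "\<Omega> - N \<in> sets borel" using \<Omega> Nb by auto
  have "\<Omega> - N \<in> sets ?M" using ON by (simp add: sets_MM[OF \<Omega>])
  then have "emeasure P (\<Omega> - N) = s.pfun (\<Omega> - N)" unfolding P_def by (rule s.emeasure_positive_variation)
  also have "\<dots> \<le> 0"
  proof (rule SUP_least)
   fix A assume "A \<in> {B \<in> sets ?M. B \<subseteq> \<Omega> - N}"
   then have "A \<inter> N = {}" by auto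
   moreover have "\<nu> {} = 0" using \<nu> by (simp add: bounded_signed_measure_def vector_measure_def)
   ultimately show "ennreal (\<nu> (A \<inter> N)) \<le> 0" by simp
  qed
  finally show "emeasure Q (\<Omega> - N) = 0" using eQ[OF ON] by (simp add: Int_absorb2)
 qed
 moreover have "measure Q (cball x r) = measure P (cball x r \<inter> \<Omega>)" for x r by (rule mQ) simp
 ultimately show ?thesis by simp
qed

text \<open>Up to sign, integration by parts writes the quantity to be bounded as the integral of
  \<open>G\<close> minus its value at \<open>x\<close> against the test function, plus a singular
  integral. The first is small at Lebesgue points of the entries of \<open>G\<close>, the second
  where both variations of the singular part have density zero.\<close>

lemma AE_differential_point:
 fixes g :: "real^'n => real^'n"
 assumes \<Omega>: "open \<Omega>" and g: "g \<in> BV \<Omega>" and u: "represents \<Omega> g u"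
 shows "negligible {x\<in>\<Omega>. \<not> differential_point u (BV_gradient \<Omega> g x) x}"
proof -
 let ?M = "borel_on \<Omega>" and ?\<mu> = "BV_derivative \<Omega> g" and ?n = "CARD('n)"
 let ?B = "enn2real (total_variation ?M ?\<mu> \<Omega>)"
 have "integrable (lebesgue_on \<Omega>) (BV_gradient \<Omega> g)"
  using is_BV_gradient_BV_gradient[OF \<Omega> g] by (simp add: is_BV_gradient_def)
 then obtain G where G: "represents \<Omega> (BV_gradient \<Omega> g) G"
  using represents_exists[of \<Omega> "BV_gradient \<Omega> g"] \<Omega> by auto
 have Gi: "integrable lborel G" and G0: "!!x. x \<notin> \<Omega> ==> G x = 0" using G by (auto simp: represents_def)
 have Gij: "integrable lborel (\<lambda>x. G x $ i $ j)" for i j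
  by (rule integrable_bounded_linear[OF bounded_linear_matrix_entry Gi])
 define N where "N = (\<lambda>i j. SOME N. N \<in> sets ?M \<and> emeasure lborel N = 0 \<and>
  (\<forall>A\<in>sets ?M. ?\<mu> A $ i $ j = (\<integral>x. G x $ i $ j * indicator A x \<partial>lborel) + ?\<mu> (A \<inter> N) $ i $ j))"
 have N3: "N i j \<in> sets ?M \<and> emeasure lborel (N i j) = 0 \<and>
  (\<forall>A\<in>sets ?M. ?\<mu> A $ i $ j = (\<integral>x. G x $ i $ j * indicator A x \<partial>lborel) + ?\<mu> (A \<inter> N i j) $ i $ j)" for i j
  unfolding N_def by (rule someI_ex[OF BV_singular_part[OF \<Omega> g G]])
 note N = N3[THEN conjunct1] N3[THEN conjunct2, THEN conjunct1] and dec = N3[THEN conjunct2, THEN conjunct2]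
 define \<sigma> where "\<sigma> = (\<lambda>i j A. ?\<mu> (A \<inter> N i j) $ i $ j)"
 have b\<mu>: "bounded_signed_measure ?M (\<lambda>A. ?\<mu> A $ i $ j) ?B" for i j by (rule BV_derivative_bounded[OF g])
 have b\<sigma>: "bounded_signed_measure ?M (\<sigma> i j) ?B" for i j
  unfolding \<sigma>_def by (rule bounded_signed_measure_restrict[OF b\<mu> N(1)])
 let ?p = "\<lambda>i j. positive_variation ?M (\<sigma> i j)" and ?q = "\<lambda>i j. positive_variation ?M (\<lambda>A. - \<sigma> i j A)"
 have fin: "finite_measure (?p i j)" "finite_measure (?q i j)" "sets (?p i j) = sets ?M" "sets (?q i j) = sets ?M" for i j
 proof -
  interpret bounded_signed_measure ?M "\<sigma> i j" ?B by (rule b\<sigma>)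
  interpret n: bounded_signed_measure ?M "\<lambda>A. - \<sigma> i j A" ?B by (rule uminus_bounded_signed_measure)
  show "finite_measure (?p i j)" "finite_measure (?q i j)" "sets (?p i j) = sets ?M" "sets (?q i j) = sets ?M"
   by (rule finite_positive_variation n.finite_positive_variation sets_positive_variation n.sets_positive_variation)+
 qed
 let ?E1 = "{x\<in>\<Omega>. G x ~= BV_gradient \<Omega> g x}"
 let ?E2 = "\<lambda>i j. {x. \<not> lebesgue_point (\<lambda>x. G x $ i $ j) x}"
 let ?E3 = "\<lambda>i j. {x\<in>\<Omega> - N i j. \<not> ((\<lambda>r. measure (?p i j) (cball x r \<inter> \<Omega>) / r ^ ?n) \<longlongrightarrow> 0) (at_right 0)}"
 let ?E4 = "\<lambda>i j. {x\<in>\<Omega> - N i j. \<not> ((\<lambda>r. measure (?q i j) (cball x r \<inter> \<Omega>) / r ^ ?n) \<longlongrightarrow> 0) (at_right 0)}"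
 let ?E = "?E1 \<union> (\<Union>i. \<Union>j. ?E2 i j \<union> N i j \<union> ?E3 i j \<union> ?E4 i j)"
 have e3: "negligible (?E3 i j)" for i j
  using singular_part_density_zero[OF \<Omega> b\<mu> N(1)] unfolding \<sigma>_def .
 have e4: "negligible (?E4 i j)" for i j
  using singular_part_density_zero[OF \<Omega> bounded_signed_measure.uminus_bounded_signed_measure[OF b\<mu>] N(1)] unfolding \<sigma>_def .
 have eN: "negligible (N i j)" for i j
  using N[of i j] by (auto simp: negligible_iff_null_sets sets_MM[OF \<Omega>] intro!: null_sets_completionI)
 have UN: "negligible (\<Union>i. F i)" if "!!i. negligible (F i)" for F :: "'n => (real^'n) set"
  by (rule negligible_Union) (use that in auto)
 have "negligible (\<Union>i. \<Union>j. ?E2 i j \<union> N i j \<union> ?E3 i j \<union> ?E4 i j)"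
  by (intro UN negligible_Un AE_lebesgue_point Gij eN e3 e4)
 moreover have "negligible ?E1" using G unfolding represents_def by (elim conjE)
 ultimately have nE: "negligible ?E" by (rule negligible_Un[rotated])
 show ?thesis
 proof (rule negligible_subset[OF nE], rule subsetI, rule ccontr)
  fix x assume x: "x \<in> {x\<in>\<Omega>. \<not> differential_point u (BV_gradient \<Omega> g x) x}" and nx: "x \<notin> ?E"
  have x\<Omega>: "x \<in> \<Omega>" and bad: "\<not> differential_point u (BV_gradient \<Omega> g x) x" using x by simp_all
  have xN: "x \<in> \<Omega> - N i j" for i j using nx x\<Omega> by simp
  have Gx: "G x = BV_gradient \<Omega> g x" using nx x\<Omega> by simp
  have lp: "lebesgue_point (\<lambda>x. G x $ i $ j) x" for i j using nx by simp
  have pz: "((\<lambda>r. measure (?p i j) (cball x r \<inter> \<Omega>) / r ^ ?n) \<longlongrightarrow> 0) (at_right 0)" for i j using nx xN[of i j] by auto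
  have qz: "((\<lambda>r. measure (?q i j) (cball x r \<inter> \<Omega>) / r ^ ?n) \<longlongrightarrow> 0) (at_right 0)" for i j using nx xN[of i j] by auto
  have "differential_point u (BV_gradient \<Omega> g x) x"
   unfolding differential_point_def
  proof (intro allI impI)
   fix \<epsilon> :: real assume \<epsilon>: "\<epsilon> > 0"
   \<comment> \<open>Three errors of size e (2r)^n occur: one from the absolutely continuous part
     and one from each variation of the singular part.\<close>
   define e where "e = \<epsilon> / (3 * 2 ^ ?n)"
   have e: "e > 0" using \<epsilon> by (simp add: e_def)
   obtain d where d: "d > 0" "ball x d \<subseteq> \<Omega>" using \<Omega> x\<Omega> openE by blast
   let ?Q = "\<lambda>i j r. (\<integral>y. \<bar>G y $ i $ j - G x $ i $ j\<bar> * indicator (ball x r) y \<partial>lborel) \<le> e * r ^ ?n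
     \<and> measure (?p i j) (cball x r \<inter> \<Omega>) \<le> e * r ^ ?n \<and> measure (?q i j) (cball x r \<inter> \<Omega>) \<le> e * r ^ ?n"
   have pos: "eventually (\<lambda>r::real. r > 0) (at_right 0)" by (simp add: eventually_at_right_less)
   have le: "eventually (\<lambda>r. F r \<le> e * r ^ ?n) (at_right 0)" if F: "((\<lambda>r. F r / r ^ ?n) \<longlongrightarrow> 0) (at_right 0)" for F :: "real => real"
   proof -
    have "eventually (\<lambda>r. F r / r ^ ?n < e) (at_right 0)" by (rule order_tendstoD(2)[OF F e])
    then show ?thesis using pos by eventually_elim (simp add: field_simps)
   qed
   have ev: "eventually (?Q i j) (at_right 0)" for i j
    by (intro eventually_conj le pz qz lp[unfolded lebesgue_point_def])
   have "eventually (\<lambda>r. \<forall>i. \<forall>j. ?Q i j r) (at_right 0)"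
    by (intro eventually_all_finite ev)
   then obtain b where b: "b > 0" "!!r i j. 0 < r ==> r < b ==> ?Q i j r"
    unfolding eventually_at_right_field by blast
   show "\<exists>r0>0. \<forall>r. 0 < r \<and> r < r0 --> (\<forall>\<phi> i j. smooth_test_function (ball x (2 * r)) \<phi> --> (\<forall>z. \<bar>\<phi> z\<bar> \<le> 1) -->
    \<bar>(\<integral>z. u z $ i * partial_deriv j \<phi> z \<partial>lborel) + BV_gradient \<Omega> g x $ i $ j * (\<integral>z. \<phi> z \<partial>lborel)\<bar> \<le> \<epsilon> * r ^ ?n)"
   proof (intro exI[of _ "min b d / 2"] conjI allI impI)
    show "min b d / 2 > 0" using b d by simp
    fix r \<phi> i j assume r: "0 < r \<and> r < min b d / 2" and \<phi>: "smooth_test_function (ball x (2 * r)) \<phi>" "\<forall>z. \<bar>\<phi> z\<bar> \<le> 1"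
    let ?r = "2 * r"
    have r': "0 < ?r" "?r < b" "?r < d" using r by auto
    note Q = b(2)[OF r'(1,2), of i j]
    have sub: "ball x ?r \<subseteq> \<Omega>" using d(2) r'(3) by (meson less_imp_le subset_ball subset_trans)
    have t: "smooth_test_function \<Omega> \<phi>"
     using \<phi>(1) sub unfolding smooth_test_function_def compact_support_in_def by blast
    have \<phi>c: "continuous_on UNIV \<phi>" using \<phi>(1) C_k.simps(1)[of \<phi>] unfolding smooth_test_function_def by blast
    then have \<phi>m: "\<phi> \<in> borel_measurable borel" by (rule borel_measurable_continuous_onI)
    have \<phi>0: "\<phi> z = 0" if "z \<notin> ball x ?r" for z
    proof (rule ccontr)
     assume "\<phi> z ~= 0"
     then have "z \<in> closure {z. \<phi> z ~= 0}" by (intro subsetD[OF closure_subset]) simp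
     then show False using \<phi>(1) that unfolding smooth_test_function_def compact_support_in_def by blast
    qed
    have \<phi>i: "integrable lborel \<phi>"
    proof (rule Bochner_Integration.integrable_bound)
     show "integrable lborel (\<lambda>z. indicator (ball x ?r) z :: real)"
      by (intro integrable_real_indicator emeasure_bounded_finite) auto
     show "\<phi> \<in> borel_measurable lborel" using \<phi>m by simp
     show "AE z in lborel. norm (\<phi> z) \<le> norm (indicator (ball x ?r) z :: real)"
      using \<phi>(2) \<phi>0 by (intro AE_I2) (auto simp: indicator_def)
    qed
    have pdm: "partial_deriv j \<phi> \<in> borel_measurable borel"
     using \<phi>(1) C_k.simps(1)[of "partial_deriv j \<phi>"] C_k.simps(2)[of 0 \<phi>] unfolding smooth_test_function_def
     by (metis borel_measurable_continuous_onI)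
    have "(\<integral>z. u z $ i * partial_deriv j \<phi> z \<partial>lborel) = (LINT x|lebesgue_on \<Omega>. g x $ i * partial_deriv j \<phi> x)"
     using \<Omega> by (intro represents_integral[OF _ u pdm, symmetric]) auto
    also have "\<dots> = - signed_integral ?M (\<lambda>A. ?\<mu> A $ i $ j) \<phi>"
     using BV_derivative_is_measure_derivative[OF g] t unfolding is_measure_derivative_def by blast
    also have "signed_integral ?M (\<lambda>A. ?\<mu> A $ i $ j) \<phi> = (\<integral>z. G z $ i $ j * \<phi> z \<partial>lborel) + signed_integral ?M (\<sigma> i j) \<phi>"
    proof (rule signed_integral_decomposition[OF \<Omega> b\<mu> b\<sigma> Gij])
     show "G z $ i $ j = 0" if "z \<notin> \<Omega>" for z using G0[OF that] by simp
     show "?\<mu> A $ i $ j = (\<integral>x. G x $ i $ j * indicator A x \<partial>lborel) + \<sigma> i j A" if "A \<in> sets ?M" for A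
      using dec[of i j] that unfolding \<sigma>_def by blast
     show "\<phi> \<in> borel_measurable borel" by (rule \<phi>m)
     show "\<bar>\<phi> z\<bar> \<le> 1" for z using \<phi>(2) by blast
    qed
    finally have eq: "(\<integral>z. u z $ i * partial_deriv j \<phi> z \<partial>lborel) = - (\<integral>z. G z $ i $ j * \<phi> z \<partial>lborel) - signed_integral ?M (\<sigma> i j) \<phi>"
     by simp
    have bm: "ball x ?r \<in> sets ?M" using sub by (simp add: sets_MM[OF \<Omega>])
    have s: "\<bar>signed_integral ?M (\<sigma> i j) \<phi>\<bar> \<le> 1 * (measure (?p i j) (ball x ?r) + measure (?q i j) (ball x ?r))"
     by (rule signed_integral_bound[OF \<Omega> b\<sigma> \<phi>m _ \<phi>0 bm]) (use \<phi>(2) in auto)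
    have mono: "measure P (ball x ?r) \<le> measure P (cball x ?r \<inter> \<Omega>)" if "finite_measure P" "sets P = sets ?M" for P
     using that(2) sub \<Omega> ball_subset_cball by (intro finite_measure.finite_measure_mono[OF that(1)]) (auto simp: sets_MM[OF \<Omega>])
    have sb: "\<bar>signed_integral ?M (\<sigma> i j) \<phi>\<bar> \<le> 2 * (e * ?r ^ ?n)"
     using s add_mono[OF order_trans[OF mono[OF fin(1,3)[of i j]] Q[THEN conjunct2, THEN conjunct1]]
       order_trans[OF mono[OF fin(2,4)[of i j]] Q[THEN conjunct2, THEN conjunct2]]]
     unfolding mult_1 mult_2 by (rule order_trans)
    have ai: "integrable lborel (\<lambda>y. \<bar>G y $ i $ j - G x $ i $ j\<bar> * indicator (ball x ?r) y)"
     by (rule integrable_diff_const_ball[OF Gij])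
    have gi: "integrable lborel (\<lambda>z. (G z $ i $ j - G x $ i $ j) * \<phi> z)"
    proof (rule Bochner_Integration.integrable_bound[OF ai])
     show "(\<lambda>z. (G z $ i $ j - G x $ i $ j) * \<phi> z) \<in> borel_measurable lborel"
      using Gij[of i j] \<phi>m by auto
     show "AE z in lborel. norm ((G z $ i $ j - G x $ i $ j) * \<phi> z) \<le> norm (\<bar>G z $ i $ j - G x $ i $ j\<bar> * indicator (ball x ?r) z)"
      using \<phi>(2) \<phi>0 by (intro AE_I2) (auto simp: indicator_def abs_mult intro!: mult_left_le)
    qed
    have i2: "integrable lborel (\<lambda>z. G x $ i $ j * \<phi> z)" using \<phi>i by simp
    have i3: "integrable lborel (\<lambda>z. G z $ i $ j * \<phi> z)"
     using Bochner_Integration.integrable_add[OF gi i2] by (simp add: algebra_simps)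
    have "(\<integral>z. (G z $ i $ j - G x $ i $ j) * \<phi> z \<partial>lborel) = (\<integral>z. G z $ i $ j * \<phi> z \<partial>lborel) - G x $ i $ j * (\<integral>z. \<phi> z \<partial>lborel)"
     using Bochner_Integration.integral_diff[OF i3 i2] by (simp add: left_diff_distrib)
    moreover have "\<bar>\<integral>z. (G z $ i $ j - G x $ i $ j) * \<phi> z \<partial>lborel\<bar> \<le> (\<integral>y. \<bar>G y $ i $ j - G x $ i $ j\<bar> * indicator (ball x ?r) y \<partial>lborel)"
    proof (rule order_trans[OF integral_abs_bound integral_mono[OF integrable_abs[OF gi] ai]])
     show "\<bar>(G z $ i $ j - G x $ i $ j) * \<phi> z\<bar> \<le> \<bar>G z $ i $ j - G x $ i $ j\<bar> * indicator (ball x ?r) z" for z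
      using \<phi>(2) \<phi>0[of z] by (cases "z \<in> ball x ?r") (auto simp: abs_mult intro!: mult_left_le)
    qed
    ultimately have "\<bar>(\<integral>z. u z $ i * partial_deriv j \<phi> z \<partial>lborel) + G x $ i $ j * (\<integral>z. \<phi> z \<partial>lborel)\<bar> \<le> 3 * (e * ?r ^ ?n)"
     using eq sb Q[THEN conjunct1] by linarith
    also have "\<dots> = \<epsilon> * r ^ ?n" by (simp add: e_def power_mult_distrib)
    finally show "\<bar>(\<integral>z. u z $ i * partial_deriv j \<phi> z \<partial>lborel) + BV_gradient \<Omega> g x $ i $ j * (\<integral>z. \<phi> z \<partial>lborel)\<bar> \<le> \<epsilon> * r ^ ?n"
     by (simp add: Gx)
   qed
  qed
  then show False using bad by simp
 qed
qed

section \<open>Blow-ups of weakly-* convergent sequences\<close>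

text \<open>The index set will consist of all closed balls in \<Omega>; it is uncountable, so a
  subsequence converging at every index need not exist. A cluster point in the product topology
  exists by Tychonoff, and it is enough: for finitely many indices and any property that holds
  eventually, some \<open>k\<close> serves both.\<close>

lemma bounded_functions_cluster_point:
 fixes m :: "nat => 'i => real"
 assumes b: "!!i. i \<in> I ==> \<exists>C. \<forall>k. \<bar>m k i\<bar> \<le> C"
 obtains L where "!!J \<eta> Q. finite J ==> J \<subseteq> I ==> \<eta> > 0 ==> eventually Q sequentially ==> \<exists>k. Q k \<and> (\<forall>i\<in>J. \<bar>m k i - L i\<bar> < \<eta>)"
proof -
 obtain C where C: "!!i k. i \<in> I ==> \<bar>m k i\<bar> \<le> C i" using b by metis
 \<comment> \<open>Outside \<open>I\<close> the factors are single points, so that the full product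
   is compact.\<close>
 define S where "S = (\<lambda>i. if i \<in> I then {- C i..C i} else {0})"
 define m' where "m' = (\<lambda>k i. if i \<in> I then m k i else 0)"
 have "compactin (product_topology (\<lambda>i. euclidean) UNIV) (PiE UNIV S)"
  unfolding compactin_PiE by (simp add: S_def)
 then have "compact (PiE UNIV S)" unfolding euclidean_product_topology by simp
 moreover have "eventually (\<lambda>x. x \<in> PiE UNIV S) (filtermap m' sequentially)"
  unfolding eventually_filtermap
 proof (rule always_eventually, rule allI)
  fix k show "m' k \<in> PiE UNIV S"
   using C[of _ k] by (auto simp: m'_def S_def abs_le_iff minus_le_iff)
 qed
 moreover have "filtermap m' sequentially ~= bot" by (simp add: filtermap_bot_iff)
 ultimately obtain L where L: "inf (nhds L) (filtermap m' sequentially) ~= bot"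
  unfolding compact_filter by blast
 show ?thesis
 proof (rule that[of L])
  fix J \<eta> Q assume J: "finite J" "J \<subseteq> I" and \<eta>: "(\<eta>::real) > 0" and Q: "eventually Q sequentially"
  have "eventually (\<lambda>x. \<bar>x i - L i\<bar> < \<eta>) (nhds L)" for i
  proof -
   have "((\<lambda>x. x i) \<longlongrightarrow> L i) (nhds L)"
   proof -
    have "((\<lambda>x. x i) \<longlongrightarrow> L i) (at L)"
     using continuous_on_product_coordinates[of i, where ?'b = real] unfolding continuous_on_def by simp
    then show ?thesis by (simp only: tendsto_at_iff_tendsto_nhds[of "\<lambda>x. x i" L])
   qed
   from tendstoD[OF this \<eta>] show ?thesis by (simp add: dist_real_def)
  qed
  then have e1: "eventually (\<lambda>x. \<forall>i\<in>J. \<bar>x i - L i\<bar> < \<eta>) (nhds L)"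
   using J(1) by (intro eventually_ball_finite) auto
  have e2: "eventually (\<lambda>x. \<exists>k. Q k \<and> x = m' k) (filtermap m' sequentially)"
   unfolding eventually_filtermap using Q by eventually_elim blast
  have "eventually (\<lambda>x. (\<forall>i\<in>J. \<bar>x i - L i\<bar> < \<eta>) \<and> (\<exists>k. Q k \<and> x = m' k)) (inf (nhds L) (filtermap m' sequentially))"
   unfolding eventually_inf using e1 e2 by blast
  from eventually_happens'[OF L this] obtain k where k: "Q k" "\<forall>i\<in>J. \<bar>m' k i - L i\<bar> < \<eta>" by blast
  have "\<bar>m k i - L i\<bar> < \<eta>" if "i \<in> J" for i using k(2) that J(2) unfolding m'_def by (auto split: if_splits dest!: bspec)
  then show "\<exists>k. Q k \<and> (\<forall>i\<in>J. \<bar>m k i - L i\<bar> < \<eta>)" using k(1) by blast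
 qed
qed

lemma BV_mass_mono:
 assumes "open \<Omega>" "g \<in> BV \<Omega>" "A \<in> sets borel" "A \<subseteq> U" "U \<in> sets borel" "U \<subseteq> \<Omega>"
 shows "BV_mass \<Omega> g A \<le> BV_mass \<Omega> g U"
 using BV_mass_superadditive[OF assms(1,2), of "{()}" "\<lambda>_. A" U] assms by (simp add: disjoint_family_on_def)

text \<open>The constant M is chosen before the scale \<delta>, so shrinking \<delta> later does not
  worsen it. The index \<open>k\<close> may depend on everything else; the eventual property
  \<open>Q\<close> allows L^1 closeness to be asked of the same \<open>k\<close>. Finitely many
  centres are enough because curves get discretised.\<close>

definition mass_controlled :: "(real^'n) set => (nat => real^'n => real^'n) => real^'n => bool" where
 "mass_controlled \<Omega> fs x \<longleftrightarrow> (\<exists>M>0. \<forall>\<delta>>0. \<exists>r0>0. \<forall>r. 0 < r \<and> r < r0 -->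
   (\<forall>Y Q. finite Y \<and> Y \<subseteq> cball x r \<and> eventually Q sequentially -->
    (\<exists>k. Q k \<and> (\<forall>y\<in>Y. ball y (\<delta> * r) \<subseteq> \<Omega> \<and> BV_mass \<Omega> (fs k) (ball y (\<delta> * r)) \<le> M * (\<delta> * r) ^ CARD('n)))))"

text \<open>A maximal function argument for the cluster point \<open>L\<close> of the masses, which
  inherits superadditivity on disjoint balls. By Vitali almost every point lies in some
  \<open>E M\<close>, where \<open>L\<close> is at most M times the n-th power of small radii. If
  the point is also not porous for \<open>E M\<close>, each small ball nearby has a point of
  \<open>E M\<close> close to its centre and sits in the ball of twice its radius around that
  point.\<close>

lemma AE_mass_controlled_ball:
 fixes \<Omega> :: "(real^'n) set"
 assumes \<Omega>: "open \<Omega>" and fs: "!!k. fs k \<in> BV \<Omega>"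
  and bm: "!!x r. cball x r \<subseteq> \<Omega> ==> \<exists>C. \<forall>k. BV_mass \<Omega> (fs k) (ball x r) \<le> C"
  and a: "cball a R \<subseteq> \<Omega>" and R: "R > 0"
 shows "negligible {x\<in>ball a R. \<not> mass_controlled \<Omega> fs x}"
proof -
 let ?n = "CARD('n)" and ?w = "unit_ball_vol (real CARD('n))"
 let ?m = "\<lambda>k p. BV_mass \<Omega> (fs k) (ball (fst p) (snd p))"
 have "\<exists>C. \<forall>k. \<bar>?m k p\<bar> \<le> C" if "p \<in> {p. cball (fst p) (snd p) \<subseteq> \<Omega>}" for p
  using bm[of "fst p" "snd p"] that BV_mass_nonneg[of \<Omega>] by simp
 then obtain L where L: "!!J \<eta> Q. finite J ==> J \<subseteq> {p. cball (fst p) (snd p) \<subseteq> \<Omega>} ==> \<eta> > 0 ==> eventually Q sequentially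
   ==> \<exists>k. Q k \<and> (\<forall>p\<in>J. \<bar>?m k p - L p\<bar> < \<eta>)"
  using bounded_functions_cluster_point[of "{p. cball (fst p) (snd p) \<subseteq> \<Omega>}" ?m] by blast
 define E where "E = (\<lambda>M::nat. {x\<in>ball a R. \<forall>\<rho>. 0 < \<rho> \<and> \<rho> < 1 / (real M + 1) \<and> cball x \<rho> \<subseteq> ball a R --> L (x, \<rho>) \<le> real M * \<rho> ^ ?n})"
 define S where "S = ball a R - (\<Union>M. E M)"
 have superadd: "(\<Sum>p\<in>F. L p) \<le> L (a, R)"
  if F: "finite F" "!!p. p \<in> F ==> cball (fst p) (snd p) \<subseteq> ball a R"
   "pairwise (\<lambda>i j. disjnt (cball (fst i) (snd i)) (cball (fst j) (snd j))) F" for F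
 proof (rule field_le_epsilon)
  fix e :: real assume e: "e > 0"
  \<comment> \<open>One error of size \<open>\<eta>\<close> for each ball in \<open>F\<close> and
    one for the big ball.\<close>
  define \<eta> where "\<eta> = e / (real (card F) + 1)"
  have \<eta>: "\<eta> > 0" using e by (simp add: \<eta>_def)
  have sub: "insert (a, R) F \<subseteq> {p. cball (fst p) (snd p) \<subseteq> \<Omega>}"
  proof
   have FO: "cball (fst p) (snd p) \<subseteq> \<Omega>" if "p \<in> F" for p using F(2)[OF that] a ball_subset_cball by blast
   fix p assume "p \<in> insert (a, R) F"
   then show "p \<in> {p. cball (fst p) (snd p) \<subseteq> \<Omega>}" using FO[of p] a by (cases "p = (a, R)") simp_all
  qed
  obtain k where k: "\<forall>p\<in>insert (a, R) F. \<bar>?m k p - L p\<bar> < \<eta>"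
   using L[of "insert (a, R) F" \<eta> "\<lambda>_. True"] F(1) sub \<eta> by auto
  have "(\<Sum>p\<in>F. L p) \<le> (\<Sum>p\<in>F. ?m k p + \<eta>)"
   using k by (intro sum_mono) (smt (verit) insert_iff)
  also have "\<dots> = (\<Sum>p\<in>F. ?m k p) + real (card F) * \<eta>" by (simp add: sum.distrib)
  also have "(\<Sum>p\<in>F. ?m k p) \<le> BV_mass \<Omega> (fs k) (ball a R)"
  proof (rule BV_mass_superadditive[OF \<Omega> fs F(1)])
   show "disjoint_family_on (\<lambda>p. ball (fst p) (snd p)) F"
    unfolding disjoint_family_on_def
   proof (intro ballI impI)
    fix i j assume "i \<in> F" "j \<in> F" "i ~= j"
    then have "disjnt (cball (fst i) (snd i)) (cball (fst j) (snd j))" using F(3) by (simp add: pairwise_def)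
    then show "ball (fst i) (snd i) \<inter> ball (fst j) (snd j) = {}"
     using ball_subset_cball[of "fst i" "snd i"] ball_subset_cball[of "fst j" "snd j"] unfolding disjnt_def by blast
   qed
   show "ball (fst p) (snd p) \<subseteq> ball a R" if "p \<in> F" for p using F(2)[OF that] ball_subset_cball by blast
   show "ball a R \<subseteq> \<Omega>" using a ball_subset_cball by blast
  qed auto
  also have "BV_mass \<Omega> (fs k) (ball a R) \<le> L (a, R) + \<eta>" using k by auto
  finally have "(\<Sum>p\<in>F. L p) \<le> L (a, R) + (real (card F) + 1) * \<eta>" by (simp add: algebra_simps)
  also have "(real (card F) + 1) * \<eta> = e" by (simp add: \<eta>_def)
  finally show "(\<Sum>p\<in>F. L p) \<le> L (a, R) + e" .
 qed
 have "negligible S"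
  unfolding negligible_outer_le
 proof (intro allI impI)
  fix e :: real assume e: "e > 0"
  have L0: "L (a, R) \<ge> 0" using superadd[of "{}"] by simp
  \<comment> \<open>Balls violating the bound M have powers of radii summing to at most L (a, R) /
    M, which is small for large M.\<close>
  obtain M :: nat where M: "?w * L (a, R) / e < real M" using reals_Archimedean2 by blast
  have M0: "real M > 0" using M L0 e by (smt (verit) divide_nonneg_pos mult_nonneg_nonneg unit_ball_vol_nonneg of_nat_0_le_iff)
  let ?P = "\<lambda>x \<rho>. cball x \<rho> \<subseteq> ball a R \<and> L (x, \<rho>) > real M * \<rho> ^ ?n"
  have "\<exists>T. S \<subseteq> T \<and> T \<in> lmeasurable \<and> measure lebesgue T \<le> ?w * (L (a, R) / real M)"
  proof (rule vitali_packing_bound[of S ?P])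
   fix x and d :: real assume x: "x \<in> S" and d: "d > 0"
   obtain N :: nat where N: "1 / d < real N" using reals_Archimedean2 by blast
   have "1 / (real (max M N) + 1) < d"
   proof -
    have "1 / d < real (max M N) + 1" using N by simp
    then show ?thesis using d by (simp add: field_simps)
   qed
   moreover have "x \<notin> E (max M N)" "x \<in> ball a R" using x by (auto simp: S_def)
   then obtain \<rho> where \<rho>: "0 < \<rho>" "\<rho> < 1 / (real (max M N) + 1)" "cball x \<rho> \<subseteq> ball a R" "L (x, \<rho>) > real (max M N) * \<rho> ^ ?n"
    unfolding E_def by (auto simp: not_le)
   moreover have "real M * \<rho> ^ ?n \<le> real (max M N) * \<rho> ^ ?n" using \<rho>(1) by (intro mult_right_mono) auto
   then have "L (x, \<rho>) > real M * \<rho> ^ ?n" using \<rho>(4) by (rule le_less_trans)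
   ultimately show "\<exists>\<rho>. 0 < \<rho> \<and> \<rho> < d \<and> ?P x \<rho>" by (intro exI[of _ \<rho>]) auto
  next
   fix F assume F: "finite F" "!!x \<rho>. (x, \<rho>) \<in> F ==> x \<in> S \<and> \<rho> > 0 \<and> ?P x \<rho>"
    "pairwise (\<lambda>i j. disjnt (cball (fst i) (snd i)) (cball (fst j) (snd j))) F"
   have "real M * (\<Sum>i\<in>F. snd i ^ ?n) \<le> (\<Sum>i\<in>F. L i)"
    unfolding sum_distrib_left
   proof (rule sum_mono)
    fix i assume "i \<in> F"
    then show "real M * snd i ^ ?n \<le> L i" using F(2)[of "fst i" "snd i"] by simp
   qed
   also have "\<dots> \<le> L (a, R)"
   proof (rule superadd[OF F(1) _ F(3)])
    fix p assume "p \<in> F"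
    then show "cball (fst p) (snd p) \<subseteq> ball a R" using F(2)[of "fst p" "snd p"] by simp
   qed
   finally show "(\<Sum>i\<in>F. snd i ^ ?n) \<le> L (a, R) / real M" using M0 by (simp add: field_simps)
  qed
  moreover have "?w * (L (a, R) / real M) \<le> e" using M M0 e by (simp add: field_simps)
  ultimately show "\<exists>T. S \<subseteq> T \<and> T \<in> lmeasurable \<and> measure lebesgue T \<le> e" by (meson order_trans)
 qed
 moreover have "negligible (\<Union>M. {x\<in>E M. \<not> (\<forall>\<delta>>0. \<exists>r0>0. \<forall>r y. 0 < r \<and> r < r0 \<and> dist x y \<le> r --> ball y (\<delta> * r) \<inter> E M ~= {})})"
  (is "negligible (\<Union>M. ?B M)")
 proof (rule negligible_countable_Union)
  fix T assume "T \<in> range ?B"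
  then show "negligible T" by (elim imageE) (simp only: negligible_porous_points)
 qed simp
 ultimately have neg: "negligible (S \<union> (\<Union>M. ?B M))" by (rule negligible_Un)
 show ?thesis
 proof (rule negligible_subset[OF neg], rule subsetI, rule ccontr)
  fix x assume x: "x \<in> {x\<in>ball a R. \<not> mass_controlled \<Omega> fs x}" and nx: "x \<notin> S \<union> (\<Union>M. ?B M)"
  have xa: "x \<in> ball a R" and nc: "\<not> mass_controlled \<Omega> fs x" using x by simp_all
  obtain M where M: "x \<in> E M" using nx xa by (auto simp: S_def)
  have por: "\<exists>r0>0. \<forall>r y. 0 < r \<and> r < r0 \<and> dist x y \<le> r --> ball y (\<delta> * r) \<inter> E M ~= {}" if "\<delta> > 0" for \<delta>
  proof -
   have nb: "x \<notin> ?B M" using nx UN_I[of M UNIV x ?B, OF UNIV_I] by blast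
   have "\<forall>\<delta>>0. \<exists>r0>0. \<forall>r y. 0 < r \<and> r < r0 \<and> dist x y \<le> r --> ball y (\<delta> * r) \<inter> E M ~= {}"
    using nb[unfolded mem_Collect_eq de_Morgan_conj not_not] M by (elim disjE) simp_all
   then show ?thesis by (rule allE) (erule mp, rule that)
  qed
  obtain d where d: "d > 0" "ball x d \<subseteq> ball a R" using xa openE[OF open_ball] by blast
  have "mass_controlled \<Omega> fs x"
   unfolding mass_controlled_def
  \<comment> \<open>The factor 2^n pays for doubling the radius, the summand 1 for replacing the
    mass of f_k by the cluster value up to (\<delta> r)^n.\<close>
  proof (rule exI[of _ "real M * 2 ^ ?n + 1"], intro conjI allI impI)
   show "real M * 2 ^ ?n + 1 > 0" by (simp add: add_nonneg_pos)
   fix \<delta> :: real assume \<delta>: "\<delta> > 0"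
   obtain r1 where r1: "r1 > 0" "!!r y. 0 < r ==> r < r1 ==> dist x y \<le> r ==> ball y (\<delta> * r) \<inter> E M ~= {}"
    using por[OF \<delta>] by blast
   \<comment> \<open>The second term keeps the doubled balls inside \<open>ball a R\<close>, the
     third keeps their radius below the limit 1/(M+1) in the definition of
     \<open>E M\<close>.\<close>
   define r0 where "r0 = min r1 (min (d / (1 + 3 * \<delta>)) (1 / (real M + 1) / (2 * \<delta>)))"
   show "\<exists>r0>0. \<forall>r. 0 < r \<and> r < r0 --> (\<forall>Y Q. finite Y \<and> Y \<subseteq> cball x r \<and> eventually Q sequentially -->
    (\<exists>k. Q k \<and> (\<forall>y\<in>Y. ball y (\<delta> * r) \<subseteq> \<Omega> \<and> BV_mass \<Omega> (fs k) (ball y (\<delta> * r)) \<le> (real M * 2 ^ ?n + 1) * (\<delta> * r) ^ ?n)))"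
   proof (intro exI[of _ r0] conjI allI impI)
    show "r0 > 0" using r1(1) d(1) \<delta> by (simp add: r0_def)
    fix r Y and Q :: "nat => bool"
    assume "0 < r \<and> r < r0" and Y: "finite Y \<and> Y \<subseteq> cball x r \<and> eventually Q sequentially"
    then have r: "0 < r" "r < r1" "r < d / (1 + 3 * \<delta>)" "r < 1 / (real M + 1) / (2 * \<delta>)" by (auto simp: r0_def)
    have rd: "(1 + 3 * \<delta>) * r < d" using r(3) \<delta> by (simp add: field_simps)
    have rM: "2 * \<delta> * r < 1 / (real M + 1)"
    proof -
     have "2 * \<delta> > 0" using \<delta> by simp
     then have "r * (2 * \<delta>) < 1 / (real M + 1)" using r(4) by (simp only: pos_less_divide_eq)
     then show ?thesis by (metis mult.commute)
    qed
    have \<delta>r: "\<delta> * r > 0" using \<delta> r by simp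
    have "\<forall>y\<in>Y. \<exists>z. z \<in> ball y (\<delta> * r) \<inter> E M"
    proof
     fix y assume "y \<in> Y"
     then have "dist x y \<le> r" using Y by auto
     then show "\<exists>z. z \<in> ball y (\<delta> * r) \<inter> E M" using r1(2)[OF r(1,2)] by blast
    qed
    then obtain z where z: "!!y. y \<in> Y ==> z y \<in> ball y (\<delta> * r) \<inter> E M" by metis
    have zb: "cball (z y) (2 * \<delta> * r) \<subseteq> ball a R" if y: "y \<in> Y" for y
    proof -
     have "dist x y \<le> r" using Y y by auto
     moreover have "dist y (z y) < \<delta> * r" using z[OF y] by simp
     ultimately have "dist x (z y) + 2 * \<delta> * r < d" using rd dist_triangle[of x "z y" y] by (simp add: algebra_simps)
     then have "cball (z y) (2 * \<delta> * r) \<subseteq> ball x d"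
      by (intro subsetI) (smt (verit) dist_triangle mem_ball mem_cball)
     then show ?thesis using d(2) by blast
    qed
    have aO: "ball a R \<subseteq> \<Omega>" using a ball_subset_cball by blast
    let ?J = "(\<lambda>y. (z y, 2 * \<delta> * r)) ` Y"
    have "?J \<subseteq> {p. cball (fst p) (snd p) \<subseteq> \<Omega>}" using zb aO by fastforce
    then obtain k where k: "Q k" "\<forall>p\<in>?J. \<bar>?m k p - L p\<bar> < (\<delta> * r) ^ ?n"
     using L[of ?J "(\<delta> * r) ^ ?n" Q] Y \<delta>r by auto
    show "\<exists>k. Q k \<and> (\<forall>y\<in>Y. ball y (\<delta> * r) \<subseteq> \<Omega> \<and> BV_mass \<Omega> (fs k) (ball y (\<delta> * r)) \<le> (real M * 2 ^ ?n + 1) * (\<delta> * r) ^ ?n)"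
    proof (intro exI[of _ k] conjI ballI k(1))
     fix y assume y: "y \<in> Y"
     have bz: "ball y (\<delta> * r) \<subseteq> ball (z y) (2 * \<delta> * r)"
     proof
      fix t assume "t \<in> ball y (\<delta> * r)"
      then have "dist y t < \<delta> * r" by simp
      moreover have "dist y (z y) < \<delta> * r" using z[OF y] by simp
      ultimately show "t \<in> ball (z y) (2 * \<delta> * r)"
       using dist_triangle[of "z y" t y] by (simp add: dist_commute)
     qed
     have zO: "ball (z y) (2 * \<delta> * r) \<subseteq> \<Omega>" using zb[OF y] aO ball_subset_cball by blast
     show "ball y (\<delta> * r) \<subseteq> \<Omega>" using bz zO by blast
     have "BV_mass \<Omega> (fs k) (ball y (\<delta> * r)) \<le> BV_mass \<Omega> (fs k) (ball (z y) (2 * \<delta> * r))"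
      by (rule BV_mass_mono[OF \<Omega> fs _ bz _ zO]) auto
     also have "\<dots> \<le> L (z y, 2 * \<delta> * r) + (\<delta> * r) ^ ?n"
     proof -
      have "\<bar>?m k (z y, 2 * \<delta> * r) - L (z y, 2 * \<delta> * r)\<bar> < (\<delta> * r) ^ ?n" using k(2) y by blast
      then show ?thesis by simp
     qed
     also have "L (z y, 2 * \<delta> * r) \<le> real M * (2 * \<delta> * r) ^ ?n"
     proof -
      have "z y \<in> E M" using z[OF y] by blast
      then have "\<forall>\<rho>. 0 < \<rho> \<and> \<rho> < 1 / (real M + 1) \<and> cball (z y) \<rho> \<subseteq> ball a R --> L (z y, \<rho>) \<le> real M * \<rho> ^ ?n"
       unfolding E_def by simp
      from this[rule_format, of "2 * \<delta> * r"] show ?thesis using rM \<delta>r zb[OF y] by (simp add: mult.assoc)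
     qed
     also have "real M * (2 * \<delta> * r) ^ ?n + (\<delta> * r) ^ ?n = (real M * 2 ^ ?n + 1) * (\<delta> * r) ^ ?n"
      by (simp add: power_mult_distrib algebra_simps)
     finally show "BV_mass \<Omega> (fs k) (ball y (\<delta> * r)) \<le> (real M * 2 ^ ?n + 1) * (\<delta> * r) ^ ?n" by simp
    qed
   qed
  qed
  then show False using nc by simp
 qed
qed

lemma AE_mass_controlled:
 fixes \<Omega> :: "(real^'n) set"
 assumes \<Omega>: "open \<Omega>" and fs: "!!k. fs k \<in> BV \<Omega>"
  and bm: "!!x r. cball x r \<subseteq> \<Omega> ==> \<exists>C. \<forall>k. BV_mass \<Omega> (fs k) (ball x r) \<le> C"
 shows "negligible {x\<in>\<Omega>. \<not> mass_controlled \<Omega> fs x}"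
proof (rule iffD2[OF locally_negligible_alt], rule ballI)
 fix x assume x: "x \<in> {x\<in>\<Omega>. \<not> mass_controlled \<Omega> fs x}"
 let ?S = "{x\<in>\<Omega>. \<not> mass_controlled \<Omega> fs x}"
 obtain R where R: "R > 0" "cball x R \<subseteq> \<Omega>" using x \<Omega> open_contains_cball by blast
 have sub: "?S \<inter> ball x R \<subseteq> {y\<in>ball x R. \<not> mass_controlled \<Omega> fs y}" by auto
 show "\<exists>U. openin (top_of_set ?S) U \<and> x \<in> U \<and> negligible U"
 proof (intro exI[of _ "?S \<inter> ball x R"] conjI)
  show "openin (top_of_set ?S) (?S \<inter> ball x R)" by (intro openin_open_Int open_ball)
  show "x \<in> ?S \<inter> ball x R" using x R by simp
  show "negligible (?S \<inter> ball x R)"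
   by (rule negligible_subset[OF AE_mass_controlled_ball[OF \<Omega> fs bm R(2,1)] sub])
 qed
qed

section \<open>Good segments and affine approximation in the mean\<close>

lemma integrable_component: "integrable M u ==> integrable M (\<lambda>x. u x $ i)"
 by (rule integrable_bounded_linear[OF bounded_linear_vec_nth])

lemma lebesgue_point_continuous_extension:
 fixes F :: "real^'n => real^'n"
 assumes \<Omega>: "open \<Omega>" and c: "continuous_on \<Omega> F" and i: "integrable lborel (\<lambda>x. indicator \<Omega> x *\<^sub>R F x)" and x: "x \<in> \<Omega>"
 shows "lebesgue_point (\<lambda>x. (indicator \<Omega> x *\<^sub>R F x) $ i) x"
proof (rule lebesgue_point_continuous[OF integrable_component[OF i]])
 have "isCont F x" using c \<Omega> x by (simp add: continuous_on_eq_continuous_at)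
 then have c: "isCont (\<lambda>x. F x $ i) x" by (intro continuous_intros)
 have ev: "eventually (\<lambda>z. (indicator \<Omega> z *\<^sub>R F z) $ i = F z $ i) (nhds x)"
  using eventually_nhds_in_open[OF \<Omega> x] by eventually_elim simp
 show "isCont (\<lambda>x. (indicator \<Omega> x *\<^sub>R F x) $ i) x" by (rule iffD2[OF isCont_cong[OF ev] c])
qed

lemma BV_test_bound:
 assumes \<Omega>: "open \<Omega>" and g: "g \<in> BV \<Omega>" and u: "represents \<Omega> g u" and U: "open U" "U \<subseteq> \<Omega>"
  and \<phi>: "smooth_test_function U \<phi>" "\<forall>x. \<bar>\<phi> x\<bar> \<le> 1"
 shows "\<bar>\<integral>z. u z $ i * partial_deriv j \<phi> z \<partial>lborel\<bar> \<le> BV_mass \<Omega> g U"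
proof -
 have "partial_deriv j \<phi> \<in> borel_measurable borel"
  using \<phi>(1) C_k.simps(1)[of "partial_deriv j \<phi>"] C_k.simps(2)[of 0 \<phi>] unfolding smooth_test_function_def
  by (metis borel_measurable_continuous_onI)
 then have "(LINT x|lebesgue_on \<Omega>. g x $ i * partial_deriv j \<phi> x) = (\<integral>z. u z $ i * partial_deriv j \<phi> z \<partial>lborel)"
  using \<Omega> by (intro represents_integral[OF _ u]) auto
 then show ?thesis using BV_mass_test_bound[OF \<Omega> g U \<phi>, of i j] by simp
qed

text \<open>
 Most points of the ball see most of the ball along segments on which \<open>F\<close> oscillates
 by at most the radius times the density of \<open>\<bar>DF\<bar>\<close>.
\<close>

definition osc_const :: "('n::finite) itself => real => real => real" where
 "osc_const _ K \<eta> = 2 * (real CARD('n))\<^sup>2 * 2 ^ CARD('n) * (K + 1) / (\<eta>\<^sup>2 * unit_ball_vol (real CARD('n)))"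

lemma osc_const_pos: "K \<ge> 0 ==> \<eta> > 0 ==> osc_const TYPE('n::finite) K \<eta> > 0"
 unfolding osc_const_def by (intro divide_pos_pos mult_pos_pos) (auto intro: add_nonneg_pos)

lemma good_segments:
 fixes F :: "real^'n => real^'n" and y :: "real^'n"
 assumes \<Omega>: "open \<Omega>" and F: "F \<in> BV \<Omega>" "continuous_on \<Omega> F" and b: "ball y (2 * \<rho>) \<subseteq> \<Omega>" and \<rho>: "\<rho> > 0"
  and K: "BV_mass \<Omega> F (ball y (2 * \<rho>)) \<le> K * \<rho> ^ CARD('n)" "K \<ge> 0" and \<eta>: "\<eta> > 0"
 obtains S T where "S \<in> sets borel" "S \<subseteq> ball y \<rho>" "measure lborel (ball y \<rho> - S) \<le> \<eta> * measure lborel (ball y \<rho>)"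
  "!!p. p \<in> S ==> T p \<in> sets borel \<and> T p \<subseteq> ball y \<rho> \<and> measure lborel (ball y \<rho> - T p) \<le> \<eta> * measure lborel (ball y \<rho>)"
  "!!p q t. p \<in> S ==> q \<in> T p ==> 0 \<le> t ==> t \<le> 1 ==> norm (F (p + t *\<^sub>R (q - p)) - F p) \<le> osc_const TYPE('n) K \<eta> * \<rho>"
proof -
 let ?n = "CARD('n)" and ?u = "\<lambda>x. indicator \<Omega> x *\<^sub>R F x"
 define h where "h = osc_const TYPE('n) K \<eta>"
 define W where "W = measure lborel (ball y \<rho>)"
 have W: "W = unit_ball_vol (real ?n) * \<rho> ^ ?n" "W > 0" using \<rho> by (simp_all add: W_def measure_ball)
 have eW: "emeasure lborel (ball y \<rho>) = ennreal W"
  unfolding W_def using emeasure_bounded_finite[OF bounded_ball, of y \<rho>] by (intro emeasure_eq_ennreal_measure) auto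
 have h: "h > 0" unfolding h_def using K(2) \<eta> by (rule osc_const_pos)
 have i: "integrable (lebesgue_on \<Omega>) F" using F(1) by (simp add: BV_def)
 have rep: "represents \<Omega> F ?u" by (rule represents_continuous[OF \<Omega> i F(2)])
 then have ui: "integrable lborel ?u" by (simp add: represents_def)
 \<comment> \<open>With K + 1 instead of K the bound is positive even in the absence of
   mass.\<close>
 define K' where "K' = (K + 1) * \<rho> ^ ?n"
 have K': "K' > 0" using K(2) \<rho> by (simp add: K'_def)
 \<comment> \<open>The segment estimate is used with the zero matrix: only the size of the
   derivative of \<open>F\<close> is under control, not its closeness to a given matrix.\<close>
 have test: "\<bar>(\<integral>z. ?u z $ i * partial_deriv j \<phi> z \<partial>lborel) + (0::real^'n^'n) $ i $ j * (\<integral>z. \<phi> z \<partial>lborel)\<bar> \<le> K'"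
  if "smooth_test_function (ball y (2 * \<rho>)) \<phi>" "\<forall>z. \<bar>\<phi> z\<bar> \<le> 1" for \<phi> i j
 proof -
  have "K * \<rho> ^ ?n \<le> K'" using \<rho> by (simp add: K'_def distrib_right)
  then show ?thesis using BV_test_bound[OF \<Omega> F(1) rep open_ball b that, of i j] K(1) by simp
 qed
 obtain \<Psi> where \<Psi>: "case_prod \<Psi> \<in> borel_measurable (borel \<Otimes>\<^sub>M borel)"
  "(\<integral>\<^sup>+p. \<integral>\<^sup>+q. \<Psi> p q \<partial>lborel \<partial>lborel) \<le> ennreal (?n * (2 * \<rho> * ?n * 2 ^ ?n * measure lborel (ball y \<rho>) * K'))"
  "!!p q t. p \<in> ball y \<rho> ==> q \<in> ball y \<rho> ==> 0 \<le> t ==> t \<le> 1 ==> (!!i. lebesgue_point (\<lambda>z. ?u z $ i) p) ==>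
    (!!i. lebesgue_point (\<lambda>z. ?u z $ i) (p + t *\<^sub>R (q - p)))
    ==> ennreal (norm (?u (p + t *\<^sub>R (q - p)) - ?u p - t *\<^sub>R ((0::real^'n^'n) *v (q - p)))) \<le> \<Psi> p q"
  using segment_estimate_vec[OF ui \<rho> test less_imp_le[OF K']] by blast
 define I where "I = (\<lambda>p. \<integral>\<^sup>+q. \<Psi> p q \<partial>lborel)"
 have \<Psi>m: "case_prod \<Psi> \<in> borel_measurable (borel \<Otimes>\<^sub>M lborel)"
  using \<Psi>(1) by (subst measurable_cong_sets[OF sets_pair_measure_cong[OF refl sets_lborel] refl])
 have Im: "I \<in> borel_measurable borel"
  unfolding I_def using lborel.borel_measurable_nn_integral[OF \<Psi>m] by simp
 have \<Psi>p: "\<Psi> p \<in> borel_measurable borel" for p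
  using measurable_compose[OF measurable_Pair1'[of p borel borel] \<Psi>(1)] by simp
 \<comment> \<open>Markov's inequality is used twice: in \<open>p\<close> for the inner integral,
   then in \<open>q\<close> for fixed \<open>p\<close>. The good far ends thus depend on
   \<open>p\<close>, and oscillation is measured from \<open>p\<close>.\<close>
 define S where "S = {p \<in> ball y \<rho>. I p \<le> ennreal (\<eta> * (h * \<rho>) * W)}"
 define T where "T = (\<lambda>p. {q \<in> ball y \<rho>. \<Psi> p q \<le> ennreal (h * \<rho>)})"
 have bb: "ball y \<rho> \<in> sets borel" by simp
 have Sm: "S \<in> sets borel"
 proof -
  have "S = ball y \<rho> \<inter> (I -` {..ennreal (\<eta> * (h * \<rho>) * W)} \<inter> space borel)" by (auto simp: S_def)
  then show ?thesis using measurable_sets[OF Im, of "{..ennreal (\<eta> * (h * \<rho>) * W)}"] by auto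
 qed
 have Tm: "T p \<in> sets borel" for p
 proof -
  have "T p = ball y \<rho> \<inter> (\<Psi> p -` {..ennreal (h * \<rho>)} \<inter> space borel)" by (auto simp: T_def)
  then show ?thesis using measurable_sets[OF \<Psi>p, of "{..ennreal (h * \<rho>)}"] by auto
 qed
 have markov: "measure lborel (ball y \<rho> - X) \<le> \<eta> * W"
  if X: "X = {q \<in> ball y \<rho>. f q \<le> ennreal c}" and f: "f \<in> borel_measurable borel" and c: "c > 0"
   and fb: "(\<integral>\<^sup>+q. f q \<partial>lborel) \<le> ennreal (\<eta> * W * c)" for f :: "real^'n => ennreal" and c X
 proof -
  let ?D = "{q \<in> space lborel. 1 \<le> ennreal (1 / c) * f q}"
  have "ball y \<rho> - X \<subseteq> ?D"
  proof
   fix q assume "q \<in> ball y \<rho> - X"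
   then have "ennreal c \<le> f q" unfolding X by (auto simp: not_le)
   then have "ennreal (1 / c) * ennreal c \<le> ennreal (1 / c) * f q" by (rule mult_left_mono) simp
   then show "q \<in> ?D" using c by (simp add: ennreal_mult[symmetric])
  qed
  moreover have "?D \<in> sets lborel" using f by measurable
  ultimately have "emeasure lborel (ball y \<rho> - X) \<le> emeasure lborel ?D" by (rule emeasure_mono)
  also have "\<dots> = emeasure lborel ({q \<in> UNIV. 1 \<le> ennreal (1 / c) * f q})" by simp
  also have "\<dots> \<le> ennreal (1 / c) * (\<integral>\<^sup>+q. f q * indicator UNIV q \<partial>lborel)"
   using f by (intro nn_integral_Markov_inequality) auto
  also have "\<dots> \<le> ennreal (1 / c) * ennreal (\<eta> * W * c)" using fb by (intro mult_left_mono) auto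
  also have "\<dots> = ennreal (\<eta> * W)" using c \<eta> W(2) by (simp add: ennreal_mult[symmetric])
  finally show ?thesis unfolding measure_def using \<eta> W(2) by (simp add: enn2real_leI)
 qed
 show ?thesis
 proof (rule that[of S T])
  show "S \<in> sets borel" by (rule Sm)
  show "S \<subseteq> ball y \<rho>" by (auto simp: S_def)
  \<comment> \<open>This equation determines \<open>osc_const\<close>: the bound on the double
    integral has to equal \<eta> W times the threshold \<eta> h \<rho> W, which is solved for
    h.\<close>
  have tot: "real ?n * (2 * \<rho> * ?n * 2 ^ ?n * measure lborel (ball y \<rho>) * K') = \<eta> * W * (\<eta> * (h * \<rho>) * W)"
  proof -
   have w: "unit_ball_vol (real ?n) ~= 0" using unit_ball_vol_pos[of "real ?n"] by linarith
   show ?thesis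
    unfolding W_def[symmetric] h_def osc_const_def K'_def using \<eta> w
    by (simp add: W(1) power2_eq_square field_simps)
  qed
  show "measure lborel (ball y \<rho> - S) \<le> \<eta> * measure lborel (ball y \<rho>)"
   unfolding W_def[symmetric]
  proof (rule markov[OF S_def Im])
   show "\<eta> * (h * \<rho>) * W > 0" using \<eta> h \<rho> W by simp
   show "(\<integral>\<^sup>+q. I q \<partial>lborel) \<le> ennreal (\<eta> * W * (\<eta> * (h * \<rho>) * W))"
    using \<Psi>(2) unfolding tot I_def .
  qed
  fix p assume p: "p \<in> S"
  have "measure lborel (ball y \<rho> - T p) \<le> \<eta> * W"
  proof (rule markov[OF _ \<Psi>p])
   show "T p = {q \<in> ball y \<rho>. \<Psi> p q \<le> ennreal (h * \<rho>)}" by (simp add: T_def)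
   show "h * \<rho> > 0" using h \<rho> by simp
   show "(\<integral>\<^sup>+q. \<Psi> p q \<partial>lborel) \<le> ennreal (\<eta> * W * (h * \<rho>))" using p by (simp add: S_def I_def mult_ac)
  qed
  moreover have "T p \<subseteq> ball y \<rho>" by (auto simp: T_def)
  ultimately show "T p \<in> sets borel \<and> T p \<subseteq> ball y \<rho> \<and> measure lborel (ball y \<rho> - T p) \<le> \<eta> * measure lborel (ball y \<rho>)"
   using Tm unfolding W_def by blast
  fix q t assume q: "q \<in> T p" and t: "0 \<le> t" "t \<le> (1::real)"
  have pq: "p \<in> ball y \<rho>" "q \<in> ball y \<rho>" using p q by (auto simp: S_def T_def)
  have "p + t *\<^sub>R (q - p) = (1 - t) *\<^sub>R p + t *\<^sub>R q" by (simp add: algebra_simps)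
  then have pt: "p + t *\<^sub>R (q - p) \<in> ball y \<rho>"
   using convexD_alt[OF convex_ball pq t] by simp
  have sub: "ball y \<rho> \<subseteq> \<Omega>" using b \<rho> subset_ball[of \<rho> "2 * \<rho>" y] by auto
  note lp = lebesgue_point_continuous_extension[OF \<Omega> F(2) ui]
  have "ennreal (norm (?u (p + t *\<^sub>R (q - p)) - ?u p - t *\<^sub>R ((0::real^'n^'n) *v (q - p)))) \<le> \<Psi> p q"
   using sub pq pt by (intro \<Psi>(3) t lp) auto
  also have "\<dots> \<le> ennreal (h * \<rho>)" using q by (simp add: T_def)
  finally have "norm (?u (p + t *\<^sub>R (q - p)) - ?u p - t *\<^sub>R ((0::real^'n^'n) *v (q - p))) \<le> h * \<rho>"
   using h \<rho> by (subst (asm) ennreal_le_iff) auto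
  moreover have "p \<in> \<Omega>" "p + t *\<^sub>R (q - p) \<in> \<Omega>" using sub pq pt by auto
  ultimately show "norm (F (p + t *\<^sub>R (q - p)) - F p) \<le> osc_const TYPE('n) K \<eta> * \<rho>"
   by (simp add: h_def)
 qed
qed

text \<open>The segment estimate at t = 1 bounds the deviation of \<open>u\<close> from the affine
  map through one point \<open>p\<close>. Averaging over \<open>p\<close> in the ball finds a
  Lebesgue point for which the integral over the other end point is small, and c is then u p - A
  p.\<close>

lemma affine_approximation_L1:
 fixes u :: "real^'n => real^'n"
 assumes u: "integrable lborel u" and x: "differential_point u A x" and \<epsilon>: "\<epsilon> > 0"
 shows "\<exists>r0>0. \<forall>r. 0 < r \<and> r < r0 --> (\<exists>c. (\<integral>\<^sup>+q. ennreal (norm (u q - A *v q - c)) * indicator (ball x r) q \<partial>lborel) \<le> ennreal (\<epsilon> * r ^ (CARD('n) + 1)))"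
proof -
 let ?n = "CARD('n)"
 \<comment> \<open>Makes the double integral at most half of the volume times the target bound; the
   half yields the strict contradiction in the averaging argument.\<close>
 define e where "e = \<epsilon> / (4 * (real ?n)\<^sup>2 * 2 ^ ?n)"
 have e: "e > 0" using \<epsilon> by (simp add: e_def)
 obtain r0 where r0: "r0 > 0" and H: "!!r \<phi> i j. 0 < r ==> r < r0 ==> smooth_test_function (ball x (2 * r)) \<phi> ==> (\<forall>z. \<bar>\<phi> z\<bar> \<le> 1) ==>
    \<bar>(\<integral>z. u z $ i * partial_deriv j \<phi> z \<partial>lborel) + A $ i $ j * (\<integral>z. \<phi> z \<partial>lborel)\<bar> \<le> e * r ^ ?n"
  using x[unfolded differential_point_def, rule_format, OF e] by blast
 have um: "u \<in> borel_measurable borel" using u by simp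
 show ?thesis
 proof (intro exI[of _ r0] conjI allI impI r0)
  fix r assume r: "0 < r \<and> r < r0"
  define W where "W = measure lborel (ball x r)"
  have W: "W > 0" using r by (simp add: W_def measure_ball)
  have eW: "emeasure lborel (ball x r) = ennreal W"
   unfolding W_def using emeasure_bounded_finite[OF bounded_ball, of x r] by (intro emeasure_eq_ennreal_measure) auto
  have K0: "e * r ^ ?n \<ge> 0" using e r by simp
  obtain \<Psi> where \<Psi>: "case_prod \<Psi> \<in> borel_measurable (borel \<Otimes>\<^sub>M borel)"
   "(\<integral>\<^sup>+p. \<integral>\<^sup>+q. \<Psi> p q \<partial>lborel \<partial>lborel) \<le> ennreal (?n * (2 * r * ?n * 2 ^ ?n * measure lborel (ball x r) * (e * r ^ ?n)))"
   "!!p q t. p \<in> ball x r ==> q \<in> ball x r ==> 0 \<le> t ==> t \<le> 1 ==> (!!i. lebesgue_point (\<lambda>z. u z $ i) p) ==>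
     (!!i. lebesgue_point (\<lambda>z. u z $ i) (p + t *\<^sub>R (q - p)))
     ==> ennreal (norm (u (p + t *\<^sub>R (q - p)) - u p - t *\<^sub>R (A *v (q - p)))) \<le> \<Psi> p q"
   using segment_estimate_vec[OF u conjunct1[OF r] H[OF conjunct1[OF r] conjunct2[OF r]] K0] by blast
  define I where "I = (\<lambda>p. \<integral>\<^sup>+q. \<Psi> p q \<partial>lborel)"
  have \<Psi>m: "case_prod \<Psi> \<in> borel_measurable (borel \<Otimes>\<^sub>M lborel)"
   using \<Psi>(1) by (subst measurable_cong_sets[OF sets_pair_measure_cong[OF refl sets_lborel] refl])
  have Im: "I \<in> borel_measurable borel"
   unfolding I_def using lborel.borel_measurable_nn_integral[OF \<Psi>m] by simp
  define s where "s = \<epsilon> * r ^ (?n + 1)"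
  have s: "s > 0" using \<epsilon> r by (simp add: s_def)
  have tot: "real ?n * (2 * r * ?n * 2 ^ ?n * measure lborel (ball x r) * (e * r ^ ?n)) = s * W / 2"
   unfolding W_def[symmetric] s_def e_def by (simp add: power2_eq_square field_simps)
  define Z where "Z = {p. \<exists>i. \<not> lebesgue_point (\<lambda>z. u z $ i) p}"
  have "Z = (\<Union>i. {p. \<not> lebesgue_point (\<lambda>z. u z $ i) p})" by (auto simp: Z_def)
  moreover have "negligible (\<Union>i. {p. \<not> lebesgue_point (\<lambda>z. u z $ i) p})"
   by (rule negligible_Union) (auto intro: AE_lebesgue_point integrable_component[OF u])
  ultimately have Z: "negligible Z" by simp
  then have "AE p in lebesgue. p \<notin> Z"
   by (intro AE_I'[of Z]) (auto simp: negligible_iff_null_sets)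
  then have AEZ: "AE p in lborel. p \<notin> Z" by (simp only: AE_completion_iff)
  \<comment> \<open>Otherwise \<open>I\<close> exceeds s almost everywhere on the ball and its
    integral is at least s W, against the bound s W / 2.\<close>
  have "\<exists>p. p \<in> ball x r \<and> p \<notin> Z \<and> I p \<le> ennreal s"
  proof (rule ccontr)
   assume no: "\<not> (\<exists>p. p \<in> ball x r \<and> p \<notin> Z \<and> I p \<le> ennreal s)"
   have "AE p in lborel. ennreal s * indicator (ball x r) p \<le> I p"
    using AEZ
   proof (rule AE_mp, intro AE_I2 impI)
    fix p assume "p \<notin> Z"
    then show "ennreal s * indicator (ball x r) p \<le> I p"
     using no by (cases "p \<in> ball x r") (auto simp: not_le intro: less_imp_le)
   qed
   then have "(\<integral>\<^sup>+p. ennreal s * indicator (ball x r) p \<partial>lborel) \<le> (\<integral>\<^sup>+p. I p \<partial>lborel)"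
    by (rule nn_integral_mono_AE)
   then have "ennreal s * ennreal W \<le> (\<integral>\<^sup>+p. I p \<partial>lborel)"
    by (simp add: nn_integral_cmult_indicator eW)
   also have "\<dots> \<le> ennreal (s * W / 2)" using \<Psi>(2) unfolding tot I_def .
   finally have "ennreal (s * W) \<le> ennreal (s * W / 2)" using s W by (simp add: ennreal_mult)
   then have "s * W \<le> s * W / 2" using s W by (subst (asm) ennreal_le_iff) auto
   then show False using s W by simp
  qed
  then obtain p where p: "p \<in> ball x r" "p \<notin> Z" "I p \<le> ennreal s" by blast
  have pl: "lebesgue_point (\<lambda>z. u z $ i) p" for i using p(2) by (simp add: Z_def)
  have "(\<integral>\<^sup>+q. ennreal (norm (u q - A *v q - (u p - A *v p))) * indicator (ball x r) q \<partial>lborel) \<le> I p"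
   unfolding I_def
  proof (rule nn_integral_mono_AE, use AEZ in \<open>rule AE_mp\<close>, intro AE_I2 impI)
   fix q assume q: "q \<notin> Z"
   show "ennreal (norm (u q - A *v q - (u p - A *v p))) * indicator (ball x r) q \<le> \<Psi> p q"
   proof (cases "q \<in> ball x r")
    case True
    have ql: "lebesgue_point (\<lambda>z. u z $ i) (p + 1 *\<^sub>R (q - p))" for i using q by (simp add: Z_def)
    have "ennreal (norm (u (p + 1 *\<^sub>R (q - p)) - u p - 1 *\<^sub>R (A *v (q - p)))) \<le> \<Psi> p q"
     by (rule \<Psi>(3)[OF p(1) True _ _ pl ql]) auto
    moreover have "u (p + 1 *\<^sub>R (q - p)) - u p - 1 *\<^sub>R (A *v (q - p)) = u q - A *v q - (u p - A *v p)"
     by (simp add: matrix_vector_mult_diff_distrib)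
    ultimately have "ennreal (norm (u q - A *v q - (u p - A *v p))) \<le> \<Psi> p q" by (simp only:)
    then show ?thesis using True by simp
   qed simp
  qed
  also have "\<dots> \<le> ennreal (\<epsilon> * r ^ (?n + 1))" using p(3) unfolding s_def .
  finally show "\<exists>c. (\<integral>\<^sup>+q. ennreal (norm (u q - A *v q - c)) * indicator (ball x r) q \<partial>lborel) \<le> ennreal (\<epsilon> * r ^ (?n + 1))" by blast
 qed
qed

lemma L1_convergence_nn_integral:
 fixes fs :: "nat => real^'n => real^'n"
 assumes \<Omega>: "open \<Omega>" and lim: "(\<lambda>k. LINT x|lebesgue_on \<Omega>. norm (fs k x - f x)) \<longlonglongrightarrow> 0"
  and i: "!!k. integrable (lebesgue_on \<Omega>) (fs k)" "integrable (lebesgue_on \<Omega>) f"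
  and r: "!!k. represents \<Omega> (fs k) (us k)" "represents \<Omega> f u" and e: "e > 0"
 shows "eventually (\<lambda>k. (\<integral>\<^sup>+q. ennreal (norm (us k q - u q)) \<partial>lborel) \<le> ennreal e) sequentially"
proof -
 have eq: "(LINT x|lebesgue_on \<Omega>. norm (fs k x - f x)) = (\<integral>q. norm (us k q - u q) \<partial>lborel)" for k
 proof -
  have "us k \<in> borel_measurable borel" "u \<in> borel_measurable borel" using r(1)[of k] r(2) unfolding represents_def by auto
  then have m: "(\<lambda>q. norm (us k q - u q)) \<in> borel_measurable borel" by measurable
  have m': "(\<lambda>q. norm (us k q - u q)) \<in> borel_measurable lebesgue" using m by (simp add: measurable_completion)
  have AE: "AE x in lebesgue. norm (us k x - u x) = indicator \<Omega> x *\<^sub>R norm (fs k x - f x)"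
  proof (rule AE_I')
   show "{x\<in>\<Omega>. us k x ~= fs k x} \<union> {x\<in>\<Omega>. u x ~= f x} \<in> null_sets lebesgue"
    using r unfolding represents_def negligible_iff_null_sets by (intro null_sets.Un) auto
   show "{x \<in> space lebesgue. norm (us k x - u x) ~= indicator \<Omega> x *\<^sub>R norm (fs k x - f x)}
     \<subseteq> {x\<in>\<Omega>. us k x ~= fs k x} \<union> {x\<in>\<Omega>. u x ~= f x}"
    using r unfolding represents_def by (auto simp: indicator_def split: if_splits)
  qed
  have "(\<integral>q. norm (us k q - u q) \<partial>lborel) = (\<integral>q. norm (us k q - u q) \<partial>lebesgue)"
   using m by (simp add: integral_completion)
  also have "\<dots> = (\<integral>x. indicator \<Omega> x *\<^sub>R norm (fs k x - f x) \<partial>lebesgue)"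
   by (rule integral_cong_AE[OF m' borel_measurable_complete_AE[OF completion.complete_measure_axioms m' AE] AE])
  also have "\<dots> = (LINT x|lebesgue_on \<Omega>. norm (fs k x - f x))"
   using \<Omega> by (intro integral_lebesgue_on[symmetric]) auto
  finally show ?thesis by simp
 qed
 have "eventually (\<lambda>k. (LINT x|lebesgue_on \<Omega>. norm (fs k x - f x)) < e) sequentially"
  by (rule order_tendstoD(2)[OF lim e])
 then show ?thesis
 proof eventually_elim
  case (elim k)
  have "integrable lborel (\<lambda>q. norm (us k q - u q))"
   using r unfolding represents_def by (intro integrable_norm Bochner_Integration.integrable_diff) auto
  then have "(\<integral>\<^sup>+q. ennreal (norm (us k q - u q)) \<partial>lborel) = ennreal (\<integral>q. norm (us k q - u q) \<partial>lborel)"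
   by (rule nn_integral_eq_integral) simp
  then show ?case using elim eq[of k] by (simp add: ennreal_leI)
 qed
qed

text \<open>The constant \<open>c\<close> depends on \<open>r\<close> but not on \<open>k\<close>: f
  is compared with an affine map at scale r, and then f_k with f, which is close once k is large for
  that r.\<close>

lemma blow_up_L1:
 fixes fs :: "nat => real^'n => real^'n"
 assumes \<Omega>: "open \<Omega>" and fs: "!!k. fs k \<in> BV \<Omega>" and f: "f \<in> BV \<Omega>"
  and lim: "(\<lambda>k. LINT x|lebesgue_on \<Omega>. norm (fs k x - f x)) \<longlonglongrightarrow> 0"
  and r: "!!k. represents \<Omega> (fs k) (us k)" "represents \<Omega> f u"
  and x: "differential_point u A x" and \<epsilon>: "\<epsilon> > 0"
 shows "\<exists>r0>0. \<forall>r. 0 < r \<and> r < r0 --> (\<exists>c. eventually (\<lambda>k.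
  (\<integral>\<^sup>+q. ennreal (norm (us k q - A *v q - c)) * indicator (ball x r) q \<partial>lborel) \<le> ennreal (\<epsilon> * r ^ (CARD('n) + 1))) sequentially)"
proof -
 let ?n = "CARD('n)"
 have u: "integrable lborel u" and us: "integrable lborel (us k)" for k using r by (auto simp: represents_def)
 obtain r0 where r0: "r0 > 0" "!!r. 0 < r ==> r < r0 ==> \<exists>c. (\<integral>\<^sup>+q. ennreal (norm (u q - A *v q - c)) * indicator (ball x r) q \<partial>lborel) \<le> ennreal (\<epsilon> / 2 * r ^ (?n + 1))"
  using affine_approximation_L1[OF u x, of "\<epsilon> / 2"] \<epsilon> by auto
 show ?thesis
 proof (intro exI[of _ r0] conjI allI impI r0(1))
  fix r assume r': "0 < r \<and> r < r0"
  obtain c where c: "(\<integral>\<^sup>+q. ennreal (norm (u q - A *v q - c)) * indicator (ball x r) q \<partial>lborel) \<le> ennreal (\<epsilon> / 2 * r ^ (?n + 1))"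
   using r0(2) r' by blast
  have "\<epsilon> / 2 * r ^ (?n + 1) > 0" using \<epsilon> r' by simp
  from L1_convergence_nn_integral[OF \<Omega> lim _ _ r this] fs f
  have "eventually (\<lambda>k. (\<integral>\<^sup>+q. ennreal (norm (us k q - u q)) \<partial>lborel) \<le> ennreal (\<epsilon> / 2 * r ^ (?n + 1))) sequentially"
   by (simp add: BV_def)
  then have "eventually (\<lambda>k. (\<integral>\<^sup>+q. ennreal (norm (us k q - A *v q - c)) * indicator (ball x r) q \<partial>lborel) \<le> ennreal (\<epsilon> * r ^ (?n + 1))) sequentially"
  proof eventually_elim
   case (elim k)
   have [measurable]: "u \<in> borel_measurable borel" "us k \<in> borel_measurable borel" using u us by auto
   have [measurable]: "(\<lambda>q. A *v q) \<in> borel_measurable borel"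
    by (intro borel_measurable_continuous_onI linear_continuous_on matrix_vector_mul_bounded_linear)
   have [measurable]: "ball x r \<in> sets borel" by simp
   have "(\<integral>\<^sup>+q. ennreal (norm (us k q - A *v q - c)) * indicator (ball x r) q \<partial>lborel)
    \<le> (\<integral>\<^sup>+q. ennreal (norm (us k q - u q)) + ennreal (norm (u q - A *v q - c)) * indicator (ball x r) q \<partial>lborel)"
   proof (rule nn_integral_mono)
    fix q
    have "norm (us k q - A *v q - c) \<le> norm (us k q - u q) + norm (u q - A *v q - c)"
    proof -
     have e: "us k q - A *v q - c = (us k q - u q) + (u q - A *v q - c)" by simp
     show ?thesis unfolding e by (rule norm_triangle_ineq)
    qed
    then have "ennreal (norm (us k q - A *v q - c)) \<le> ennreal (norm (us k q - u q)) + ennreal (norm (u q - A *v q - c))"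
     by (simp add: ennreal_plus[symmetric] ennreal_leI del: ennreal_plus)
    then show "ennreal (norm (us k q - A *v q - c)) * indicator (ball x r) q
     \<le> ennreal (norm (us k q - u q)) + ennreal (norm (u q - A *v q - c)) * indicator (ball x r) q"
     by (cases "q \<in> ball x r") auto
   qed
   also have "\<dots> = (\<integral>\<^sup>+q. ennreal (norm (us k q - u q)) \<partial>lborel) + (\<integral>\<^sup>+q. ennreal (norm (u q - A *v q - c)) * indicator (ball x r) q \<partial>lborel)"
    by (rule nn_integral_add) measurable
   also have "\<dots> \<le> ennreal (\<epsilon> / 2 * r ^ (?n + 1)) + ennreal (\<epsilon> / 2 * r ^ (?n + 1))"
    by (rule add_mono[OF elim c])
   also have "\<dots> = ennreal (\<epsilon> * r ^ (?n + 1))"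
    using \<epsilon> r' by (simp add: ennreal_plus[symmetric] del: ennreal_plus)
   finally show ?case .
  qed
  then show "\<exists>c. eventually (\<lambda>k. (\<integral>\<^sup>+q. ennreal (norm (us k q - A *v q - c)) * indicator (ball x r) q \<partial>lborel) \<le> ennreal (\<epsilon> * r ^ (?n + 1))) sequentially" by blast
 qed
qed

section \<open>Loops along which a map is nearly affine\<close>

lemma chain_paths:
 fixes P :: "nat => 'a::topological_space => bool"
 assumes "!!i. i < m ==> \<exists>g::real => 'a. continuous_on {0..1} g \<and> g 0 = p i \<and> g 1 = p (Suc i) \<and> (\<forall>s\<in>{0..1}. P i (g s))"
 shows "\<exists>\<gamma>. continuous_on {0..real m} \<gamma> \<and> \<gamma> 0 = p 0 \<and> \<gamma> (real m) = p m \<and> (\<forall>i<m. \<forall>s\<in>{real i..real i + 1}. P i (\<gamma> s))"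
 using assms
proof (induction m)
 case 0
 show ?case by (intro exI[of _ "\<lambda>_. p 0"]) simp
next
 case (Suc m)
 obtain \<gamma> where \<gamma>: "continuous_on {0..real m} \<gamma>" "\<gamma> 0 = p 0" "\<gamma> (real m) = p m" "!!i s. i < m ==> s \<in> {real i..real i + 1} ==> P i (\<gamma> s)"
  using Suc.IH Suc.prems less_Suc_eq by metis
 obtain g :: "real => 'a" where g: "continuous_on {0..1} g" "g 0 = p m" "g 1 = p (Suc m)" "\<forall>s\<in>{0..1}. P m (g s)"
  using Suc.prems[of m] by blast
 let ?\<gamma> = "\<lambda>s. if s \<le> real m then \<gamma> s else g (s - real m)"
 show ?case
 proof (intro exI[of _ ?\<gamma>] conjI allI impI ballI)
  have "continuous_on ({0..real m} \<union> {real m..real m + 1}) ?\<gamma>"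
  proof (rule continuous_on_cases)
   show "continuous_on {real m..real m + 1} (\<lambda>s. g (s - real m))"
    by (rule continuous_on_compose2[OF g(1)]) (auto intro!: continuous_intros)
   show "\<forall>x. x \<in> {0..real m} \<and> \<not> x \<le> real m \<or> x \<in> {real m..real m + 1} \<and> x \<le> real m --> \<gamma> x = g (x - real m)"
    using \<gamma>(3) g(2) by (auto dest: antisym)
  qed (use \<gamma>(1) in auto)
  moreover have "{0..real m} \<union> {real m..real m + 1} = {0..real (Suc m)}" by auto
  ultimately show "continuous_on {0..real (Suc m)} ?\<gamma>" by simp
  show "?\<gamma> 0 = p 0" using \<gamma>(2) by simp
  show "?\<gamma> (real (Suc m)) = p (Suc m)" using g(3) by simp
  fix i s assume i: "i < Suc m" and s: "s \<in> {real i..real i + 1}"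
  show "P i (?\<gamma> s)"
  proof (cases "i < m")
   case True
   then have "real i + 1 \<le> real m" by simp
   then show ?thesis using s \<gamma>(4)[OF True s] by simp
  next
   case False
   then have im: "i = m" using i by simp
   show ?thesis
   proof (cases "s \<le> real m")
    case True
    then have "s = real m" using s im by simp
    then show ?thesis using bspec[OF g(4), of 0] g(2) \<gamma>(3) im by simp
   next
    case False
    then show ?thesis using bspec[OF g(4), of "s - real m"] s im by simp
   qed
  qed
 qed
qed

text \<open>The second leg is run backwards: oscillation is controlled from the good end points
  \<open>p\<close> and \<open>p'\<close>, and \<open>q\<close> is only their common far end.\<close>

lemma two_segment_path:
 fixes p p' q :: "'a::real_normed_vector"
 assumes "!!t. 0 \<le> t ==> t \<le> 1 ==> P (p + t *\<^sub>R (q - p))" "!!t. 0 \<le> t ==> t \<le> 1 ==> P (p' + t *\<^sub>R (q - p'))"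
 shows "\<exists>g::real => 'a. continuous_on {0..1} g \<and> g 0 = p \<and> g 1 = p' \<and> (\<forall>s\<in>{0..1}. P (g s))"
proof (intro exI[of _ "linepath p q +++ linepath q p'"] conjI ballI)
 show "continuous_on {0..1} (linepath p q +++ linepath q p')"
  unfolding path_def[symmetric] by (intro path_join_imp) auto
 show "(linepath p q +++ linepath q p') 0 = p" "(linepath p q +++ linepath q p') 1 = p'"
  by (simp_all add: joinpaths_def linepath_def)
 fix s :: real assume s: "s \<in> {0..1}"
 show "P ((linepath p q +++ linepath q p') s)"
 proof (cases "s \<le> 1 / 2")
  case True
  have "(linepath p q +++ linepath q p') s = p + (2 * s) *\<^sub>R (q - p)"
   using True by (simp add: joinpaths_def linepath_def algebra_simps)
  then show ?thesis using assms(1)[of "2 * s"] True s by simp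
 next
  case False
  define u where "u = 2 - 2 * s"
  have u: "2 * s - 1 = 1 - u" by (simp add: u_def)
  have "(linepath p q +++ linepath q p') s = linepath q p' (2 * s - 1)" using False by (simp add: joinpaths_def)
  also have "\<dots> = p' + u *\<^sub>R (q - p')" unfolding u linepath_def by (simp add: algebra_simps)
  finally have "(linepath p q +++ linepath q p') s = p' + u *\<^sub>R (q - p')" .
  then show ?thesis using assms(2)[of u] False s by (simp add: u_def)
 qed
qed

lemma ball_not_covered:
 fixes X :: "'i => (real^'n) set"
 assumes I: "finite I" and X: "!!i. i \<in> I ==> X i \<in> sets borel" "!!i. i \<in> I ==> bounded (X i)"
  and lt: "(\<Sum>i\<in>I. measure lborel (X i)) < measure lborel (ball c \<rho>)"
 shows "\<exists>p\<in>ball c \<rho>. \<forall>i\<in>I. p \<notin> X i"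
proof (rule ccontr)
 assume "\<not> (\<exists>p\<in>ball c \<rho>. \<forall>i\<in>I. p \<notin> X i)"
 then have sub: "ball c \<rho> \<subseteq> (\<Union>i\<in>I. X i)" by blast
 have fm: "X i \<in> fmeasurable lborel" if "i \<in> I" for i
  using X[OF that] by (intro fmeasurableI emeasure_bounded_finite) auto
 have "measure lborel (ball c \<rho>) \<le> measure lborel (\<Union>i\<in>I. X i)"
  using fm I by (intro measure_mono_fmeasurable[OF sub] fmeasurable.finite_UN) auto
 also have "\<dots> \<le> (\<Sum>i\<in>I. measure lborel (X i))" by (rule measure_UNION_le[OF I]) (use X(1) in auto)
 finally show False using lt by simp
qed

lemma markov_ball:
 fixes v :: "real^'n => real^'n"
 assumes v: "v \<in> borel_measurable borel" and b: "b > 0" and m: "m \<ge> 0"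
  and int: "(\<integral>\<^sup>+q. ennreal (norm (v q)) * indicator (ball x R) q \<partial>lborel) \<le> ennreal (b * m)"
 shows "measure lborel {q \<in> ball x R. norm (v q) > b} \<le> m"
proof -
 let ?f = "\<lambda>q. ennreal (norm (v q))"
 let ?D = "{q \<in> space lborel. 1 \<le> ennreal (1 / b) * ?f q} \<inter> ball x R"
 have [measurable]: "v \<in> borel_measurable borel" "ball x R \<in> sets borel" using v by auto
 have "{q \<in> ball x R. norm (v q) > b} \<subseteq> ?D"
 proof
  fix q assume q: "q \<in> {q \<in> ball x R. norm (v q) > b}"
  have "1 \<le> ennreal (1 / b) * ennreal (norm (v q))"
   using b q by (subst ennreal_mult[symmetric]) (auto simp: field_simps)
  then show "q \<in> ?D" using q by auto
 qed
 moreover have "?D \<in> sets lborel" by measurable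
 ultimately have "emeasure lborel {q \<in> ball x R. norm (v q) > b} \<le> emeasure lborel ?D" by (rule emeasure_mono)
 also have "\<dots> = emeasure lborel ({q \<in> ball x R. 1 \<le> ennreal (1 / b) * ?f q})"
  by (rule arg_cong[of _ _ "emeasure lborel"]) auto
 also have "\<dots> \<le> ennreal (1 / b) * (\<integral>\<^sup>+q. ?f q * indicator (ball x R) q \<partial>lborel)"
  by (rule nn_integral_Markov_inequality) measurable
 also have "\<dots> \<le> ennreal (1 / b) * ennreal (b * m)" using int by (intro mult_left_mono) auto
 also have "\<dots> = ennreal m" using b m by (simp add: ennreal_mult[symmetric])
 finally show ?thesis unfolding measure_def using m by (simp add: enn2real_leI)
qed

text \<open>A ball of half the radius has 2^(-n) of the volume, and three exceptional sets of
  relative size 2^(-n-2) do not cover it.\<close>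

definition eta_const :: "('n::finite) itself => real" where
 "eta_const _ = 1 / 2 ^ (CARD('n) + 2)"

text \<open>The loop is sampled at N points. Near each sample a point is chosen that is good for the
  balls on both sides and at which \<open>F\<close> is close to the affine map; neighbouring choices
  are joined through a point that both see along good segments. Closeness at the chosen points comes
  from the L^1 bound, closeness in between from the oscillation bound.\<close>

lemma approximating_loop:
 fixes F :: "real^'n => real^'n" and C :: "real => real^'n" and A :: "real^'n^'n"
 assumes \<Omega>: "open \<Omega>" and F: "F \<in> BV \<Omega>" "continuous_on \<Omega> F"
  and C: "C 0 = C 1" "!!t. t \<in> {0..1} ==> C t \<in> ball x r"
  and \<rho>: "0 < \<rho>" "\<rho> \<le> r" and N: "N > 0"
  and unif: "!!s t. s \<in> {0..1} ==> t \<in> {0..1} ==> \<bar>s - t\<bar> \<le> 1 / real N ==> dist (C s) (C t) < \<rho> / 2"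
  and sub: "!!i. i < N ==> ball (C (real i / real N)) (2 * \<rho>) \<subseteq> \<Omega>"
  and K: "!!i. i < N ==> BV_mass \<Omega> F (ball (C (real i / real N)) (2 * \<rho>)) \<le> K * \<rho> ^ CARD('n)" "K \<ge> 0"
  and b: "b > 0"
  and L1: "(\<integral>\<^sup>+q. ennreal (norm (indicator \<Omega> q *\<^sub>R F q - A *v q - c)) * indicator (ball x (2 * r)) q \<partial>lborel)
    \<le> ennreal (b * (eta_const TYPE('n) * measure lborel (ball (0::real^'n) \<rho>)))"
 shows "\<exists>\<gamma>. continuous_on {0..1} \<gamma> \<and> \<gamma> 0 = \<gamma> 1 \<and> (\<forall>t\<in>{0..1}. dist (\<gamma> t) (C t) < 2 * \<rho> \<and>
   norm (F (\<gamma> t) - A *v \<gamma> t - c) \<le> osc_const TYPE('n) K (eta_const TYPE('n)) * \<rho> + b + onorm ((*v) A) * (2 * \<rho>))"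
proof -
 let ?n = "CARD('n)" and ?\<eta> = "eta_const TYPE('n)"
 let ?h = "osc_const TYPE('n) K ?\<eta>"
 let ?v = "\<lambda>q. indicator \<Omega> q *\<^sub>R F q - A *v q - c"
 define W where "W = measure lborel (ball (0::real^'n) \<rho>)"
 have W: "W > 0" "!!y::real^'n. measure lborel (ball y \<rho>) = W" "!!y::real^'n. measure lborel (ball y (\<rho> / 2)) = W / 2 ^ ?n"
  using \<rho>(1) by (simp_all add: W_def measure_ball power_divide)
 have \<eta>: "?\<eta> > 0" "?\<eta> * W = W / 2 ^ ?n / 4" "2 * ?\<eta> < 1"
 proof -
  have "(2::real) * 1 < 2 ^ 2 * 2 ^ ?n" by (rule less_le_trans[of _ "2 ^ 2 * 1"]) (auto intro: one_le_power)
  then show "2 * ?\<eta> < 1" by (simp add: eta_const_def power_add mult.commute)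
 qed (simp_all add: eta_const_def power_add)
 have i: "integrable (lebesgue_on \<Omega>) F" using F(1) by (simp add: BV_def)
 have um: "(\<lambda>x. indicator \<Omega> x *\<^sub>R F x) \<in> borel_measurable borel"
  using represents_continuous[OF \<Omega> i F(2)] by (auto simp: represents_def)
 have Am: "(\<lambda>q. A *v q) \<in> borel_measurable borel"
  by (intro borel_measurable_continuous_onI linear_continuous_on matrix_vector_mul_bounded_linear)
 have vm: "?v \<in> borel_measurable borel" using um Am by (intro borel_measurable_diff) auto
 \<comment> \<open>Points where the affine approximation fails by more than \<open>b\<close>; by
   Markov their measure is at most the fraction \<eta> of the volume of a ball of radius
   \<rho>.\<close>
 define Z where "Z = {q \<in> ball x (2 * r). norm (?v q) > b}"
 have Zm: "measure lborel Z \<le> ?\<eta> * W"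
  unfolding Z_def
 proof (rule markov_ball[OF vm b])
  show "?\<eta> * W \<ge> 0" using \<eta>(1) W(1) by simp
  show "(\<integral>\<^sup>+q. ennreal (norm (?v q)) * indicator (ball x (2 * r)) q \<partial>lborel) \<le> ennreal (b * (?\<eta> * W))"
   using L1 unfolding W_def .
 qed
 have Zs: "Z \<in> sets borel"
 proof -
  have "Z = ball x (2 * r) \<inter> (\<lambda>q. norm (?v q)) -` {b<..} \<inter> space borel" by (auto simp: Z_def)
  then show ?thesis using measurable_sets[OF measurable_compose[OF vm borel_measurable_norm], of "{b<..}"] by (auto simp: Int_assoc)
 qed
 have Zb: "bounded Z" by (rule bounded_subset[OF bounded_ball[of x "2 * r"]]) (auto simp: Z_def)
 define y where "y = (\<lambda>i::nat. C (real i / real N))"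
 have ybr: "y i \<in> ball x r" if "i \<le> N" for i using C(2)[of "real i / real N"] that N by (simp add: y_def)
 have yN: "y N = y 0" using N C(1) by (simp add: y_def)
 have ydist: "dist (y i) (y (Suc i)) < \<rho> / 2" if "i < N" for i
  unfolding y_def using that N by (intro unif) (auto simp: field_simps)
 define G where "G = (\<lambda>i ST. fst ST \<in> sets borel \<and> fst ST \<subseteq> ball (y i) \<rho> \<and> measure lborel (ball (y i) \<rho> - fst ST) \<le> ?\<eta> * W \<and>
  (\<forall>p\<in>fst ST. snd ST p \<in> sets borel \<and> snd ST p \<subseteq> ball (y i) \<rho> \<and> measure lborel (ball (y i) \<rho> - snd ST p) \<le> ?\<eta> * W \<and>
   (\<forall>q\<in>snd ST p. \<forall>t. 0 \<le> t --> t \<le> 1 --> norm (F (p + t *\<^sub>R (q - p)) - F p) \<le> ?h * \<rho>)))"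
 have "\<exists>ST. G i ST" if i: "i < N" for i
 proof -
  obtain S T where ST: "S \<in> sets borel" "S \<subseteq> ball (y i) \<rho>" "measure lborel (ball (y i) \<rho> - S) \<le> ?\<eta> * measure lborel (ball (y i) \<rho>)"
   "!!p. p \<in> S ==> T p \<in> sets borel \<and> T p \<subseteq> ball (y i) \<rho> \<and> measure lborel (ball (y i) \<rho> - T p) \<le> ?\<eta> * measure lborel (ball (y i) \<rho>)"
   "!!p q t. p \<in> S ==> q \<in> T p ==> 0 \<le> t ==> t \<le> 1 ==> norm (F (p + t *\<^sub>R (q - p)) - F p) \<le> ?h * \<rho>"
   using good_segments[OF \<Omega> F sub[OF i, folded y_def[THEN fun_cong]] \<rho>(1) K(1)[OF i, folded y_def[THEN fun_cong]] K(2) \<eta>(1)] unfolding y_def by blast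
  have "G i (S, T)" unfolding G_def fst_conv snd_conv using ST unfolding W(2) by simp
  then show ?thesis by blast
 qed
 then obtain ST where ST: "!!i. i < N ==> G i (ST i)" by metis
 define S where "S = (\<lambda>i. fst (ST i))"
 define T where "T = (\<lambda>i. snd (ST i))"
 have S: "S i \<in> sets borel" "S i \<subseteq> ball (y i) \<rho>" "measure lborel (ball (y i) \<rho> - S i) \<le> ?\<eta> * W" if "i < N" for i
  using ST[OF that] unfolding G_def S_def by simp_all
 have T: "T i p \<in> sets borel" "T i p \<subseteq> ball (y i) \<rho>" "measure lborel (ball (y i) \<rho> - T i p) \<le> ?\<eta> * W" if "i < N" "p \<in> S i" for i p
  using ST[OF that(1)] that(2) unfolding G_def S_def T_def by simp_all
 have seg: "norm (F (p + t *\<^sub>R (q - p)) - F p) \<le> ?h * \<rho>" if "i < N" "p \<in> S i" "q \<in> T i p" "0 \<le> t" "t \<le> 1" for i p q t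
  using ST[OF that(1)] that(2-) unfolding G_def S_def T_def by blast
 \<comment> \<open>The cyclic predecessor: sample 0 follows sample N - 1, so that the chain of paths
   can close.\<close>
 define prv where "prv = (\<lambda>i. if i = 0 then N - 1 else i - 1)"
 have "\<exists>p. p \<in> ball (y i) (\<rho> / 2) \<and> p \<in> S i \<and> p \<in> S (prv i) \<and> p \<notin> Z" if i: "i < N" for i
 proof -
  have pv: "prv i < N" using i by (auto simp: prv_def)
  have d: "dist (y (prv i)) (y i) < \<rho> / 2"
  proof (cases "i = 0")
   case True
   then have "Suc (prv i) = N" using N by (simp add: prv_def)
   then show ?thesis using ydist[OF pv] yN True by simp
  next
   case False
   then have "Suc (prv i) = i" by (simp add: prv_def)
   then show ?thesis using ydist[OF pv] by simp
  qed
  let ?X = "\<lambda>j::nat. if j = 0 then ball (y i) \<rho> - S i else if j = 1 then ball (y (prv i)) \<rho> - S (prv i) else Z"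
  have I3: "{..<3::nat} = {0, 1, 2}" by auto
  have "\<exists>p\<in>ball (y i) (\<rho> / 2). \<forall>j\<in>{..<3::nat}. p \<notin> ?X j"
  proof (rule ball_not_covered)
   show "?X j \<in> sets borel" for j using S(1)[OF i] S(1)[OF pv] Zs by auto
   show "bounded (?X j)" for j using Zb by (auto intro: bounded_subset[OF bounded_ball])
   have "(\<Sum>j<3. measure lborel (?X j)) \<le> 3 * (?\<eta> * W)"
    unfolding I3 using S(3)[OF i] S(3)[OF pv] Zm by simp
   also have "\<dots> < W / 2 ^ ?n"
   proof -
    have "3 * (a / 4) < a" if "a > 0" for a :: real using that by simp
    then show ?thesis unfolding \<eta>(2) using W(1) by (metis divide_pos_pos zero_less_numeral zero_less_power)
   qed
   finally show "(\<Sum>j<3. measure lborel (?X j)) < measure lborel (ball (y i) (\<rho> / 2))" by (simp add: W(3))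
  qed simp
  then obtain p where p: "p \<in> ball (y i) (\<rho> / 2)" "\<forall>j\<in>{..<3::nat}. p \<notin> ?X j" by blast
  have pX: "p \<notin> ball (y i) \<rho> - S i" "p \<notin> ball (y (prv i)) \<rho> - S (prv i)" "p \<notin> Z"
   using p(2) unfolding I3 by simp_all
  have "p \<in> ball (y i) \<rho>" using p(1) \<rho>(1) by simp
  moreover have "p \<in> ball (y (prv i)) \<rho>" using p(1) d dist_triangle[of "y (prv i)" p "y i"] by simp
  ultimately show ?thesis using p(1) pX by blast
 qed
 then obtain p0 where p0: "!!i. i < N ==> p0 i \<in> ball (y i) (\<rho> / 2) \<and> p0 i \<in> S i \<and> p0 i \<in> S (prv i) \<and> p0 i \<notin> Z" by metis
 \<comment> \<open>Reduction mod N makes p N equal to p 0, and thus the concatenated path a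
   loop.\<close>
 define p where "p = (\<lambda>i. p0 (i mod N))"
 have pS: "p i \<in> S i" "p (Suc i) \<in> S i" if i: "i < N" for i
 proof -
  show "p i \<in> S i" using p0[OF i] i by (simp add: p_def)
  show "p (Suc i) \<in> S i"
  proof (cases "Suc i = N")
   case True
   then have "prv 0 = i" by (auto simp: prv_def)
   then show ?thesis using p0[OF N] True by (simp add: p_def)
  next
   case False
   then have s: "Suc i < N" using i by simp
   then show ?thesis using p0[OF s] by (simp add: p_def prv_def)
  qed
 qed
 have pclose: "norm (F (p i) - A *v p i - c) \<le> b" for i
 proof -
  have m: "i mod N < N" using N by simp
  have nz: "p i \<notin> Z" and pb: "p i \<in> ball (y (i mod N)) (\<rho> / 2)" using p0[OF m] by (simp_all add: p_def)
  have "dist x (y (i mod N)) < r" using ybr[of "i mod N"] m by simp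
  then have "p i \<in> ball x (2 * r)" using pb \<rho> dist_triangle[of x "p i" "y (i mod N)"] by simp
  moreover have "p i \<in> \<Omega>" using sub[OF m] pb \<rho>(1) by (auto simp: y_def)
  ultimately show ?thesis using nz by (simp add: Z_def not_less)
 qed
 \<comment> \<open>Oscillation of \<open>F\<close> along the segment, error at its starting point,
   and variation of the linear part over a distance of at most 2 \<rho>.\<close>
 define \<kappa> where "\<kappa> = ?h * \<rho> + b + onorm ((*v) A) * (2 * \<rho>)"
 define P where "P = (\<lambda>i x. dist (y i) x < \<rho> \<and> norm (F x - A *v x - c) \<le> \<kappa>)"
 have segP: "P i (a + t *\<^sub>R (q - a))" if i: "i < N" and a: "a \<in> S i" "norm (F a - A *v a - c) \<le> b" and q: "q \<in> T i a" and t: "0 \<le> t" "t \<le> 1" for i a q t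
 proof -
  have ab: "a \<in> ball (y i) \<rho>" "q \<in> ball (y i) \<rho>" using S(2)[OF i] T(2)[OF i a(1)] a q by auto
  have "a + t *\<^sub>R (q - a) = (1 - t) *\<^sub>R a + t *\<^sub>R q" by (simp add: algebra_simps)
  then have z: "a + t *\<^sub>R (q - a) \<in> ball (y i) \<rho>" (is "?z \<in> _")
   using convexD_alt[OF convex_ball ab t] by simp
  have "norm (?z - a) \<le> 2 * \<rho>"
   using z ab(1) dist_triangle2[of ?z a "y i"] by (simp add: dist_norm dist_commute norm_minus_commute)
  then have "norm (A *v (?z - a)) \<le> onorm ((*v) A) * (2 * \<rho>)"
   using onorm[OF matrix_vector_mul_bounded_linear, of A "?z - a"] onorm_pos_le[OF matrix_vector_mul_bounded_linear, of A]
   by (meson mult_left_mono order_trans)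
  moreover have "norm (F ?z - F a) \<le> ?h * \<rho>" by (rule seg[OF i a(1) q t])
  moreover have "norm (F w - A *v w - c) \<le> norm (F w - F a) + norm (F a - A *v a - c) + norm (A *v (w - a))" for w
  proof -
   have "F w - A *v w - c = (F w - F a) + (F a - A *v a - c) - A *v (w - a)"
    by (simp add: matrix_vector_mult_diff_distrib)
   then show ?thesis
    by (metis order_trans[OF norm_triangle_ineq4 add_right_mono[OF norm_triangle_ineq]])
  qed
  note this[of ?z]
  ultimately have "norm (F ?z - A *v ?z - c) \<le> \<kappa>" using a(2) unfolding \<kappa>_def by linarith
  then show ?thesis using z by (simp add: P_def)
 qed
 have "\<exists>g::real => real^'n. continuous_on {0..1} g \<and> g 0 = p i \<and> g 1 = p (Suc i) \<and> (\<forall>s\<in>{0..1}. P i (g s))" if i: "i < N" for i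
 proof -
  note pi = pS[OF i]
  \<comment> \<open>Points of the ball not well seen from one of the two consecutive choices; both
    sets together do not exhaust the ball since 2 \<eta> < 1.\<close>
  let ?X = "\<lambda>j::nat. ball (y i) \<rho> - T i (if j = 0 then p i else p (Suc i))"
  have I2: "{..<2::nat} = {0, 1}" by auto
  have "\<exists>q\<in>ball (y i) \<rho>. \<forall>j\<in>{..<2::nat}. q \<notin> ?X j"
  proof (rule ball_not_covered)
   show "?X j \<in> sets borel" for j using T(1)[OF i pi(1)] T(1)[OF i pi(2)] by auto
   show "bounded (?X j)" for j by (auto intro: bounded_subset[OF bounded_ball])
   have "(\<Sum>j<2. measure lborel (?X j)) \<le> 2 * (?\<eta> * W)"
    unfolding I2 using T(3)[OF i pi(1)] T(3)[OF i pi(2)] by simp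
   also have "\<dots> < W" using \<eta>(3) W(1) by (simp add: mult.assoc[symmetric])
   finally show "(\<Sum>j<2. measure lborel (?X j)) < measure lborel (ball (y i) \<rho>)" by (simp add: W(2))
  qed simp
  then obtain q where q: "q \<in> ball (y i) \<rho>" "\<forall>j\<in>{..<2::nat}. q \<notin> ?X j" by blast
  have qT: "q \<in> T i (p i)" "q \<in> T i (p (Suc i))" using q unfolding I2 by auto
  show ?thesis
   by (rule two_segment_path[of "P i" "p i" q "p (Suc i)"]) (auto intro!: segP i pi pclose qT)
 qed
 from chain_paths[where P = P and p = p and m = N, OF this] obtain \<gamma> where \<gamma>: "continuous_on {0..real N} \<gamma>" "\<gamma> 0 = p 0" "\<gamma> (real N) = p N"
  "!!i s. i < N ==> s \<in> {real i..real i + 1} ==> P i (\<gamma> s)" by blast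
 show ?thesis
 proof (intro exI[of _ "\<lambda>t. \<gamma> (real N * t)"] conjI ballI)
  show "continuous_on {0..1} (\<lambda>t. \<gamma> (real N * t))"
   by (rule continuous_on_compose2[OF \<gamma>(1)]) (auto intro!: continuous_intros simp: mult_left_le)
  show "\<gamma> (real N * 0) = \<gamma> (real N * 1)" using \<gamma>(2,3) by (simp add: p_def)
  fix t :: real assume t: "t \<in> {0..1}"
  obtain i where i: "i < N" "real N * t \<in> {real i..real i + 1}"
  proof (cases "t = 1")
   case True
   then show ?thesis using that[of "N - 1"] N by (auto simp: of_nat_diff)
  next
   case False
   then have "real N * t < real N * 1" using t N by (intro mult_strict_left_mono) auto
   moreover have "real N * t \<ge> 0" using t by simp
   ultimately have "nat \<lfloor>real N * t\<rfloor> < N" by linarith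
   moreover have "real N * t \<in> {real (nat \<lfloor>real N * t\<rfloor>)..real (nat \<lfloor>real N * t\<rfloor>) + 1}"
   proof -
    have "y \<in> {real (nat \<lfloor>y\<rfloor>)..real (nat \<lfloor>y\<rfloor>) + 1}" if "y \<ge> 0" for y :: real
     using that of_int_floor_le[of y] real_of_int_floor_add_one_gt[of y] by (simp add: less_imp_le)
    then show ?thesis using \<open>real N * t \<ge> 0\<close> by blast
   qed
   ultimately show ?thesis by (rule that)
  qed
  have P: "P i (\<gamma> (real N * t))" by (rule \<gamma>(4)[OF i])
  have "dist (C (real i / real N)) (C t) < \<rho> / 2"
  proof (rule unif)
   show "real i / real N \<in> {0..1}" using i(1) by simp
   have "\<bar>real i - real N * t\<bar> \<le> 1" using i(2) by auto
   moreover have "real i / real N - t = (real i - real N * t) / real N" using N by (simp add: field_simps)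
   ultimately show "\<bar>real i / real N - t\<bar> \<le> 1 / real N" using N by (simp add: abs_divide divide_right_mono)
  qed (rule t)
  then show "dist (\<gamma> (real N * t)) (C t) < 2 * \<rho>"
   using P \<rho>(1) dist_triangle3[of "\<gamma> (real N * t)" "C t" "y i"] unfolding P_def y_def by linarith
  show "norm (F (\<gamma> (real N * t)) - A *v \<gamma> (real N * t) - c) \<le> ?h * \<rho> + b + onorm ((*v) A) * (2 * \<rho>)"
   using P unfolding P_def \<kappa>_def by simp
 qed
qed

text \<open>The angle \<open>Arg2pi\<close> jumps at the positive real axis, where the two ends of
  the loop coincide. Continuity is borrowed from the correspondence between homotopies of loops and
  of circle maps, applied to the constant homotopy.\<close>

lemma closed_loop_on_circle:
 fixes \<gamma> :: "real => 'a::real_normed_vector"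
 assumes "continuous_on {0..1} \<gamma>" "\<gamma> 0 = \<gamma> 1"
 shows "continuous_on (sphere (0::complex) 1) (\<lambda>z. \<gamma> (Arg2pi z / (2 * pi)))"
proof -
 have "homotopic_loops UNIV \<gamma> \<gamma>"
  using assms by (simp add: homotopic_loops_refl path_def pathstart_def pathfinish_def)
 from homotopic_with_imp_continuous[OF homotopic_loops_imp_homotopic_circlemaps[OF this]]
 show ?thesis by (simp add: o_def)
qed

lemma matrix_bounded_below:
 fixes A :: "real^'n^'n"
 assumes "!!v. v ~= 0 ==> A *v v ~= 0"
 obtains \<alpha> where "\<alpha> > 0" "!!v. \<alpha> * norm v \<le> norm (A *v v)"
proof -
 have lin: "linear ((*v) A)" by (rule matrix_vector_mul_linear)
 have "inj ((*v) A)" unfolding linear_injective_0[OF lin] using assms by blast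
 from linear_inj_bounded_below_pos[OF lin this] that show ?thesis by (metis mult.commute)
qed

lemma loop_modulus:
 fixes C :: "'i => real => 'a::metric_space"
 assumes "finite I" "!!i. i \<in> I ==> continuous_on {0..1} (C i)" and e: "e > 0"
 obtains N where "N > 0" "!!i s t. i \<in> I ==> s \<in> {0..1} ==> t \<in> {0..1} ==> \<bar>s - t\<bar> \<le> 1 / real N ==> dist (C i s) (C i t) < e"
proof -
 have "\<exists>d>0. \<forall>s\<in>{0..1}. \<forall>t\<in>{0..1}. \<bar>s - t\<bar> < d --> dist (C i s) (C i t) < e" if "i \<in> I" for i
  using compact_uniformly_continuous[OF assms(2)[OF that] compact_Icc] e unfolding uniformly_continuous_on_def
  by (metis abs_minus_commute dist_commute dist_real_def)
 then obtain d where d: "!!i. i \<in> I ==> d i > 0" "!!i s t. i \<in> I ==> s \<in> {0..1} ==> t \<in> {0..1} ==> \<bar>s - t\<bar> < d i ==> dist (C i s) (C i t) < e"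
  by metis
 define m where "m = Min (insert 1 (d ` I))"
 have m: "m > 0" "!!i. i \<in> I ==> m \<le> d i" using assms(1) d(1) by (auto simp: m_def)
 obtain N :: nat where N: "1 / m < real N" using reals_Archimedean2 by blast
 then have N0: "real N > 0" using m(1) by (smt (verit) divide_pos_pos)
 have "1 / real N < m" using N N0 m(1) by (simp add: field_simps)
 then show ?thesis using that[of N] N0 d(2) m(2) by (smt (verit) of_nat_0_less_iff)
qed

text \<open>
 The loops are first moved to nearby loops along which \<open>fs k\<close> is uniformly close to an affine map
 with linear part \<open>A\<close>.
\<close>

lemma blow_up_homotopy:
 fixes fs :: "nat => real^'n => real^'n" and A :: "real^'n^'n" and K :: "bool => complex => real^'n"
 assumes \<Omega>: "open \<Omega>" and x\<Omega>: "x \<in> \<Omega>" and fs: "!!k. fs k \<in> BV \<Omega>" "!!k. continuous_on \<Omega> (fs k)" "!!k. inj_on (fs k) \<Omega>"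
  and f: "f \<in> BV \<Omega>" and lim: "(\<lambda>k. LINT x|lebesgue_on \<Omega>. norm (fs k x - f x)) \<longlonglongrightarrow> 0"
  and u: "represents \<Omega> f u" and dp: "differential_point u A x" and mc: "mass_controlled \<Omega> fs x"
  and A: "!!v. v ~= 0 ==> A *v v ~= 0"
  and Kc: "!!i. continuous_on (sphere 0 1) (K i)" and Kn: "!!i z. z \<in> sphere 0 1 ==> norm (K i z) < 1"
  and Kd: "!!z w. z \<in> sphere 0 1 ==> w \<in> sphere 0 1 ==> K True z ~= K False w"
 shows "\<exists>k r. 0 < r \<and> ball x r \<subseteq> \<Omega> \<and>
  homotopic_maps (sphere 0 1 \<times> sphere 0 1) (- {0})
   (\<lambda>z. fs k (x + r *\<^sub>R K True (fst z)) - fs k (x + r *\<^sub>R K False (snd z)))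
   (\<lambda>z. A *v (K True (fst z) - K False (snd z)))"
proof -
 let ?n = "CARD('n)" and ?\<eta> = "eta_const TYPE('n)" and ?S = "sphere (0::complex) 1"
 obtain \<alpha> where \<alpha>: "\<alpha> > 0" "!!v. \<alpha> * norm v \<le> norm (A *v v)" using matrix_bounded_below[OF A] by blast
 have "\<exists>d>0. \<forall>a\<in>K True ` ?S. \<forall>b\<in>K False ` ?S. d \<le> dist a b"
 proof (rule separate_compact_closed)
  show "compact (K True ` ?S)" by (intro compact_continuous_image Kc compact_sphere)
  show "closed (K False ` ?S)" by (intro compact_imp_closed compact_continuous_image Kc compact_sphere)
  show "K True ` ?S \<inter> K False ` ?S = {}" using Kd by fastforce
 qed
 then obtain d where d: "d > 0" "!!z w. z \<in> ?S ==> w \<in> ?S ==> d \<le> norm (K True z - K False w)"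
  by (auto simp: dist_norm)
 obtain M where M: "M > 0" "!!\<delta>. \<delta> > 0 ==> \<exists>r0>0. \<forall>r. 0 < r \<and> r < r0 -->
   (\<forall>Y Q. finite Y \<and> Y \<subseteq> cball x r \<and> eventually Q sequentially -->
    (\<exists>k. Q k \<and> (\<forall>y\<in>Y. ball y (\<delta> * r) \<subseteq> \<Omega> \<and> BV_mass \<Omega> (fs k) (ball y (\<delta> * r)) \<le> M * (\<delta> * r) ^ ?n)))"
  using mc unfolding mass_controlled_def by blast
 \<comment> \<open>Mass control is applied on balls of radius 2 \<rho>, whereas the oscillation
   estimate measures mass against \<rho>^n.\<close>
 define Kc' where "Kc' = M * 2 ^ ?n"
 have Kc': "Kc' \<ge> 0" using M(1) by (simp add: Kc'_def)
 define h where "h = osc_const TYPE('n) Kc' ?\<eta>"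
 have \<eta>: "?\<eta> > 0" by (simp add: eta_const_def)
 have h: "h > 0" unfolding h_def by (rule osc_const_pos[OF Kc' \<eta>])
 define B where "B = onorm ((*v) A)"
 have B: "B \<ge> 0" unfolding B_def by (rule onorm_pos_le[OF matrix_vector_mul_bounded_linear])
 \<comment> \<open>Chosen after h, which depends on the mass bound and not on \<delta>. The term
   d/16 keeps the moved circles more than d r / 2 apart; the last term makes the oscillation error
   small against \<alpha> d r, the least size of the linear image of a difference of points on the
   two circles.\<close>
 define \<delta> where "\<delta> = min 1 (min (d / 16) (\<alpha> * d / (16 * (h + 2 * B + 1))))"
 have \<delta>: "0 < \<delta>" "\<delta> \<le> 1" "\<delta> \<le> d / 16" "(h + 2 * B) * \<delta> \<le> \<alpha> * d / 16"
 proof -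
  have p: "h + 2 * B + 1 > 0" using h B by simp
  show "0 < \<delta>" using d(1) \<alpha>(1) p by (simp add: \<delta>_def)
  show "\<delta> \<le> 1" by (simp add: \<delta>_def)
  show "\<delta> \<le> d / 16" unfolding \<delta>_def by (intro min.coboundedI2 min.coboundedI1 order_refl)
  have "\<delta> \<le> \<alpha> * d / (16 * (h + 2 * B + 1))" by (simp add: \<delta>_def)
  then have "(h + 2 * B + 1) * \<delta> \<le> \<alpha> * d / 16" using p by (simp add: field_simps)
  then show "(h + 2 * B) * \<delta> \<le> \<alpha> * d / 16" using \<open>0 < \<delta>\<close> by (simp add: distrib_right)
 qed
 \<comment> \<open>Such that the L^1 error at scale 2r equals the threshold \<open>b\<close> times
   the fraction \<eta> of the volume of a ball of radius \<delta> r.\<close>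
 define \<epsilon> where "\<epsilon> = \<alpha> * d / 16 * (?\<eta> * (unit_ball_vol (real ?n) * \<delta> ^ ?n)) / 2 ^ (?n + 1)"
 have \<epsilon>: "\<epsilon> > 0" unfolding \<epsilon>_def using \<alpha>(1) d(1) \<eta> \<delta>(1) by simp
 define us where "us = (\<lambda>k x. indicator \<Omega> x *\<^sub>R fs k x)"
 have us: "represents \<Omega> (fs k) (us k)" for k
  unfolding us_def using fs(1)[of k] by (intro represents_continuous \<Omega> fs(2)) (simp add: BV_def)
 obtain r1 where r1: "r1 > 0" "!!r. 0 < r ==> r < r1 ==> \<exists>c. eventually (\<lambda>k.
  (\<integral>\<^sup>+q. ennreal (norm (us k q - A *v q - c)) * indicator (ball x r) q \<partial>lborel) \<le> ennreal (\<epsilon> * r ^ (?n + 1))) sequentially"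
  using blow_up_L1[OF \<Omega> fs(1) f lim us u dp \<epsilon>] by blast
 have "2 * \<delta> > 0" using \<delta>(1) by simp
 from M(2)[OF this] obtain r2 where r2': "r2 > 0 \<and> (\<forall>r. 0 < r \<and> r < r2 -->
   (\<forall>Y Q. finite Y \<and> Y \<subseteq> cball x r \<and> eventually Q sequentially -->
    (\<exists>k. Q k \<and> (\<forall>y\<in>Y. ball y (2 * \<delta> * r) \<subseteq> \<Omega> \<and> BV_mass \<Omega> (fs k) (ball y (2 * \<delta> * r)) \<le> M * (2 * \<delta> * r) ^ ?n))))" ..
 note r2 = conjunct1[OF r2'] conjunct2[OF r2']
 obtain r3 where r3: "r3 > 0" "ball x r3 \<subseteq> \<Omega>" using \<Omega> x\<Omega> openE by blast
 define r where "r = min r1 (min r2 r3) / 4"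
 have r: "0 < r" "2 * r < r1" "r < r2" "3 * r < r3" using r1(1) r2(1) r3(1) by (auto simp: r_def)
 define \<rho> where "\<rho> = \<delta> * r"
 have \<rho>: "0 < \<rho>" "\<rho> \<le> r" "\<rho> \<le> d * r / 16" using \<delta> r(1) by (auto simp: \<rho>_def mult_le_cancel_right1 mult_right_mono dest: mult_right_mono[of \<delta> "d / 16" r])
 define b where "b = \<alpha> * d / 16 * r"
 have b: "b > 0" using \<alpha>(1) d(1) r(1) by (simp add: b_def)
 have "0 < 2 * r" using r(1) by simp
 from r1(2)[OF this r(2)] obtain c where c: "eventually (\<lambda>k.
  (\<integral>\<^sup>+q. ennreal (norm (us k q - A *v q - c)) * indicator (ball x (2 * r)) q \<partial>lborel) \<le> ennreal (\<epsilon> * (2 * r) ^ (?n + 1))) sequentially"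
  by blast
 have \<epsilon>eq: "\<epsilon> * (2 * r) ^ (?n + 1) = b * (?\<eta> * measure lborel (ball (0::real^'n) \<rho>))"
  using \<rho>(1) by (simp add: measure_ball \<epsilon>_def b_def \<rho>_def power_mult_distrib field_simps)
 define C where "C = (\<lambda>i t. x + r *\<^sub>R K i (cis (2 * pi * t)))"
 have cs: "cis a \<in> ?S" for a by simp
 have CC: "continuous_on {0..1} (C i)" for i
  unfolding C_def
  by (intro continuous_intros continuous_on_compose2[OF Kc, of _ "\<lambda>t. cis (2 * pi * t)"]) auto
 have C01: "C i 0 = C i 1" for i by (simp add: C_def)
 have Cb: "C i t \<in> ball x r" for i t using Kn[OF cs, of i "2 * pi * t"] r(1) by (simp add: C_def dist_norm)
 have "\<rho> / 2 > 0" using \<rho> by simp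
 from loop_modulus[of "UNIV :: bool set" C, OF finite CC this]
 obtain N where N: "N > 0" "!!i s t. s \<in> {0..1} ==> t \<in> {0..1} ==> \<bar>s - t\<bar> \<le> 1 / real N ==> dist (C i s) (C i t) < \<rho> / 2"
  by (metis UNIV_I)
 define Y where "Y = (\<Union>i. (\<lambda>j. C i (real j / real N)) ` {..<N})"
 have Y: "finite Y" by (simp add: Y_def)
 have Yr: "Y \<subseteq> cball x r" unfolding Y_def using subsetD[OF ball_subset_cball Cb] by blast
 \<comment> \<open>The L^1 estimate holds eventually, and the mass bound at the finitely many
   samples holds for some index among those; a single k has both.\<close>
 have "\<exists>k. (\<integral>\<^sup>+q. ennreal (norm (us k q - A *v q - c)) * indicator (ball x (2 * r)) q \<partial>lborel) \<le> ennreal (\<epsilon> * (2 * r) ^ (?n + 1)) \<and>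
  (\<forall>y\<in>Y. ball y (2 * \<delta> * r) \<subseteq> \<Omega> \<and> BV_mass \<Omega> (fs k) (ball y (2 * \<delta> * r)) \<le> M * (2 * \<delta> * r) ^ ?n)"
  by (rule r2(2)[rule_format]) (use r Y Yr c in auto)
 then obtain k where k': "(\<integral>\<^sup>+q. ennreal (norm (us k q - A *v q - c)) * indicator (ball x (2 * r)) q \<partial>lborel) \<le> ennreal (\<epsilon> * (2 * r) ^ (?n + 1)) \<and>
  (\<forall>y\<in>Y. ball y (2 * \<delta> * r) \<subseteq> \<Omega> \<and> BV_mass \<Omega> (fs k) (ball y (2 * \<delta> * r)) \<le> M * (2 * \<delta> * r) ^ ?n)" ..
 note k = conjunct1[OF k'] conjunct2[OF k']
 define \<kappa> where "\<kappa> = h * \<rho> + b + B * (2 * \<rho>)"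
 have \<kappa>: "4 * \<kappa> \<le> \<alpha> * (d * r) / 2"
 proof -
  have "(h + 2 * B) * \<delta> * r \<le> \<alpha> * d / 16 * r" using \<delta>(4) r(1) by (intro mult_right_mono) auto
  then show ?thesis unfolding \<kappa>_def \<rho>_def b_def by (simp add: algebra_simps)
 qed
 have "\<exists>\<gamma>. continuous_on {0..1} \<gamma> \<and> \<gamma> 0 = \<gamma> 1 \<and> (\<forall>t\<in>{0..1}. dist (\<gamma> t) (C i t) < 2 * \<rho> \<and>
   norm (fs k (\<gamma> t) - A *v \<gamma> t - c) \<le> \<kappa>)" for i
  unfolding \<kappa>_def h_def B_def
 proof (rule approximating_loop[OF \<Omega> fs(1,2) C01 Cb \<rho>(1,2) N _ _ Kc' b])
  fix j assume "j < N"
  then have y: "C i (real j / real N) \<in> Y" by (auto simp: Y_def)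
  have e: "2 * \<rho> = 2 * \<delta> * r" by (simp add: \<rho>_def)
  show "ball (C i (real j / real N)) (2 * \<rho>) \<subseteq> \<Omega>" unfolding e using k(2) y by blast
  have "M * (2 * \<delta> * r) ^ ?n = Kc' * \<rho> ^ ?n" by (simp add: Kc'_def \<rho>_def power_mult_distrib)
  then show "BV_mass \<Omega> (fs k) (ball (C i (real j / real N)) (2 * \<rho>)) \<le> Kc' * \<rho> ^ ?n" unfolding e using k(2) y by metis
 next
  show "(\<integral>\<^sup>+q. ennreal (norm (indicator \<Omega> q *\<^sub>R fs k q - A *v q - c)) * indicator (ball x (2 * r)) q \<partial>lborel)
   \<le> ennreal (b * (?\<eta> * measure lborel (ball (0::real^'n) \<rho>)))"
   using k(1) unfolding \<epsilon>eq us_def .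
 qed
 then obtain \<gamma> where \<gamma>: "!!i. continuous_on {0..1} (\<gamma> i)" "!!i. \<gamma> i 0 = \<gamma> i 1"
  "!!i t. t \<in> {0..1} ==> dist (\<gamma> i t) (C i t) < 2 * \<rho>" "!!i t. t \<in> {0..1} ==> norm (fs k (\<gamma> i t) - A *v \<gamma> i t - c) \<le> \<kappa>"
  by metis
 define \<Gamma> where "\<Gamma> = (\<lambda>i z. \<gamma> i (Arg2pi z / (2 * pi)))"
 define H where "H = (\<lambda>i z. x + r *\<^sub>R K i z)"
 have \<Gamma>c: "continuous_on ?S (\<Gamma> i)" for i unfolding \<Gamma>_def by (rule closed_loop_on_circle[OF \<gamma>(1,2)])
 have Hc: "continuous_on ?S (H i)" for i unfolding H_def by (intro continuous_intros Kc)
 have arg: "Arg2pi z / (2 * pi) \<in> {0..1}" for z using Arg2pi_ge_0[of z] Arg2pi_lt_2pi[of z] by (simp add: field_simps)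
 have CH: "C i (Arg2pi z / (2 * pi)) = H i z" if "z \<in> ?S" for i z
  using that Arg2pi_eq[of z] by (simp add: C_def H_def cis_conv_exp mult.commute)
 have \<Gamma>H: "norm (\<Gamma> i z - H i z) < 2 * \<rho>" if "z \<in> ?S" for i z
  using \<gamma>(3)[OF arg, of i z] CH[OF that] by (simp add: \<Gamma>_def dist_norm)
 have \<Gamma>\<kappa>: "norm (fs k (\<Gamma> i z) - A *v \<Gamma> i z - c) \<le> \<kappa>" for i z
  using \<gamma>(4)[OF arg, of i z] by (simp add: \<Gamma>_def)
 have HH: "d * r \<le> norm (H True z - H False w)" if "z \<in> ?S" "w \<in> ?S" for z w
 proof -
  have "H True z - H False w = r *\<^sub>R (K True z - K False w)" by (simp add: H_def scaleR_diff_right)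
  then show ?thesis using d(2)[OF that] r(1) by (simp add: mult.commute)
 qed
 have Hb: "norm (H i z - x) < r" if "z \<in> ?S" for i z using Kn[OF that, of i] r(1) by (simp add: H_def)
 have norm3: "norm v \<le> norm p + norm q + norm s" if "v = p - q + s" for v p q s :: "real^'n"
  unfolding that by (rule order_trans[OF norm_triangle_ineq add_right_mono[OF norm_triangle_ineq4]])
 let ?X = "?S \<times> ?S"
 have dr: "d * r > 0" using d(1) r(1) by simp
 \<comment> \<open>Pairs of distinct points of \<Omega>. The circles are moved to the nearby loops
   inside this set; continuity and injectivity of f_k then carry the homotopy to nonzero
   differences.\<close>
 let ?U = "{p :: (real^'n) \<times> (real^'n). fst p \<in> \<Omega> \<and> snd p \<in> \<Omega> \<and> fst p ~= snd p}"
 have h1: "homotopic_maps ?X ?U (\<lambda>z. (H True (fst z), H False (snd z))) (\<lambda>z. (\<Gamma> True (fst z), \<Gamma> False (snd z)))"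
 proof (rule homotopic_with_linear)
  show "continuous_on ?X (\<lambda>z. (H True (fst z), H False (snd z)))" "continuous_on ?X (\<lambda>z. (\<Gamma> True (fst z), \<Gamma> False (snd z)))"
   by (intro continuous_on_Pair continuous_on_compose2[OF Hc] continuous_on_compose2[OF \<Gamma>c] continuous_intros; auto)+
  fix z assume z: "z \<in> ?X"
  then have zS: "fst z \<in> ?S" "snd z \<in> ?S" by auto
  show "closed_segment (H True (fst z), H False (snd z)) (\<Gamma> True (fst z), \<Gamma> False (snd z)) \<subseteq> ?U"
  proof
   fix p assume "p \<in> closed_segment (H True (fst z), H False (snd z)) (\<Gamma> True (fst z), \<Gamma> False (snd z))"
   then obtain t where t: "0 \<le> t" "t \<le> 1" and p: "p = (1 - t) *\<^sub>R (H True (fst z), H False (snd z)) + t *\<^sub>R (\<Gamma> True (fst z), \<Gamma> False (snd z))"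
    by (auto simp: in_segment)
   let ?e = "\<lambda>i w. t *\<^sub>R (\<Gamma> i w - H i w)"
   have pe: "fst p = H True (fst z) + ?e True (fst z)" "snd p = H False (snd z) + ?e False (snd z)"
    unfolding p by (simp_all add: algebra_simps)
   have eb: "norm (?e i w) < 2 * \<rho>" if "w \<in> ?S" for i w
    using \<Gamma>H[OF that, of i] t mult_left_le_one_le[of "norm (\<Gamma> i w - H i w)" t] by (simp add: )
   have in\<Omega>: "H i w + ?e i w \<in> \<Omega>" if w: "w \<in> ?S" for i w
   proof -
    have "norm (H i w + ?e i w - x) \<le> norm (H i w - x) + norm (?e i w)"
     using norm_triangle_ineq[of "H i w - x" "?e i w"] by (simp add: algebra_simps)
    also have "\<dots> < r3" using Hb[OF w, of i] eb[OF w, of i] \<rho>(2) r(4) by linarith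
    finally show ?thesis using r3(2) by (auto simp: dist_norm norm_minus_commute)
   qed
   have "norm (H True (fst z) - H False (snd z)) \<le> norm (fst p - snd p) + norm (?e True (fst z)) + norm (?e False (snd z))"
   proof -
    have "H True (fst z) - H False (snd z) = (fst p - snd p) - ?e True (fst z) + ?e False (snd z)" unfolding pe by simp
    then show ?thesis by (rule norm3)
   qed
   then have "norm (fst p - snd p) > 0"
    using HH[OF zS] eb[OF zS(1), of True] eb[OF zS(2), of False] \<rho>(3) dr by linarith
   then show "p \<in> ?U" using in\<Omega>[OF zS(1), of True] in\<Omega>[OF zS(2), of False] pe by auto
  qed
 qed
 have "homotopic_maps ?X (- {0}) ((\<lambda>p. fs k (fst p) - fs k (snd p)) \<circ> (\<lambda>z. (H True (fst z), H False (snd z))))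
   ((\<lambda>p. fs k (fst p) - fs k (snd p)) \<circ> (\<lambda>z. (\<Gamma> True (fst z), \<Gamma> False (snd z))))"
 proof (rule homotopic_with_compose_continuous_left[OF h1])
  show "continuous_on ?U (\<lambda>p. fs k (fst p) - fs k (snd p))"
   by (intro continuous_intros continuous_on_compose2[OF fs(2)]) auto
  show "(\<lambda>p. fs k (fst p) - fs k (snd p)) \<in> ?U \<rightarrow> - {0}"
  proof (rule Pi_I)
   fix p assume "p \<in> ?U"
   then have "fst p \<in> \<Omega>" "snd p \<in> \<Omega>" "fst p ~= snd p" by simp_all
   then have "fs k (fst p) ~= fs k (snd p)" using inj_onD[OF fs(3)[of k]] by metis
   then show "fs k (fst p) - fs k (snd p) \<in> - {0}" by simp
  qed
 qed
 then have h2: "homotopic_maps ?X (- {0}) (\<lambda>z. fs k (H True (fst z)) - fs k (H False (snd z)))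
   (\<lambda>z. fs k (\<Gamma> True (fst z)) - fs k (\<Gamma> False (snd z)))" by (simp add: o_def)
 have c2: "continuous_on ?X (\<lambda>z. fs k (\<Gamma> True (fst z)) - fs k (\<Gamma> False (snd z)))"
  using homotopic_with_imp_continuous[OF h2] by blast
 have cA: "continuous_on X (\<lambda>z. A *v g z)" if "continuous_on X g" for X and g :: "complex \<times> complex => real^'n"
  using bounded_linear.continuous_on[OF matrix_vector_mul_bounded_linear that] .
 have c3: "continuous_on ?X (\<lambda>z. A *v (\<Gamma> True (fst z) - \<Gamma> False (snd z)))"
  by (intro cA continuous_on_diff continuous_on_compose2[OF \<Gamma>c] continuous_intros) auto
 have c4: "continuous_on ?X (\<lambda>z. A *v (K True (fst z) - K False (snd z)))"
  by (intro cA continuous_on_diff continuous_on_compose2[OF Kc] continuous_intros) auto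
 have \<Gamma>\<Gamma>: "d * r / 2 < norm (\<Gamma> True z - \<Gamma> False w)" if "z \<in> ?S" "w \<in> ?S" for z w
 proof -
  have "H True z - H False w = (\<Gamma> True z - \<Gamma> False w) - (\<Gamma> True z - H True z) + (\<Gamma> False w - H False w)" by simp
  then have "norm (H True z - H False w) \<le> norm (\<Gamma> True z - \<Gamma> False w) + norm (\<Gamma> True z - H True z) + norm (\<Gamma> False w - H False w)" by (rule norm3)
  then show ?thesis using HH[OF that] \<Gamma>H[OF that(1), of True] \<Gamma>H[OF that(2), of False] \<rho>(3) dr by linarith
 qed
 \<comment> \<open>On the new loops the difference of values is within 2 \<kappa> of the linear
   image, whose norm exceeds \<alpha> d r / 2 and hence 2 \<kappa>.\<close>
 have h3: "homotopic_maps ?X (- {0}) (\<lambda>z. fs k (\<Gamma> True (fst z)) - fs k (\<Gamma> False (snd z)))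
   (\<lambda>z. A *v (\<Gamma> True (fst z) - \<Gamma> False (snd z)))"
 proof (rule homotopic_with_linear[OF c2 c3], rule subsetI)
  fix z p assume z: "z \<in> ?X"
   and "p \<in> closed_segment (fs k (\<Gamma> True (fst z)) - fs k (\<Gamma> False (snd z))) (A *v (\<Gamma> True (fst z) - \<Gamma> False (snd z)))"
  let ?a = "fs k (\<Gamma> True (fst z)) - fs k (\<Gamma> False (snd z))" and ?b = "A *v (\<Gamma> True (fst z) - \<Gamma> False (snd z))"
  have zS: "fst z \<in> ?S" "snd z \<in> ?S" using z by auto
  have "norm (p - ?b) \<le> norm (?a - ?b)"
   using segment_bound(2)[OF \<open>p \<in> _\<close>] by (simp add: norm_minus_commute)
  also have "?a - ?b = (fs k (\<Gamma> True (fst z)) - A *v \<Gamma> True (fst z) - c) - (fs k (\<Gamma> False (snd z)) - A *v \<Gamma> False (snd z) - c)"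
   by (simp add: matrix_vector_mult_diff_distrib)
  also have "norm \<dots> \<le> \<kappa> + \<kappa>" by (rule order_trans[OF norm_triangle_ineq4 add_mono[OF \<Gamma>\<kappa> \<Gamma>\<kappa>]])
  finally have "norm (p - ?b) \<le> 2 * \<kappa>" by simp
  moreover have "\<alpha> * (d * r / 2) < norm ?b"
   using mult_strict_left_mono[OF \<Gamma>\<Gamma>[OF zS] \<alpha>(1)] \<alpha>(2)[of "\<Gamma> True (fst z) - \<Gamma> False (snd z)"] by linarith
  moreover have "norm (p - ?b) = norm ?b" if "p = 0" using that by simp
  moreover have "\<alpha> * (d * r) > 0" using \<alpha>(1) dr by simp
  ultimately show "p \<in> - {0}" using \<kappa> by (cases "p = 0") auto
 qed
 \<comment> \<open>Back to the original circles, now under the linear map alone; the factor r is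
   deformed to 1 at the same time.\<close>
 have h4: "homotopic_maps ?X (- {0}) (\<lambda>z. A *v (\<Gamma> True (fst z) - \<Gamma> False (snd z)))
   (\<lambda>z. A *v (K True (fst z) - K False (snd z)))"
 proof (rule homotopic_with_linear[OF c3 c4], rule subsetI)
  fix z p assume z: "z \<in> ?X"
   and "p \<in> closed_segment (A *v (\<Gamma> True (fst z) - \<Gamma> False (snd z))) (A *v (K True (fst z) - K False (snd z)))"
  then obtain t where t: "0 \<le> t" "t \<le> 1"
   and p: "p = (1 - t) *\<^sub>R (A *v (\<Gamma> True (fst z) - \<Gamma> False (snd z))) + t *\<^sub>R (A *v (K True (fst z) - K False (snd z)))"
   by (auto simp: in_segment)
  have zS: "fst z \<in> ?S" "snd z \<in> ?S" using z by auto
  let ?D = "K True (fst z) - K False (snd z)"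
  define e where "e = (\<Gamma> True (fst z) - H True (fst z)) - (\<Gamma> False (snd z) - H False (snd z))"
  have e: "norm e < 4 * \<rho>"
   using \<Gamma>H[OF zS(1), of True] \<Gamma>H[OF zS(2), of False]
    norm_triangle_ineq4[of "\<Gamma> True (fst z) - H True (fst z)" "\<Gamma> False (snd z) - H False (snd z)"] unfolding e_def by linarith
  have ge: "\<Gamma> True (fst z) - \<Gamma> False (snd z) = r *\<^sub>R ?D + e" by (simp add: e_def H_def scaleR_diff_right)
  let ?w = "((1 - t) * r + t) *\<^sub>R ?D + (1 - t) *\<^sub>R e"
  have "p = A *v ?w"
   unfolding p ge by (simp add: matrix_vector_mult_add_rdistrib matrix_vector_right_distrib matrix_vector_mult_scaleR algebra_simps)
  moreover have "?w ~= 0"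
  proof
   assume "?w = 0"
   then have sc: "((1 - t) * r + t) *\<^sub>R ?D = - ((1 - t) *\<^sub>R e)" by (simp add: eq_neg_iff_add_eq_0)
   have eq: "((1 - t) * r + t) * norm ?D = (1 - t) * norm e"
    using t r(1) arg_cong[of _ _ norm, OF sc] by simp
   have "((1 - t) * r + t) * d \<le> ((1 - t) * r + t) * norm ?D"
    using d(2)[OF zS] t r(1) by (intro mult_left_mono) auto
   moreover have "(1 - t) * norm e \<le> (1 - t) * (d * r / 4)"
    using e \<rho>(3) t by (intro mult_left_mono) auto
   ultimately have "((1 - t) * r + t) * d \<le> (1 - t) * (d * r / 4)" using eq by linarith
   then have "(1 - t) * (d * r) * (3 / 4) + t * d \<le> 0" by (simp add: algebra_simps)
   moreover have "(1 - t) * (d * r) \<ge> 0" "t * d \<ge> 0" using t dr d(1) by simp_all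
   moreover have "(1 - t) * (d * r) > 0 \<or> t * d > 0" using t dr d(1) by (cases "t = 0") auto
   ultimately show False by linarith
  qed
  ultimately show "p \<in> - {0}" using A by simp
 qed
 have "homotopic_maps ?X (- {0}) (\<lambda>z. fs k (H True (fst z)) - fs k (H False (snd z)))
   (\<lambda>z. A *v (K True (fst z) - K False (snd z)))"
  by (rule homotopic_with_trans[OF homotopic_with_trans[OF h2 h3] h4])
 moreover have "ball x r \<subseteq> \<Omega>" using r3(2) r(1,4) subset_ball[of r r3 x] by auto
 ultimately show ?thesis using r(1) unfolding H_def by blast
qed

section \<open>Differentiability in the plane\<close>

text \<open>By invariance of domain the injective map \<open>F\<close> is open on the interior. At
  an interior maximum of the distance to \<open>q\<close>, the image would contain a neighbourhood
  of F w and with it points farther away from \<open>q\<close>.\<close>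

lemma max_principle:
 fixes F :: "'a::euclidean_space => 'a"
 assumes T: "compact T" "T \<subseteq> \<Omega>" and F: "continuous_on \<Omega> F" "inj_on F \<Omega>"
  and bd: "!!z. z \<in> frontier T ==> norm (F z - q) \<le> m" and z: "z \<in> T"
 shows "norm (F z - q) \<le> m"
proof -
 have "continuous_on T (\<lambda>z. norm (F z - q))"
  by (intro continuous_intros continuous_on_subset[OF F(1) T(2)])
 then obtain w where w: "w \<in> T" "!!z. z \<in> T ==> norm (F z - q) \<le> norm (F w - q)"
  using continuous_attains_sup[OF T(1)] z by blast
 have "w \<notin> interior T"
 proof
  assume wi: "w \<in> interior T"
  have sub: "interior T \<subseteq> \<Omega>" using interior_subset T(2) by blast
  have "open (F ` interior T)"
   by (rule Further_Topology.invariance_of_domain[OF continuous_on_subset[OF F(1) sub] open_interior inj_on_subset[OF F(2) sub]])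
  moreover have "F w \<in> F ` interior T" using wi by simp
  ultimately obtain e where e: "e > 0" "cball (F w) e \<subseteq> F ` interior T" using open_contains_cball by blast
  obtain b :: 'a where b: "b \<in> Basis" using nonempty_Basis by blast
  \<comment> \<open>The direction pointing away from \<open>q\<close>, or any unit vector if
    \<open>F w\<close> equals \<open>q\<close>.\<close>
  define v where "v = (if F w = q then b else sgn (F w - q))"
  have v: "norm v = 1" using b by (simp add: v_def norm_sgn)
  have "F w + e *\<^sub>R v \<in> cball (F w) e" using v e by (simp add: dist_norm)
  then obtain w' where w': "w' \<in> interior T" "F w' = F w + e *\<^sub>R v" using e(2) by (metis imageE subsetD)
  have "F w + e *\<^sub>R v - q = (norm (F w - q) + e) *\<^sub>R v"
   by (cases "F w = q") (simp_all add: v_def sgn_div_norm algebra_simps)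
  then have "norm (F w' - q) = norm (F w - q) + e" using w'(2) v e by simp
  moreover have "w' \<in> T" using w'(1) interior_subset by blast
  ultimately show False using w(2)[of w'] e(1) by simp
 qed
 then have "w \<in> frontier T"
  using w(1) compact_imp_closed[OF T(1)] by (simp add: frontier_def closure_closed)
 then show ?thesis using bd w(2)[OF z] by force
qed

section \<open>Good triangles and oscillation on discs\<close>

lemma card_two_cases:
 assumes "CARD('n::finite) = 2"
 obtains i j :: "'n::finite" where "i ~= j" "!!k. k = i \<or> k = j"
proof -
 obtain i j :: 'n where ij: "UNIV = {i, j}" "i ~= j" using assms by (auto simp: card_2_iff)
 have "k = i \<or> k = j" for k using UNIV_I[of k] unfolding ij(1) by simp
 then show ?thesis using that ij(2) by blast
qed

text \<open>A separating unit normal \<open>a\<close> would satisfy a_i > -1/3, a_j > -1/3 and a_i +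
  a_j < 1/3, one inequality for each vertex. Then both entries are at most 2/3 in modulus and the
  norm is less than 1. The tolerances \<rho>/10 and \<rho>/40 add up to \<rho>/8, which these
  inequalities absorb.\<close>

lemma ball_subset_triangle:
 fixes y :: "real^'n" and i j :: 'n
 assumes ij: "i ~= j" "!!k. k = i \<or> k = j" and \<rho>: "\<rho> > 0"
  and p: "dist p1 (y + (\<rho> / 2) *\<^sub>R axis i 1) < \<rho> / 40" "dist p2 (y + (\<rho> / 2) *\<^sub>R axis j 1) < \<rho> / 40"
   "dist p3 (y - (\<rho> / 2) *\<^sub>R (axis i 1 + axis j 1)) < \<rho> / 40"
 shows "ball y (\<rho> / 10) \<subseteq> convex hull {p1, p2, p3}"
proof (rule subsetI, rule ccontr)
 fix z assume z: "z \<in> ball y (\<rho> / 10)" and nz: "z \<notin> convex hull {p1, p2, p3}"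
 have cl: "closed (convex hull {p1, p2, p3})" by (intro compact_imp_closed finite_imp_compact_convex_hull) simp
 obtain a0 b where ab: "a0 \<bullet> z < b" "\<forall>x\<in>convex hull {p1, p2, p3}. b < a0 \<bullet> x"
  using separating_hyperplane_closed_point[OF convex_convex_hull cl nz] by blast
 have gt0: "a0 \<bullet> z < a0 \<bullet> p" if "p \<in> {p1, p2, p3}" for p
  using ab(1) bspec[OF ab(2) hull_inc[OF that]] by linarith
 have "a0 ~= 0" using gt0[of p1] by auto
 define a where "a = sgn a0"
 have na: "norm a = 1" using \<open>a0 ~= 0\<close> by (simp add: a_def norm_sgn)
 have gt: "a \<bullet> z < a \<bullet> p" if "p \<in> {p1, p2, p3}" for p
  using gt0[OF that] \<open>a0 ~= 0\<close> by (simp add: a_def sgn_div_norm divide_strict_right_mono)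
 have dot: "\<bar>a \<bullet> v\<bar> \<le> norm v" for v using Cauchy_Schwarz_ineq2[of a v] na by simp
 have zy: "a \<bullet> z > a \<bullet> y - \<rho> / 10"
  using dot[of "z - y"] z by (simp add: inner_diff_right dist_norm norm_minus_commute abs_le_iff)
 have near: "a \<bullet> p \<le> a \<bullet> v + \<rho> / 40" if "dist p v < \<rho> / 40" for p v
  using dot[of "p - v"] that by (simp add: inner_diff_right dist_norm abs_le_iff)
 have ax: "a \<bullet> axis k 1 = a $ k" for k by (simp add: inner_axis)
 have lin: "s > - 1 / 3" if "\<rho> / 2 * s > - (\<rho> / 8)" for s
 proof (rule ccontr)
  assume "\<not> s > - 1 / 3"
  then have "\<rho> / 2 * s \<le> \<rho> / 2 * (- 1 / 3)" using \<rho> by (intro mult_left_mono) auto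
  then show False using that \<rho> by simp
 qed
 have "a \<bullet> p1 \<le> a \<bullet> y + \<rho> / 2 * a $ i + \<rho> / 40" using near[OF p(1)] by (simp add: inner_add_right ax)
 then have c1: "a $ i > - 1 / 3" using gt[of p1] zy \<rho> by (intro lin) simp
 have "a \<bullet> p2 \<le> a \<bullet> y + \<rho> / 2 * a $ j + \<rho> / 40" using near[OF p(2)] by (simp add: inner_add_right ax)
 then have c2: "a $ j > - 1 / 3" using gt[of p2] zy \<rho> by (intro lin) simp
 have "a \<bullet> p3 \<le> a \<bullet> y + \<rho> / 2 * (- (a $ i + a $ j)) + \<rho> / 40"
  using near[OF p(3)] by (simp add: inner_add_right inner_diff_right ax algebra_simps)
 then have "- (a $ i + a $ j) > - 1 / 3" using gt[of p3] zy \<rho> by (intro lin) simp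
 then have c3: "a $ i + a $ j < 1 / 3" by simp
 have U: "(UNIV :: 'n set) = {i, j}" using ij(2) by blast
 have "(norm a)\<^sup>2 = (a $ i)\<^sup>2 + (a $ j)\<^sup>2"
 proof -
  have "(norm a)\<^sup>2 = (\<Sum>k\<in>(UNIV :: 'n set). (a $ k)\<^sup>2)"
   unfolding power2_norm_eq_inner inner_vec_def by (simp add: power2_eq_square)
  also have "\<dots> = (a $ i)\<^sup>2 + (a $ j)\<^sup>2" unfolding U using ij(1) by simp
  finally show ?thesis .
 qed
 moreover have "(a $ i)\<^sup>2 \<le> (2 / 3)\<^sup>2" "(a $ j)\<^sup>2 \<le> (2 / 3)\<^sup>2"
  unfolding abs_le_square_iff[symmetric] using c1 c2 c3 by auto
 then have "(a $ i)\<^sup>2 + (a $ j)\<^sup>2 < 1" by (simp add: power2_eq_square)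
 ultimately show False using na by simp
qed

text \<open>Vertices are picked one after the other: \<open>p2\<close> among the points seen from
  \<open>p1\<close>, and \<open>p3\<close> among those seen from both. All three edges are then good
  segments, which bounds F - F p1 on the boundary of the triangle, and the maximum principle extends
  the bound to the inside, where the small ball lies.\<close>

lemma planar_oscillation:
 fixes F :: "real^'n => real^'n" and y :: "real^'n"
 assumes n2: "CARD('n) = 2" and \<Omega>: "open \<Omega>" and F: "F \<in> BV \<Omega>" "continuous_on \<Omega> F" "inj_on F \<Omega>"
  and b: "ball y (2 * \<rho>) \<subseteq> \<Omega>" and \<rho>: "\<rho> > 0"
  and K: "BV_mass \<Omega> F (ball y (2 * \<rho>)) \<le> K * \<rho> ^ CARD('n)" "K \<ge> 0"
  and a: "a1 \<in> ball y (\<rho> / 10)" "a2 \<in> ball y (\<rho> / 10)"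
 shows "norm (F a1 - F a2) \<le> 4 * (osc_const TYPE('n) K (1 / 10000) * \<rho>)"
proof -
 let ?\<eta> = "1 / 10000 :: real"
 let ?m = "osc_const TYPE('n) K ?\<eta> * \<rho>"
 obtain i j :: 'n where ij: "i ~= j" "!!k. k = i \<or> k = j" using card_two_cases[OF n2] by blast
 have \<eta>: "?\<eta> > 0" by simp
 obtain S T where S: "S \<in> sets borel" "S \<subseteq> ball y \<rho>" "measure lborel (ball y \<rho> - S) \<le> ?\<eta> * measure lborel (ball y \<rho>)"
  and T: "!!p. p \<in> S ==> T p \<in> sets borel \<and> T p \<subseteq> ball y \<rho> \<and> measure lborel (ball y \<rho> - T p) \<le> ?\<eta> * measure lborel (ball y \<rho>)"
  and seg: "!!p q t. p \<in> S ==> q \<in> T p ==> 0 \<le> t ==> t \<le> 1 ==> norm (F (p + t *\<^sub>R (q - p)) - F p) \<le> ?m"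
  using good_segments[OF \<Omega> F(1,2) b \<rho> K \<eta>] by blast
 define W where "W = measure lborel (ball y \<rho>)"
 \<comment> \<open>In two dimensions a ball of radius \<rho>/40 has 1/1600 of the area; two
   exceptional sets of relative size 1/10000 cannot cover it.\<close>
 have W: "W > 0" "!!v::real^'n. measure lborel (ball v (\<rho> / 40)) = W / 1600"
  using \<rho> by (simp_all add: W_def measure_ball n2 power_divide)
 have pick: "\<exists>p\<in>ball v (\<rho> / 40). p \<in> X \<and> p \<in> X'"
  if v: "ball v (\<rho> / 40) \<subseteq> ball y \<rho>" and X: "X \<in> sets borel" "measure lborel (ball y \<rho> - X) \<le> ?\<eta> * W"
   and X': "X' \<in> sets borel" "measure lborel (ball y \<rho> - X') \<le> ?\<eta> * W" for v X X'
 proof -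
  let ?Y = "\<lambda>b. if b then ball y \<rho> - X else ball y \<rho> - X'"
  have "\<exists>p\<in>ball v (\<rho> / 40). \<forall>b\<in>UNIV. p \<notin> ?Y b"
  proof (rule ball_not_covered)
   show "?Y b \<in> sets borel" for b using X X' by auto
   show "bounded (?Y b)" for b by (auto intro: bounded_subset[OF bounded_ball])
   have "(\<Sum>b\<in>UNIV. measure lborel (?Y b)) \<le> 2 * (?\<eta> * W)" using X X' by (simp add: UNIV_bool)
   also have "\<dots> < measure lborel (ball v (\<rho> / 40))" using W(1) unfolding W(2) by simp
   finally show "(\<Sum>b\<in>UNIV. measure lborel (?Y b)) < measure lborel (ball v (\<rho> / 40))" .
  qed simp
  then obtain p where p: "p \<in> ball v (\<rho> / 40)" "\<forall>b. p \<notin> ?Y b" by blast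
  have "p \<notin> ball y \<rho> - X" "p \<notin> ball y \<rho> - X'" using spec[OF p(2), of True] spec[OF p(2), of False] by simp_all
  then show ?thesis using p(1) v by blast
 qed
 have sub: "ball v (\<rho> / 40) \<subseteq> ball y \<rho>" if "norm (v - y) \<le> 9 / 10 * \<rho>" for v
 proof
  fix q assume "q \<in> ball v (\<rho> / 40)"
  then show "q \<in> ball y \<rho>" using that dist_triangle[of y q v] \<rho> by (simp add: dist_norm norm_minus_commute)
 qed
 have nax: "norm ((\<rho> / 2) *\<^sub>R (axis i 1 + axis j 1 :: real^'n)) \<le> 9 / 10 * \<rho>"
 proof -
  have "(norm (axis i 1 + axis j 1 :: real^'n))\<^sup>2 = 2"
   using ij(1) by (simp add: power2_norm_eq_inner inner_add_left inner_add_right inner_axis_axis)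
  then have "(norm (axis i 1 + axis j 1 :: real^'n))\<^sup>2 \<le> (9 / 5)\<^sup>2" by (simp add: power_divide)
  then have "norm (axis i 1 + axis j 1 :: real^'n) \<le> 9 / 5"
   by (rule power2_le_imp_le) simp
  then show ?thesis using \<rho> by simp
 qed
 have Tm: "T p \<in> sets borel" "T p \<subseteq> ball y \<rho>" "measure lborel (ball y \<rho> - T p) \<le> ?\<eta> * W" if "p \<in> S" for p
  using T[OF that] by (auto simp: W_def)
 have SW: "measure lborel (ball y \<rho> - S) \<le> ?\<eta> * W" using S(3) by (simp add: W_def)
 obtain p1 where p1: "p1 \<in> ball (y + (\<rho> / 2) *\<^sub>R axis i 1) (\<rho> / 40)" "p1 \<in> S"
  using pick[OF sub S(1) SW S(1) SW, of "y + (\<rho> / 2) *\<^sub>R axis i 1"] \<rho> by (auto simp: norm_axis_1)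
 obtain p2 where p2: "p2 \<in> ball (y + (\<rho> / 2) *\<^sub>R axis j 1) (\<rho> / 40)" "p2 \<in> S" "p2 \<in> T p1"
  using pick[OF sub S(1) SW Tm(1,3)[OF p1(2)], of "y + (\<rho> / 2) *\<^sub>R axis j 1"] \<rho> by (auto simp: norm_axis_1)
 obtain p3 where p3: "p3 \<in> ball (y - (\<rho> / 2) *\<^sub>R (axis i 1 + axis j 1)) (\<rho> / 40)" "p3 \<in> T p1" "p3 \<in> T p2"
  using pick[OF sub Tm(1,3)[OF p1(2)] Tm(1,3)[OF p2(2)], of "y - (\<rho> / 2) *\<^sub>R (axis i 1 + axis j 1)"] nax
  by auto
 let ?H = "convex hull {p1, p2, p3}"
 have bH: "ball y (\<rho> / 10) \<subseteq> ?H"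
  by (rule ball_subset_triangle[OF ij \<rho>]) (use p1(1) p2(1) p3(1) in \<open>simp_all add: dist_commute\<close>)
 have "{p1, p2, p3} \<subseteq> ball y \<rho>" using p1(2) p2(2) p3(2) S(2) Tm(2)[OF p1(2)] by auto
 then have "?H \<subseteq> ball y \<rho>" by (rule hull_minimal) (rule convex_ball)
 also have "ball y \<rho> \<subseteq> \<Omega>" using b \<rho> subset_ball[of \<rho> "2 * \<rho>" y] by auto
 finally have H\<Omega>: "?H \<subseteq> \<Omega>" .
 have cH: "compact ?H" by (rule finite_imp_compact_convex_hull) simp
 have sg: "norm (F z - F p) \<le> ?m" if pqz: "p \<in> S" "q \<in> T p" "z \<in> closed_segment p q" for p q z
 proof -
  obtain t where t: "0 \<le> t" "t \<le> 1" "z = (1 - t) *\<^sub>R p + t *\<^sub>R q" using pqz(3) by (auto simp: in_segment)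
  have "z = p + t *\<^sub>R (q - p)" unfolding t(3) by (simp add: algebra_simps)
  then show ?thesis using seg[OF pqz(1,2) t(1,2)] by simp
 qed
 have m0: "?m \<ge> 0" using seg[OF p1(2) p2(3), of 0] by simp
 have fr: "norm (F z - F p1) \<le> 2 * ?m" if "z \<in> frontier ?H" for z
 proof -
  have "DIM(real^'n) = 2" using n2 by simp
  from that[unfolded frontier_of_triangle[OF this]]
  consider "z \<in> closed_segment p1 p2" | "z \<in> closed_segment p2 p3" | "z \<in> closed_segment p1 p3"
   by (auto simp: closed_segment_commute)
  then show ?thesis
  proof cases
   case 1 then show ?thesis using sg[OF p1(2) p2(3)] m0 by force
  next
   case 2
   have "norm (F z - F p1) \<le> norm (F z - F p2) + norm (F p2 - F p1)"
    using norm_triangle_ineq[of "F z - F p2" "F p2 - F p1"] by simp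
   then show ?thesis using sg[OF p2(2) p3(3) 2] sg[OF p1(2) p2(3), of p2] by simp
  next
   case 3 then show ?thesis using sg[OF p1(2) p3(2)] m0 by force
  qed
 qed
 have "norm (F z - F p1) \<le> 2 * ?m" if "z \<in> ball y (\<rho> / 10)" for z
  using max_principle[OF cH H\<Omega> F(2,3) fr] that bH by blast
 from this[OF a(1)] this[OF a(2)] show ?thesis
  using norm_triangle_ineq4[of "F a1 - F p1" "F a2 - F p1"] by simp
qed

text \<open>This supplies the representative claimed in the theorem. Estimates are available only on
  a dense set \<open>Z\<close> of good points; elsewhere \<open>g\<close> takes a limit value of
  \<open>f\<close> along \<open>Z\<close>. The inequality defining the derivative is closed under
  limits, so it passes to these values. A single \<open>g\<close> serves for all points and all
  derivatives.\<close>

lemma continuous_value_extension: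
 fixes f :: "'a::euclidean_space => 'b::euclidean_space"
 assumes \<Omega>: "open \<Omega>" and dense: "\<Omega> \<subseteq> closure Z"
 obtains g where "!!x. x \<in> Z ==> g x = f x"
  "!!x A. x \<in> \<Omega> ==> x \<in> Z ==> bounded_linear A ==>
   (!!e. e > 0 ==> \<exists>d>0. \<forall>z\<in>Z. norm (z - x) < d --> norm (f z - f x - A (z - x)) \<le> e * norm (z - x)) ==> (g has_derivative A) (at x)"
proof -
 define cl where "cl = (\<lambda>x v. \<exists>s::nat => 'a. (\<forall>k. s k \<in> Z) \<and> s \<longlonglongrightarrow> x \<and> (\<lambda>k. f (s k)) \<longlonglongrightarrow> v)"
 \<comment> \<open>If no limit value exists the choice is arbitrary; near a point with the first
   order estimate one always exists, because \<open>f\<close> is bounded on \<open>Z\<close>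
   there.\<close>
 define g where "g = (\<lambda>x. if x \<in> Z then f x else (SOME v. cl x v))"
 show ?thesis
 proof (rule that[of g])
  show "g x = f x" if "x \<in> Z" for x using that by (simp add: g_def)
  fix x A assume x: "x \<in> \<Omega>" "x \<in> Z" and A: "bounded_linear A"
   and D: "!!e. e > 0 ==> \<exists>d>0. \<forall>z\<in>Z. norm (z - x) < d --> norm (f z - f x - A (z - x)) \<le> e * norm (z - x)"
  obtain r where r: "r > 0" "ball x r \<subseteq> \<Omega>" using \<Omega> x(1) openE by blast
  have gx: "g x = f x" using x(2) by (simp add: g_def)
  have cA: "continuous_on UNIV A" by (rule linear_continuous_on[OF A])
  have bound: "norm (v - f x - A (w - x)) \<le> e * norm (w - x)"
   if d: "\<forall>z\<in>Z. norm (z - x) < d --> norm (f z - f x - A (z - x)) \<le> e * norm (z - x)"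
    and w: "norm (w - x) < d" and cl: "cl w v" for d e w v
  proof -
   obtain s where s: "!!k. s k \<in> Z" "s \<longlonglongrightarrow> w" "(\<lambda>k. f (s k)) \<longlonglongrightarrow> v" using cl unfolding cl_def by blast
   have "(\<lambda>k. norm (s k - x)) \<longlonglongrightarrow> norm (w - x)" by (intro tendsto_intros s)
   then have "eventually (\<lambda>k. norm (s k - x) < d) sequentially" using w by (rule order_tendstoD(2))
   then have "eventually (\<lambda>k. norm (f (s k) - f x - A (s k - x)) \<le> e * norm (s k - x)) sequentially"
    by eventually_elim (use d s(1) in blast)
   moreover have "(\<lambda>k. norm (f (s k) - f x - A (s k - x))) \<longlonglongrightarrow> norm (v - f x - A (w - x))"
    by (intro tendsto_intros s bounded_linear.tendsto[OF A])
   moreover have "(\<lambda>k. e * norm (s k - x)) \<longlonglongrightarrow> e * norm (w - x)" by (intro tendsto_intros s)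
   ultimately show ?thesis by (intro tendsto_le[OF sequentially_bot])
  qed
  obtain d1 where d1: "d1 > 0" "\<forall>z\<in>Z. norm (z - x) < d1 --> norm (f z - f x - A (z - x)) \<le> 1 * norm (z - x)" using D[of 1] by auto
  have ex: "\<exists>v. cl w v" if w: "norm (w - x) < min r d1" for w
  proof -
   have "w \<in> ball x r" using w by (simp add: dist_norm norm_minus_commute)
   then have "w \<in> closure Z" using r(2) dense by blast
   then obtain s where s: "!!k. s k \<in> Z" "s \<longlonglongrightarrow> w" unfolding closure_sequential by blast
   have "(\<lambda>k. norm (s k - x)) \<longlonglongrightarrow> norm (w - x)" by (intro tendsto_intros s)
   then have "eventually (\<lambda>k. norm (s k - x) < d1) sequentially" using w by (intro order_tendstoD(2)) auto
   then obtain k0 where k0: "!!k. k \<ge> k0 ==> norm (s k - x) < d1" unfolding eventually_sequentially by blast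
   define s' where "s' = (\<lambda>k. s (k + k0))"
   have s': "s' k \<in> Z" "norm (s' k - x) < d1" for k using s(1) k0[of "k + k0"] by (simp_all add: s'_def)
   have s'l: "s' \<longlonglongrightarrow> w" unfolding s'_def using s(2) by (rule LIMSEQ_ignore_initial_segment)
   obtain B where B: "!!v. norm (A v) \<le> norm v * B" using bounded_linear.bounded[OF A] by blast
   have "bounded (range (\<lambda>k. f (s' k)))"
    unfolding bounded_iff
   proof (intro exI ballI)
    fix v assume "v \<in> range (\<lambda>k. f (s' k))"
    then obtain k where v: "v = f (s' k)" by blast
    have "norm (f (s' k) - f x - A (s' k - x)) \<le> norm (s' k - x)" using d1(2) s'[of k] by auto
    moreover have "norm (A (s' k - x)) \<le> d1 * \<bar>B\<bar>"
     using B[of "s' k - x"] s'(2)[of k] by (smt (verit) abs_ge_self mult_mono norm_ge_zero mult_left_mono mult_right_mono)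
    moreover have tri: "norm (p + q + v) \<le> norm p + norm q + norm v" for p q v :: 'b
     by (rule order_trans[OF norm_triangle_ineq add_right_mono[OF norm_triangle_ineq]])
    have "norm (f (s' k)) \<le> norm (f (s' k) - f x - A (s' k - x)) + norm (f x) + norm (A (s' k - x))"
     using tri[of "f (s' k) - f x - A (s' k - x)" "f x" "A (s' k - x)"] by simp
    ultimately show "norm v \<le> d1 + norm (f x) + d1 * \<bar>B\<bar>" using s'(2)[of k] unfolding v by linarith
   qed
   then obtain l \<sigma> where \<sigma>: "strict_mono \<sigma>" "((\<lambda>k. f (s' k)) \<circ> \<sigma>) \<longlonglongrightarrow> l"
    using bounded_imp_convergent_subsequence by blast
   have "cl w l" unfolding cl_def
    using s'(1) LIMSEQ_subseq_LIMSEQ[OF s'l \<sigma>(1)] \<sigma>(2) by (intro exI[of _ "s' \<circ> \<sigma>"]) (simp add: o_def)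
   then show ?thesis ..
  qed
  show "(g has_derivative A) (at x)"
   unfolding has_derivative_at_alt
  proof (intro conjI allI impI A)
   fix e :: real assume "e > 0"
   then obtain d where d: "d > 0" "\<forall>z\<in>Z. norm (z - x) < d --> norm (f z - f x - A (z - x)) \<le> e * norm (z - x)" using D by blast
   show "\<exists>d>0. \<forall>w. norm (w - x) < d --> norm (g w - g x - A (w - x)) \<le> e * norm (w - x)"
   proof (intro exI[of _ "min d (min r d1)"] conjI allI impI)
    show "min d (min r d1) > 0" using d(1) r(1) d1(1) by simp
    fix w assume w: "norm (w - x) < min d (min r d1)"
    show "norm (g w - g x - A (w - x)) \<le> e * norm (w - x)"
    proof (cases "w \<in> Z")
     case True
     then show ?thesis using d(2) w gx by (simp add: g_def)
    next
     case False
     have "cl w (g w)" using someI_ex[OF ex[of w]] w False by (simp add: g_def)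
     then show ?thesis unfolding gx using bound[OF d(2)] w by simp
    qed
   qed
  qed
 qed
qed

section \<open>Differentiability almost everywhere\<close>

lemma AE_lebesgue_on_iff_negligible:
 assumes "\<Omega> \<in> sets lebesgue"
 shows "(AE x in lebesgue_on \<Omega>. P x) \<longleftrightarrow> negligible {x\<in>\<Omega>. \<not> P x}"
proof -
 have "(AE x in lebesgue_on \<Omega>. P x) \<longleftrightarrow> (AE x in lebesgue. x \<in> \<Omega> --> P x)"
  using assms by (intro AE_restrict_space_iff) simp
 also have "\<dots> \<longleftrightarrow> negligible {x\<in>\<Omega>. \<not> P x}"
 proof
  assume "AE x in lebesgue. x \<in> \<Omega> --> P x"
  then obtain N where N: "{x \<in> space lebesgue. \<not> (x \<in> \<Omega> --> P x)} \<subseteq> N" "N \<in> null_sets lebesgue"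
   unfolding eventually_ae_filter by blast
  have "negligible N" using N(2) by (simp add: negligible_iff_null_sets)
  then show "negligible {x\<in>\<Omega>. \<not> P x}" by (rule negligible_subset) (use N(1) in auto)
 next
  assume "negligible {x\<in>\<Omega>. \<not> P x}"
  then show "AE x in lebesgue. x \<in> \<Omega> --> P x"
   unfolding negligible_iff_null_sets by (rule AE_I') auto
 qed
 finally show ?thesis .
qed

text \<open>At scale r = |z - x| the L^1 estimate provides points p near x and q near z at which
  \<open>f\<close> is almost affine. The oscillation of f_k on balls of radius \<delta> r / 10
  around x and z is at most a constant times \<delta> r, and pointwise convergence on
  \<open>Z\<close> hands this bound to \<open>f\<close>, so the estimate moves from p and q to x and
  z.\<close>

lemma planar_derivative_within:
 fixes fs :: "nat => real^'n => real^'n" and A :: "real^'n^'n"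
 assumes n2: "CARD('n) = 2" and \<Omega>: "open \<Omega>"
  and fs: "!!k. fs k \<in> BV \<Omega>" "!!k. continuous_on \<Omega> (fs k)" "!!k. inj_on (fs k) \<Omega>"
  and u: "integrable lborel u" and dp: "differential_point u A x" and mc: "mass_controlled \<Omega> fs x"
  and Z: "Z \<subseteq> \<Omega>" "negligible (\<Omega> - Z)" "!!z. z \<in> Z ==> (\<lambda>k. fs k z) \<longlonglongrightarrow> f z" "!!z. z \<in> Z ==> u z = f z"
  and x: "x \<in> Z" and e: "e > 0"
 shows "\<exists>d>0. \<forall>z\<in>Z. norm (z - x) < d --> norm (f z - f x - A *v (z - x)) \<le> e * norm (z - x)"
proof -
 let ?n = "CARD('n)"
 obtain M where M: "M > 0" "!!\<delta>. \<delta> > 0 ==> \<exists>r0>0. \<forall>r. 0 < r \<and> r < r0 -->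
   (\<forall>Y Q. finite Y \<and> Y \<subseteq> cball x r \<and> eventually Q sequentially -->
    (\<exists>k. Q k \<and> (\<forall>y\<in>Y. ball y (\<delta> * r) \<subseteq> \<Omega> \<and> BV_mass \<Omega> (fs k) (ball y (\<delta> * r)) \<le> M * (\<delta> * r) ^ ?n)))"
  using mc unfolding mass_controlled_def by blast
 define K where "K = M * 2 ^ ?n"
 have K: "K \<ge> 0" using M(1) by (simp add: K_def)
 define h where "h = osc_const TYPE('n) K (1 / 10000)"
 have h: "h > 0" unfolding h_def by (rule osc_const_pos[OF K]) simp
 define B where "B = onorm ((*v) A)"
 have B: "B \<ge> 0" unfolding B_def by (rule onorm_pos_le[OF matrix_vector_mul_bounded_linear])
 have AB: "norm (A *v v) \<le> B * norm v" for v unfolding B_def by (rule onorm[OF matrix_vector_mul_bounded_linear])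
 \<comment> \<open>The constant h is fixed before; \<delta> makes the oscillation and the variation
   of the linear part over the small balls at most e r / 2 together.\<close>
 define \<delta> where "\<delta> = min 1 (e / (2 * (12 * h + B + 1)))"
 have p: "12 * h + B + 1 > 0" using h B by simp
 have \<delta>: "0 < \<delta>" "\<delta> \<le> 1" using e p by (simp_all add: \<delta>_def)
 have \<delta>e: "(12 * h + B) * \<delta> \<le> e / 2"
 proof -
  have "\<delta> \<le> e / (2 * (12 * h + B + 1))" by (simp add: \<delta>_def)
  then have "(12 * h + B + 1) * \<delta> \<le> e / 2" using p by (simp add: field_simps)
  then show ?thesis using \<delta>(1) by (simp add: distrib_right)
 qed
 define w where "w = unit_ball_vol (real ?n)"
 have w: "w > 0" by (simp add: w_def)
 define \<epsilon> where "\<epsilon> = e / 4 * (w * (\<delta> / 10) ^ ?n / 2) / 2 ^ (?n + 1)"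
 have \<epsilon>: "\<epsilon> > 0" using e w \<delta>(1) by (simp add: \<epsilon>_def)
 obtain r1 where r1: "r1 > 0" "!!r. 0 < r ==> r < r1 ==> \<exists>c. (\<integral>\<^sup>+q. ennreal (norm (u q - A *v q - c)) * indicator (ball x r) q \<partial>lborel) \<le> ennreal (\<epsilon> * r ^ (?n + 1))"
  using affine_approximation_L1[OF u dp \<epsilon>] by blast
 have "2 * \<delta> > 0" using \<delta>(1) by simp
 from M(2)[OF this] obtain r2 where r2': "r2 > 0 \<and> (\<forall>r. 0 < r \<and> r < r2 -->
   (\<forall>Y Q. finite Y \<and> Y \<subseteq> cball x r \<and> eventually Q sequentially -->
    (\<exists>k. Q k \<and> (\<forall>y\<in>Y. ball y (2 * \<delta> * r) \<subseteq> \<Omega> \<and> BV_mass \<Omega> (fs k) (ball y (2 * \<delta> * r)) \<le> M * (2 * \<delta> * r) ^ ?n))))" ..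
 note r2 = conjunct1[OF r2'] conjunct2[OF r2']
 obtain r3 where r3: "r3 > 0" "ball x r3 \<subseteq> \<Omega>" using \<Omega> x Z(1) openE by blast
 obtain N where N: "N \<in> null_sets lborel" "\<Omega> - Z \<subseteq> N"
  using Z(2) unfolding negligible_iff_null_sets null_sets_completion_iff2 by blast
 show ?thesis
 proof (intro exI[of _ "min r1 (min r2 r3) / 2"] conjI ballI impI)
  show "min r1 (min r2 r3) / 2 > 0" using r1 r2 r3 by simp
  fix z assume z: "z \<in> Z" and zx: "norm (z - x) < min r1 (min r2 r3) / 2"
  show "norm (f z - f x - A *v (z - x)) \<le> e * norm (z - x)"
  proof (cases "z = x")
   case False
   define r where "r = norm (z - x)"
   have r: "0 < r" "2 * r < r1" "r < r2" "2 * r < r3" using zx False r1(1) r2(1) r3(1) by (auto simp: r_def)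
   define \<rho> where "\<rho> = \<delta> * r"
   have \<rho>: "0 < \<rho>" "\<rho> \<le> r" using \<delta> r(1) by (auto simp: \<rho>_def mult_le_cancel_right1)
   define b where "b = e / 4 * r"
   have b: "b > 0" using e r(1) by (simp add: b_def)
   \<comment> \<open>Half the volume of the small ball: the set where the affine approximation fails
     is at most that large and cannot fill it, even with a null set added.\<close>
   define m where "m = w * (\<rho> / 10) ^ ?n / 2"
   have m: "m > 0" using w \<rho>(1) by (simp add: m_def)
   have mb: "measure lborel (ball y (\<rho> / 10)) = 2 * m" for y :: "real^'n"
    using \<rho>(1) by (simp add: measure_ball m_def w_def)
   have "\<epsilon> * (2 * r) ^ (?n + 1) = b * m"
    by (simp add: \<epsilon>_def b_def m_def \<rho>_def power_mult_distrib power_divide field_simps)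
   moreover have "0 < 2 * r" using r(1) by simp
   ultimately obtain c where c: "(\<integral>\<^sup>+q. ennreal (norm (u q - A *v q - c)) * indicator (ball x (2 * r)) q \<partial>lborel) \<le> ennreal (b * m)"
    using r1(2)[OF _ r(2)] by auto
   have Am: "(\<lambda>q. A *v q) \<in> borel_measurable borel"
    by (intro borel_measurable_continuous_onI linear_continuous_on matrix_vector_mul_bounded_linear)
   have vm: "(\<lambda>q. u q - A *v q - c) \<in> borel_measurable borel" using u Am by (intro borel_measurable_diff) auto
   define bad where "bad = {q \<in> ball x (2 * r). norm (u q - A *v q - c) > b}"
   have badm: "measure lborel bad \<le> m" unfolding bad_def by (rule markov_ball[OF vm b less_imp_le[OF m] c])
   have bads: "bad \<in> sets borel"
   proof -
    have "bad = ball x (2 * r) \<inter> (\<lambda>q. norm (u q - A *v q - c)) -` {b<..} \<inter> space borel" by (auto simp: bad_def)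
    then show ?thesis using measurable_sets[OF measurable_compose[OF vm borel_measurable_norm], of "{b<..}"] by (auto simp: Int_assoc)
   qed
   have yr: "dist x y \<le> r" if "y \<in> {x, z}" for y using that r(1) by (auto simp: r_def dist_norm norm_minus_commute)
   have bsub: "ball y (\<rho> / 10) \<subseteq> ball x (2 * r)" if "y \<in> {x, z}" for y
   proof
    fix q assume "q \<in> ball y (\<rho> / 10)"
    then show "q \<in> ball x (2 * r)" using yr[OF that] \<rho> dist_triangle[of x q y] by simp
   qed
   have b2: "ball x (2 * r) \<subseteq> \<Omega>" using r3(2) r(4) subset_ball[of "2 * r" r3 x] by auto
   have pick: "\<exists>q\<in>ball y (\<rho> / 10). q \<in> Z \<and> norm (f q - A *v q - c) \<le> b" if y: "y \<in> {x, z}" for y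
   proof -
    let ?X = "\<lambda>t. if t then bad else N \<inter> ball x (2 * r)"
    have "\<exists>q\<in>ball y (\<rho> / 10). \<forall>t\<in>UNIV. q \<notin> ?X t"
    proof (rule ball_not_covered)
     show "?X t \<in> sets borel" for t using bads N(1) by auto
     show "bounded (?X t)" for t by (auto intro!: bounded_subset[OF bounded_ball[of x "2 * r"]] simp: bad_def)
     have "N \<inter> ball x (2 * r) \<in> null_sets lborel" using N(1) by (intro null_set_Int2) auto
     then have "measure lborel (N \<inter> ball x (2 * r)) = 0" by (simp add: measure_eq_0_null_sets)
     then show "(\<Sum>t\<in>UNIV. measure lborel (?X t)) < measure lborel (ball y (\<rho> / 10))"
      using badm m unfolding mb by (simp add: UNIV_bool)
    qed simp
    then obtain q where q: "q \<in> ball y (\<rho> / 10)" "\<forall>t. q \<notin> ?X t" by blast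
    have q2: "q \<in> ball x (2 * r)" using q(1) bsub[OF y] by blast
    then have "q \<notin> N" "q \<notin> bad" using spec[OF q(2), of True] spec[OF q(2), of False] by auto
    then have "q \<in> Z" using N(2) q2 b2 by blast
    then show ?thesis using q(1) q2 \<open>q \<notin> bad\<close> Z(4)[of q] by (intro bexI[of _ q]) (auto simp: bad_def not_less)
   qed
   \<comment> \<open>The factor 6 is four from the oscillation of f_k, and one for replacing f_k by
     f at each of the two points. The index k is chosen for the pair at hand, with closeness at both
     points as the eventual property.\<close>
   have osc: "norm (f a1 - f a2) \<le> 6 * (h * \<rho>)" if y: "y \<in> {x, z}" and a: "a1 \<in> ball y (\<rho> / 10)" "a2 \<in> ball y (\<rho> / 10)" "a1 \<in> Z" "a2 \<in> Z" for y a1 a2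
   proof -
    have hr: "h * \<rho> > 0" using h \<rho>(1) by simp
    have ev: "eventually (\<lambda>k. dist (fs k a1) (f a1) < h * \<rho> \<and> dist (fs k a2) (f a2) < h * \<rho>) sequentially"
     by (intro eventually_conj tendstoD[OF Z(3) hr] a)
    have "\<exists>k. (dist (fs k a1) (f a1) < h * \<rho> \<and> dist (fs k a2) (f a2) < h * \<rho>) \<and>
     (\<forall>y\<in>{y}. ball y (2 * \<delta> * r) \<subseteq> \<Omega> \<and> BV_mass \<Omega> (fs k) (ball y (2 * \<delta> * r)) \<le> M * (2 * \<delta> * r) ^ ?n)"
     by (rule r2(2)[rule_format]) (use r ev yr[OF y] in auto)
    then obtain k where k: "dist (fs k a1) (f a1) < h * \<rho>" "dist (fs k a2) (f a2) < h * \<rho>"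
     "ball y (2 * \<delta> * r) \<subseteq> \<Omega>" "BV_mass \<Omega> (fs k) (ball y (2 * \<delta> * r)) \<le> M * (2 * \<delta> * r) ^ ?n" by auto
    have e2: "2 * \<rho> = 2 * \<delta> * r" by (simp add: \<rho>_def)
    have "M * (2 * \<delta> * r) ^ ?n = K * \<rho> ^ ?n" by (simp add: K_def \<rho>_def power_mult_distrib)
    then have mass: "BV_mass \<Omega> (fs k) (ball y (2 * \<rho>)) \<le> K * \<rho> ^ ?n" unfolding e2 using k(4) by simp
    have "norm (fs k a1 - fs k a2) \<le> 4 * (h * \<rho>)"
     unfolding h_def by (rule planar_oscillation[OF n2 \<Omega> fs k(3)[folded e2] \<rho>(1) mass K a(1,2)])
    moreover have "norm (f a1 - f a2) \<le> norm (fs k a1 - fs k a2) + norm (fs k a1 - f a1) + norm (fs k a2 - f a2)"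
    proof -
     have "f a1 - f a2 = (fs k a1 - fs k a2) - (fs k a1 - f a1) + (fs k a2 - f a2)" by simp
     then show ?thesis by (metis order_trans[OF norm_triangle_ineq add_right_mono[OF norm_triangle_ineq4]])
    qed
    ultimately show ?thesis using k(1,2) by (simp add: dist_norm)
   qed
   obtain q where q: "q \<in> ball z (\<rho> / 10)" "q \<in> Z" "norm (f q - A *v q - c) \<le> b" using pick[of z] by auto
   obtain p where p: "p \<in> ball x (\<rho> / 10)" "p \<in> Z" "norm (f p - A *v p - c) \<le> b" using pick[of x] by auto
   have zz: "norm (f z - f q) \<le> 6 * (h * \<rho>)" by (rule osc[of z]) (use \<rho> q z in auto)
   have xx: "norm (f x - f p) \<le> 6 * (h * \<rho>)" by (rule osc[of x]) (use \<rho> p x in auto)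
   have za: "norm (A *v (z - q)) \<le> B * (\<rho> / 10)"
    by (rule order_trans[OF AB mult_left_mono[OF _ B]]) (use q(1) in \<open>simp add: dist_norm\<close>)
   have xa: "norm (A *v (x - p)) \<le> B * (\<rho> / 10)"
    by (rule order_trans[OF AB mult_left_mono[OF _ B]]) (use p(1) in \<open>simp add: dist_norm\<close>)
   have n6: "norm v \<le> norm a1 + norm a2 + norm a3 + norm a4 + norm a5 + norm a6"
    if "v = a1 + a2 - a3 - a4 - a5 + a6" for v a1 a2 a3 a4 a5 a6 :: "real^'n"
    unfolding that by (intro order_trans[OF norm_triangle_ineq add_right_mono] order_trans[OF norm_triangle_ineq4 add_right_mono] norm_triangle_ineq order_refl)
   have "f z - f x - A *v (z - x) = (f z - f q) + (f q - A *v q - c) - (f p - A *v p - c) - (f x - f p) - A *v (z - q) + A *v (x - p)"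
    by (simp add: matrix_vector_mult_diff_distrib)
   from n6[OF this] have "norm (f z - f x - A *v (z - x)) \<le> 12 * (h * \<rho>) + 2 * b + 2 * (B * (\<rho> / 10))"
    using zz xx za xa q(3) p(3) by linarith
   also have "\<dots> \<le> (12 * h + B) * \<delta> * r + e / 2 * r"
    using B \<rho>(1) by (simp add: \<rho>_def b_def algebra_simps)
   also have "\<dots> \<le> e / 2 * r + e / 2 * r" using \<delta>e r(1) by (intro add_right_mono mult_right_mono) auto
   also have "\<dots> = e * norm (z - x)" by (simp add: r_def)
   finally show ?thesis .
  qed simp
 qed
qed

text \<open>L^1 convergence gives almost everywhere convergence along a subsequence only, and
  \<open>mass_controlled\<close> need not be inherited by subsequences; it is derived afresh for the
  subsequence from the same uniform mass bound.\<close>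

lemma planar_differentiable_AE:
 fixes fs :: "nat => real^'n => real^'n"
 assumes n2: "CARD('n) = 2" and \<Omega>: "open \<Omega>"
  and fs: "!!k. fs k \<in> BV \<Omega>" "!!k. continuous_on \<Omega> (fs k)" "!!k. inj_on (fs k) \<Omega>"
  and f: "f \<in> BV \<Omega>" and w: "BV_weak_star_limit \<Omega> fs f"
 shows "\<exists>g. (AE x in lebesgue_on \<Omega>. g x = f x) \<and> (AE x in lebesgue_on \<Omega>. g differentiable (at x))"
proof -
 have \<Omega>l: "\<Omega> \<in> sets lebesgue" using \<Omega> by simp
 have fi: "integrable (lebesgue_on \<Omega>) f" and fsi: "integrable (lebesgue_on \<Omega>) (fs k)" for k
  using f fs(1) by (simp_all add: BV_def)
 have lim: "(\<lambda>k. LINT x|lebesgue_on \<Omega>. norm (fs k x - f x)) \<longlonglongrightarrow> 0" using w by (simp add: BV_weak_star_limit_def)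
 obtain s where s: "strict_mono s" "AE x in lebesgue_on \<Omega>. (\<lambda>k. fs (s k) x - f x) \<longlonglongrightarrow> 0"
  using tendsto_L1_AE_subseq[OF Bochner_Integration.integrable_diff[OF fsi fi] lim] by blast
 obtain u where u: "represents \<Omega> f u" using represents_exists[of \<Omega> f] \<Omega> fi by auto
 define gs where "gs = (\<lambda>k. fs (s k))"
 define Z where "Z = {x\<in>\<Omega>. (\<lambda>k. gs k x) \<longlonglongrightarrow> f x \<and> u x = f x}"
 have "negligible {x\<in>\<Omega>. \<not> ((\<lambda>k. fs (s k) x - f x) \<longlonglongrightarrow> 0)}"
  using s(2) unfolding AE_lebesgue_on_iff_negligible[OF \<Omega>l] .
 moreover have "negligible {x\<in>\<Omega>. u x ~= f x}" using u unfolding represents_def by (elim conjE)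
 ultimately have "negligible ({x\<in>\<Omega>. \<not> ((\<lambda>k. fs (s k) x - f x) \<longlonglongrightarrow> 0)} \<union> {x\<in>\<Omega>. u x ~= f x})" by (rule negligible_Un)
 then have nZ: "negligible (\<Omega> - Z)"
  by (rule negligible_subset) (auto simp: Z_def gs_def LIM_zero_iff)
 have mc: "negligible {x\<in>\<Omega>. \<not> mass_controlled \<Omega> gs x}"
 proof (rule AE_mass_controlled[OF \<Omega>])
  show "gs k \<in> BV \<Omega>" for k using fs(1) by (simp add: gs_def)
  fix x r assume "cball x r \<subseteq> \<Omega>"
  from weak_star_bounded_mass[OF \<Omega> w this] show "\<exists>C. \<forall>k. BV_mass \<Omega> (gs k) (ball x r) \<le> C"
   unfolding gs_def by blast
 qed
 have dp: "negligible {x\<in>\<Omega>. \<not> differential_point u (BV_gradient \<Omega> f x) x}" by (rule AE_differential_point[OF \<Omega> f u])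
 have "\<Omega> \<subseteq> closure Z"
 proof (rule subsetI, rule ccontr)
  fix x assume x: "x \<in> \<Omega>" "x \<notin> closure Z"
  have o: "open (\<Omega> - closure Z)" using \<Omega> by (intro open_Diff) auto
  have "negligible (\<Omega> - closure Z)" by (rule negligible_subset[OF nZ]) (use closure_subset in auto)
  then show False using open_not_negligible[OF o] x by blast
 qed
 from continuous_value_extension[OF \<Omega> this, of f] obtain g where g: "!!x. x \<in> Z ==> g x = f x"
  "!!x A. x \<in> \<Omega> ==> x \<in> Z ==> bounded_linear A ==>
   (!!e. e > 0 ==> \<exists>d>0. \<forall>z\<in>Z. norm (z - x) < d --> norm (f z - f x - A (z - x)) \<le> e * norm (z - x)) ==> (g has_derivative A) (at x)"
  by blast
 have diff: "g differentiable (at x)" if x: "x \<in> Z" "differential_point u (BV_gradient \<Omega> f x) x" "mass_controlled \<Omega> gs x" for x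
 proof -
  have "(g has_derivative (*v) (BV_gradient \<Omega> f x)) (at x)"
  proof (rule g(2)[OF _ x(1) matrix_vector_mul_bounded_linear])
   show "x \<in> \<Omega>" using x(1) by (simp add: Z_def)
   fix e :: real assume e: "e > 0"
   show "\<exists>d>0. \<forall>z\<in>Z. norm (z - x) < d --> norm (f z - f x - BV_gradient \<Omega> f x *v (z - x)) \<le> e * norm (z - x)"
   proof (rule planar_derivative_within[OF n2 \<Omega> _ _ _ _ x(2,3) _ nZ _ _ x(1) e])
    show "gs k \<in> BV \<Omega>" "continuous_on \<Omega> (gs k)" "inj_on (gs k) \<Omega>" for k using fs by (simp_all add: gs_def)
    show "integrable lborel u" using u by (simp add: represents_def)
    show "Z \<subseteq> \<Omega>" by (auto simp: Z_def)
    show "(\<lambda>k. gs k z) \<longlonglongrightarrow> f z" "u z = f z" if "z \<in> Z" for z using that by (simp_all add: Z_def)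
   qed
  qed
  then show ?thesis by (rule differentiableI)
 qed
 show ?thesis
 proof (intro exI[of _ g] conjI)
  show "AE x in lebesgue_on \<Omega>. g x = f x"
   unfolding AE_lebesgue_on_iff_negligible[OF \<Omega>l] by (rule negligible_subset[OF nZ]) (use g(1) in auto)
  have "negligible ((\<Omega> - Z) \<union> {x\<in>\<Omega>. \<not> differential_point u (BV_gradient \<Omega> f x) x} \<union> {x\<in>\<Omega>. \<not> mass_controlled \<Omega> gs x})"
   by (intro negligible_Un nZ dp mc)
  then show "AE x in lebesgue_on \<Omega>. g differentiable (at x)"
   unfolding AE_lebesgue_on_iff_negligible[OF \<Omega>l] by (rule negligible_subset) (use diff in auto)
 qed
qed

section \<open>The sign of the Jacobian\<close>

text \<open>Where det \<nabla>f(x) < 0, the blow-up selects one k whose link differences have the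
  class of an orientation reversing matrix. For this k the set of positive Jacobian is not
  negligible, so it contains a point at which f_k itself can be blown up, and there the class is the
  opposite one. Connectedness of \<Omega> identifies the two classes.\<close>

lemma jacobian_sign:
 fixes fs :: "nat => real^'n => real^'n" and K :: "bool => complex => real^'n"
 assumes \<Omega>: "open \<Omega>" "connected \<Omega>"
  and fs: "!!k. fs k \<in> BV \<Omega>" "!!k. continuous_on \<Omega> (fs k)" "!!k. inj_on (fs k) \<Omega>"
  and pos: "!!k. emeasure lebesgue {x \<in> \<Omega>. BV_jacobian \<Omega> (fs k) x > 0} > 0"
  and f: "f \<in> BV \<Omega>" and w: "BV_weak_star_limit \<Omega> fs f"
  and Kc: "!!i. continuous_on (sphere 0 1) (K i)" and Kn: "!!i z. z \<in> sphere 0 1 ==> norm (K i z) < 1"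
  and Kd: "!!z w. z \<in> sphere 0 1 ==> w \<in> sphere 0 1 ==> K True z ~= K False w"
  and orient: "!!A B :: real^'n^'n. det A > 0 ==> det B < 0 ==>
   \<not> homotopic_maps (sphere 0 1 \<times> sphere 0 1) (- {0})
    (\<lambda>z. A *v (K True (fst z) - K False (snd z))) (\<lambda>z. B *v (K True (fst z) - K False (snd z)))"
 shows "AE x in lebesgue_on \<Omega>. BV_jacobian \<Omega> f x \<ge> 0"
proof -
 have \<Omega>l: "\<Omega> \<in> sets lebesgue" using \<Omega>(1) by simp
 have lim: "(\<lambda>k. LINT x|lebesgue_on \<Omega>. norm (fs k x - f x)) \<longlonglongrightarrow> 0" using w by (simp add: BV_weak_star_limit_def)
 have nz: "!!v. v ~= 0 ==> A *v v ~= 0" if "det A ~= 0" for A :: "real^'n^'n"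
  by (rule matrix_vector_mult_nonzero[OF that])
 have "integrable (lebesgue_on \<Omega>) f" using f by (simp add: BV_def)
 then obtain u where u: "represents \<Omega> f u" using represents_exists[of \<Omega> f] \<Omega>(1) by auto
 have neg: "negligible ({x\<in>\<Omega>. \<not> differential_point u (BV_gradient \<Omega> f x) x} \<union> {x\<in>\<Omega>. \<not> mass_controlled \<Omega> fs x})"
  by (intro negligible_Un AE_differential_point \<Omega>(1) f u AE_mass_controlled fs(1) weak_star_bounded_mass[OF \<Omega>(1) w])
 have "negligible {x\<in>\<Omega>. \<not> BV_jacobian \<Omega> f x \<ge> 0}"
 proof (rule negligible_subset[OF neg], rule subsetI, rule ccontr)
  fix x assume x: "x \<in> {x\<in>\<Omega>. \<not> BV_jacobian \<Omega> f x \<ge> 0}"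
   and good: "x \<notin> {x\<in>\<Omega>. \<not> differential_point u (BV_gradient \<Omega> f x) x} \<union> {x\<in>\<Omega>. \<not> mass_controlled \<Omega> fs x}"
  let ?B = "BV_gradient \<Omega> f x"
  have x\<Omega>: "x \<in> \<Omega>" and dB: "det ?B < 0" using x by (auto simp: BV_jacobian_def)
  have dp: "differential_point u ?B x" and mc: "mass_controlled \<Omega> fs x" using good x\<Omega> by auto
  have "det ?B ~= 0" using dB by simp
  from blow_up_homotopy[where K = K, OF \<Omega>(1) x\<Omega> fs f lim u dp mc nz[OF this] Kc Kn Kd] obtain k r where
   r: "0 < r" "ball x r \<subseteq> \<Omega>" and hx: "homotopic_maps (sphere 0 1 \<times> sphere 0 1) (- {0})
   (\<lambda>z. fs k (x + r *\<^sub>R K True (fst z)) - fs k (x + r *\<^sub>R K False (snd z)))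
   (\<lambda>z. ?B *v (K True (fst z) - K False (snd z)))" by blast
  let ?F = "fs k"
  let ?v = "\<lambda>x. indicator \<Omega> x *\<^sub>R ?F x"
  have Fi: "integrable (lebesgue_on \<Omega>) ?F" using fs(1)[of k] by (simp add: BV_def)
  have v: "represents \<Omega> ?F ?v" by (rule represents_continuous[OF \<Omega>(1) Fi fs(2)])
  \<comment> \<open>For the blow-up of \<open>?F\<close> itself the sequence is constant, and its
    uniform mass bound is trivial.\<close>
  have "negligible ({x\<in>\<Omega>. \<not> differential_point ?v (BV_gradient \<Omega> ?F x) x} \<union> {x\<in>\<Omega>. \<not> mass_controlled \<Omega> (\<lambda>_. ?F) x})"
   by (intro negligible_Un AE_differential_point AE_mass_controlled \<Omega>(1) fs(1) v) auto
  note nF = this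
  have "\<not> {x \<in> \<Omega>. BV_jacobian \<Omega> ?F x > 0} \<subseteq>
    {x\<in>\<Omega>. \<not> differential_point ?v (BV_gradient \<Omega> ?F x) x} \<union> {x\<in>\<Omega>. \<not> mass_controlled \<Omega> (\<lambda>_. ?F) x}"
  proof
   assume "{x \<in> \<Omega>. BV_jacobian \<Omega> ?F x > 0} \<subseteq>
    {x\<in>\<Omega>. \<not> differential_point ?v (BV_gradient \<Omega> ?F x) x} \<union> {x\<in>\<Omega>. \<not> mass_controlled \<Omega> (\<lambda>_. ?F) x}"
   from negligible_subset[OF nF this] have "{x \<in> \<Omega>. BV_jacobian \<Omega> ?F x > 0} \<in> null_sets lebesgue"
    by (simp only: negligible_iff_null_sets)
   then show False using pos[of k] null_setsD1 by fastforce
  qed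
  then obtain y where y: "y \<in> \<Omega>" "BV_jacobian \<Omega> ?F y > 0" "differential_point ?v (BV_gradient \<Omega> ?F y) y" "mass_controlled \<Omega> (\<lambda>_. ?F) y"
   by blast
  let ?A = "BV_gradient \<Omega> ?F y"
  have dA: "det ?A > 0" using y(2) by (simp add: BV_jacobian_def)
  then have "det ?A ~= 0" by simp
  from blow_up_homotopy[where K = K and fs = "\<lambda>_. ?F", OF \<Omega>(1) y(1) fs fs(1) _ v y(3,4) nz[OF this] Kc Kn Kd] obtain r' where
   r': "0 < r'" "ball y r' \<subseteq> \<Omega>" and hy: "homotopic_maps (sphere 0 1 \<times> sphere 0 1) (- {0})
   (\<lambda>z. ?F (y + r' *\<^sub>R K True (fst z)) - ?F (y + r' *\<^sub>R K False (snd z)))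
   (\<lambda>z. ?A *v (K True (fst z) - K False (snd z)))" by auto
  have "homotopic_maps (sphere 0 1 \<times> sphere 0 1) (- {0})
   (\<lambda>z. ?F (y + r' *\<^sub>R K True (fst z)) - ?F (y + r' *\<^sub>R K False (snd z)))
   (\<lambda>z. ?F (x + r *\<^sub>R K True (fst z)) - ?F (x + r *\<^sub>R K False (snd z)))"
   by (rule link_difference_homotopic[OF \<Omega> fs(2,3) Kc Kc Kn Kn Kd r'(2,1) r(2,1)])
  from homotopic_with_trans[OF homotopic_with_symD[OF hy] homotopic_with_trans[OF this hx]]
  show False using orient[OF dA dB] by blast
 qed
 then show ?thesis unfolding AE_lebesgue_on_iff_negligible[OF \<Omega>l] .
qed

section \<open>The test links in dimensions two and three\<close>

lemma norm_axis_add_le: "norm (axis i a + axis j b :: real^'n) \<le> \<bar>a\<bar> + \<bar>b\<bar>"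
 by (rule order_trans[OF norm_triangle_ineq]) (simp add: norm_eq_sqrt_inner[of "axis _ _"] inner_axis_axis)

lemma sphere_Re_Im: "z \<in> sphere 0 1 ==> (Re z)\<^sup>2 + (Im z)\<^sup>2 = 1" "z \<in> sphere 0 1 ==> \<bar>Re z\<bar> \<le> 1 \<and> \<bar>Im z\<bar> \<le> 1"
 using abs_Re_le_cmod[of z] abs_Im_le_cmod[of z] by (auto simp: cmod_power2[symmetric])

text \<open>The factor 1/4 brings both curves into the open unit ball. \<open>None\<close> is the
  planar case, in which the second curve is the constant centre, so that one statement on pairs of
  circles covers n = 2 and n = 3.\<close>

definition test_link :: "'n => 'n => 'n option => bool => complex => real^'n" where
 "test_link i j k b z = (1 / 4) *\<^sub>R (if b then plane_circle i j z else case k of None => 0 | Some k => link_circle i k z)"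

lemma test_link_continuous: "continuous_on S (test_link i j k b)"
 unfolding test_link_def plane_circle_def link_circle_def
 by (cases b; cases k) (auto intro!: continuous_intros continuous_on_axis)

lemma test_link_norm:
 assumes z: "z \<in> sphere 0 1" shows "norm (test_link i j k b z) < 1"
proof -
 note z2 = conjunct1[OF sphere_Re_Im(2)[OF z]] conjunct2[OF sphere_Re_Im(2)[OF z]]
 have "norm (plane_circle i j z) \<le> 3"
  using norm_axis_add_le[of i "Re z" j "Im z"] z2 unfolding plane_circle_def by linarith
 moreover have "norm (link_circle i k z) \<le> 3" for k
  using norm_axis_add_le[of i "1 + Re z" k "Im z"] z2 unfolding link_circle_def by linarith
 ultimately have "norm (if b then plane_circle i j z else case k of None => 0 | Some k => link_circle i k z) \<le> 3"
  by (cases b; cases k) simp_all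
 then show ?thesis by (simp add: test_link_def)
qed

lemma test_link_disjoint:
 assumes ij: "i ~= j" "!!l. k = Some l ==> l ~= i \<and> l ~= j" and z: "z \<in> sphere 0 1" and w: "w \<in> sphere 0 1"
 shows "test_link i j k True z ~= test_link i j k False w"
proof
 assume "test_link i j k True z = test_link i j k False w"
 then have eq: "plane_circle i j z = (case k of None => 0 | Some k => link_circle i k w)" by (simp add: test_link_def)
 have ci: "plane_circle i j z $ i = Re z" "plane_circle i j z $ j = Im z" using ij(1) by (auto simp: plane_circle_def axis_def)
 show False
 proof (cases k)
  case None
  then show False using ci eq sphere_Re_Im(1)[OF z] by simp
 next
  case (Some l)
  have l: "l ~= i" "l ~= j" using ij(2)[OF Some] by auto
  have cl: "link_circle i l w $ i = 1 + Re w" "link_circle i l w $ j = 0" "link_circle i l w $ l = Im w"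
   using ij(1) l by (auto simp: link_circle_def axis_def)
  have "plane_circle i j z $ l = 0" using l by (auto simp: plane_circle_def axis_def)
  then have "Im w = 0" "Re z = 1 + Re w" "Im z = 0" using ci cl eq Some by simp_all
  then have "(Re w)\<^sup>2 = 1" "(1 + Re w)\<^sup>2 = 1" using sphere_Re_Im(1)[OF z] sphere_Re_Im(1)[OF w] by simp_all
  then show False by (auto simp: power2_eq_1_iff)
 qed
qed

lemma homotopic_rescale:
 fixes A B :: "real^'n^'n"
 assumes "homotopic_maps X (- {0}) (\<lambda>z. A *v ((1 / 4) *\<^sub>R v z)) (\<lambda>z. B *v ((1 / 4) *\<^sub>R v z))"
 shows "homotopic_maps X (- {0}) (\<lambda>z. A *v v z) (\<lambda>z. B *v v z)"
proof -
 have "homotopic_maps X (- {0}) ((\<lambda>x. 4 *\<^sub>R x) \<circ> (\<lambda>z. A *v ((1 / 4) *\<^sub>R v z))) ((\<lambda>x. 4 *\<^sub>R x) \<circ> (\<lambda>z. B *v ((1 / 4) *\<^sub>R v z)))"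
  by (rule homotopic_with_compose_continuous_left[OF assms]) (auto intro!: continuous_intros)
 then show ?thesis by (simp add: o_def matrix_vector_mult_scaleR)
qed

theorem theorem1p2:
  fixes \<Omega> :: "(real^'n) set"
    and f_seq :: "nat \<Rightarrow> real^'n \<Rightarrow> real^'n"
    and f :: "real^'n \<Rightarrow> real^'n"
  assumes "CARD('n) \<in> {2, 3}"
    and "open \<Omega>" and "connected \<Omega>" and "\<Omega> \<noteq> {}"
    and "\<And>k. f_seq k \<in> BV \<Omega>"
    and "\<And>k. \<exists>h. homeomorphism \<Omega> (f_seq k ` \<Omega>) (f_seq k) h"
    and "\<And>k. emeasure lebesgue {x \<in> \<Omega>. BV_jacobian \<Omega> (f_seq k) x > 0} > 0"
    and "f \<in> BV \<Omega>"
    and "BV_weak_star_limit \<Omega> f_seq f"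
  shows "(AE x\<^sub>0 in lebesgue_on \<Omega>. BV_jacobian \<Omega> f x\<^sub>0 \<ge> 0) \<and>
         (CARD('n) = 2 \<longrightarrow>
            (\<exists>g. (AE x in lebesgue_on \<Omega>. g x = f x) \<and>
                 (AE x in lebesgue_on \<Omega>. g differentiable (at x))))"
proof -
 have c: "continuous_on \<Omega> (f_seq k)" and inj: "inj_on (f_seq k) \<Omega>" for k
  using assms(6)[of k] by (auto simp: homeomorphism_def intro: inj_on_inverseI)
 let ?X = "sphere (0::complex) 1 \<times> sphere (0::complex) 1"
 have sign: "AE x in lebesgue_on \<Omega>. BV_jacobian \<Omega> f x \<ge> 0"
  if ij: "i ~= j" "!!l. k = Some l ==> l ~= i \<and> l ~= j"
   and orient: "!!A B :: real^'n^'n. det A > 0 ==> det B < 0 ==> \<not> homotopic_maps ?X (- {0})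
    (\<lambda>z. A *v (test_link i j k True (fst z) - test_link i j k False (snd z)))
    (\<lambda>z. B *v (test_link i j k True (fst z) - test_link i j k False (snd z)))" for i j :: 'n and k
 proof (rule jacobian_sign[where K = "test_link i j k", OF assms(2,3,5) c inj assms(7,8,9) test_link_continuous])
  show "norm (test_link i j k b z) < 1" if "z \<in> sphere 0 1" for b z by (rule test_link_norm[OF that])
  show "test_link i j k True z ~= test_link i j k False w" if "z \<in> sphere 0 1" "w \<in> sphere 0 1" for z w
   by (rule test_link_disjoint[OF ij that])
 qed (rule orient)
 have "AE x in lebesgue_on \<Omega>. BV_jacobian \<Omega> f x \<ge> 0"
 proof (cases "CARD('n) = 2")
  case True
  then obtain i j :: 'n where ij: "UNIV = {i, j}" "i ~= j" by (auto simp: card_2_iff)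
  show ?thesis
  proof (rule sign[of i j None])
   show "i ~= j" by (rule ij(2))
   fix A B :: "real^'n^'n" assume d: "det A > 0" "det B < 0"
   show "\<not> homotopic_maps ?X (- {0})
    (\<lambda>z. A *v (test_link i j None True (fst z) - test_link i j None False (snd z)))
    (\<lambda>z. B *v (test_link i j None True (fst z) - test_link i j None False (snd z)))"
   proof
    assume "homotopic_maps ?X (- {0})
    (\<lambda>z. A *v (test_link i j None True (fst z) - test_link i j None False (snd z)))
    (\<lambda>z. B *v (test_link i j None True (fst z) - test_link i j None False (snd z)))"
    then have "homotopic_maps ?X (- {0})
     (\<lambda>z. A *v ((1 / 4) *\<^sub>R plane_circle i j (fst z))) (\<lambda>z. B *v ((1 / 4) *\<^sub>R plane_circle i j (fst z)))"
     by (simp add: test_link_def)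
    \<comment> \<open>As the second curve is constant, the torus homotopy may be restricted to the
      slice with second coordinate 1.\<close>
    from homotopic_with_compose_continuous_right[OF homotopic_rescale[OF this], of "sphere 0 1" "\<lambda>z. (z, 1)"]
    have "homotopic_maps (sphere 0 1) (- {0}) (\<lambda>z. A *v plane_circle i j z) (\<lambda>z. B *v plane_circle i j z)"
     by (simp add: o_def continuous_on_Pair continuous_on_id Pi_def)
    then show False using no_orientation_change_2[OF ij d] by blast
   qed
  qed simp_all
 next
  case False
  then have "CARD('n) = 3" using assms(1) by simp
  then obtain i j k :: 'n where ijk: "UNIV = {i, j, k}" "i ~= j" "j ~= k" "i ~= k" by (auto simp: card_3_iff)
  show ?thesis
  proof (rule sign[of i j "Some k"])
   show "i ~= j" by (rule ijk(2))
   show "!!l. Some k = Some l ==> l ~= i \<and> l ~= j" using ijk(3,4) by auto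
   fix A B :: "real^'n^'n" assume d: "det A > 0" "det B < 0"
   show "\<not> homotopic_maps ?X (- {0})
    (\<lambda>z. A *v (test_link i j (Some k) True (fst z) - test_link i j (Some k) False (snd z)))
    (\<lambda>z. B *v (test_link i j (Some k) True (fst z) - test_link i j (Some k) False (snd z)))"
   proof
    assume "homotopic_maps ?X (- {0})
    (\<lambda>z. A *v (test_link i j (Some k) True (fst z) - test_link i j (Some k) False (snd z)))
    (\<lambda>z. B *v (test_link i j (Some k) True (fst z) - test_link i j (Some k) False (snd z)))"
    then have "homotopic_maps ?X (- {0})
     (\<lambda>z. A *v ((1 / 4) *\<^sub>R (plane_circle i j (fst z) - link_circle i k (snd z))))
     (\<lambda>z. B *v ((1 / 4) *\<^sub>R (plane_circle i j (fst z) - link_circle i k (snd z))))"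
     by (simp add: test_link_def scaleR_diff_right)
    from homotopic_rescale[OF this] show False using no_orientation_change_3[OF ijk d] by blast
   qed
  qed
 qed
 moreover have "\<exists>g. (AE x in lebesgue_on \<Omega>. g x = f x) \<and> (AE x in lebesgue_on \<Omega>. g differentiable (at x))" if "CARD('n) = 2"
  by (rule planar_differentiable_AE[OF that assms(2,5) c inj assms(8,9)])
 ultimately show ?thesis by blast
qed

end
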